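(* Let $Q>2$ be an integer and let $0<s<1$ be given. Then there is a Dirichlet minimizer $u\in W^{1,2}_{loc}(\mathbb{R}^2_+,\mathcal{A}_Q(\mathbb{R}^2))$ with (i) $u|_{\partial\mathbb{R}^2_+}\in C^k(\partial\mathbb{R}^2_+,\mathcal{A}_Q(\mathbb{R}^2))$ for all $k\in\mathbb{N}$; (ii) $\operatorname{sing}(u)=\emptyset$, but $u(z)=Q\llbracket0\rrbracket$ for all $z\in-iE_s$, where $\mathcal{H}^s(E_s)=1$; (iii) there are a countable subset $\{y_k\}_{k\in\mathbb{N}}\subset E_s$ and a sequence $R_n\to0$ (with $R_n>0$) such that $\lim_{n\to\infty}I(u,-iy_k,R_n)=+\infty$ for every $k$.
   Context: $\mathbb{R}^2_+=\{(x,y)\in\mathbb{R}^2: x>0\}$ is identified with $\mathbb{C}_+=\{z\in\mathbb{C}:\Re z>0\}$ via $z=x+iy$; $\partial\mathbb{R}^2_+$ is identified with $\mathbb{R}$, and $-iE_s=\{-iy:y\in E_s\}$. Values of $u$ on $\partial\mathbb{R}^2_+$ are those of its trace. The set $E_s\subset[0,1]$ ($0<s<1$): let $E_{0,1}=[0,1]$ and, inductively, let $E_{k,2l-1},E_{k,2l}$ ($l=1,\dots,2^{k-1}$) be the two disjoint closed intervals of length $2^{-k/s}$ obtained by removing an open interval from the middle of $E_{k-1,l}$; $E_s=\bigcap_{k\ge1}\bigcup_{l=1}^{2^k}E_{k,l}$. $\mathcal{H}^s$ is the unnormalised Hausdorff measure $\mathcal{H}^s(E)=\sup_{\delta>0}\inf\{\sum_j\operatorname{diam}(U_j)^s: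 E\subset\bigcup_jU_j\text{ countable cover},\ \operatorname{diam}(U_j)<\delta\}$. $Q$-valued functions: $\mathcal{A}_Q(\mathbb{R}^m)$ is the set of unordered $Q$-tuples $\sum_{i=1}^Q\llbracket P_i\rrbracket$ of points of $\mathbb{R}^m$ ($\llbracket P\rrbracket$ the Dirac mass at $P$), with metric $\mathcal{G}(\sum_i\llbracket P_i\rrbracket,\sum_i\llbracket S_i\rrbracket)=\min_{\sigma\in\mathcal{P}_Q}(\sum_i|P_i-S_{\sigma(i)}|^2)^{1/2}$, $\mathcal{P}_Q$ being the permutations of $\{1,\dots,Q\}$. For $\Omega\subset\mathbb{R}^N$ open, a measurable $u:\Omega\to\mathcal{A}_Q(\mathbb{R}^m)$ is in $W^{1,2}(\Omega,\mathcal{A}_Q(\mathbb{R}^m))$ if there are $\varphi_1,\dots,\varphi_N\in L^2(\Omega)$ such that for all $T\in\mathcal{A}_Q(\mathbb{R}^m)$, $\mathcal{G}(u,T)\in W^{1,2}(\Omega)$ and $|\partial_j\mathcal{G}(u,T)|\le\varphi_j$ a.e.; the minimal such $\varphi_j$ is denoted $|\partial_ju|$, and $|Du|^2=\sum_j|\partial_ju|^2$. Also $|u|^2=\sum_i|u_i|^2$ for $u=\sum_i\llbracket u_i\rrbracket$. Two such functions have the same trace on $\partial\Omega$ if $\mathcal{G}(u,T)$ and $\mathcal{G}(v,T)$ have the same trace for every $T$. Here $u\in W^{1,2}_{loc}(\mathbb{R}^2_+,\mathcal{A}_Q(\mathbb{R}^2))$ means $u\in W^{1,2}(\Omega,\mathcal{A}_Q(\mathbb{R}^2))$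 for every bounded open $C^1$-regular $\Omega\subset\mathbb{R}^2_+$ ($\Omega$ may touch $\partial\mathbb{R}^2_+$), and $u$ is a Dirichlet minimizer (with respect to compact perturbations) if for every such $\Omega$ and every $v\in W^{1,2}(\Omega,\mathcal{A}_Q(\mathbb{R}^2))$ with the same trace as $u$ on $\partial\Omega$ one has $\int_\Omega|Du|^2\le\int_\Omega|Dv|^2$. Singular set: a point $y\in\Omega$ is regular for $u$ if there are an open neighbourhood $U\subset\Omega$ of $y$ and harmonic $u_1,\dots,u_Q\in C^\infty(U,\mathbb{R}^m)$ with $u(x)=\sum_i\llbracket u_i(x)\rrbracket$ for a.e. $x\in U$ and, for each $i,j$, either $u_i(x)\ne u_j(x)$ for all $x\in U$ or $u_i\equiv u_j$. $\operatorname{sing}(u)$ is the complement in $\Omega$ (here $\Omega=\mathbb{R}^2_+$) of the set of regular points. Frequency function: for $u$ on $\Omega=\mathbb{R}^2_+$, $y\in\overline{\Omega}$ and $r>0$, $$I(u,y,r)=\frac{\int_{B_r(y)\cap\Omega}|Du|^2}{\frac1r\int_{\partial B_r(y)\cap\Omega}|u|^2}.$$ $C^k$ regularity: a continuous $u:\Omega\to\mathcal{A}_Q(\mathbb{R}^m)$ ($\Omega\subset\mathbb{R}^N$) is in $C^k(\Omega,\mathcal{A}_Q(\mathbb{R}^m))$ if there is a map $x\mapsto U_x(y)=\sum_{i=1}^Q\llbracket P^i_x(y)\rrbracket$, each $P^i_x$ a polynomial of degree $\le k$, such that: (a) $U_x(x)=\sum_i\llbracket P_x^i(x)\rrbracket=u(x)$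 for all $x\in\Omega$; (b) $P^i_x=P^j_x$ whenever $u_i(x)=u_j(x)$, where $u_i(x)=P^i_x(x)$; (c) for every compact $K\subset\Omega$, the quantity $$\rho_K(\delta)=\sup_{x,y\in K,\,0<|x-y|\le\delta}\ \inf_{\sigma\in\mathcal{P}_Q}\ \sum_{i=1}^Q\Big(\sum_{|\alpha|\le k}|D^\alpha P^i_y(y)-D^\alpha P^{\sigma(i)}_x(y)|\,|x-y|^{|\alpha|-k}(k-|\alpha|)!\Big)^2$$ tends to $0$ as $\delta\to0$. *)

theory Defs
  imports "HOL-Analysis.Analysis" "HOL-Combinatorics.Permutations"
begin

section \<open>The space of unordered Q-tuples\<close>

text \<open>An unordered \<open>Q\<close>-tuple is a multiset of size \<open>Q\<close>; \<open>qtup Q P\<close> is the sum of the Dirac masses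
  at \<open>P 0, \<dots>, P (Q - 1)\<close>.\<close>

definition qtup :: "nat \<Rightarrow> (nat \<Rightarrow> 'b) \<Rightarrow> 'b multiset" where
  "qtup Q P = (\<Sum>i<Q. {#P i#})"

definition AQ :: "nat \<Rightarrow> 'b multiset set" where
  "AQ Q = range (qtup Q)"

text \<open>The value under the minimum depends on the enumerations \<open>P\<close>, \<open>R\<close> only through a
  permutation, so ranging over all enumerations does not change the minimum over \<open>\<sigma>\<close>
  (see \<open>qdist_qtup\<close>). The value off \<open>AQ Q\<close> makes \<open>qdist Q\<close> fit the locale \<open>Metric_space\<close>,
  which asks for nonnegativity and symmetry on the whole type.\<close>

definition qdist :: "nat \<Rightarrow> 'b::euclidean_space multiset \<Rightarrow> 'b multiset \<Rightarrow> real" where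
  "qdist Q S T = (if S \<in> AQ Q \<and> T \<in> AQ Q then
     Min {sqrt (\<Sum>i<Q. (norm (P i - R (\<sigma> i)))\<^sup>2) | P R \<sigma>.
       S = qtup Q P \<and> T = qtup Q R \<and> \<sigma> permutes {..<Q}} else 0)"

definition qnorm2 :: "'b::euclidean_space multiset \<Rightarrow> real" where
  "qnorm2 S = (\<Sum>p\<in>#S. (norm p)\<^sup>2)"

abbreviation AQ_top :: "nat \<Rightarrow> 'b::euclidean_space multiset topology" where
  "AQ_top Q \<equiv> Metric_space.mtopology (AQ Q) (qdist Q)"

abbreviation AQ_borel :: "nat \<Rightarrow> 'b::euclidean_space multiset measure" where
  "AQ_borel Q \<equiv> sigma (AQ Q) {U. openin (AQ_top Q) U}"

lemma qtup_mset: "qtup Q P = mset (map P [0..<Q])"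
  by (induction Q) (simp_all add: qtup_def)

lemma qtup_permute:
  assumes "\<sigma> permutes {..<Q}"
  shows "qtup Q (\<lambda>i. R (\<sigma> i)) = qtup Q R"
  unfolding qtup_def
  by (rule sum.reindex_bij_betw[OF permutes_imp_bij[OF assms], of "\<lambda>i. {#R i#}"])

lemma qtup_eq_permute:
  assumes "qtup Q P = qtup Q R"
  obtains \<sigma> where "\<sigma> permutes {..<Q}" "\<And>i. i < Q \<Longrightarrow> P i = R (\<sigma> i)"
proof -
  have "mset (map P [0..<Q]) = mset (map R [0..<Q])"
    using assms by (simp only: qtup_mset)
  then obtain p where p: "p permutes {..<length (map R [0..<Q])}"
      "permute_list p (map R [0..<Q]) = map P [0..<Q]"
    by (rule mset_eq_permutation)
  have "P i = R (p i)" if i: "i < Q" for i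
  proof -
    have "P i = permute_list p (map R [0..<Q]) ! i" using p(2) i by simp
    also have "\<dots> = map R [0..<Q] ! p i"
      using permute_list_nth[OF p(1)] i by simp
    also have "\<dots> = R (p i)"
      using permutes_in_image[OF p(1), of i] i by simp
    finally show ?thesis .
  qed
  with p(1) show ?thesis using that by simp
qed

lemma qdist_qtup:
  "qdist Q (qtup Q P) (qtup Q R)
     = Min ((\<lambda>\<sigma>. sqrt (\<Sum>i<Q. (norm (P i - R (\<sigma> i)))\<^sup>2)) ` {\<sigma>. \<sigma> permutes {..<Q}})"
proof -
  have "{sqrt (\<Sum>i<Q. (norm (P' i - R' (\<sigma> i)))\<^sup>2) | P' R' \<sigma>.
     qtup Q P = qtup Q P' \<and> qtup Q R = qtup Q R' \<and> \<sigma> permutes {..<Q}}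
    = (\<lambda>\<sigma>. sqrt (\<Sum>i<Q. (norm (P i - R (\<sigma> i)))\<^sup>2)) ` {\<sigma>. \<sigma> permutes {..<Q}}"
    (is "?A = ?B")
  proof
    show "?B \<subseteq> ?A" by blast
    show "?A \<subseteq> ?B"
    proof
      fix x assume "x \<in> ?A"
      then obtain P' R' \<sigma> where x: "x = sqrt (\<Sum>i<Q. (norm (P' i - R' (\<sigma> i)))\<^sup>2)"
        and P': "qtup Q P = qtup Q P'" and R': "qtup Q R' = qtup Q R" and \<sigma>: "\<sigma> permutes {..<Q}"
        by fastforce
      obtain p where p: "p permutes {..<Q}" "\<And>i. i < Q \<Longrightarrow> P i = P' (p i)"
        using qtup_eq_permute[OF P'] by metis
      obtain r where r: "r permutes {..<Q}" "\<And>i. i < Q \<Longrightarrow> R' i = R (r i)"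
        using qtup_eq_permute[OF R'] by metis
      have "(\<Sum>i<Q. (norm (P' i - R' (\<sigma> i)))\<^sup>2) = (\<Sum>i<Q. (norm (P' (p i) - R' (\<sigma> (p i))))\<^sup>2)"
        by (rule sum.reindex_bij_betw[OF permutes_imp_bij[OF p(1)], symmetric,
              of "\<lambda>i. (norm (P' i - R' (\<sigma> i)))\<^sup>2"])
      also have "\<dots> = (\<Sum>i<Q. (norm (P i - R ((r \<circ> \<sigma> \<circ> p) i)))\<^sup>2)"
      proof (rule sum.cong)
        fix i assume "i \<in> {..<Q}"
        then have "i < Q" "\<sigma> (p i) < Q"
          using permutes_in_image[OF p(1)] permutes_in_image[OF \<sigma>] by auto
        then show "(norm (P' (p i) - R' (\<sigma> (p i))))\<^sup>2 = (norm (P i - R ((r \<circ> \<sigma> \<circ> p) i)))\<^sup>2"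
          using p(2) r(2) by simp
      qed simp
      finally show "x \<in> ?B"
        using x permutes_compose[OF p(1) permutes_compose[OF \<sigma> r(1)]]
        by (intro image_eqI[where x = "r \<circ> \<sigma> \<circ> p"]) auto
    qed
  qed
  then show ?thesis by (simp add: qdist_def AQ_def)
qed

lemma qdist_le: "qdist Q (qtup Q P) (qtup Q R) \<le> sqrt (\<Sum>i<Q. (norm (P i - R i))\<^sup>2)"
proof -
  have "sqrt (\<Sum>i<Q. (norm (P i - R (id i)))\<^sup>2)
     \<in> (\<lambda>\<sigma>. sqrt (\<Sum>i<Q. (norm (P i - R (\<sigma> i)))\<^sup>2)) ` {\<sigma>. \<sigma> permutes {..<Q}}"
    by (rule imageI) (simp add: permutes_id del: id_apply)
  then show ?thesis
    unfolding qdist_qtup by (intro Min_le) (auto intro: finite_permutations)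
qed

lemma qdist_attained:
  assumes "T \<in> AQ Q"
  obtains R where "T = qtup Q R" "qdist Q (qtup Q P) T = sqrt (\<Sum>i<Q. (norm (P i - R i))\<^sup>2)"
proof -
  obtain R where T: "T = qtup Q R" using assms by (auto simp: AQ_def)
  let ?A = "(\<lambda>\<sigma>. sqrt (\<Sum>i<Q. (norm (P i - R (\<sigma> i)))\<^sup>2)) ` {\<sigma>. \<sigma> permutes {..<Q}}"
  have "Min ?A \<in> ?A"
    by (rule Min_in) (auto intro: finite_permutations permutes_id)
  then obtain \<sigma> where \<sigma>: "\<sigma> permutes {..<Q}"
    "qdist Q (qtup Q P) T = sqrt (\<Sum>i<Q. (norm (P i - R (\<sigma> i)))\<^sup>2)"
    unfolding T qdist_qtup by auto
  show ?thesis
    by (rule that[of "\<lambda>i. R (\<sigma> i)"]) (use T \<sigma> qtup_permute[OF \<sigma>(1), of R] in auto)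
qed

lemma Metric_space_AQ: "Metric_space (AQ Q) (qdist Q)"
proof -
  have sym_le: "qdist Q S T \<le> qdist Q T S" if "S \<in> AQ Q" "T \<in> AQ Q" for S T :: "'a multiset"
  proof -
    obtain P where P: "T = qtup Q P" using \<open>T \<in> AQ Q\<close> by (auto simp: AQ_def)
    obtain R where R: "S = qtup Q R" "qdist Q T S = sqrt (\<Sum>i<Q. (norm (P i - R i))\<^sup>2)"
      using qdist_attained[OF \<open>S \<in> AQ Q\<close>] P by metis
    show ?thesis using qdist_le[of Q R P] R(2) unfolding R(1) P by (simp add: norm_minus_commute)
  qed
  have tri: "qdist Q S U \<le> qdist Q S T + qdist Q T U"
    if "S \<in> AQ Q" "T \<in> AQ Q" "U \<in> AQ Q" for S T U :: "'a multiset"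
  proof -
    obtain P where P: "S = qtup Q P" using \<open>S \<in> AQ Q\<close> by (auto simp: AQ_def)
    obtain R where R: "T = qtup Q R" "qdist Q S T = sqrt (\<Sum>i<Q. (norm (P i - R i))\<^sup>2)"
      using qdist_attained[OF \<open>T \<in> AQ Q\<close>] P by metis
    obtain W where W: "U = qtup Q W" "qdist Q T U = sqrt (\<Sum>i<Q. (norm (R i - W i))\<^sup>2)"
      using qdist_attained[OF \<open>U \<in> AQ Q\<close>] R(1) by metis
    have "qdist Q S U \<le> L2_set (\<lambda>i. norm (P i - W i)) {..<Q}"
      unfolding P W(1) L2_set_def by (rule qdist_le)
    also have "\<dots> \<le> L2_set (\<lambda>i. norm (P i - R i) + norm (R i - W i)) {..<Q}"
      by (intro L2_set_mono) (use norm_triangle_ineq[of "P i - R i" "R i - W i" for i] in auto)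
    also have "\<dots> \<le> L2_set (\<lambda>i. norm (P i - R i)) {..<Q} + L2_set (\<lambda>i. norm (R i - W i)) {..<Q}"
      by (rule L2_set_triangle_ineq)
    finally show ?thesis using R(2) W(2) by (simp add: L2_set_def)
  qed
  have nn: "0 \<le> qdist Q S T" if "S \<in> AQ Q" "T \<in> AQ Q" for S T :: "'a multiset"
  proof -
    obtain P where "S = qtup Q P" using \<open>S \<in> AQ Q\<close> by (auto simp: AQ_def)
    then obtain R where "qdist Q S T = sqrt (\<Sum>i<Q. (norm (P i - R i))\<^sup>2)"
      using qdist_attained[OF \<open>T \<in> AQ Q\<close>] by metis
    then show ?thesis by (simp add: sum_nonneg)
  qed
  have zero: "qdist Q S T = 0 \<longleftrightarrow> S = T" if "S \<in> AQ Q" "T \<in> AQ Q" for S T :: "'a multiset"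
  proof
    obtain P where P: "S = qtup Q P" using \<open>S \<in> AQ Q\<close> by (auto simp: AQ_def)
    { assume "qdist Q S T = 0"
      moreover obtain R where R: "T = qtup Q R" "qdist Q S T = sqrt (\<Sum>i<Q. (norm (P i - R i))\<^sup>2)"
        using qdist_attained[OF \<open>T \<in> AQ Q\<close>] P by metis
      ultimately have "\<forall>i\<in>{..<Q}. P i = R i"
        by (simp add: sum_nonneg_eq_0_iff)
      then show "S = T" unfolding P R(1) qtup_def by (intro sum.cong) auto }
    assume "S = T"
    then show "qdist Q S T = 0"
      using qdist_le[of Q P P] nn[OF that] P by simp
  qed
  show ?thesis
  proof
    show "0 \<le> qdist Q S T" for S T :: "'a multiset"
      using nn by (cases "S \<in> AQ Q \<and> T \<in> AQ Q") (auto simp: qdist_def)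
    show "qdist Q S T = qdist Q T S" for S T :: "'a multiset"
      using sym_le[of S T] sym_le[of T S]
      by (cases "S \<in> AQ Q \<and> T \<in> AQ Q") (auto simp: qdist_def)
  qed (use zero tri in auto)
qed

section \<open>Hausdorff measure\<close>

text \<open>Unnormalised Hausdorff (outer) measure. Covering sets are required to be bounded because
  \<open>diameter\<close> is a meaningless real number on unbounded sets.\<close>

definition hausdorff_outer :: "real \<Rightarrow> 'a::metric_space set \<Rightarrow> ennreal" where
  "hausdorff_outer s E = (SUP \<delta>\<in>{0<..}.
     INF U\<in>{U :: nat \<Rightarrow> 'a set. E \<subseteq> (\<Union>j. U j) \<and> (\<forall>j. bounded (U j) \<and> diameter (U j) < \<delta>)}.
       (\<Sum>j. ennreal (diameter (U j) powr s)))"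

text \<open>\<open>hausdorff_outer s\<close> is a metric outer measure, hence countably additive on the Borel sets; so
  \<open>measure_of\<close> does not fall back to the null measure here.\<close>

definition hausdorff_measure :: "real \<Rightarrow> 'a::metric_space measure" where
  "hausdorff_measure s = measure_of UNIV (sets borel) (hausdorff_outer s)"

section \<open>Cantor-type sets\<close>

text \<open>\<open>cantor_left s k l\<close> is the left end point of the interval with indices \<open>k\<close> and
  \<open>l \<in> {1..2 ^ k}\<close>; the interval has length \<open>2 powr (- k / s)\<close>.\<close>

fun cantor_left :: "real \<Rightarrow> nat \<Rightarrow> nat \<Rightarrow> real" where
  "cantor_left s 0 l = 0"
| "cantor_left s (Suc k) l =
    (if odd l then cantor_left s k ((l + 1) div 2)
     else cantor_left s k (l div 2) + 2 powr (- real k / s) - 2 powr (- real (Suc k) / s))"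

definition cantor_interval :: "real \<Rightarrow> nat \<Rightarrow> nat \<Rightarrow> real set" where
  "cantor_interval s k l = {cantor_left s k l .. cantor_left s k l + 2 powr (- real k / s)}"

definition cantor_E :: "real \<Rightarrow> real set" where
  "cantor_E s = (\<Inter>k\<in>{1..}. \<Union>l\<in>{1..2 ^ k}. cantor_interval s k l)"

section \<open>Differentiability classes, harmonic functions and regular domains\<close>

text \<open>Only used for open \<open>S\<close>.\<close>

primrec cont_diff_on :: "nat \<Rightarrow> 'a::euclidean_space set \<Rightarrow> ('a \<Rightarrow> 'b::real_normed_vector) \<Rightarrow> bool"
where
  "cont_diff_on 0 S f \<longleftrightarrow> continuous_on S f"
| "cont_diff_on (Suc k) S f \<longleftrightarrow> (\<forall>x\<in>S. f differentiable (at x)) \<and>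
     (\<forall>e. cont_diff_on k S (\<lambda>x. frechet_derivative f (at x) e))"

definition smooth_on :: "'a::euclidean_space set \<Rightarrow> ('a \<Rightarrow> 'b::real_normed_vector) \<Rightarrow> bool" where
  "smooth_on S f \<longleftrightarrow> (\<forall>k. cont_diff_on k S f)"

definition laplacian :: "('a::euclidean_space \<Rightarrow> 'b::real_normed_vector) \<Rightarrow> 'a \<Rightarrow> 'b" where
  "laplacian f x =
     (\<Sum>e\<in>Basis. frechet_derivative (\<lambda>z. frechet_derivative f (at z) e) (at x) e)"

definition harmonic_on :: "'a::euclidean_space set \<Rightarrow> ('a \<Rightarrow> 'b::real_normed_vector) \<Rightarrow> bool" where
  "harmonic_on S f \<longleftrightarrow> smooth_on S f \<and> (\<forall>x\<in>S. laplacian f x = 0)"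

text \<open>Near each boundary point the domain is the strict epigraph, in some direction \<open>\<nu>\<close>, of a
  \<open>C\<^sup>1\<close> function on the hyperplane orthogonal to \<open>\<nu>\<close>.\<close>

definition C1_regular :: "'a::euclidean_space set \<Rightarrow> bool" where
  "C1_regular \<Omega> \<longleftrightarrow> open \<Omega> \<and> (\<forall>x\<in>frontier \<Omega>. \<exists>r>0. \<exists>\<nu> \<gamma>.
     norm \<nu> = 1 \<and> cont_diff_on 1 UNIV (\<gamma> :: 'a \<Rightarrow> real) \<and>
     \<Omega> \<inter> ball x r = {z \<in> ball x r. \<gamma> (z - (z \<bullet> \<nu>) *\<^sub>R \<nu>) < z \<bullet> \<nu>})"

definition admissible_domain :: "'a::euclidean_space set \<Rightarrow> 'a set \<Rightarrow> bool" where
  "admissible_domain D \<Omega> \<longleftrightarrow> bounded \<Omega> \<and> C1_regular \<Omega> \<and> \<Omega> \<subseteq> D"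

section \<open>Real-valued Sobolev functions and traces\<close>

definition test_fun :: "'a::euclidean_space set \<Rightarrow> ('a \<Rightarrow> real) \<Rightarrow> bool" where
  "test_fun \<Omega> \<phi> \<longleftrightarrow> smooth_on UNIV \<phi> \<and>
     compact (closure {x. \<phi> x \<noteq> 0}) \<and> closure {x. \<phi> x \<noteq> 0} \<subseteq> \<Omega>"

definition locally_integrable :: "'a::euclidean_space set \<Rightarrow> ('a \<Rightarrow> real) \<Rightarrow> bool" where
  "locally_integrable \<Omega> f \<longleftrightarrow> (\<forall>K. compact K \<and> K \<subseteq> \<Omega> \<longrightarrow> set_integrable lebesgue K f)"

definition is_weak_partial ::
  "'a::euclidean_space set \<Rightarrow> 'a \<Rightarrow> ('a \<Rightarrow> real) \<Rightarrow> ('a \<Rightarrow> real) \<Rightarrow> bool" where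
  "is_weak_partial \<Omega> e f g \<longleftrightarrow> locally_integrable \<Omega> f \<and> locally_integrable \<Omega> g \<and>
     (\<forall>\<phi>. test_fun \<Omega> \<phi> \<longrightarrow>
        (LINT x:\<Omega>|lebesgue. f x * frechet_derivative \<phi> (at x) e) = - (LINT x:\<Omega>|lebesgue. g x * \<phi> x))"

text \<open>Weak partial derivatives are unique up to null sets, so the choice is immaterial.\<close>

definition weak_partial :: "'a::euclidean_space set \<Rightarrow> 'a \<Rightarrow> ('a \<Rightarrow> real) \<Rightarrow> 'a \<Rightarrow> real" where
  "weak_partial \<Omega> e f = (SOME g. is_weak_partial \<Omega> e f g)"

definition L2 :: "'a::euclidean_space set \<Rightarrow> ('a \<Rightarrow> real) \<Rightarrow> bool" where
  "L2 \<Omega> f \<longleftrightarrow> f \<in> borel_measurable (lebesgue_on \<Omega>) \<and> integrable (lebesgue_on \<Omega>) (\<lambda>x. (f x)\<^sup>2)"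

definition W12 :: "'a::euclidean_space set \<Rightarrow> ('a \<Rightarrow> real) \<Rightarrow> bool" where
  "W12 \<Omega> f \<longleftrightarrow> L2 \<Omega> f \<and> (\<forall>e\<in>Basis. \<exists>g. is_weak_partial \<Omega> e f g \<and> L2 \<Omega> g)"

definition W12_norm :: "'a::euclidean_space set \<Rightarrow> ('a \<Rightarrow> real) \<Rightarrow> real" where
  "W12_norm \<Omega> f = sqrt ((\<integral>x. (f x)\<^sup>2 \<partial>lebesgue_on \<Omega>)
     + (\<Sum>e\<in>Basis. \<integral>x. (weak_partial \<Omega> e f x)\<^sup>2 \<partial>lebesgue_on \<Omega>))"

text \<open>\<open>w\<close> is (a representative of) the image of \<open>f\<close> under the trace operator, that is the continuous
  extension of the restriction map from functions in \<open>W12 \<Omega>\<close> continuous up to the boundary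
  to a map from \<open>W12 \<Omega>\<close> to the space \<open>L\<^sup>2\<close> of the boundary with surface measure. The missing
  normalisation of the surface measure plays no role here.\<close>

definition has_trace :: "'a::euclidean_space set \<Rightarrow> ('a \<Rightarrow> real) \<Rightarrow> ('a \<Rightarrow> real) \<Rightarrow> bool" where
  "has_trace \<Omega> f w \<longleftrightarrow> W12 \<Omega> f \<and> w \<in> borel_measurable borel \<and>
     (\<exists>F. (\<forall>n. W12 \<Omega> (F n) \<and> continuous_on (closure \<Omega>) (F n)) \<and>
        (\<lambda>n. W12_norm \<Omega> (\<lambda>x. F n x - f x)) \<longlonglongrightarrow> 0 \<and>
        (\<lambda>n. \<integral>\<^sup>+z\<in>frontier \<Omega>. ennreal ((F n z - w z)\<^sup>2) \<partial>hausdorff_measure (real DIM('a) - 1))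
          \<longlonglongrightarrow> 0)"

definition same_trace :: "'a::euclidean_space set \<Rightarrow> ('a \<Rightarrow> real) \<Rightarrow> ('a \<Rightarrow> real) \<Rightarrow> bool" where
  "same_trace \<Omega> f h \<longleftrightarrow> (\<exists>w. has_trace \<Omega> f w \<and> has_trace \<Omega> h w)"

section \<open>Q-valued Sobolev functions\<close>

definition partial_bound :: "nat \<Rightarrow> 'a::euclidean_space set \<Rightarrow> ('a \<Rightarrow> 'b::euclidean_space multiset) \<Rightarrow>
    'a \<Rightarrow> ('a \<Rightarrow> real) \<Rightarrow> bool" where
  "partial_bound Q \<Omega> u e \<phi> \<longleftrightarrow> L2 \<Omega> \<phi> \<and>
     (\<forall>T\<in>AQ Q. AE x in lebesgue_on \<Omega>. \<bar>weak_partial \<Omega> e (\<lambda>x. qdist Q (u x) T) x\<bar> \<le> \<phi> x)"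

definition W12Q :: "nat \<Rightarrow> 'a::euclidean_space set \<Rightarrow> ('a \<Rightarrow> 'b::euclidean_space multiset) \<Rightarrow> bool"
where
  "W12Q Q \<Omega> u \<longleftrightarrow> u \<in> lebesgue_on \<Omega> \<rightarrow>\<^sub>M AQ_borel Q \<and>
     (\<forall>T\<in>AQ Q. W12 \<Omega> (\<lambda>x. qdist Q (u x) T)) \<and> (\<forall>e\<in>Basis. \<exists>\<phi>. partial_bound Q \<Omega> u e \<phi>)"

text \<open>The minimal bound is unique up to null sets.\<close>

definition partial_norm :: "nat \<Rightarrow> 'a::euclidean_space set \<Rightarrow> ('a \<Rightarrow> 'b::euclidean_space multiset) \<Rightarrow>
    'a \<Rightarrow> 'a \<Rightarrow> real" where
  "partial_norm Q \<Omega> u e = (SOME \<phi>. partial_bound Q \<Omega> u e \<phi> \<and>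
     (\<forall>\<psi>. partial_bound Q \<Omega> u e \<psi> \<longrightarrow> (AE x in lebesgue_on \<Omega>. \<phi> x \<le> \<psi> x)))"

definition dirichlet_energy ::
  "nat \<Rightarrow> 'a::euclidean_space set \<Rightarrow> ('a \<Rightarrow> 'b::euclidean_space multiset) \<Rightarrow> real" where
  "dirichlet_energy Q \<Omega> u = (\<integral>x. (\<Sum>e\<in>Basis. (partial_norm Q \<Omega> u e x)\<^sup>2) \<partial>lebesgue_on \<Omega>)"

definition same_traceQ :: "nat \<Rightarrow> 'a::euclidean_space set \<Rightarrow> ('a \<Rightarrow> 'b::euclidean_space multiset) \<Rightarrow>
    ('a \<Rightarrow> 'b multiset) \<Rightarrow> bool" where
  "same_traceQ Q \<Omega> u v \<longleftrightarrow>
     (\<forall>T\<in>AQ Q. same_trace \<Omega> (\<lambda>x. qdist Q (u x) T) (\<lambda>x. qdist Q (v x) T))"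

definition W12Q_loc :: "nat \<Rightarrow> 'a::euclidean_space set \<Rightarrow> ('a \<Rightarrow> 'b::euclidean_space multiset) \<Rightarrow> bool"
where
  "W12Q_loc Q D u \<longleftrightarrow> (\<forall>\<Omega>. admissible_domain D \<Omega> \<longrightarrow> W12Q Q \<Omega> u)"

definition dirichlet_minimizer ::
  "nat \<Rightarrow> 'a::euclidean_space set \<Rightarrow> ('a \<Rightarrow> 'b::euclidean_space multiset) \<Rightarrow> bool" where
  "dirichlet_minimizer Q D u \<longleftrightarrow>
     (\<forall>\<Omega> v. admissible_domain D \<Omega> \<and> W12Q Q \<Omega> v \<and> same_traceQ Q \<Omega> u v \<longrightarrow>
        dirichlet_energy Q \<Omega> u \<le> dirichlet_energy Q \<Omega> v)"

text \<open>A Sobolev function is only defined almost everywhere. The pointwise values of \<open>u\<close> inside \<open>D\<close>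
  (which enter the integral over spheres in the frequency function) are those of the continuous
  representative, and its values on the boundary of \<open>D\<close> are those of its trace.\<close>

definition trace_normalized ::
  "nat \<Rightarrow> 'a::euclidean_space set \<Rightarrow> ('a \<Rightarrow> 'b::euclidean_space multiset) \<Rightarrow> bool" where
  "trace_normalized Q D u \<longleftrightarrow> u ` frontier D \<subseteq> AQ Q \<and>
     continuous_map (top_of_set D) (AQ_top Q) u \<and>
     (\<forall>\<Omega> T. admissible_domain D \<Omega> \<and> T \<in> AQ Q \<longrightarrow>
        (\<exists>w. has_trace \<Omega> (\<lambda>x. qdist Q (u x) T) w \<and>
          (AE z in hausdorff_measure (real DIM('a) - 1).
             z \<in> frontier \<Omega> \<inter> frontier D \<longrightarrow> w z = qdist Q (u z) T)))"

section \<open>Singular set, frequency function and higher regularity\<close>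

definition regular_point ::
  "nat \<Rightarrow> 'a::euclidean_space set \<Rightarrow> ('a \<Rightarrow> 'b::euclidean_space multiset) \<Rightarrow> 'a \<Rightarrow> bool" where
  "regular_point Q \<Omega> u y \<longleftrightarrow> (\<exists>U f. open U \<and> y \<in> U \<and> U \<subseteq> \<Omega> \<and>
     (\<forall>i<Q. harmonic_on U (f i)) \<and>
     (AE x in lebesgue_on U. u x = qtup Q (\<lambda>i. f i x)) \<and>
     (\<forall>i<Q. \<forall>j<Q. (\<forall>x\<in>U. f i x \<noteq> f j x) \<or> (\<forall>x\<in>U. f i x = f j x)))"

definition sing :: "nat \<Rightarrow> 'a::euclidean_space set \<Rightarrow> ('a \<Rightarrow> 'b::euclidean_space multiset) \<Rightarrow> 'a set"
where
  "sing Q \<Omega> u = {y \<in> \<Omega>. \<not> regular_point Q \<Omega> u y}"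

definition circle_integral :: "complex set \<Rightarrow> complex \<Rightarrow> real \<Rightarrow> (complex \<Rightarrow> real) \<Rightarrow> real" where
  "circle_integral \<Omega> y r f =
     (LINT t:{t \<in> {0..2 * pi}. y + of_real r * cis t \<in> \<Omega>}|lborel. f (y + of_real r * cis t) * r)"

text \<open>The numerator uses the minimal bounds of \<open>u\<close> on \<open>ball y r \<inter> \<Omega>\<close>, which are the restrictions
  of those on larger domains.\<close>

definition frequency :: "nat \<Rightarrow> complex set \<Rightarrow> (complex \<Rightarrow> 'b::euclidean_space multiset) \<Rightarrow>
    complex \<Rightarrow> real \<Rightarrow> real" where
  "frequency Q \<Omega> u y r =
     dirichlet_energy Q (ball y r \<inter> \<Omega>) u / (1 / r * circle_integral \<Omega> y r (\<lambda>z. qnorm2 (u z)))"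

definition poly_le :: "nat \<Rightarrow> (real \<Rightarrow> 'b::real_vector) \<Rightarrow> bool" where
  "poly_le k p \<longleftrightarrow> (\<exists>a. \<forall>t. p t = (\<Sum>j\<le>k. t ^ j *\<^sub>R a j))"

definition nth_deriv :: "nat \<Rightarrow> (real \<Rightarrow> 'b::real_normed_vector) \<Rightarrow> real \<Rightarrow> 'b" where
  "nth_deriv j = (\<lambda>p t. vector_derivative p (at t)) ^^ j"

text \<open>The modulus \<open>\<rho>\<^sub>K(\<delta>)\<close> for a family \<open>P x i\<close> of polynomials in one variable. It is valued in
  \<open>ennreal\<close>, so it may be infinite, and the supremum over the empty set is \<open>0\<close>.\<close>

definition CkQ_modulus ::
  "nat \<Rightarrow> nat \<Rightarrow> (real \<Rightarrow> nat \<Rightarrow> real \<Rightarrow> 'b::real_normed_vector) \<Rightarrow> real set \<Rightarrow> real \<Rightarrow> ennreal" where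
  "CkQ_modulus k Q P K \<delta> =
     (SUP (x, y) \<in> {(x, y). x \<in> K \<and> y \<in> K \<and> 0 < \<bar>x - y\<bar> \<and> \<bar>x - y\<bar> \<le> \<delta>}.
        INF \<sigma> \<in> {\<sigma>. \<sigma> permutes {..<Q}}.
          ennreal (\<Sum>i<Q. (\<Sum>j\<le>k. norm (nth_deriv j (P y i) y - nth_deriv j (P x (\<sigma> i)) y)
             * \<bar>x - y\<bar> powi (int j - int k) * fact (k - j))\<^sup>2))"

text \<open>The class \<open>C\<^sup>k\<close> for Q-valued functions of one real variable (multi-indices are then natural
  numbers).\<close>

definition CkQ_on :: "nat \<Rightarrow> nat \<Rightarrow> real set \<Rightarrow> (real \<Rightarrow> 'b::euclidean_space multiset) \<Rightarrow> bool" where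
  "CkQ_on k Q S g \<longleftrightarrow> continuous_map (top_of_set S) (AQ_top Q) g \<and>
     (\<exists>P. (\<forall>x\<in>S. \<forall>i<Q. poly_le k (P x i)) \<and>
        (\<forall>x\<in>S. qtup Q (\<lambda>i. P x i x) = g x) \<and>
        (\<forall>x\<in>S. \<forall>i<Q. \<forall>j<Q. P x i x = P x j x \<longrightarrow> P x i = P x j) \<and>
        (\<forall>K. compact K \<and> K \<subseteq> S \<longrightarrow> ((CkQ_modulus k Q P K) \<longlongrightarrow> 0) (at_right 0)))"

abbreviation half_plane :: "complex set" where
  "half_plane \<equiv> {z. 0 < Re z}"

end

(*
All Q values coincide: u is Q copies of h b with b a unit vector and h = Re (exp (- F)),
where F z is the sum of the terms c_n e^(-i psi) (z - q_n)^(-beta) over a dense set of points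
q_n of -i E_s, with s < beta < 1. On the half plane Re F is nonnegative and at least of order
d^(s sigma - beta) near -i E_s, d being the distance from -i E_s (sigma is the decay rate of the
c_n), so exp (- F) vanishes to infinite order on -i E_s and is smooth up to the boundary.
For T = Q[[2b]] the function G(u, T) equals sqrt Q (2 - h), which is harmonic, and
|D G(v, T)| <= |D v| for every competitor v; so Dirichlet's principle for real functions shows
that u minimizes.
At a pole q_n having a gap of E_s on one side, |exp (- F)| on the half circle of radius r
decreases at the rate r^(-beta) in the angle measured from the gap. It is therefore concentrated
in an angle of order r^beta, while its logarithmic derivative there has size r^(-beta-1):
the frequency is at least of order r^(-beta).
*)
theory Submission
  imports Defs "HOL-Complex_Analysis.Complex_Analysis"
begin

section \<open>The Cantor set\<close>

text \<open>The exponents are forced. In the half plane z - q_n has argument at most pi/2 in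
  modulus, so \<beta> < 1 leaves room to keep each term of F in the right half plane. A point at
  distance d from -i E_s has a pole at comparable distance on a level k with 2^(-k/s) about d; its
  weight is of order 2^(-k \<sigma>), that is d^(s \<sigma>). Summable weights need \<sigma> > 1,
  blow-up needs s \<sigma> < \<beta>, whence s < \<beta>. The factor e^(-i psi) breaks a symmetry:
  without it the real part of (z - q)^(-\<beta>) is equally small at both ends of the half circle,
  with it the end in the gap is the only minimum. Positivity persists on a slightly larger sector,
  so Cauchy's inequality applies on balls that cross the boundary. The other obstacle is that
  competitors are tied to u by traces only, which are limits in mean square for a Hausdorff measure,
  on C^1 domains that may touch the boundary of the half plane. Green's formula against the gradient
  of h is obtained from thin strips along the boundary, with the gradient translated so that it is
  smooth on the closed domain.\<close>

lemma powr_add_le_of_half: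
  fixes s lam x y :: real
  assumes s: "0 < s" "s < 1" and lam: "0 < lam" "2 * lam < 1"
    and xy: "0 \<le> x" "x \<le> 1" "0 \<le> y" "y \<le> 1"
  shows "x powr s + y powr s \<le> 2 * (lam * (x + y) + 1 - 2 * lam) powr s"
proof -
  define m where "m = (x + y) / 2"
  have conc: "x powr s + y powr s \<le> 2 * m powr s"
  proof (cases "m = 0")
    case True
    then have "x = 0" "y = 0" using xy by (auto simp: m_def)
    then show ?thesis by simp
  next
    case False
    then have m: "m > 0" using xy by (auto simp: m_def)
    \<comment> \<open>Weighted arithmetic-geometric mean: divided by \<open>m powr (1 - s)\<close>
      this is the tangent at \<open>m\<close> of the concave function t^s. Adding it for
      \<open>x\<close> and \<open>y\<close> gives concavity at the midpoint.\<close>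
    have young: "z powr s * m powr (1 - s) \<le> s * z + (1 - s) * m" if "0 \<le> z" for z
      using Youngs_inequality_0[of s "1 - s" z m] s m that by (cases "z = 0") auto
    have "(x powr s + y powr s) * m powr (1 - s) \<le> s * (x + y) + 2 * (1 - s) * m"
      using young[of x] young[of y] xy by (simp add: algebra_simps)
    also have "\<dots> = s * (2 * m) + 2 * (1 - s) * m" by (simp add: m_def)
    also have "\<dots> = 2 * m" by (simp add: algebra_simps)
    also have "\<dots> = 2 * m powr s * m powr (1 - s)"
      using m powr_add[of m s "1 - s"] by simp
    finally show ?thesis using m by (simp add: mult_le_cancel_right)
  qed
  \<comment> \<open>Compares \<open>m\<close> with 1 - 2 lam (1 - m), the length of an interval made
    of the proportion \<open>x\<close> of the left copy, the middle gap, and the proportion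
    \<open>y\<close> of the right copy.\<close>
  have "0 \<le> (1 - 2 * lam) * (1 - m)"
    using lam xy by (intro mult_nonneg_nonneg) (auto simp: m_def)
  then have "m \<le> lam * (x + y) + 1 - 2 * lam" by (simp add: m_def field_simps)
  then have "m powr s \<le> (lam * (x + y) + 1 - 2 * lam) powr s"
    using s xy by (intro powr_mono2) (auto simp: m_def)
  with conc show ?thesis by simp
qed

section \<open>Self-similarity and counting of the Cantor intervals\<close>

context
  fixes s :: real
  assumes s: "0 < s" "s < 1"
begin

text \<open>Ratio of the two similarities that generate the set. Its s-th power is 1/2, so s is the
  similarity dimension.\<close>

definition cratio :: real where "cratio = 2 powr (- 1 / s)"

definition clen :: "nat \<Rightarrow> real" where "clen k = 2 powr (- real k / s)"

lemma cratio_pos: "0 < cratio" and cratio_half: "2 * cratio < 1"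
proof -
  show "0 < cratio" by (simp add: cratio_def)
  have "cratio < 2 powr (-1)"
    unfolding cratio_def using s by (intro powr_less_mono) (auto simp: field_simps)
  then show "2 * cratio < 1" by simp
qed

lemma cratio_powr: "cratio powr s = 1 / 2"
proof -
  have "(-1 / s) * s = -1" using s by simp
  then show ?thesis unfolding cratio_def powr_powr by simp
qed

lemma clen_0 [simp]: "clen 0 = 1" and clen_pos: "0 < clen k"
  and clen_Suc: "clen (Suc k) = cratio * clen k"
  using s by (auto simp: clen_def cratio_def powr_add[symmetric] field_simps)

lemma clen_eq_power: "clen k = cratio ^ k"
  by (induction k) (auto simp: clen_Suc)

lemma clen_powr: "clen k powr s = 1 / 2 ^ k"
proof -
  have "(- real k / s) * s = - real k" using s by simp
  then show ?thesis unfolding clen_def powr_powr by (simp only: powr_minus powr_realpow) (simp add: divide_inverse)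
qed

lemma clen_le_1: "clen k \<le> 1"
  using cratio_pos cratio_half by (simp add: clen_eq_power power_le_one)

lemma clen_tendsto: "clen \<longlonglongrightarrow> 0"
proof -
  have "(\<lambda>k. cratio ^ k) \<longlonglongrightarrow> 0"
    using cratio_pos cratio_half by (intro LIMSEQ_power_zero) auto
  then show ?thesis by (simp add: clen_eq_power[abs_def])
qed

text \<open>The defining recursion splits the intervals of the last level. Induction by
  self-similarity needs the opposite reading: the first half of level \<open>Suc k\<close> is level
  \<open>k\<close> scaled by \<open>cratio\<close>, and the second half (next lemma) is the same
  copy moved so as to end at 1.\<close>

lemma cantor_left_low:
  assumes "1 \<le> l" "l \<le> 2 ^ k"
  shows "cantor_left s (Suc k) l = cratio * cantor_left s k l"
  using assms
proof (induction k arbitrary: l)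
  case 0
  then have "l = 1" by simp
  then show ?case by simp
next
  case (Suc k)
  show ?case
  proof (cases "odd l")
    case True
    then show ?thesis using Suc.IH[of "(l + 1) div 2"] Suc.prems by (auto elim!: oddE)
  next
    case False
    have "2 powr (- real (Suc k) / s) - 2 powr (- real (Suc (Suc k)) / s)
      = cratio * (2 powr (- real k / s) - 2 powr (- real (Suc k) / s))"
      using clen_Suc[of k] clen_Suc[of "Suc k"] unfolding clen_def by (simp add: algebra_simps)
    moreover have "cantor_left s (Suc k) (l div 2) = cratio * cantor_left s k (l div 2)"
      using False Suc.prems by (intro Suc.IH) (auto elim!: evenE)
    ultimately show ?thesis
      using False by (simp only: cantor_left.simps if_False) (simp add: algebra_simps)
  qed
qed

lemma cantor_left_high:
  assumes "1 \<le> l" "l \<le> 2 ^ k"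
  shows "cantor_left s (Suc k) (2 ^ k + l) = cratio * cantor_left s k l + 1 - cratio"
  using assms
proof (induction k arbitrary: l)
  case 0
  then have "l = 1" by simp
  then show ?case by (simp add: cratio_def)
next
  case (Suc k)
  show ?case
  proof (cases "odd l")
    case True
    have "(2 ^ Suc k + l + 1) div 2 = 2 ^ k + (l + 1) div 2"
      by (simp add: algebra_simps)
    moreover have "odd (2 ^ Suc k + l)" using True by simp
    moreover have "cantor_left s (Suc k) (2 ^ k + (l + 1) div 2)
        = cratio * cantor_left s k ((l + 1) div 2) + 1 - cratio"
      using True Suc.prems by (intro Suc.IH) (auto elim!: oddE)
    ultimately show ?thesis
      using True by (simp only: cantor_left.simps(2)[of s "Suc k"] cantor_left.simps(2)[of s k l] if_True simp_thms)
  next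
    case False
    have "2 powr (- real (Suc k) / s) - 2 powr (- real (Suc (Suc k)) / s)
      = cratio * (2 powr (- real k / s) - 2 powr (- real (Suc k) / s))"
      using clen_Suc[of k] clen_Suc[of "Suc k"] unfolding clen_def by (simp add: algebra_simps)
    moreover have "cantor_left s (Suc k) (2 ^ k + l div 2)
        = cratio * cantor_left s k (l div 2) + 1 - cratio"
      using False Suc.prems by (intro Suc.IH) (auto elim!: evenE)
    moreover have "(2 ^ Suc k + l) div 2 = 2 ^ k + l div 2" by (simp add: algebra_simps)
    moreover have "even (2 ^ Suc k + l)" using False by simp
    ultimately show ?thesis
      using False
      by (simp only: cantor_left.simps(2)[of s "Suc k"] cantor_left.simps(2)[of s k l] if_False)
        (simp add: algebra_simps)
  qed
qed

lemma cantor_index_cases: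
  fixes l :: nat
  assumes "l \<in> {1..2 ^ Suc k}"
  obtains "l \<in> {1..2 ^ k}" | l' where "l' \<in> {1..2 ^ k}" "l = 2 ^ k + l'"
proof (cases "l \<le> 2 ^ k")
  case False
  then show ?thesis using that(2)[of "l - 2 ^ k"] assms by auto
qed (use assms that(1) in auto)

lemma cantor_left_bounds:
  assumes "l \<in> {1..2 ^ k}"
  shows "0 \<le> cantor_left s k l" "cantor_left s k l + clen k \<le> 1"
proof -
  have "0 \<le> cantor_left s k l \<and> cantor_left s k l + clen k \<le> 1"
    using assms
  proof (induction k arbitrary: l)
    case (Suc k)
    have c: "cratio * t \<le> cratio" if "t \<le> 1" for t
      using cratio_pos that by simp
    from Suc.prems show ?case
    proof (cases rule: cantor_index_cases)
      case 1
      then show ?thesis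
        using Suc.IH[of l] c[of "cantor_left s k l + clen k"] cratio_pos cratio_half
        by (simp only: cantor_left_low atLeastAtMost_iff clen_Suc) (auto simp: algebra_simps)
    next
      case (2 l')
      then have ih: "0 \<le> cantor_left s k l'" "cantor_left s k l' + clen k \<le> 1"
        using Suc.IH[of l'] by auto
      have "0 \<le> cratio * cantor_left s k l'" using ih cratio_pos by simp
      moreover have "cratio * cantor_left s k l' + cratio * clen k \<le> cratio"
        using c[OF ih(2)] by (simp add: distrib_left)
      ultimately show ?thesis
        using 2 cratio_half cratio_pos cantor_left_high[of l' k]
        by (simp add: clen_Suc del: cantor_left.simps)
    qed
  qed simp
  then show "0 \<le> cantor_left s k l" "cantor_left s k l + clen k \<le> 1" by auto
qed

text \<open>Mass distribution: if every interval of level \<open>k\<close> has mass 2^(-k), an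
  interval of length L contains mass at most L^s. There is no constant in front, which is what makes
  the Hausdorff measure exactly 1. In the induction each half is rescaled to level \<open>k\<close>,
  and \<open>cratio powr s = 1 / 2\<close> pays for the doubled number of intervals.\<close>

lemma card_cantor_intervals_le:
  assumes "a \<le> b"
  shows "real (card {l \<in> {1..2 ^ k}. a \<le> cantor_left s k l \<and> cantor_left s k l + clen k \<le> b})
    \<le> 2 ^ k * (b - a) powr s"
  using assms
proof (induction k arbitrary: a b)
  case 0
  show ?case
  proof (cases "a \<le> 0 \<and> 1 \<le> b")
    case True
    then have "1 powr s \<le> (b - a) powr s" using s by (intro powr_mono2) auto
    moreover have "{l \<in> {1..2 ^ 0}. a \<le> cantor_left s 0 l \<and> cantor_left s 0 l + clen 0 \<le> b} = {1::nat}"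
      using True by auto
    ultimately show ?thesis by simp
  next
    case False
    then have "{l \<in> {1..2 ^ 0}. a \<le> cantor_left s 0 l \<and> cantor_left s 0 l + clen 0 \<le> b} = {}"
      by auto
    then show ?thesis by (simp only: card.empty) simp
  qed
next
  case (Suc k)
  let ?L = cratio
  let ?N = "\<lambda>a b. {l \<in> {1..2 ^ k}. a \<le> cantor_left s k l \<and> cantor_left s k l + clen k \<le> b}"
  let ?S = "{l \<in> {1..2 ^ Suc k}. a \<le> cantor_left s (Suc k) l \<and> cantor_left s (Suc k) l + clen (Suc k) \<le> b}"
  \<comment> \<open>The counted intervals of the left and of the right half, pulled back to level
    \<open>k\<close> by the two similarities.\<close>
  define A where "A = ?N (a / ?L) (b / ?L)"
  define B where "B = ?N ((a - (1 - ?L)) / ?L) ((b - (1 - ?L)) / ?L)"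
  have fin: "finite A" "finite B" by (auto simp: A_def B_def)
  have L: "?L > 0" by (rule cratio_pos)
  have "?S \<subseteq> A \<union> (\<lambda>l. 2 ^ k + l) ` B"
  proof
    fix l assume l: "l \<in> ?S"
    then have "l \<in> {1..2 ^ Suc k}" by simp
    then show "l \<in> A \<union> (\<lambda>l. 2 ^ k + l) ` B"
    proof (cases rule: cantor_index_cases)
      case 1
      then have "l \<in> A" using l L cantor_left_low[of l k]
        by (auto simp: A_def field_simps clen_Suc simp del: cantor_left.simps)
      then show ?thesis by simp
    next
      case (2 l')
      then have "l' \<in> B" using l L cantor_left_high[of l' k]
        by (auto simp: B_def field_simps clen_Suc simp del: cantor_left.simps)
      then show ?thesis using 2 by auto
    qed
  qed
  then have "card ?S \<le> card (A \<union> (\<lambda>l. 2 ^ k + l) ` B)"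
    using fin by (intro card_mono) auto
  also have "\<dots> \<le> card A + card B"
    using card_Un_le[of A "(\<lambda>l. 2 ^ k + l) ` B"] card_image_le[of B "\<lambda>l. 2 ^ k + l"] fin by linarith
  finally have cS: "real (card ?S) \<le> real (card A) + real (card B)" by linarith
  have scale: "(t / ?L) powr s = 2 * t powr s" if "0 \<le> t" for t
    using that L by (simp add: powr_divide cratio_powr)
  show ?case
  proof (cases "A = {} \<or> B = {}")
    case True
    have "real (card A) \<le> 2 ^ k * (b / ?L - a / ?L) powr s"
      unfolding A_def using Suc.prems L by (intro Suc.IH divide_right_mono) auto
    also have "b / ?L - a / ?L = (b - a) / ?L" by (simp add: diff_divide_distrib)
    finally have 1: "real (card A) \<le> 2 ^ Suc k * (b - a) powr s"
      using scale[of "b - a"] Suc.prems by simp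
    have "real (card B) \<le> 2 ^ k * ((b - (1 - ?L)) / ?L - (a - (1 - ?L)) / ?L) powr s"
      unfolding B_def using Suc.prems L by (intro Suc.IH divide_right_mono) auto
    also have "(b - (1 - ?L)) / ?L - (a - (1 - ?L)) / ?L = (b - a) / ?L"
      by (simp add: diff_divide_distrib[symmetric])
    finally have 2: "real (card B) \<le> 2 ^ Suc k * (b - a) powr s"
      using scale[of "b - a"] Suc.prems by simp
    have "card A = 0 \<or> card B = 0" using True by auto
    then show ?thesis using cS 1 2 by linarith
  next
    case False
    \<comment> \<open>Since both halves contain counted intervals, [a, b] contains the middle gap.
      \<open>x\<close> and \<open>y\<close> are the rescaled lengths of what it covers of the two
      first-level intervals, and concavity replaces plain scaling.\<close>
    define x where "x = 1 - max a 0 / ?L"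
    define y where "y = (min b 1 - (1 - ?L)) / ?L"
    from False obtain l where l: "l \<in> A" by auto
    from False obtain l' where l': "l' \<in> B" by auto
    have "a / ?L \<le> 1" using l cantor_left_bounds[of l k] clen_pos[of k] by (auto simp: A_def)
    then have x: "0 \<le> x" "x \<le> 1" using L by (auto simp: x_def field_simps max_def)
    have "0 \<le> (b - (1 - ?L)) / ?L"
      using l' cantor_left_bounds[of l' k] clen_pos[of k] by (auto simp: B_def)
    then have y: "0 \<le> y" "y \<le> 1" using L by (auto simp: y_def field_simps min_def)
    have "A \<subseteq> ?N (max a 0 / ?L) 1"
      using cantor_left_bounds[of _ k] by (auto simp: A_def max_def)
    then have "real (card A) \<le> real (card (?N (max a 0 / ?L) 1))"
      by (intro of_nat_mono card_mono) auto
    also have "\<dots> \<le> 2 ^ k * x powr s" unfolding x_def using x by (intro Suc.IH) (auto simp: x_def)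
    finally have cA: "real (card A) \<le> 2 ^ k * x powr s" .
    have "B \<subseteq> ?N 0 y"
      using cantor_left_bounds[of _ k] L by (auto simp: B_def y_def min_def)
    then have "real (card B) \<le> real (card (?N 0 y))"
      by (intro of_nat_mono card_mono) auto
    also have "\<dots> \<le> 2 ^ k * (y - 0) powr s" using y by (intro Suc.IH)
    finally have cB: "real (card B) \<le> 2 ^ k * y powr s" by simp
    have "?L * (x + y) + 1 - 2 * ?L = min b 1 - max a 0"
      using L by (simp add: x_def y_def field_simps)
    then have "x powr s + y powr s \<le> 2 * (min b 1 - max a 0) powr s"
      using powr_add_le_of_half[OF s cratio_pos cratio_half x y] by simp
    also have "(min b 1 - max a 0) powr s \<le> (b - a) powr s"
    proof (intro powr_mono2)
      have "0 \<le> ?L * (x + y) + (1 - 2 * ?L)" 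
        using x y L cratio_half by (intro add_nonneg_nonneg mult_nonneg_nonneg) auto
      then show "0 \<le> min b 1 - max a 0"
        using \<open>?L * (x + y) + 1 - 2 * ?L = min b 1 - max a 0\<close> by linarith
    qed (use s in auto)
    finally have "x powr s + y powr s \<le> 2 * (b - a) powr s" by simp
    then have "2 ^ k * (x powr s + y powr s) \<le> 2 ^ k * (2 * (b - a) powr s)"
      by (intro mult_left_mono) auto
    then show ?thesis using cS cA cB by (simp add: algebra_simps)
  qed
qed

section \<open>Compactness, end points and approximation\<close>

definition cantor_level :: "nat \<Rightarrow> real set" where
  "cantor_level k = (\<Union>l\<in>{1..2 ^ k}. {cantor_left s k l .. cantor_left s k l + clen k})"

lemma cantor_E_eq: "cantor_E s = (\<Inter>k\<in>{1..}. cantor_level k)"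
  by (simp add: cantor_E_def cantor_level_def cantor_interval_def clen_def)

lemma cantor_level_Suc: "cantor_level (Suc k) \<subseteq> cantor_level k"
proof
  fix x assume "x \<in> cantor_level (Suc k)"
  then obtain l where l: "l \<in> {1..2 ^ Suc k}"
    "cantor_left s (Suc k) l \<le> x" "x \<le> cantor_left s (Suc k) l + clen (Suc k)"
    by (auto simp: cantor_level_def)
  have len: "clen (Suc k) \<le> clen k" "2 powr (- real k / s) = clen k"
      "2 powr (- real (Suc k) / s) = clen (Suc k)"
    using clen_Suc[of k] clen_pos[of k] cratio_pos cratio_half
    by (auto simp: clen_def)
  show "x \<in> cantor_level k"
  proof (cases "odd l")
    case True
    then have "(l + 1) div 2 \<in> {1..2 ^ k}" using l by (auto elim!: oddE)
    moreover have "x \<in> {cantor_left s k ((l + 1) div 2) .. cantor_left s k ((l + 1) div 2) + clen k}"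
      using True l len by simp
    ultimately show ?thesis unfolding cantor_level_def by blast
  next
    case False
    then have "l div 2 \<in> {1..2 ^ k}" using l by (auto elim!: evenE)
    moreover have "x \<in> {cantor_left s k (l div 2) .. cantor_left s k (l div 2) + clen k}"
      using False l len by simp
    ultimately show ?thesis unfolding cantor_level_def by blast
  qed
qed

lemma cantor_level_antimono: "m \<le> k \<Longrightarrow> cantor_level k \<subseteq> cantor_level m"
  by (rule lift_Suc_antimono_le[of cantor_level]) (use cantor_level_Suc in auto)

lemma cantor_E_subset_level: "cantor_E s \<subseteq> cantor_level k"
proof -
  have "cantor_E s \<subseteq> cantor_level (Suc k)" unfolding cantor_E_eq by auto
  then show ?thesis using cantor_level_Suc[of k] by blast
qed

text \<open>A left end point is never removed: the left child of the interval \<open>l\<close> has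
  index \<open>2 * l - 1\<close> and the same left end.\<close>

lemma cantor_left_in_E:
  assumes "l \<in> {1..2 ^ k}"
  shows "cantor_left s k l \<in> cantor_E s"
proof -
  have later: "\<exists>l'\<in>{1..2 ^ (k + j)}. cantor_left s k l = cantor_left s (k + j) l'" for j
  proof (induction j)
    case (Suc j)
    then obtain l' where l': "l' \<in> {1..2 ^ (k + j)}" "cantor_left s k l = cantor_left s (k + j) l'"
      by blast
    have "odd (2 * l' - 1)" "(2 * l' - 1 + 1) div 2 = l'" using l' by auto
    then have "cantor_left s (k + Suc j) (2 * l' - 1) = cantor_left s (k + j) l'"
      by (simp only: cantor_left.simps(2)[of s "k + j"] add_Suc_right if_True simp_thms)
    moreover have "2 * l' - 1 \<in> {1..2 ^ (k + Suc j)}" using l' by auto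
    ultimately show ?case using l'(2) by metis
  qed (use assms in auto)
  have "cantor_left s k l \<in> cantor_level m" if "k \<le> m" for m
  proof -
    have "k + (m - k) = m" using that by simp
    then obtain l' where "l' \<in> {1..2 ^ m}" "cantor_left s k l = cantor_left s m l'"
      using later[of "m - k"] by auto
    moreover from this have "cantor_left s k l \<in> {cantor_left s m l' .. cantor_left s m l' + clen m}"
      using clen_pos[of m] by simp
    ultimately show ?thesis unfolding cantor_level_def by blast
  qed
  then have "cantor_left s k l \<in> cantor_level m" for m
    using cantor_level_antimono[of m k] by (cases "k \<le> m") auto
  then show ?thesis by (simp add: cantor_E_eq)
qed

lemma cantor_E_subset: "cantor_E s \<subseteq> {0..1}"
  using cantor_E_subset_level[of 0] by (simp add: cantor_level_def)

lemma compact_cantor_E: "compact (cantor_E s)"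
proof -
  have "closed (cantor_E s)"
    unfolding cantor_E_eq cantor_level_def by (intro closed_INT ballI closed_UN) auto
  moreover have "bounded (cantor_E s)"
    using cantor_E_subset bounded_closed_interval[of 0 1] bounded_subset by blast
  ultimately show ?thesis by (simp add: compact_eq_bounded_closed)
qed

lemma cantor_E_approx:
  assumes "y \<in> cantor_E s"
  shows "\<exists>l\<in>{1..2 ^ k}. \<bar>y - cantor_left s k l\<bar> \<le> clen k"
  using assms cantor_E_subset_level[of k] by (force simp: cantor_level_def)

section \<open>Points of the Cantor set with a gap on their left\<close>

lemma cantor_second_le:
  assumes "l \<in> {2..2 ^ Suc n}"
  shows "clen n * (1 - cratio) \<le> cantor_left s (Suc n) l"
  using assms
proof (induction n arbitrary: l)
  case 0
  then have "l = 2" by auto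
  then show ?case using cantor_left_high[of 1 0] by (simp add: numeral_2_eq_2)
next
  case (Suc n)
  then have "l \<in> {1..2 ^ Suc (Suc n)}" by auto
  then show ?case
  proof (cases rule: cantor_index_cases)
    case 1
    then have "l \<in> {2..2 ^ Suc n}" using Suc.prems by auto
    from Suc.IH[OF this] have "cratio * (clen n * (1 - cratio)) \<le> cratio * cantor_left s (Suc n) l"
      using cratio_pos by simp
    then show ?thesis using 1 cantor_left_low[of l "Suc n"]
      by (simp add: clen_Suc mult.assoc del: cantor_left.simps)
  next
    case (2 l')
    have "clen (Suc n) * (1 - cratio) \<le> 1 * (1 - cratio)"
      using clen_le_1[of "Suc n"] cratio_half cratio_pos by (intro mult_right_mono) auto
    moreover have "0 \<le> cratio * cantor_left s (Suc n) l'"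
      using cantor_left_bounds[OF 2(1)] cratio_pos by simp
    ultimately show ?thesis using 2 cantor_left_high[of l' "Suc n"]
      by (simp del: cantor_left.simps)
  qed
qed

text \<open>Left end of the second interval of level \<open>Suc n\<close>. These points decrease to
  0 and form the countable subset on which the frequency blows up.\<close>

definition cantor_pt :: "nat \<Rightarrow> real" where "cantor_pt n = clen n * (1 - cratio)"

lemma cantor_pt_eq: "cantor_pt n = cantor_left s (Suc n) 2"
proof -
  have "cantor_left s n 1 = 0" by (induction n) auto
  then show ?thesis
    using clen_Suc[of n] by (simp add: cantor_pt_def clen_def algebra_simps)
qed

lemma cantor_pt_in_E: "cantor_pt n \<in> cantor_E s"
  unfolding cantor_pt_eq by (rule cantor_left_in_E) auto

lemma inj_cantor_pt: "inj cantor_pt"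
proof -
  have "cantor_pt n < cantor_pt m" if "m < n" for m n
  proof -
    have "clen n < clen m"
      unfolding clen_eq_power using cratio_pos cratio_half that
      by (intro power_strict_decreasing) auto
    then show ?thesis
      unfolding cantor_pt_def using cratio_half cratio_pos by (intro mult_strict_right_mono) auto
  qed
  then show ?thesis
    by (intro linorder_injI) (metis less_irrefl)
qed

text \<open>To the left of this point lies only the first interval of level \<open>Suc n\<close>,
  which ends at \<open>clen (Suc n)\<close>. The gap therefore has length
  \<open>clen n * (1 - 2 * cratio)\<close>.\<close>

lemma cantor_pt_gap:
  "\<exists>g>0. \<forall>y\<in>cantor_E s. cantor_pt n \<le> y \<or> y \<le> cantor_pt n - g"
proof (intro exI conjI ballI)
  show "0 < cantor_pt n - clen (Suc n)"
  proof -
    have "0 < clen n * (1 - 2 * cratio)" using clen_pos[of n] cratio_half by simp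
    then show ?thesis by (simp add: cantor_pt_def clen_Suc algebra_simps)
  qed
  fix y assume "y \<in> cantor_E s"
  then obtain l where l: "l \<in> {1..2 ^ Suc n}" "cantor_left s (Suc n) l \<le> y"
      "y \<le> cantor_left s (Suc n) l + clen (Suc n)"
    using cantor_E_subset_level[of "Suc n"] by (auto simp: cantor_level_def)
  have left1: "cantor_left s (Suc n) 1 = 0" 
  proof -
    have "cantor_left s n 1 = 0" for n by (induction n) auto
    then show ?thesis .
  qed
  show "cantor_pt n \<le> y \<or> y \<le> cantor_pt n - (cantor_pt n - clen (Suc n))"
  proof (cases "l = 1")
    case True
    then show ?thesis using l left1 by simp
  next
    case False
    then show ?thesis using l cantor_second_le[of l n] by (auto simp: cantor_pt_def)
  qed
qed

section \<open>The Hausdorff measure of the Cantor set\<close>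

lemma hausdorff_cantor_E_le: "hausdorff_outer s (cantor_E s) \<le> 1"
  unfolding hausdorff_outer_def
proof (intro SUP_least)
  fix \<delta> :: real assume "\<delta> \<in> {0<..}"
  then have "\<forall>\<^sub>F k in sequentially. clen k < \<delta>"
    using clen_tendsto by (auto intro: order_tendstoD)
  then obtain k where k: "clen k < \<delta>" by (meson eventually_at_top_linorder order_refl)
  \<comment> \<open>The intervals of level \<open>k\<close>, indexed from 0 and continued by empty
    sets, whose terms are \<open>0 powr s = 0\<close>. The remaining sum is 2^k times
    2^(-k).\<close>
  define U where "U j = (if j < 2 ^ k then {cantor_left s k (Suc j) .. cantor_left s k (Suc j) + clen k} else {})"
    for j :: nat
  have diam: "diameter (U j) = (if j < 2 ^ k then clen k else 0)" for j
    using clen_pos[of k] by (auto simp: U_def)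
  have "cantor_level k \<subseteq> (\<Union>j. U j)"
  proof
    fix x assume "x \<in> cantor_level k"
    then obtain l where l: "l \<in> {1..2 ^ k}" "x \<in> {cantor_left s k l .. cantor_left s k l + clen k}"
      unfolding cantor_level_def by blast
    then have "x \<in> U (l - 1)" by (auto simp: U_def)
    then show "x \<in> (\<Union>j. U j)" by blast
  qed
  then have "U \<in> {U. cantor_E s \<subseteq> (\<Union>j. U j) \<and> (\<forall>j. bounded (U j) \<and> diameter (U j) < \<delta>)}"
    using cantor_E_subset_level[of k] k \<open>\<delta> \<in> {0<..}\<close> by (auto simp: diam) (auto simp: U_def)
  moreover have "(\<Sum>j. ennreal (diameter (U j) powr s)) = 1"
  proof -
    have "(\<Sum>j. ennreal (diameter (U j) powr s)) = (\<Sum>j<2 ^ k. ennreal (diameter (U j) powr s))"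
      by (rule suminf_finite) (auto simp: diam)
    also have "\<dots> = ennreal (\<Sum>j<(2::nat) ^ k. 1 / 2 ^ k)"
      by (subst sum_ennreal[symmetric]) (auto simp: diam clen_powr)
    finally show ?thesis by simp
  qed
  ultimately show "(INF U\<in>{U. cantor_E s \<subseteq> (\<Union>j. U j) \<and> (\<forall>j. bounded (U j) \<and> diameter (U j) < \<delta>)}.
       \<Sum>j. ennreal (diameter (U j) powr s)) \<le> 1"
    by (intro INF_lower2[of U]) auto
qed

text \<open>Right continuity of t^s at the diameter of \<open>U\<close>, including diameter 0
  because s > 0. Openness serves the compactness argument below, and being an interval serves the
  counting bound.\<close>

lemma enlarge_interval:
  fixes U :: "real set"
  assumes "bounded U" "0 < e"
  shows "\<exists>a b. a \<le> b \<and> U \<subseteq> {a<..<b} \<and> (b - a) powr s \<le> diameter U powr s + e"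
proof -
  define d where "d = diameter U"
  have d: "0 \<le> d" using assms by (simp add: d_def diameter_ge_0)
  have "((\<lambda>t. (d + t) powr s) \<longlongrightarrow> (d + 0) powr s) (at_right 0)"
  proof (intro tendsto_powr')
    show "((\<lambda>t. d + t) \<longlongrightarrow> d + 0) (at_right 0)" by (intro tendsto_intros)
    show "d + 0 \<noteq> 0 \<or> 0 < s \<and> (\<forall>\<^sub>F x in at_right 0. 0 \<le> d + x)"
      using s d by (auto simp: eventually_at_filter intro!: always_eventually)
  qed auto
  then have "\<forall>\<^sub>F t in at_right 0. (d + t) powr s < d powr s + e"
    using assms(2) by (intro order_tendstoD) auto
  then have "\<forall>\<^sub>F t in at_right 0. (d + t) powr s < d powr s + e \<and> 0 < t"
    by (intro eventually_conj) (auto simp: eventually_at_filter)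
  then obtain t where t: "(d + t) powr s < d powr s + e" "0 < t"
    using eventually_happens[of _ "at_right (0::real)"] by force
  show ?thesis
  proof (cases "U = {}")
    case True
    have "t powr s \<le> (d + t) powr s" using t d s by (intro powr_mono2) auto
    then show ?thesis using t True by (intro exI[of _ 0] exI[of _ t]) (auto simp: d_def)
  next
    case False
    have bdd: "bdd_above U" "bdd_below U"
      using assms(1) by (auto simp: bounded_imp_bdd_above bounded_imp_bdd_below)
    have "Sup U - d \<le> Inf U"
    proof (rule cInf_greatest[OF False])
      fix y assume y: "y \<in> U"
      have "Sup U \<le> y + d"
      proof (rule cSup_least[OF False])
        fix x assume "x \<in> U"
        then show "x \<le> y + d"
          using diameter_bounded_bound[OF assms(1) _ y, of x] by (auto simp: d_def dist_real_def)
      qed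
      then show "Sup U - d \<le> y" by simp
    qed
    moreover have "Inf U \<le> Sup U"
      using False bdd by (meson cInf_lower cSup_upper ex_in_conv order_trans)
    moreover have "U \<subseteq> {Inf U - t / 2<..<Sup U + t / 2}"
    proof
      fix x assume "x \<in> U"
      then have "Inf U \<le> x" "x \<le> Sup U" using bdd by (auto intro: cInf_lower cSup_upper)
      then show "x \<in> {Inf U - t / 2<..<Sup U + t / 2}" using t by auto
    qed
    moreover have "(Sup U + t / 2 - (Inf U - t / 2)) powr s \<le> (d + t) powr s"
      using calculation t s by (intro powr_mono2) auto
    ultimately show ?thesis using t
      by (intro exI[of _ "Inf U - t / 2"] exI[of _ "Sup U + t / 2"]) (auto simp: d_def)
  qed
qed

text \<open>The cover is enlarged to open intervals at a total cost \<open>e\<close>. A Lebesgue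
  number puts each interval of a fine level \<open>k\<close> inside one of them, and each of them
  holds at most 2^k times the s-th power of its length, while 2^k intervals have to be
  housed.\<close>

lemma cantor_cover_ge_1:
  fixes U :: "nat \<Rightarrow> real set"
  assumes cov: "cantor_E s \<subseteq> (\<Union>j. U j)" and bdd: "\<And>j. bounded (U j)"
  shows "1 \<le> (\<Sum>j. ennreal (diameter (U j) powr s))"
proof (rule ennreal_le_epsilon)
  fix e :: real assume e: "0 < e"
  have "\<forall>j. \<exists>a b. a \<le> b \<and> U j \<subseteq> {a<..<b} \<and> (b - a) powr s \<le> diameter (U j) powr s + e * (1/2) ^ Suc j"
    using enlarge_interval[OF bdd] e by simp
  then obtain a b where ab: "\<And>j. a j \<le> b j" "\<And>j. U j \<subseteq> {a j<..<b j}"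
    "\<And>j. (b j - a j) powr s \<le> diameter (U j) powr s + e * (1/2) ^ Suc j" by metis
  have "cantor_E s \<subseteq> \<Union> (range (\<lambda>j. {a j<..<b j}))" using cov ab(2) by blast
  then obtain d where d: "d > 0" "\<And>x. x \<in> cantor_E s \<Longrightarrow> \<exists>G\<in>range (\<lambda>j. {a j<..<b j}). ball x d \<subseteq> G"
    by (rule Heine_Borel_lemma[OF compact_cantor_E]) auto
  have "\<forall>\<^sub>F k in sequentially. clen k < d" using clen_tendsto d by (auto intro: order_tendstoD)
  then obtain k where k: "clen k < d" by (meson eventually_at_top_linorder order_refl)
  have "\<forall>l\<in>{1..2 ^ k}. \<exists>j. ball (cantor_left s k l) d \<subseteq> {a j<..<b j}"
    using d(2) cantor_left_in_E by blast
  then obtain g where g: "\<And>l. l \<in> {1..2 ^ k} \<Longrightarrow> ball (cantor_left s k l) d \<subseteq> {a (g l)<..<b (g l)}"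
    by metis
  define N where "N j = {l \<in> {1..2 ^ k}. a j \<le> cantor_left s k l \<and> cantor_left s k l + clen k \<le> b j}" for j
  define J where "J = g ` {1..2 ^ k}"
  have "{1..2 ^ k} \<subseteq> (\<Union>j\<in>J. N j)"
  proof
    fix l :: nat assume l: "l \<in> {1..2 ^ k}"
    have "cantor_left s k l \<in> ball (cantor_left s k l) d"
        "cantor_left s k l + clen k \<in> ball (cantor_left s k l) d"
      using d k clen_pos[of k] by (auto simp: dist_real_def)
    then have "cantor_left s k l \<in> {a (g l)<..<b (g l)}"
        "cantor_left s k l + clen k \<in> {a (g l)<..<b (g l)}"
      using g[OF l] by (metis subsetD)+
    then have "l \<in> N (g l)" using l by (simp add: N_def)
    then show "l \<in> (\<Union>j\<in>J. N j)" using l by (auto simp: J_def)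
  qed
  then have "card {1..(2::nat) ^ k} \<le> card (\<Union>j\<in>J. N j)"
    by (intro card_mono) (auto simp: J_def N_def)
  also have "\<dots> \<le> (\<Sum>j\<in>J. card (N j))" by (intro card_UN_le) (auto simp: J_def)
  finally have "real (2 ^ k) \<le> real (\<Sum>j\<in>J. card (N j))"
    by (intro of_nat_mono) simp
  also have "\<dots> \<le> (\<Sum>j\<in>J. 2 ^ k * (b j - a j) powr s)"
    unfolding of_nat_sum N_def by (intro sum_mono card_cantor_intervals_le ab)
  finally have "1 \<le> (\<Sum>j\<in>J. (b j - a j) powr s)" by (simp add: sum_distrib_left[symmetric])
  also have "\<dots> \<le> (\<Sum>j\<in>J. diameter (U j) powr s + e * (1/2) ^ Suc j)"
    by (intro sum_mono ab)
  finally have "ennreal 1 \<le> ennreal (\<Sum>j\<in>J. diameter (U j) powr s + e * (1/2) ^ Suc j)"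
    by (rule ennreal_leI)
  also have "\<dots> = (\<Sum>j\<in>J. ennreal (diameter (U j) powr s) + ennreal (e * (1/2) ^ Suc j))"
    using e by (subst sum_ennreal[symmetric]) (auto intro!: sum.cong simp: ennreal_plus)
  also have "\<dots> \<le> (\<Sum>j. ennreal (diameter (U j) powr s) + ennreal (e * (1/2) ^ Suc j))"
    by (intro sum_le_suminf) (auto simp: J_def)
  also have "\<dots> = (\<Sum>j. ennreal (diameter (U j) powr s)) + (\<Sum>j. ennreal (e * (1/2) ^ Suc j))"
    by (rule suminf_add[symmetric]) auto
  also have "(\<Sum>j. ennreal (e * (1/2) ^ Suc j)) = ennreal e"
    using e sums_mult[OF power_half_series, of e] by (intro suminf_ennreal_eq) auto
  finally show "1 \<le> (\<Sum>j. ennreal (diameter (U j) powr s)) + ennreal e" by simp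
qed

lemma hausdorff_cantor_E: "hausdorff_outer s (cantor_E s) = 1"
proof (rule antisym[OF hausdorff_cantor_E_le])
  have "1 \<le> (INF U\<in>{U. cantor_E s \<subseteq> (\<Union>j. U j) \<and> (\<forall>j. bounded (U j) \<and> diameter (U j) < 1)}.
       \<Sum>j. ennreal (diameter (U j) powr s))"
    by (intro INF_greatest cantor_cover_ge_1) auto
  also have "\<dots> \<le> hausdorff_outer s (cantor_E s)"
    unfolding hausdorff_outer_def by (intro SUP_upper) auto
  finally show "1 \<le> hausdorff_outer s (cantor_E s)" .
qed

end

section \<open>Hausdorff measure as a Borel measure\<close>

definition hausdorff_cover :: "real \<Rightarrow> 'a::metric_space set \<Rightarrow> (nat \<Rightarrow> 'a set) set" where
  "hausdorff_cover \<delta> E = {U. E \<subseteq> (\<Union>j. U j) \<and> (\<forall>j. bounded (U j) \<and> diameter (U j) < \<delta>)}"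

text \<open>The infimum at a fixed scale has a name because subadditivity holds at every scale and
  additivity on separated sets at all scales below their distance; only then is the supremum
  taken.\<close>

definition hausdorff_pre :: "real \<Rightarrow> real \<Rightarrow> 'a::metric_space set \<Rightarrow> ennreal" where
  "hausdorff_pre s \<delta> E = (INF U\<in>hausdorff_cover \<delta> E. (\<Sum>j. ennreal (diameter (U j) powr s)))"

lemma hausdorff_outer_eq: "hausdorff_outer s E = (SUP \<delta>\<in>{0<..}. hausdorff_pre s \<delta> E)"
  by (simp add: hausdorff_outer_def hausdorff_pre_def hausdorff_cover_def)

lemma hausdorff_pre_mono: "E \<subseteq> F \<Longrightarrow> hausdorff_pre s \<delta> E \<le> hausdorff_pre s \<delta> F"
  unfolding hausdorff_pre_def by (intro INF_superset_mono) (auto simp: hausdorff_cover_def)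

lemma hausdorff_pre_antimono: "\<delta> \<le> \<delta>' \<Longrightarrow> hausdorff_pre s \<delta>' E \<le> hausdorff_pre s \<delta> E"
  unfolding hausdorff_pre_def
  by (intro INF_superset_mono) (auto simp: hausdorff_cover_def intro: less_le_trans)

lemma hausdorff_pre_le_outer: "0 < \<delta> \<Longrightarrow> hausdorff_pre s \<delta> E \<le> hausdorff_outer s E"
  unfolding hausdorff_outer_eq by (intro SUP_upper) auto

lemma hausdorff_outer_mono: "E \<subseteq> F \<Longrightarrow> hausdorff_outer s E \<le> hausdorff_outer s F"
  unfolding hausdorff_outer_eq by (intro SUP_mono) (auto intro: hausdorff_pre_mono)

lemma hausdorff_outer_empty [simp]: "hausdorff_outer s {} = 0"
proof -
  have "hausdorff_pre s \<delta> ({} :: 'a set) \<le> 0" if "0 < \<delta>" for \<delta>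
    unfolding hausdorff_pre_def
    by (rule INF_lower2[of "\<lambda>_. {}"]) (use that in \<open>auto simp: hausdorff_cover_def\<close>)
  then show ?thesis
    unfolding hausdorff_outer_eq by (simp add: SUP_eq_const zero_ennreal.rep_eq)
qed

text \<open>Covers of the \<open>A i\<close> that are optimal up to e / 2^(i+1) are merged into one
  sequence by the pairing function. The right side may be taken finite, so that each infimum is
  finite and can be approached strictly.\<close>

lemma hausdorff_pre_countably_subadditive:
  "hausdorff_pre s \<delta> (\<Union>i. A i) \<le> (\<Sum>i. hausdorff_pre s \<delta> (A i))"
proof (rule ennreal_le_epsilon)
  fix e :: real assume e: "0 < e" and fin: "(\<Sum>i. hausdorff_pre s \<delta> (A i)) < top"
  have "\<exists>U\<in>hausdorff_cover \<delta> (A i). (\<Sum>j. ennreal (diameter (U j) powr s)) 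
      \<le> hausdorff_pre s \<delta> (A i) + ennreal (e * (1/2) ^ Suc i)" for i
  proof -
    have "hausdorff_pre s \<delta> (A i) < top"
      using ennreal_suminf_lessD[OF fin] by auto
    then have "hausdorff_pre s \<delta> (A i) < hausdorff_pre s \<delta> (A i) + ennreal (e * (1/2) ^ Suc i)"
      using e ennreal_add_left_cancel_less[of "hausdorff_pre s \<delta> (A i)" 0] by (simp add: less_top)
    then show ?thesis unfolding hausdorff_pre_def INF_less_iff by (auto intro: less_imp_le)
  qed
  then obtain U where U: "\<And>i. U i \<in> hausdorff_cover \<delta> (A i)"
    "\<And>i. (\<Sum>j. ennreal (diameter (U i j) powr s)) 
      \<le> hausdorff_pre s \<delta> (A i) + ennreal (e * (1/2) ^ Suc i)" by metis
  define V where "V n = (case prod_decode n of (i, j) \<Rightarrow> U i j)" for n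
  have "(\<Union>i. A i) \<subseteq> (\<Union>n. V n)"
  proof
    fix x assume "x \<in> (\<Union>i. A i)"
    then obtain i j where "x \<in> U i j" using U(1) unfolding hausdorff_cover_def by blast
    then have "x \<in> V (prod_encode (i, j))" by (simp add: V_def)
    then show "x \<in> (\<Union>n. V n)" by blast
  qed
  then have "V \<in> hausdorff_cover \<delta> (\<Union>i. A i)"
    using U(1) by (auto simp: hausdorff_cover_def V_def split: prod.split)
  then have "hausdorff_pre s \<delta> (\<Union>i. A i) \<le> (\<Sum>n. ennreal (diameter (V n) powr s))"
    unfolding hausdorff_pre_def by (rule INF_lower)
  also have "\<dots> = (\<Sum>n. (\<lambda>(i, j). ennreal (diameter (U i j) powr s)) (prod_decode n))"
    by (simp add: V_def case_prod_unfold)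
  also have "\<dots> = (\<Sum>i j. ennreal (diameter (U i j) powr s))"
    by (rule suminf_ennreal_2dimen) simp
  also have "\<dots> \<le> (\<Sum>i. hausdorff_pre s \<delta> (A i) + ennreal (e * (1/2) ^ Suc i))"
    using U(2) by (intro suminf_le) auto
  also have "\<dots> = (\<Sum>i. hausdorff_pre s \<delta> (A i)) + (\<Sum>i. ennreal (e * (1/2) ^ Suc i))"
    by (rule suminf_add[symmetric]) auto
  also have "(\<Sum>j. ennreal (e * (1/2) ^ Suc j)) = ennreal e"
    using e sums_mult[OF power_half_series, of e] by (intro suminf_ennreal_eq) auto
  finally show "hausdorff_pre s \<delta> (\<Union>i. A i) \<le> (\<Sum>i. hausdorff_pre s \<delta> (A i)) + ennreal e" .
qed

lemma hausdorff_outer_countably_subadditive: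
  "hausdorff_outer s (\<Union>i. A i) \<le> (\<Sum>i. hausdorff_outer s (A i))"
  unfolding hausdorff_outer_eq[of s "\<Union>i. A i"]
proof (rule SUP_least)
  fix \<delta> :: real assume d: "\<delta> \<in> {0<..}"
  have "hausdorff_pre s \<delta> (\<Union>i. A i) \<le> (\<Sum>i. hausdorff_pre s \<delta> (A i))"
    by (rule hausdorff_pre_countably_subadditive)
  also have "\<dots> \<le> (\<Sum>i. hausdorff_outer s (A i))"
    using d by (intro suminf_le hausdorff_pre_le_outer) auto
  finally show "hausdorff_pre s \<delta> (\<Union>i. A i) \<le> (\<Sum>i. hausdorff_outer s (A i))" .
qed

lemma hausdorff_outer_Un: "hausdorff_outer s (A \<union> B) \<le> hausdorff_outer s A + hausdorff_outer s B"
proof -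
  define C where "C i = (if i = 0 then A else if i = 1 then B else {})" for i :: nat
  have "A \<union> B = (\<Union>i. C i)" by (auto simp: C_def split: if_splits)
  then have "hausdorff_outer s (A \<union> B) \<le> (\<Sum>i. hausdorff_outer s (C i))"
    using hausdorff_outer_countably_subadditive[of s C] by simp
  also have "\<dots> = (\<Sum>i\<in>{0, 1}. hausdorff_outer s (C i))"
    by (rule suminf_finite) (auto simp: C_def)
  finally show ?thesis by (simp add: C_def)
qed

lemma hausdorff_pre_separated:
  assumes d: "0 < d" "\<And>x y. x \<in> A \<Longrightarrow> y \<in> B \<Longrightarrow> d \<le> dist x y" and \<delta>: "0 < \<delta>" "\<delta> \<le> d"
  shows "hausdorff_pre s \<delta> A + hausdorff_pre s \<delta> B \<le> hausdorff_pre s \<delta> (A \<union> B)"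
  unfolding hausdorff_pre_def[of s \<delta> "A \<union> B"]
proof (rule INF_greatest)
  fix U assume U: "U \<in> hausdorff_cover \<delta> (A \<union> B)"
  define V where "V j = (if U j \<inter> A \<noteq> {} then U j else {})" for j
  define W where "W j = (if U j \<inter> B \<noteq> {} then U j else {})" for j
  have "V \<in> hausdorff_cover \<delta> A" "W \<in> hausdorff_cover \<delta> B"
    using U \<delta> by (auto simp: hausdorff_cover_def V_def W_def)
      (metis IntI UnI1 UnI2 UN_iff empty_iff subsetD UnCI)+
  then have "hausdorff_pre s \<delta> A + hausdorff_pre s \<delta> B
      \<le> (\<Sum>j. ennreal (diameter (V j) powr s)) + (\<Sum>j. ennreal (diameter (W j) powr s))"
    unfolding hausdorff_pre_def by (intro add_mono INF_lower)
  also have "\<dots> = (\<Sum>j. ennreal (diameter (V j) powr s) + ennreal (diameter (W j) powr s))"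
    by (intro suminf_add) auto
  also have "\<dots> \<le> (\<Sum>j. ennreal (diameter (U j) powr s))"
  proof (intro suminf_le)
    fix j
    have "\<not> (U j \<inter> A \<noteq> {} \<and> U j \<inter> B \<noteq> {})"
    proof
      assume "U j \<inter> A \<noteq> {} \<and> U j \<inter> B \<noteq> {}"
      then obtain x y where xy: "x \<in> U j" "x \<in> A" "y \<in> U j" "y \<in> B" by blast
      have "bounded (U j)" "diameter (U j) < \<delta>" using U by (auto simp: hausdorff_cover_def)
      then have "dist x y < \<delta>" using diameter_bounded_bound[of "U j" x y] xy by simp
      then show False using d(2)[OF xy(2,4)] \<delta> by simp
    qed
    then show "ennreal (diameter (V j) powr s) + ennreal (diameter (W j) powr s)
        \<le> ennreal (diameter (U j) powr s)"
      by (auto simp: V_def W_def)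
  qed auto
  finally show "hausdorff_pre s \<delta> A + hausdorff_pre s \<delta> B \<le> (\<Sum>j. ennreal (diameter (U j) powr s))" .
qed

lemma hausdorff_outer_separated:
  assumes d: "0 < d" "\<And>x y. x \<in> A \<Longrightarrow> y \<in> B \<Longrightarrow> d \<le> dist x y"
  shows "hausdorff_outer s A + hausdorff_outer s B \<le> hausdorff_outer s (A \<union> B)"
proof -
  \<comment> \<open>Two independent scales, so that the two suprema on the left can be formed one
    after the other.\<close>
  have le: "hausdorff_pre s \<delta>1 A + hausdorff_pre s \<delta>2 B \<le> hausdorff_outer s (A \<union> B)"
    if "0 < \<delta>1" "0 < \<delta>2" for \<delta>1 \<delta>2
  proof -
    define \<delta> where "\<delta> = min d (min \<delta>1 \<delta>2)"
    have "hausdorff_pre s \<delta>1 A + hausdorff_pre s \<delta>2 B \<le> hausdorff_pre s \<delta> A + hausdorff_pre s \<delta> B"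
      by (intro add_mono hausdorff_pre_antimono) (auto simp: \<delta>_def)
    also have "\<dots> \<le> hausdorff_pre s \<delta> (A \<union> B)"
      using that d by (intro hausdorff_pre_separated[of d]) (auto simp: \<delta>_def)
    also have "\<dots> \<le> hausdorff_outer s (A \<union> B)"
      using that d by (intro hausdorff_pre_le_outer) (auto simp: \<delta>_def)
    finally show ?thesis .
  qed
  have ne: "{0<..} \<noteq> ({} :: real set)" by (metis greaterThan_iff empty_iff zero_less_one)
  have "hausdorff_outer s A + hausdorff_pre s \<delta>2 B \<le> hausdorff_outer s (A \<union> B)" if "0 < \<delta>2" for \<delta>2
  proof -
    have "(SUP \<delta>\<in>{0<..}. hausdorff_pre s \<delta> A + hausdorff_pre s \<delta>2 B) \<le> hausdorff_outer s (A \<union> B)"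
      using le that by (intro SUP_least) auto
    then show ?thesis by (simp add: hausdorff_outer_eq[of s A] ennreal_SUP_add_left[OF ne])
  qed
  then have "(SUP \<delta>\<in>{0<..}. hausdorff_outer s A + hausdorff_pre s \<delta> B) \<le> hausdorff_outer s (A \<union> B)"
    by (intro SUP_least) auto
  then show ?thesis by (simp add: hausdorff_outer_eq[of s B] ennreal_SUP_add_right[OF ne])
qed

lemma hausdorff_outer_separated_sum:
  fixes R :: "nat \<Rightarrow> 'a::metric_space set"
  assumes sep: "\<And>j. \<exists>d>0. \<forall>i<j. \<forall>x\<in>R i. \<forall>y\<in>R j. d \<le> dist x y"
  shows "(\<Sum>i<n. hausdorff_outer s (R i)) \<le> hausdorff_outer s (\<Union>i<n. R i)"
proof (induction n)
  case (Suc n)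
  obtain d where d: "d > 0" "\<forall>i<n. \<forall>x\<in>R i. \<forall>y\<in>R n. d \<le> dist x y" using sep by blast
  have "(\<Sum>i<Suc n. hausdorff_outer s (R i)) \<le> hausdorff_outer s (\<Union>i<n. R i) + hausdorff_outer s (R n)"
    using Suc by (simp add: add_right_mono)
  also have "\<dots> \<le> hausdorff_outer s ((\<Union>i<n. R i) \<union> R n)"
    using d by (intro hausdorff_outer_separated[of d]) auto
  also have "(\<Union>i<n. R i) \<union> R n = (\<Union>i<Suc n. R i)" by (auto simp: lessThan_Suc)
  finally show ?case .
qed simp

text \<open>The rings at distance between \<open>1 / (k + 2)\<close> and \<open>1 / (k + 1)\<close> from \<open>C\<close> are separated as soon
  as their indices differ by two, so their measures have a finite sum.\<close>

lemma hausdorff_outer_Caratheodory: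
  fixes A C :: "'a::metric_space set"
  assumes "closed C"
  shows "hausdorff_outer s (A \<inter> C) + hausdorff_outer s (A - C) \<le> hausdorff_outer s A"
proof (cases "hausdorff_outer s A = top \<or> C = {}")
  case False
  then have fin: "hausdorff_outer s A < top" and C: "C \<noteq> {}" by (auto simp: less_top)
  let ?H = "hausdorff_outer s :: 'a set \<Rightarrow> ennreal"
  define D where "D n = {x \<in> A. 1 / real (n + 1) \<le> infdist x C}" for n
  define R where "R n = {x \<in> A. 1 / real (n + 2) \<le> infdist x C \<and> infdist x C < 1 / real (n + 1)}" for n
  have sep: "1 / real (i + 2) - 1 / real (j + 1) \<le> dist x y" if "x \<in> R i" "y \<in> R j" for i j x y
  proof -
    have "infdist x C \<le> infdist y C + dist x y" by (rule infdist_triangle)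
    then show ?thesis using that by (auto simp: R_def)
  qed
  have inv: "1 / real (i + 2) \<ge> 1 / real m" if "i + 2 \<le> m" for i m
    using that by (intro divide_left_mono) auto
  have half: "(\<Sum>i<n. ?H (R (2 * i + b))) \<le> ?H A" for n b
  proof -
    have "(\<Sum>i<n. ?H (R (2 * i + b))) \<le> ?H (\<Union>i<n. R (2 * i + b))"
    proof (rule hausdorff_outer_separated_sum)
      fix j
      show "\<exists>d>0. \<forall>i<j. \<forall>x\<in>R (2 * i + b). \<forall>y\<in>R (2 * j + b). d \<le> dist x y"
      proof (intro exI conjI allI impI ballI)
        \<comment> \<open>For \<open>j = 0\<close> there is no \<open>i < j\<close> and any positive
          number will do. The general formula would fail there for \<open>b = 0\<close>, as
          \<open>1 / 0 = 0\<close>.\<close>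
        show "0 < (if j = 0 then 1 else 1 / real (2 * j + b) - 1 / real (2 * j + b + 1))"
          by (simp add: frac_less2)
        fix i x y assume i: "i < j" and "x \<in> R (2 * i + b)" "y \<in> R (2 * j + b)"
        then have "1 / real (2 * i + b + 2) - 1 / real (2 * j + b + 1) \<le> dist x y" by (intro sep)
        moreover have "1 / real (2 * i + b + 2) \<ge> 1 / real (2 * j + b)" using i by (intro inv) auto
        ultimately show "(if j = 0 then 1 else 1 / real (2 * j + b) - 1 / real (2 * j + b + 1)) \<le> dist x y"
          using i by simp
      qed
    qed
    also have "\<dots> \<le> ?H A" by (intro hausdorff_outer_mono) (auto simp: R_def)
    finally show ?thesis .
  qed
  have sumR: "(\<Sum>i. ?H (R i)) \<le> 2 * ?H A"
  proof (rule suminf_le_const)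
    fix n
    have "(\<Sum>i<n. ?H (R i)) \<le> (\<Sum>i<2 * n. ?H (R i))" by (intro sum_mono2) auto
    also have "\<dots> = (\<Sum>i<n. ?H (R (2 * i))) + (\<Sum>i<n. ?H (R (2 * i + 1)))"
      by (induction n) (auto simp: algebra_simps)
    also have "\<dots> \<le> ?H A + ?H A" using half[where n = n and b = 0] half[where n = n and b = 1] by (intro add_mono) auto
    finally show "(\<Sum>i<n. ?H (R i)) \<le> 2 * ?H A" by (simp add: mult_2)
  qed auto
  define r where "r i = enn2real (?H (R i))" for i
  have "?H (R i) \<le> ?H A" for i by (intro hausdorff_outer_mono) (auto simp: R_def)
  then have r: "?H (R i) = ennreal (r i)" "0 \<le> r i" for i
    using fin by (auto simp: r_def intro!: ennreal_enn2real[symmetric] intro: le_less_trans)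
  have "(\<Sum>i. ennreal (r i)) \<noteq> top"
    using sumR fin unfolding r(1)[symmetric]
    by (metis ennreal_mult_less_top ennreal_numeral_less_top less_irrefl order_le_less_trans top.extremum_strict less_top)
  then have summ: "summable r" using r(2) by (intro summable_suminf_not_top) auto
  \<comment> \<open>Up to the rings from index \<open>n\<close> on, \<open>A - C\<close> is the set
    \<open>D n\<close>, which has positive distance from \<open>C\<close>. The tail of the
    convergent sum over the rings is the only error.\<close>
  have main: "?H (A \<inter> C) + ?H (A - C) \<le> ?H A + ennreal (\<Sum>i. r (i + n))" for n
  proof -
    have "A - C \<subseteq> D n \<union> (\<Union>i. R (i + n))"
    proof
      fix x assume x: "x \<in> A - C"
      then have pos: "0 < infdist x C"
        using assms C by (simp add: infdist_pos_not_in_closed)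
      show "x \<in> D n \<union> (\<Union>i. R (i + n))"
      proof (cases "1 / real (n + 1) \<le> infdist x C")
        case False
        have "\<exists>m. 1 / real (m + n + 2) \<le> infdist x C"
        proof -
          obtain m where "inverse (real (Suc m)) < infdist x C" using reals_Archimedean[OF pos] by blast
          moreover have "1 / real (m + n + 2) \<le> inverse (real (Suc m))"
            by (simp add: inverse_eq_divide frac_le)
          ultimately show ?thesis by (intro exI[of _ m]) linarith
        qed
        then have l1: "1 / real ((LEAST m. 1 / real (m + n + 2) \<le> infdist x C) + n + 2) \<le> infdist x C"
          by (rule LeastI_ex)
        define m where "m = (LEAST m. 1 / real (m + n + 2) \<le> infdist x C)"
        have "infdist x C < 1 / real (m + n + 1)"
        proof (cases m)
          case (Suc k)
          have "\<not> 1 / real (k + n + 2) \<le> infdist x C"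
            using not_less_Least[of k "\<lambda>m. 1 / real (m + n + 2) \<le> infdist x C"] Suc
            unfolding m_def by simp
          then show ?thesis using Suc by (simp add: add_ac)
        qed (use False in auto)
        then have "x \<in> R (m + n)" using l1 x unfolding m_def[symmetric] by (auto simp: R_def)
        then show ?thesis by blast
      qed (use x in \<open>auto simp: D_def\<close>)
    qed
    then have "?H (A - C) \<le> ?H (D n \<union> (\<Union>i. R (i + n)))" by (rule hausdorff_outer_mono)
    also have "\<dots> \<le> ?H (D n) + (\<Sum>i. ?H (R (i + n)))"
      by (intro order_trans[OF hausdorff_outer_Un] add_left_mono hausdorff_outer_countably_subadditive)
    also have "(\<Sum>i. ?H (R (i + n))) = ennreal (\<Sum>i. r (i + n))"
      unfolding r(1) using r(2) summ by (intro suminf_ennreal2) (auto simp: summable_ignore_initial_segment)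
    finally have "?H (A \<inter> C) + ?H (A - C) \<le> (?H (A \<inter> C) + ?H (D n)) + ennreal (\<Sum>i. r (i + n))"
      by (simp add: add.assoc add_left_mono)
    also have "?H (A \<inter> C) + ?H (D n) \<le> ?H ((A \<inter> C) \<union> D n)"
    proof (rule hausdorff_outer_separated)
      show "0 < 1 / real (n + 1)" by simp
      fix x y assume "x \<in> A \<inter> C" "y \<in> D n"
      then show "1 / real (n + 1) \<le> dist x y"
        using infdist_le[of x C y] by (auto simp: D_def dist_commute)
    qed
    also have "\<dots> \<le> ?H A" by (intro hausdorff_outer_mono) (auto simp: D_def)
    finally show ?thesis by (simp add: add_right_mono)
  qed
  show ?thesis
  proof (rule ennreal_le_epsilon)
    fix e :: real assume "0 < e"
    then obtain n where "norm (\<Sum>i. r (i + n)) < e"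
      using suminf_exist_split[OF _ summ] by blast
    then have "ennreal (\<Sum>i. r (i + n)) \<le> ennreal e" by (intro ennreal_leI) auto
    then show "?H (A \<inter> C) + ?H (A - C) \<le> ?H A + ennreal e"
      using main[of n] by (meson add_left_mono order_trans)
  qed
qed auto

text \<open>Caratheodory's construction: closed sets split every set additively, so the
  sigma-algebra of all sets with this property contains the Borel sets.\<close>

lemma measure_space_hausdorff:
  "measure_space UNIV (sets (borel :: 'a::metric_space measure)) (hausdorff_outer s)"
proof -
  let ?H = "hausdorff_outer s :: 'a set \<Rightarrow> ennreal"
  interpret sigma_algebra UNIV "UNIV :: 'a set set"
    using sigma_algebra_Pow[of UNIV] by simp
  have "outer_measure_space UNIV ?H"
    unfolding outer_measure_space_def
    by (auto simp: positive_def increasing_def countably_subadditive_def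
        intro: hausdorff_outer_mono hausdorff_outer_countably_subadditive)
  then have ms: "measure_space UNIV (lambda_system UNIV UNIV ?H) ?H"
    by (rule caratheodory_lemma)
  have closed: "C \<in> lambda_system UNIV UNIV ?H" if "closed C" for C
    unfolding lambda_system_def
  proof (intro CollectI conjI ballI UNIV_I)
    fix A
    have "A = (C \<inter> A) \<union> ((UNIV - C) \<inter> A)" by blast
    then have "?H A \<le> ?H (C \<inter> A) + ?H ((UNIV - C) \<inter> A)"
      using hausdorff_outer_Un[of s "C \<inter> A" "(UNIV - C) \<inter> A"] by simp
    moreover have "?H (C \<inter> A) + ?H ((UNIV - C) \<inter> A) \<le> ?H A"
      using hausdorff_outer_Caratheodory[OF that, of s A]
      by (simp add: Int_commute Diff_eq)
    ultimately show "?H (C \<inter> A) + ?H ((UNIV - C) \<inter> A) = ?H A" by (rule antisym[rotated])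
  qed
  interpret L: sigma_algebra UNIV "lambda_system UNIV UNIV ?H"
    using ms by (simp add: measure_space_def)
  have sub: "sets borel \<subseteq> lambda_system UNIV UNIV ?H"
    unfolding borel_eq_closed using closed by (auto intro!: L.sigma_sets_subset)
  then show ?thesis
    using ms sets.sigma_algebra_axioms[of "borel :: 'a measure"]
    unfolding measure_space_def positive_def countably_additive_def by auto
qed

lemma sets_hausdorff_measure [simp, measurable_cong]: "sets (hausdorff_measure s) = sets borel"
  unfolding hausdorff_measure_def using sets.sigma_sets_eq[of borel] by (simp add: sets_measure_of_conv)

lemma space_hausdorff_measure [simp]: "space (hausdorff_measure s) = UNIV"
  unfolding hausdorff_measure_def by (simp add: space_measure_of_conv)

lemma emeasure_hausdorff_measure:
  fixes A :: "'a::metric_space set"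
  assumes "A \<in> sets borel"
  shows "emeasure (hausdorff_measure s) A = hausdorff_outer s A"
proof -
  have "hausdorff_measure s = measure_of UNIV (sets (borel :: 'a measure)) (hausdorff_outer s)"
    by (simp add: hausdorff_measure_def)
  then show ?thesis
    using measure_space_hausdorff[of s, where 'a = 'a] assms
    unfolding measure_space_def by (simp only:) (intro emeasure_measure_of_sigma, auto)
qed

section \<open>Continuously differentiable functions\<close>

lemma cont_diff_on_cong:
  assumes "open S" "\<And>x. x \<in> S \<Longrightarrow> f x = g x" "cont_diff_on k S f"
  shows "cont_diff_on k S g"
  using assms
proof (induction k arbitrary: f g)
  case 0
  then show ?case by (simp cong: continuous_on_cong)
next
  case (Suc k)
  have der: "(g has_derivative frechet_derivative f (at x)) (at x)" if "x \<in> S" for x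
  proof (rule has_derivative_transform_within_open[OF _ \<open>open S\<close> that])
    show "(f has_derivative frechet_derivative f (at x)) (at x)"
      using Suc.prems(3) that by (simp add: frechet_derivative_works)
  qed (use Suc.prems(2) in auto)
  have "cont_diff_on k S (\<lambda>x. frechet_derivative g (at x) e)" for e
  proof (rule Suc.IH[OF \<open>open S\<close>])
    show "cont_diff_on k S (\<lambda>x. frechet_derivative f (at x) e)" using Suc.prems(3) by simp
    show "frechet_derivative f (at x) e = frechet_derivative g (at x) e" if "x \<in> S" for x
      using frechet_derivative_at[OF der[OF that]] by simp
  qed
  then show ?case using der by (auto simp: differentiable_def)
qed

text \<open>\<open>cont_diff_on\<close> refers to \<open>frechet_derivative\<close>. Here any
  derivative known in closed form takes its place, which is how the inductions over \<open>k\<close>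
  proceed.\<close>

lemma cont_diff_on_Suc_iff:
  assumes "open S" "\<And>x. x \<in> S \<Longrightarrow> (f has_derivative f' x) (at x)"
  shows "cont_diff_on (Suc k) S f \<longleftrightarrow> (\<forall>e. cont_diff_on k S (\<lambda>x. f' x e))"
proof
  assume *: "\<forall>e. cont_diff_on k S (\<lambda>x. f' x e)"
  have "cont_diff_on k S (\<lambda>x. frechet_derivative f (at x) e)" for e
    by (rule cont_diff_on_cong[OF assms(1) _ *[rule_format, of e]])
      (simp add: frechet_derivative_at[OF assms(2)])
  then show "cont_diff_on (Suc k) S f" using assms(2) by (auto simp: differentiable_def)
next
  assume f: "cont_diff_on (Suc k) S f"
  have "frechet_derivative f (at x) = f' x" if "x \<in> S" for x
    using frechet_derivative_at[OF assms(2)[OF that]] by simp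
  then have "cont_diff_on k S (\<lambda>x. f' x e)" for e
    using f by (auto intro: cont_diff_on_cong[OF assms(1), of "\<lambda>x. frechet_derivative f (at x) e" "\<lambda>x. f' x e"])
  then show "\<forall>e. cont_diff_on k S (\<lambda>x. f' x e)" by blast
qed

lemma cont_diff_on_SucD:
  assumes "cont_diff_on (Suc k) S f" "x \<in> S"
  shows "(f has_derivative frechet_derivative f (at x)) (at x)"
  using assms by (simp add: frechet_derivative_works)

lemma cont_diff_on_less:
  assumes "open S" "cont_diff_on (Suc k) S f"
  shows "cont_diff_on k S f"
  using assms(2)
proof (induction k arbitrary: f)
  case 0
  then show ?case
    using \<open>open S\<close> by (auto simp: continuous_on_eq_continuous_at dest: differentiable_imp_continuous_within)
next
  case (Suc k)
  from Suc.prems have "\<And>e. cont_diff_on k S (\<lambda>x. frechet_derivative f (at x) e)"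
    by (intro Suc.IH) auto
  with Suc.prems show ?case by simp
qed

lemma cont_diff_on_const: "cont_diff_on k S (\<lambda>_. c)"
proof (induction k arbitrary: c)
  case (Suc k)
  then show ?case by (simp add: frechet_derivative_const)
qed simp

lemma cont_diff_on_bounded_linear:
  assumes "open S" "bounded_linear f"
  shows "cont_diff_on k S f"
proof (cases k)
  case 0
  then show ?thesis using assms(2) by (simp add: linear_continuous_on)
next
  case (Suc j)
  then show ?thesis
    using cont_diff_on_Suc_iff[OF assms(1), of f "\<lambda>_. f" j] assms(2)
    by (simp add: bounded_linear_imp_has_derivative cont_diff_on_const)
qed

lemma cont_diff_on_add:
  assumes "open S" "cont_diff_on k S f" "cont_diff_on k S g"
  shows "cont_diff_on k S (\<lambda>x. f x + g x)"
  using assms(2,3)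
proof (induction k arbitrary: f g)
  case (Suc k)
  have "((\<lambda>x. f x + g x) has_derivative
      (\<lambda>e. frechet_derivative f (at x) e + frechet_derivative g (at x) e)) (at x)" if "x \<in> S" for x
    using Suc.prems that by (intro has_derivative_add cont_diff_on_SucD)
  note * = cont_diff_on_Suc_iff[OF \<open>open S\<close> this]
  have "cont_diff_on k S (\<lambda>x. frechet_derivative f (at x) e + frechet_derivative g (at x) e)" for e
    by (rule Suc.IH) (use Suc.prems in auto)
  then show ?case using * by blast
qed (auto intro: continuous_intros)

lemma cont_diff_on_mult:
  fixes f g :: "'a::euclidean_space \<Rightarrow> real"
  assumes "open S" "cont_diff_on k S f" "cont_diff_on k S g"
  shows "cont_diff_on k S (\<lambda>x. f x * g x)"
  using assms(2,3)
proof (induction k arbitrary: f g)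
  case (Suc k)
  have "((\<lambda>x. f x * g x) has_derivative
      (\<lambda>e. f x * frechet_derivative g (at x) e + frechet_derivative f (at x) e * g x)) (at x)"
    if "x \<in> S" for x
    using Suc.prems that by (intro has_derivative_mult cont_diff_on_SucD)
  note * = cont_diff_on_Suc_iff[OF \<open>open S\<close> this]
  have "cont_diff_on k S f" "cont_diff_on k S g"
    by (rule cont_diff_on_less[OF \<open>open S\<close>], rule Suc.prems)+
  then show ?case
    using Suc.prems
    by (intro *[THEN iffD2] allI cont_diff_on_add[OF \<open>open S\<close>] Suc.IH) auto
qed (auto intro: continuous_intros)

text \<open>The derivative is an explicit second argument, because the later integrations by parts
  need formulas for derivatives of products and cut-offs. Continuity is asked direction by
  direction.\<close>

definition C1_deriv :: "'a::real_normed_vector set \<Rightarrow> ('a \<Rightarrow> real) \<Rightarrow> ('a \<Rightarrow> 'a \<Rightarrow> real) \<Rightarrow> bool" where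
  "C1_deriv S f f' \<longleftrightarrow>
     (\<forall>x\<in>S. (f has_derivative f' x) (at x)) \<and> (\<forall>e. continuous_on S (\<lambda>x. f' x e))"

lemma cont_diff_on_imp_C1_deriv:
  assumes "cont_diff_on (Suc 0) S f"
  shows "C1_deriv S f (\<lambda>x. frechet_derivative f (at x))"
  using assms cont_diff_on_SucD[OF assms] by (auto simp: C1_deriv_def)

lemma smooth_on_imp_C1_deriv:
  "smooth_on S f \<Longrightarrow> C1_deriv S f (\<lambda>x. frechet_derivative f (at x))"
  by (metis smooth_on_def cont_diff_on_imp_C1_deriv)

lemma C1_derivD: "C1_deriv S f f' \<Longrightarrow> x \<in> S \<Longrightarrow> (f has_derivative f' x) (at x)"
  and C1_deriv_contD: "C1_deriv S f f' \<Longrightarrow> continuous_on S (\<lambda>x. f' x e)"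
  by (auto simp: C1_deriv_def)

lemma C1_deriv_continuous: "C1_deriv S f f' \<Longrightarrow> continuous_on S f"
  unfolding C1_deriv_def by (metis continuous_at_imp_continuous_on has_derivative_continuous)

lemma C1_deriv_subset: "C1_deriv S f f' \<Longrightarrow> T \<subseteq> S \<Longrightarrow> C1_deriv T f f'"
  by (auto simp: C1_deriv_def intro: continuous_on_subset)

lemma C1_deriv_mult:
  assumes "C1_deriv S f f'" "C1_deriv S g g'"
  shows "C1_deriv S (\<lambda>x. f x * g x) (\<lambda>x e. f x * g' x e + f' x e * g x)"
  unfolding C1_deriv_def
proof (intro conjI ballI allI)
  fix x assume "x \<in> S"
  then show "((\<lambda>x. f x * g x) has_derivative (\<lambda>e. f x * g' x e + f' x e * g x)) (at x)"
    using assms by (intro has_derivative_mult C1_derivD)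
next
  fix e
  show "continuous_on S (\<lambda>x. f x * g' x e + f' x e * g x)"
    using assms by (intro continuous_intros C1_deriv_contD C1_deriv_continuous)
qed

lemma C1_deriv_compose:
  assumes "C1_deriv S f f'" "\<And>t. (h has_real_derivative h' t) (at t)" "continuous_on UNIV h'"
  shows "C1_deriv S (\<lambda>x. h (f x)) (\<lambda>x e. h' (f x) * f' x e)"
  unfolding C1_deriv_def
proof (intro conjI ballI allI)
  fix x assume "x \<in> S"
  then have "(f has_derivative f' x) (at x)" by (rule C1_derivD[OF assms(1)])
  from has_derivative_compose[OF this, of h "(*) (h' (f x))"] assms(2)[of "f x"]
  show "((\<lambda>x. h (f x)) has_derivative (\<lambda>e. h' (f x) * f' x e)) (at x)"
    by (simp add: has_field_derivative_def)
next
  fix e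
  have "continuous_on S (\<lambda>x. h' (f x))"
    by (rule continuous_on_compose2[OF assms(3) C1_deriv_continuous[OF assms(1)]]) auto
  then show "continuous_on S (\<lambda>x. h' (f x) * f' x e)"
    by (rule continuous_on_mult[OF _ C1_deriv_contD[OF assms(1)]])
qed

text \<open>\<open>S\<close> and the complement of \<open>K\<close> are open and cover the space. On
  the overlap both formulas for the derivative agree, a function that vanishes on an open set having
  derivative 0 there.\<close>

lemma C1_deriv_extend_zero:
  assumes "open S" "C1_deriv S f f'" "compact K" "K \<subseteq> S" "\<And>x. x \<in> S - K \<Longrightarrow> f x = 0"
  shows "C1_deriv UNIV (\<lambda>x. if x \<in> S then f x else 0) (\<lambda>x e. if x \<in> S then f' x e else 0)"
proof -
  let ?g = "\<lambda>x. if x \<in> S then f x else 0"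
  have op: "open (- K)" using assms(3) by (simp add: compact_imp_closed open_Compl)
  have derS: "(?g has_derivative f' x) (at x)" if "x \<in> S" for x
    by (rule has_derivative_transform_within_open[OF C1_derivD[OF assms(2) that] assms(1) that]) auto
  have derK: "(?g has_derivative (\<lambda>_. 0)) (at x)" if "x \<notin> K" for x
    by (rule has_derivative_transform_within_open[OF has_derivative_const op])
      (use that assms(5) in auto)
  have f'0: "f' x e = 0" if "x \<in> S" "x \<notin> K" for x e
    using has_derivative_unique[OF derS[OF that(1)] derK[OF that(2)]] by simp
  have "continuous_on UNIV (\<lambda>x. if x \<in> S then f' x e else 0)" for e
  proof -
    have "continuous_on S (\<lambda>x. if x \<in> S then f' x e else 0)"
      using C1_deriv_contD[OF assms(2), of e] by (simp cong: continuous_on_cong)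
    moreover have "continuous_on (- K) (\<lambda>x. if x \<in> S then f' x e else 0)"
      using f'0 by (intro continuous_on_eq[OF continuous_on_const[of "- K" 0]]) auto
    ultimately have "continuous_on (S \<union> - K) (\<lambda>x. if x \<in> S then f' x e else 0)"
      using assms(1) op by (intro continuous_on_open_Un)
    moreover have "S \<union> - K = UNIV" using assms(4) by auto
    ultimately show ?thesis by simp
  qed
  moreover have "(?g has_derivative (\<lambda>e. if x \<in> S then f' x e else 0)) (at x)" for x
    using derS[of x] derK[of x] assms(4) by (cases "x \<in> S") auto
  ultimately show ?thesis by (simp add: C1_deriv_def)
qed

section \<open>Smooth bump functions\<close>

text \<open>The functions t^(-m) exp (-1/t), continued by 0. The whole family is needed:
  differentiation maps member \<open>m\<close> to a combination of members \<open>m + 1\<close> and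
  \<open>m + 2\<close>, so smoothness follows by one induction for all \<open>m\<close>.\<close>

definition flat_exp :: "nat \<Rightarrow> real \<Rightarrow> real" where
  "flat_exp m t = (if 0 < t then (1 / t) ^ m / exp (1 / t) else 0)"

lemma flat_exp_tendsto_0: "((\<lambda>t. flat_exp m t / t) \<longlongrightarrow> 0) (at 0)"
proof -
  have inv: "filterlim (\<lambda>t::real. 1 / t) at_top (at_right 0)"
    using filterlim_inverse_at_top_right by (simp add: inverse_eq_divide)
  have "((\<lambda>t. (1 / t) ^ Suc m / exp (1 / t)) \<longlongrightarrow> 0) (at_right (0::real))"
    by (rule filterlim_compose[OF tendsto_power_div_exp_0 inv])
  then have "((\<lambda>t. flat_exp m t / t) \<longlongrightarrow> 0) (at_right 0)"
    by (rule Lim_transform_eventually)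
      (auto simp: flat_exp_def eventually_at_filter field_simps intro!: always_eventually)
  moreover have "((\<lambda>t. flat_exp m t / t) \<longlongrightarrow> 0) (at_left 0)"
    by (rule Lim_transform_eventually[OF tendsto_const])
      (auto simp: flat_exp_def eventually_at_filter intro!: always_eventually)
  ultimately show ?thesis by (simp add: filterlim_at_split)
qed

lemma flat_exp_has_derivative:
  "(flat_exp m has_real_derivative flat_exp (m + 2) t - real m * flat_exp (m + 1) t) (at t)"
proof (cases t "0::real" rule: linorder_cases)
  case less
  have "(flat_exp m has_real_derivative 0) (at t)"
    by (rule has_field_derivative_transform_within_open[of "\<lambda>_. 0" _ _ "{..<0}"])
      (use less in \<open>auto simp: flat_exp_def\<close>)
  then show ?thesis using less by (simp add: flat_exp_def)
next
  case equal
  have "(flat_exp m has_real_derivative 0) (at 0)"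
    unfolding has_field_derivative_iff using flat_exp_tendsto_0[of m] by (simp add: flat_exp_def)
  then show ?thesis using equal by (simp add: flat_exp_def)
next
  case greater
  have "((\<lambda>t. (1 / t) ^ m / exp (1 / t)) has_real_derivative
      (real m * (1 / t) ^ (m - 1) * (- 1 / t\<^sup>2) * exp (1 / t) - (1 / t) ^ m * (exp (1 / t) * (- 1 / t\<^sup>2)))
        / (exp (1 / t) * exp (1 / t))) (at t)"
    using greater by (auto intro!: derivative_eq_intros simp: power2_eq_square)
  also have "(real m * (1 / t) ^ (m - 1) * (- 1 / t\<^sup>2) * exp (1 / t) - (1 / t) ^ m * (exp (1 / t) * (- 1 / t\<^sup>2)))
        / (exp (1 / t) * exp (1 / t)) = flat_exp (m + 2) t - real m * flat_exp (m + 1) t"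
    using greater by (cases m) (auto simp: flat_exp_def field_simps power2_eq_square)
  finally show ?thesis
    by (rule has_field_derivative_transform_within_open[of _ _ _ "{0<..}"])
      (use greater in \<open>auto simp: flat_exp_def\<close>)
qed

definition bump :: "real \<Rightarrow> 'a::euclidean_space \<Rightarrow> real" where
  "bump r x = flat_exp 0 (r\<^sup>2 - x \<bullet> x)"

lemma cont_diff_on_flat_exp:
  "cont_diff_on k UNIV (\<lambda>x::'a::euclidean_space. flat_exp m (r - x \<bullet> x))"
proof (induction k arbitrary: m)
  case 0
  have "isCont (flat_exp m) t" for t
    using flat_exp_has_derivative[of m t] by (rule DERIV_isCont)
  then have "continuous_on UNIV (flat_exp m)" by (simp add: continuous_at_imp_continuous_on)
  then have "continuous_on UNIV (\<lambda>x::'a. flat_exp m (r - x \<bullet> x))"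
    by (rule continuous_on_compose2) (auto intro!: continuous_intros)
  then show ?case by simp
next
  case (Suc k)
  let ?f' = "\<lambda>x e::'a. (flat_exp (m + 2) (r - x \<bullet> x) + (- real m) * flat_exp (m + 1) (r - x \<bullet> x)) * ((-2) * (x \<bullet> e))"
  have "((\<lambda>x::'a. flat_exp m (r - x \<bullet> x)) has_derivative ?f' x) (at x)" for x
  proof -
    have "((\<lambda>x::'a. r - x \<bullet> x) has_derivative (\<lambda>e. (-2) * (x \<bullet> e))) (at x)"
      by (auto intro!: derivative_eq_intros simp: inner_commute)
    from has_derivative_compose[OF this flat_exp_has_derivative[unfolded has_field_derivative_def]]
    show ?thesis by simp
  qed
  note * = cont_diff_on_Suc_iff[OF open_UNIV this]
  have "cont_diff_on k UNIV (\<lambda>x::'a. x \<bullet> e)" for e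
    by (intro cont_diff_on_bounded_linear open_UNIV bounded_linear_inner_left)
  then show ?case
    by (intro *[THEN iffD2] allI cont_diff_on_mult cont_diff_on_add Suc.IH cont_diff_on_const open_UNIV)
qed

lemma smooth_bump: "smooth_on UNIV (bump r)"
  unfolding smooth_on_def bump_def[abs_def] using cont_diff_on_flat_exp by blast

lemma bump_nonneg: "0 \<le> bump r x" and bump_minus: "bump r (- x) = bump r x"
  and bump_pos: "norm x < r \<Longrightarrow> 0 < bump r x" and bump_eq_0: "0 \<le> r \<Longrightarrow> r \<le> norm x \<Longrightarrow> bump r x = 0"
proof -
  show "0 \<le> bump r x" "bump r (- x) = bump r x" by (auto simp: bump_def flat_exp_def)
  show "0 < bump r x" if "norm x < r"
  proof -
    have "(norm x)\<^sup>2 < r\<^sup>2" using that by (intro power_strict_mono) auto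
    then show ?thesis by (simp add: bump_def flat_exp_def power2_norm_eq_inner)
  qed
  show "bump r x = 0" if "0 \<le> r" "r \<le> norm x"
  proof -
    have "r\<^sup>2 \<le> (norm x)\<^sup>2" using that by (intro power_mono) auto
    then show ?thesis by (simp add: bump_def flat_exp_def power2_norm_eq_inner)
  qed
qed

section \<open>Mollification\<close>

lemma continuous_compact_support_integrable:
  fixes f :: "'a::euclidean_space \<Rightarrow> real"
  assumes "continuous_on UNIV f" "compact K" "\<And>x. x \<notin> K \<Longrightarrow> f x = 0"
  shows "integrable lborel f"
proof -
  have "integrable lborel (\<lambda>x. indicator K x *\<^sub>R f x)"
    using assms by (intro borel_integrable_compact) (auto intro: continuous_on_subset)
  also have "(\<lambda>x. indicator K x *\<^sub>R f x) = f" using assms(3) by (auto simp: indicator_def fun_eq_iff)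
  finally show ?thesis .
qed

lemma integral_lborel_translation:
  fixes f :: "'a::euclidean_space \<Rightarrow> real"
  assumes "f \<in> borel_measurable borel"
  shows "(LINT x|lborel. f (c + x)) = (LINT x|lborel. f x)"
proof -
  have "(LINT x|lborel. f x) = (LINT x|distr lborel borel ((+) c). f x)"
    by (simp add: lborel_distr_plus)
  also have "\<dots> = (LINT x|lborel. f (c + x))" using assms by (subst integral_distr) auto
  finally show ?thesis by simp
qed

lemma compact_support_bound:
  fixes f :: "'a::euclidean_space \<Rightarrow> real"
  assumes "continuous_on UNIV f" "compact K" "\<And>x. x \<notin> K \<Longrightarrow> f x = 0"
  obtains M where "0 \<le> M" "\<And>x. \<bar>f x\<bar> \<le> M"
proof -
  have "bounded (f ` K)"
    using assms by (intro compact_imp_bounded compact_continuous_image) (auto intro: continuous_on_subset)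
  then obtain M where M: "\<And>x. x \<in> K \<Longrightarrow> \<bar>f x\<bar> \<le> M" by (auto simp: bounded_iff)
  have "\<bar>f x\<bar> \<le> max M 0" for x
    using M[of x] assms(3)[of x] by (cases "x \<in> K") auto
  then show ?thesis by (intro that[of "max M 0"]) auto
qed

text \<open>The integral of the difference quotient of \<open>f\<close> vanishes by translation invariance.\<close>

lemma integral_C1_deriv_eq_0:
  fixes f :: "'a::euclidean_space \<Rightarrow> real"
  assumes f: "C1_deriv UNIV f f'" and K: "compact K" "\<And>x. x \<notin> K \<Longrightarrow> f x = 0"
  shows "(LINT x|lborel. f' x e) = 0"
proof -
  have cont: "continuous_on UNIV f" "continuous_on UNIV (\<lambda>x. f' x e)"
    using f by (auto intro: C1_deriv_continuous C1_deriv_contD)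
  have der: "(f has_derivative f' x) (at x)" for x using C1_derivD[OF f] by simp
  have f'0: "f' x e = 0" if "x \<notin> K" for x
  proof -
    have "open (- K)" using K by (simp add: compact_imp_closed open_Compl)
    from has_derivative_transform_within_open[OF has_derivative_const[of 0] this, of x f]
    have "(f has_derivative (\<lambda>_. 0)) (at x)" using that K(2) by auto
    then show ?thesis using has_derivative_unique[OF der[of x]] by metis
  qed
  obtain M where M: "0 \<le> M" "\<And>x. \<bar>f' x e\<bar> \<le> M"
    using compact_support_bound[OF cont(2) K(1) f'0] by metis
  define s where "s n x = real (Suc n) * (f ((1 / real (Suc n)) *\<^sub>R e + x) - f x)" for n x
  define B where "B = (\<Union>x\<in>K. cball x (norm e))"
  have B: "compact B" unfolding B_def by (rule compact_minkowski_sum_cball[OF K(1)])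
  have line: "((\<lambda>t. f (t *\<^sub>R e + x)) has_real_derivative f' (t *\<^sub>R e + x) e) (at t)" for x t
  proof -
    have "((\<lambda>t. t *\<^sub>R e + x) has_derivative (\<lambda>h. h *\<^sub>R e)) (at t)"
      by (auto intro!: derivative_eq_intros)
    from has_derivative_compose[OF this der[of "t *\<^sub>R e + x"]]
    show ?thesis
      using linear_cmul[OF has_derivative_linear[OF der[of "t *\<^sub>R e + x"]]]
      by (simp add: has_field_derivative_def mult_commute_abs)
  qed
  \<comment> \<open>By the mean value theorem each difference quotient is a value of the derivative
    at an intermediate point. The step lengths are at most 1, so all quotients vanish off the
    compact neighbourhood \<open>B\<close> of \<open>K\<close>, and \<open>M\<close> on
    \<open>B\<close> is a common majorant.\<close>
  have bound: "\<bar>s n x\<bar> \<le> M * indicator B x" for n x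
  proof -
    let ?h = "1 / real (Suc n)"
    obtain t where t: "0 < t" "t < ?h" "f (?h *\<^sub>R e + x) - f (0 *\<^sub>R e + x) = (?h - 0) * f' (t *\<^sub>R e + x) e"
      using MVT2[of 0 ?h "\<lambda>t. f (t *\<^sub>R e + x)" "\<lambda>t. f' (t *\<^sub>R e + x) e"] line by auto
    then have "s n x = f' (t *\<^sub>R e + x) e" by (simp add: s_def field_simps)
    moreover have "t *\<^sub>R e + x \<notin> K" if "x \<notin> B"
    proof
      assume "t *\<^sub>R e + x \<in> K"
      moreover have "?h \<le> 1" by simp
      then have "t \<le> 1" using t(2) by linarith
      then have "x \<in> cball (t *\<^sub>R e + x) (norm e)"
        using t(1) by (simp add: dist_norm mult_left_le_one_le)
      ultimately show False using that by (auto simp: B_def)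
    qed
    ultimately show ?thesis using M f'0 by (auto simp: indicator_def)
  qed
  have meas: "f \<in> borel_measurable borel" "(\<lambda>x. f' x e) \<in> borel_measurable borel"
    using cont by (auto intro: borel_measurable_continuous_onI)
  have s_meas: "s n \<in> borel_measurable lborel" for n
  proof -
    have "continuous_on UNIV (s n)"
      unfolding s_def by (intro continuous_intros continuous_on_compose2[OF cont(1)]) auto
    then show ?thesis by (simp add: borel_measurable_continuous_onI)
  qed
  have "(\<lambda>n. LINT x|lborel. s n x) \<longlonglongrightarrow> (LINT x|lborel. f' x e)"
  proof (rule integral_dominated_convergence[where w = "\<lambda>x. M * indicator B x"])
    show "integrable lborel (\<lambda>x. M * indicator B x)"
      using emeasure_bounded_finite[OF compact_imp_bounded[OF B]] borel_compact[OF B]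
      by (intro integrable_mult_right integrable_real_indicator) auto
    show "AE x in lborel. (\<lambda>n. s n x) \<longlonglongrightarrow> f' x e"
    proof (intro AE_I2)
      fix x
      have "((\<lambda>h. (f (h *\<^sub>R e + x) - f (0 *\<^sub>R e + x)) / (h - 0)) \<longlongrightarrow> f' (0 *\<^sub>R e + x) e) (at 0)"
        using line[of x 0] unfolding has_field_derivative_iff by simp
      moreover have "filterlim (\<lambda>n. 1 / real (Suc n)) (at 0) sequentially"
        using LIMSEQ_inverse_real_of_nat
        by (auto simp: filterlim_at inverse_eq_divide intro!: always_eventually)
      ultimately have "(\<lambda>n. (f ((1 / real (Suc n)) *\<^sub>R e + x) - f (0 *\<^sub>R e + x)) / (1 / real (Suc n) - 0))
          \<longlonglongrightarrow> f' (0 *\<^sub>R e + x) e"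
        by (rule filterlim_compose)
      then show "(\<lambda>n. s n x) \<longlonglongrightarrow> f' x e" by (simp add: s_def mult.commute)
    qed
    show "AE x in lborel. norm (s n x) \<le> M * indicator B x" for n using bound by simp
  qed (use meas s_meas in auto)
  moreover have "(LINT x|lborel. s n x) = 0" for n
  proof -
    have int: "integrable lborel f" by (rule continuous_compact_support_integrable[OF cont(1) K])
    have int': "integrable lborel (\<lambda>x. f ((1 / real (Suc n)) *\<^sub>R e + x))"
      using int integrable_distr_eq[of "(+) ((1 / real (Suc n)) *\<^sub>R e)" lborel borel f] meas
      by (simp add: lborel_distr_plus)
    show ?thesis
      unfolding s_def using int int' meas(1)
      by (simp add: integral_lborel_translation)
  qed
  ultimately show ?thesis by (simp add: LIMSEQ_const_iff)
qed

lemma integration_by_parts_C1: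
  fixes f g :: "'a::euclidean_space \<Rightarrow> real"
  assumes f: "C1_deriv UNIV f f'" and g: "C1_deriv UNIV g g'"
    and K: "compact K" "\<And>x. x \<notin> K \<Longrightarrow> f x = 0"
  shows "(LINT x|lborel. f x * g' x e) = - (LINT x|lborel. f' x e * g x)"
proof -
  have f'0: "f' x e = 0" if "x \<notin> K" for x
  proof -
    have "open (- K)" using K by (simp add: compact_imp_closed open_Compl)
    from has_derivative_transform_within_open[OF has_derivative_const[of 0] this, of x f]
    have "(f has_derivative (\<lambda>_. 0)) (at x)" using that K(2) by auto
    then show ?thesis using has_derivative_unique[OF C1_derivD[OF f, of x]] by simp
  qed
  have "integrable lborel (\<lambda>x. f x * g' x e)" "integrable lborel (\<lambda>x. f' x e * g x)"
    using K f'0 C1_deriv_continuous[OF f] C1_deriv_continuous[OF g]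
      C1_deriv_contD[OF f, of e] C1_deriv_contD[OF g, of e]
    by (auto intro!: continuous_compact_support_integrable[OF _ K(1)] continuous_on_mult)
  then have "(LINT x|lborel. f x * g' x e) + (LINT x|lborel. f' x e * g x)
      = (LINT x|lborel. f x * g' x e + f' x e * g x)"
    by simp
  also have "\<dots> = 0"
    by (rule integral_C1_deriv_eq_0[OF C1_deriv_mult[OF f g] K(1)]) (use K(2) in simp)
  finally show ?thesis by simp
qed

definition convol :: "('a::euclidean_space \<Rightarrow> real) \<Rightarrow> ('a \<Rightarrow> real) \<Rightarrow> 'a \<Rightarrow> real" where
  "convol f g x = (LINT y|lborel. f y * g (x - y))"

text \<open>Differentiation under the integral sign. The compact support of \<open>f\<close> reduces
  the integral to a box, where joint continuity of the derivative is enough.\<close>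

lemma convol_has_derivative:
  fixes f g :: "'a::euclidean_space \<Rightarrow> real"
  assumes f: "continuous_on UNIV f" and K: "compact K" "\<And>x. x \<notin> K \<Longrightarrow> f x = 0"
    and g: "C1_deriv UNIV g g'"
  shows "(convol f g has_derivative (\<lambda>e. convol f (\<lambda>z. g' z e) x)) (at x)"
proof -
  obtain a b where ab: "K \<subseteq> cbox a b"
    using bounded_subset_cbox_symmetric[OF compact_imp_bounded[OF K(1)]] by metis
  have cg: "continuous_on UNIV g" "\<And>e. continuous_on UNIV (\<lambda>x. g' x e)"
    using g by (auto intro: C1_deriv_continuous C1_deriv_contD)
  have der: "(g has_derivative g' x) (at x)" for x using C1_derivD[OF g] by simp
  have conv_eq: "convol f h x = integral (cbox a b) (\<lambda>y. f y * h (x - y))"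
    if "continuous_on UNIV h" for h x
  proof -
    have c: "continuous_on UNIV (\<lambda>y. f y * h (x - y))"
      by (intro continuous_intros f continuous_on_compose2[OF that]) auto
    have int: "integrable lborel (\<lambda>y. f y * h (x - y))"
      by (rule continuous_compact_support_integrable[OF c K(1)]) (use K(2) in simp)
    have "convol f h x = integral UNIV (\<lambda>y. f y * h (x - y))"
      unfolding convol_def using integral_lborel[OF int] by simp
    also have "\<dots> = integral UNIV (\<lambda>y. if y \<in> cbox a b then f y * h (x - y) else 0)"
      by (rule arg_cong[where f = "integral UNIV"]) (use K(2) ab in \<open>auto simp: fun_eq_iff\<close>)
    also have "\<dots> = integral (cbox a b) (\<lambda>y. f y * h (x - y))"
      by (rule integral_restrict_UNIV)
    finally show ?thesis .
  qed
  \<comment> \<open>The Leibniz rule asks for a continuous family of bounded linear maps; it is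
    assembled from the values of \<open>g'\<close> on the basis.\<close>
  define D :: "'a \<Rightarrow> 'a \<Rightarrow>\<^sub>L real" where "D z = (\<Sum>b\<in>Basis. g' z b *\<^sub>R blinfun_inner_left b)" for z
  have D: "blinfun_apply (D z) e = g' z e" for z e
  proof -
    have lin: "linear (g' z)" using der[of z] by (rule has_derivative_linear)
    have "g' z e = g' z (\<Sum>b\<in>Basis. (e \<bullet> b) *\<^sub>R b)" by (simp add: euclidean_representation)
    also have "\<dots> = (\<Sum>b\<in>Basis. (e \<bullet> b) * g' z b)"
      using lin by (simp add: linear_sum linear_cmul)
    finally show ?thesis by (simp add: D_def blinfun.sum_left blinfun.scaleR_left mult.commute)
  qed
  have contD: "continuous_on UNIV D" unfolding D_def by (intro continuous_intros cg)
  have contfx: "continuous_on (UNIV \<times> cbox a b) (\<lambda>(x, t). f t *\<^sub>R D (x - t))"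
    unfolding case_prod_beta
    by (intro continuous_intros continuous_on_compose2[OF f] continuous_on_compose2[OF contD]) auto
  have "((\<lambda>x. integral (cbox a b) (\<lambda>t. f t * g (x - t))) has_derivative
      blinfun_apply (integral (cbox a b) (\<lambda>t. f t *\<^sub>R D (x - t)))) (at x within UNIV)"
  proof (rule leibniz_rule[of UNIV a b "\<lambda>x t. f t * g (x - t)" "\<lambda>x t. f t *\<^sub>R D (x - t)" x])
    fix x t
    have "((\<lambda>x. g (x - t)) has_derivative (\<lambda>e. g' (x - t) e)) (at x)"
      by (rule has_derivative_compose[of "\<lambda>x. x - t" "\<lambda>e. e" x UNIV g "g' (x - t)", OF _ der])
        (auto intro!: derivative_eq_intros)
    then have "((\<lambda>x. f t * g (x - t)) has_derivative (\<lambda>e. f t * g' (x - t) e)) (at x)"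
      by (rule has_derivative_mult_right)
    moreover have "blinfun_apply (f t *\<^sub>R D (x - t)) = (\<lambda>e. f t * g' (x - t) e)"
      by (auto simp: blinfun.scaleR_left D)
    ultimately show "((\<lambda>x. f t * g (x - t)) has_derivative blinfun_apply (f t *\<^sub>R D (x - t))) (at x within UNIV)"
      by simp
  next
    fix x
    show "(\<lambda>t. f t * g (x - t)) integrable_on cbox a b"
      by (intro integrable_continuous continuous_intros continuous_on_compose2[OF f]
          continuous_on_compose2[OF cg(1)]) auto
  qed (use contfx in auto)
  moreover have "blinfun_apply (integral (cbox a b) (\<lambda>t. f t *\<^sub>R D (x - t))) = (\<lambda>e. convol f (\<lambda>z. g' z e) x)"
  proof
    fix e
    have "(\<lambda>t. f t *\<^sub>R D (x - t)) integrable_on cbox a b"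
      by (intro integrable_continuous continuous_intros continuous_on_compose2[OF f]
          continuous_on_compose2[OF contD]) auto
    from integral_linear[OF this, of "\<lambda>L. blinfun_apply L e"]
    have "blinfun_apply (integral (cbox a b) (\<lambda>t. f t *\<^sub>R D (x - t))) e
        = integral (cbox a b) (\<lambda>t. f t * g' (x - t) e)"
      by (simp add: o_def blinfun.scaleR_left D blinfun.bounded_linear_left)
    then show "blinfun_apply (integral (cbox a b) (\<lambda>t. f t *\<^sub>R D (x - t))) e = convol f (\<lambda>z. g' z e) x"
      by (simp add: conv_eq[OF cg(2)])
  qed
  ultimately show ?thesis by (simp add: conv_eq[OF cg(1), abs_def] cong: conv_eq)
qed

lemma smooth_convol:
  fixes f g :: "'a::euclidean_space \<Rightarrow> real"
  assumes f: "continuous_on UNIV f" and K: "compact K" "\<And>x. x \<notin> K \<Longrightarrow> f x = 0"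
    and g: "smooth_on UNIV g"
  shows "smooth_on UNIV (convol f g)"
proof -
  have "cont_diff_on k UNIV (convol f g)" if "smooth_on UNIV g" for k and g :: "'a \<Rightarrow> real"
    using that
  proof (induction k arbitrary: g)
    case 0
    have "(convol f g has_derivative (\<lambda>e. convol f (\<lambda>z. frechet_derivative g (at z) e) x)) (at x)" for x
      by (rule convol_has_derivative[OF f K smooth_on_imp_C1_deriv[OF 0]])
    then show ?case
      by (auto simp: continuous_on_eq_continuous_at intro: has_derivative_continuous)
  next
    case (Suc k)
    have "(convol f g has_derivative (\<lambda>e. convol f (\<lambda>z. frechet_derivative g (at z) e) x)) (at x)" for x
      by (rule convol_has_derivative[OF f K smooth_on_imp_C1_deriv[OF Suc.prems]])
    note * = cont_diff_on_Suc_iff[OF open_UNIV this]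
    have "smooth_on UNIV (\<lambda>z. frechet_derivative g (at z) e)" for e
      using Suc.prems unfolding smooth_on_def by (metis cont_diff_on.simps(2))
    then have "\<forall>e. cont_diff_on k UNIV (\<lambda>x. convol f (\<lambda>z. frechet_derivative g (at z) e) x)"
      using Suc.IH by blast
    then show ?case using * by blast
  qed
  then show ?thesis using g by (simp add: smooth_on_def)
qed

definition mollifier :: "real \<Rightarrow> 'a::euclidean_space \<Rightarrow> real" where
  "mollifier r x = bump r x / (LINT x|lborel. bump r (x::'a))"

lemma bump_integrable: "0 < r \<Longrightarrow> integrable lborel (bump r :: 'a::euclidean_space \<Rightarrow> real)"
  by (rule continuous_compact_support_integrable[of _ "cball 0 r"])
    (use smooth_bump[of r] in \<open>auto simp: bump_eq_0 smooth_on_imp_C1_deriv C1_deriv_continuous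
      intro: C1_deriv_continuous[OF smooth_on_imp_C1_deriv]\<close>)

lemma bump_integral_pos: 
  assumes "0 < r" shows "0 < (LINT x|lborel. bump r (x::'a::euclidean_space))"
proof -
  let ?b = "bump r :: 'a \<Rightarrow> real"
  have "(LINT x|lborel. ?b x) \<noteq> 0"
  proof
    assume "(LINT x|lborel. ?b x) = 0"
    then have "AE x in lborel. ?b x = 0"
      using integral_nonneg_eq_0_iff_AE[OF bump_integrable[OF assms, where 'a='a]] bump_nonneg by auto
    moreover have "{x \<in> space lborel. \<not> ?b x = 0} = ball 0 r"
    proof -
      have "?b x \<noteq> 0 \<longleftrightarrow> norm x < r" for x
        using bump_pos[of x r] bump_eq_0[of r x] assms by (cases "norm x < r") auto
      then show ?thesis by (simp only: set_eq_iff mem_Collect_eq mem_ball_0 space_lborel) simp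
    qed
    ultimately have "emeasure lborel (ball (0::'a) r) = 0"
      using AE_iff_measurable[of "ball (0::'a) r" lborel "\<lambda>x. ?b x = 0"] by simp
    then show False using content_ball_pos[OF assms, of "0::'a"] by (simp add: measure_def)
  qed
  moreover have "0 \<le> (LINT x|lborel. ?b x)" by (intro Bochner_Integration.integral_nonneg bump_nonneg)
  ultimately show ?thesis by simp
qed

lemma smooth_mollifier: "smooth_on UNIV (mollifier r)"
proof -
  have "cont_diff_on k UNIV (\<lambda>x::'a. bump r x * inverse (LINT x|lborel. bump r (x::'a)))" for k
    using smooth_bump by (intro cont_diff_on_mult cont_diff_on_const) (auto simp: smooth_on_def)
  then show ?thesis by (simp add: smooth_on_def mollifier_def[abs_def] divide_inverse)
qed

lemma mollifier_props:
  assumes "0 < r"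
  shows "0 \<le> mollifier r x" "r \<le> norm x \<Longrightarrow> mollifier r x = 0" "mollifier r (- x) = mollifier r x"
    "integrable lborel (mollifier r :: 'a::euclidean_space \<Rightarrow> real)"
    "(LINT x|lborel. mollifier r (x::'a)) = 1"
  using assms bump_integral_pos[OF assms, where 'a='a] bump_integrable[OF assms, where 'a='a]
  by (auto simp: mollifier_def[abs_def] bump_nonneg bump_eq_0 bump_minus)

text \<open>The mollifier is a probability density on a ball of radius \<open>r\<close>, so the
  difference is a weighted mean of f y - f x over the points \<open>y\<close> of that ball.\<close>

lemma convol_mollifier_close:
  fixes f :: "'a::euclidean_space \<Rightarrow> real"
  assumes f: "continuous_on UNIV f" and K: "compact K" "\<And>x. x \<notin> K \<Longrightarrow> f x = 0" and r: "0 < r"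
    and close: "\<And>y. dist y x < r \<Longrightarrow> \<bar>f y - f x\<bar> \<le> e"
  shows "\<bar>convol f (mollifier r) x - f x\<bar> \<le> e"
proof -
  have cm: "continuous_on UNIV (mollifier r :: 'a \<Rightarrow> real)"
    using smooth_mollifier[of r] by (auto intro: C1_deriv_continuous smooth_on_imp_C1_deriv)
  then have meas: "(mollifier r :: 'a \<Rightarrow> real) \<in> borel_measurable borel"
    by (rule borel_measurable_continuous_onI)
  have sym: "mollifier r (x - y) = mollifier r (- x + y)" for y
    using mollifier_props(3)[OF r, of "x - y"] by (simp add: algebra_simps)
  have int1: "integrable lborel (\<lambda>y. mollifier r (x - y))"
    unfolding sym using mollifier_props(4)[OF r, where 'a='a] meas
      integrable_distr_eq[of "(+) (- x)" lborel borel "mollifier r"]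
    by (simp add: lborel_distr_plus)
  have one: "(LINT y|lborel. mollifier r (x - y)) = 1"
    unfolding sym integral_lborel_translation[OF meas] by (rule mollifier_props(5)[OF r])
  have int2: "integrable lborel (\<lambda>y. f y * mollifier r (x - y))"
    by (rule continuous_compact_support_integrable[OF _ K(1)])
      (use K(2) in \<open>auto intro!: continuous_intros f continuous_on_compose2[OF cm]\<close>)
  have "convol f (mollifier r) x - f x = (LINT y|lborel. f y * mollifier r (x - y)) - f x * (LINT y|lborel. mollifier r (x - y))"
    by (simp add: convol_def one)
  also have "\<dots> = (LINT y|lborel. (f y - f x) * mollifier r (x - y))"
    using int1 int2 by (simp add: left_diff_distrib)
  also have "\<bar>\<dots>\<bar> \<le> (LINT y|lborel. e * mollifier r (x - y))"
  proof (rule order_trans[OF integral_abs_bound integral_mono])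
    show "integrable lborel (\<lambda>y. \<bar>(f y - f x) * mollifier r (x - y)\<bar>)"
      using int1 int2 by (auto simp: left_diff_distrib)
    show "integrable lborel (\<lambda>y. e * mollifier r (x - y))" using int1 by simp
    fix y
    show "\<bar>(f y - f x) * mollifier r (x - y)\<bar> \<le> e * mollifier r (x - y)"
    proof (cases "dist y x < r")
      case True
      then show ?thesis
        using close[OF True] mollifier_props(1)[OF r, of "x - y"] by (simp add: abs_mult mult_right_mono)
    next
      case False
      then have "mollifier r (x - y) = 0"
        by (intro mollifier_props(2)[OF r]) (simp add: dist_norm norm_minus_commute)
      then show ?thesis by simp
    qed
  qed
  also have "\<dots> = e" using one by simp
  finally show ?thesis .
qed

text \<open>The derivative first falls on the mollifier and is moved to \<open>f\<close> by
  integration by parts.\<close>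

lemma convol_deriv_eq:
  fixes f :: "'a::euclidean_space \<Rightarrow> real"
  assumes f: "C1_deriv UNIV f f'" and K: "compact K" "\<And>x. x \<notin> K \<Longrightarrow> f x = 0" and r: "0 < r"
  shows "frechet_derivative (convol f (mollifier r)) (at x) e = convol (\<lambda>y. f' y e) (mollifier r) x"
proof -
  let ?m = "mollifier r :: 'a \<Rightarrow> real"
  have m: "C1_deriv UNIV ?m (\<lambda>x. frechet_derivative ?m (at x))"
    by (rule smooth_on_imp_C1_deriv[OF smooth_mollifier])
  have cf: "continuous_on UNIV f" by (rule C1_deriv_continuous[OF f])
  have "frechet_derivative (convol f ?m) (at x) = (\<lambda>e. convol f (\<lambda>z. frechet_derivative ?m (at z) e) x)"
    using frechet_derivative_at[OF convol_has_derivative[OF cf K m]] by simp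
  moreover have "C1_deriv UNIV (\<lambda>y. ?m (x - y)) (\<lambda>y e. - frechet_derivative ?m (at (x - y)) e)"
    unfolding C1_deriv_def
  proof (intro conjI ballI allI)
    fix y
    have "((\<lambda>y. x - y) has_derivative (\<lambda>e. - e)) (at y)" by (auto intro!: derivative_eq_intros)
    from has_derivative_compose[OF this C1_derivD[OF m UNIV_I]]
    show "((\<lambda>y. ?m (x - y)) has_derivative (\<lambda>e. - frechet_derivative ?m (at (x - y)) e)) (at y)"
      using linear_neg[OF has_derivative_linear[OF C1_derivD[OF m UNIV_I]]] by simp
    fix e
    show "continuous_on UNIV (\<lambda>y. - frechet_derivative ?m (at (x - y)) e)"
      by (intro continuous_intros continuous_on_compose2[OF C1_deriv_contD[OF m, of e]]) auto
  qed
  from integration_by_parts_C1[OF f this K, of e]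
  have "convol f (\<lambda>z. frechet_derivative ?m (at z) e) x = convol (\<lambda>y. f' y e) ?m x"
    by (simp add: convol_def)
  ultimately show ?thesis by simp
qed

text \<open>All approximants live in one compact set \<open>L\<close> inside \<open>S\<close>; hence
  they are test functions for \<open>S\<close> and dominated convergence applies to them.
  Convergence of the derivatives is an implication inside the conclusion, so that the same statement
  serves continuous functions and continuously differentiable ones.\<close>

lemma mollify_approx:
  fixes f :: "'a::euclidean_space \<Rightarrow> real"
  assumes S: "open S" and f: "continuous_on UNIV f" and K: "compact K" "K \<subseteq> S" "\<And>x. x \<notin> K \<Longrightarrow> f x = 0"
  shows "\<exists>g L. compact L \<and> L \<subseteq> S \<and> (\<forall>n::nat. test_fun S (g n)) \<and> (\<forall>n x. x \<notin> L \<longrightarrow> g n x = 0) \<and>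
    uniform_limit UNIV g f sequentially \<and>
    (\<forall>f' e. C1_deriv UNIV f f' \<longrightarrow>
        uniform_limit UNIV (\<lambda>n x. frechet_derivative (g n) (at x) e) (\<lambda>x. f' x e) sequentially)"
proof -
  obtain d where d: "d > 0" "(\<Union>x\<in>K. cball x d) \<subseteq> S"
    using compact_subset_open_imp_cball_epsilon_subset[OF K(1) S K(2)] by blast
  define L where "L = (\<Union>x\<in>K. cball x d)"
  have L: "compact L" "L \<subseteq> S" unfolding L_def using compact_minkowski_sum_cball[OF K(1)] d by auto
  define rr where "rr n = d / real (Suc n)" for n
  have rr: "0 < rr n" "rr n \<le> d" for n using d by (auto simp: rr_def field_simps)
  have rr_lim: "rr \<longlonglongrightarrow> 0"
    using tendsto_mult[OF tendsto_const LIMSEQ_inverse_real_of_nat, of d]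
    by (simp add: rr_def[abs_def] divide_inverse)
  define g where "g n = convol f (mollifier (rr n))" for n
  have g0: "g n x = 0" if "x \<notin> L" for n x
  proof -
    have "f y * mollifier (rr n) (x - y) = 0" for y
    proof (cases "y \<in> K")
      case True
      then have "x \<notin> cball y d" using that by (auto simp: L_def)
      then have "rr n \<le> norm (x - y)" using rr(2)[of n] by (simp add: dist_norm norm_minus_commute)
      from mollifier_props(2)[OF rr(1) this] show ?thesis by simp
    qed (use K(3) in simp)
    then show ?thesis by (simp only: g_def convol_def) simp
  qed
  have test: "test_fun S (g n)" for n
  proof -
    have "smooth_on UNIV (g n)" unfolding g_def by (rule smooth_convol[OF f K(1,3) smooth_mollifier])
    moreover have sub: "closure {x. g n x \<noteq> 0} \<subseteq> L"
      using g0 by (intro closure_minimal) (auto simp: compact_imp_closed L(1))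
    moreover have "compact (closure {x. g n x \<noteq> 0})"
      using compact_Int_closed[OF L(1) closed_closure, of "{x. g n x \<noteq> 0}"] sub by (simp add: inf.absorb2)
    ultimately show ?thesis using L(2) by (simp add: test_fun_def)
  qed
  have unif: "uniform_limit UNIV (\<lambda>n. convol h (mollifier (rr n))) h sequentially"
    if h: "continuous_on UNIV h" and h0: "\<And>x. x \<notin> K \<Longrightarrow> h x = 0" for h :: "'a \<Rightarrow> real"
    unfolding uniform_limit_iff
  proof (intro allI impI)
    fix e :: real assume e: "0 < e"
    define B where "B = (\<Union>x\<in>K. cball x 1)"
    have B: "compact B" unfolding B_def by (rule compact_minkowski_sum_cball[OF K(1)])
    have "uniformly_continuous_on B h"
      using B h by (intro compact_uniformly_continuous) (auto intro: continuous_on_subset)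
    then obtain r where r: "r > 0" "\<And>x y. x \<in> B \<Longrightarrow> y \<in> B \<Longrightarrow> dist y x < r \<Longrightarrow> dist (h y) (h x) < e / 2"
      using e unfolding uniformly_continuous_on_def by (metis half_gt_zero)
    \<comment> \<open>If neither point lies in \<open>K\<close>, both values are 0. Otherwise both
      lie in the compact set \<open>B\<close>, where \<open>h\<close> is uniformly continuous; the
      bound 1 in the minimum is the width of \<open>B\<close> around \<open>K\<close>.\<close>
    have close: "\<bar>h y - h x\<bar> \<le> e / 2" if "dist y x < min r 1" for x y
    proof (cases "x \<in> K \<or> y \<in> K")
      case True
      have "\<exists>z\<in>K. dist z x \<le> 1 \<and> dist z y \<le> 1"
      proof (cases "x \<in> K")
        case True
        then show ?thesis using that by (intro bexI[of _ x]) (auto simp: dist_commute)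
      next
        case False
        then have "y \<in> K" using True by simp
        then show ?thesis using that by (intro bexI[of _ y]) auto
      qed
      then have "x \<in> B" "y \<in> B" by (auto simp: B_def)
      then show ?thesis using r(2)[of x y] that by (simp add: dist_real_def)
    qed (use h0 e in auto)
    have "\<forall>\<^sub>F n in sequentially. rr n < min r 1"
      using rr_lim r(1) by (intro order_tendstoD) auto
    then show "\<forall>\<^sub>F n in sequentially. \<forall>x\<in>UNIV. dist (convol h (mollifier (rr n)) x) (h x) < e"
    proof eventually_elim
      case (elim n)
      have "\<bar>convol h (mollifier (rr n)) x - h x\<bar> < e" for x
      proof -
        have "\<bar>convol h (mollifier (rr n)) x - h x\<bar> \<le> e / 2"
          by (rule convol_mollifier_close[OF h K(1) h0 rr(1)]) (use close elim in auto)
        then show ?thesis using e by simp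
      qed
      then show ?case by (simp add: dist_real_def)
    qed
  qed
  show ?thesis
  proof (intro exI[of _ g] exI[of _ L] conjI allI impI)
    show "uniform_limit UNIV g f sequentially" unfolding g_def[abs_def] by (rule unif[OF f K(3)])
    fix f' e assume f': "C1_deriv UNIV f f'"
    have "(f has_derivative (\<lambda>_. 0)) (at x)" if "x \<notin> K" for x
      by (rule has_derivative_transform_within_open[OF has_derivative_const, of "- K"])
        (use that K in \<open>auto simp: compact_imp_closed\<close>)
    then have f'0: "f' x e = 0" if "x \<notin> K" for x
      using has_derivative_unique[OF C1_derivD[OF f' UNIV_I, of x]] that by metis
    have "(\<lambda>n x. frechet_derivative (g n) (at x) e) = (\<lambda>n. convol (\<lambda>y. f' y e) (mollifier (rr n)))"
      unfolding g_def using convol_deriv_eq[OF f' K(1,3) rr(1)] by auto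
    then show "uniform_limit UNIV (\<lambda>n x. frechet_derivative (g n) (at x) e) (\<lambda>x. f' x e) sequentially"
      using unif[OF C1_deriv_contD[OF f'] f'0] by simp
  qed (use L test g0 in auto)
qed

section \<open>Weak derivatives\<close>

lemma locally_integrableD:
  "locally_integrable S f \<Longrightarrow> compact K \<Longrightarrow> K \<subseteq> S \<Longrightarrow> integrable lebesgue (\<lambda>x. indicator K x * f x)"
  by (auto simp: locally_integrable_def set_integrable_def)

lemma set_integral_compact_support:
  fixes f :: "'a::euclidean_space \<Rightarrow> real"
  assumes "K \<subseteq> S" "\<And>x. x \<in> S - K \<Longrightarrow> h x = 0"
  shows "(LINT x:S|M. f x * h x) = (LINT x|M. (indicator K x * f x) * h x)"
  unfolding set_lebesgue_integral_def
  by (rule arg_cong[where f = "integral\<^sup>L M"]) (use assms in \<open>auto simp: indicator_def fun_eq_iff\<close>)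

lemma uniform_limit_set_integral:
  fixes f :: "'a::euclidean_space \<Rightarrow> real"
  assumes f: "locally_integrable S f" and L: "compact L" "L \<subseteq> S"
    and h: "\<And>n. continuous_on UNIV (h n)" "\<And>n x. x \<notin> L \<Longrightarrow> h n x = 0"
    and lim: "uniform_limit UNIV h g sequentially"
  shows "(\<lambda>n. LINT x:S|lebesgue. f x * h n x) \<longlonglongrightarrow> (LINT x:S|lebesgue. f x * g x)"
proof -
  have ptw: "(\<lambda>n. h n x) \<longlonglongrightarrow> g x" for x using tendsto_uniform_limitI[OF lim, of x] by simp
  have g: "continuous_on UNIV g"
    by (rule uniform_limit_theorem[OF _ lim]) (use h(1) in auto)
  have g0: "g x = 0" if "x \<notin> L" for x
    using ptw[of x] h(2)[OF that] by (simp add: LIMSEQ_const_iff)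
  obtain M where M: "0 \<le> M" "\<And>x. \<bar>g x\<bar> \<le> M" using compact_support_bound[OF g L(1) g0] by metis
  have "\<forall>\<^sub>F n in sequentially. \<forall>x\<in>UNIV. dist (h n x) (g x) < 1"
    using lim by (auto simp: uniform_limit_iff)
  then obtain N where N: "\<And>n x. n \<ge> N \<Longrightarrow> \<bar>h n x - g x\<bar> < 1"
    by (auto simp: eventually_sequentially dist_real_def)
  let ?F = "\<lambda>x. indicator L x * f x"
  have F: "integrable lebesgue ?F" by (rule locally_integrableD[OF f L])
  have m: "k \<in> borel_measurable lebesgue" if "continuous_on UNIV k" for k :: "'a \<Rightarrow> real"
    using that by (intro measurable_completion) (auto intro: borel_measurable_continuous_onI)
  have "(\<lambda>n. LINT x|lebesgue. ?F x * h (n + N) x) \<longlonglongrightarrow> (LINT x|lebesgue. ?F x * g x)"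
  proof (rule integral_dominated_convergence[where w = "\<lambda>x. \<bar>?F x\<bar> * (M + 1)"])
    show "integrable lebesgue (\<lambda>x. \<bar>?F x\<bar> * (M + 1))" using F by auto
    show "AE x in lebesgue. (\<lambda>n. ?F x * h (n + N) x) \<longlonglongrightarrow> ?F x * g x"
      using LIMSEQ_ignore_initial_segment[OF ptw] by (intro AE_I2 tendsto_mult_left)
    fix n
    show "AE x in lebesgue. norm (?F x * h (n + N) x) \<le> \<bar>?F x\<bar> * (M + 1)"
    proof (intro AE_I2)
      fix x
      have "\<bar>h (n + N) x\<bar> \<le> M + 1" using N[of "n + N" x] M(2)[of x] by auto
      then have "\<bar>?F x\<bar> * \<bar>h (n + N) x\<bar> \<le> \<bar>?F x\<bar> * (M + 1)" by (intro mult_left_mono) auto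
      then show "norm (?F x * h (n + N) x) \<le> \<bar>?F x\<bar> * (M + 1)" by (simp only: real_norm_def abs_mult)
    qed
  qed (use F m g h(1) in auto)
  then have "(\<lambda>n. LINT x|lebesgue. ?F x * h n x) \<longlonglongrightarrow> (LINT x|lebesgue. ?F x * g x)"
    by (rule LIMSEQ_offset)
  moreover have "(LINT x:S|lebesgue. f x * k x) = (LINT x|lebesgue. ?F x * k x)"
    if "\<And>x. x \<notin> L \<Longrightarrow> k x = 0" for k
    by (rule set_integral_compact_support[OF L(2)]) (use that in auto)
  ultimately show ?thesis using g0 h(2) by simp
qed

lemma test_fun_C1_deriv: "test_fun S \<phi> \<Longrightarrow> C1_deriv UNIV \<phi> (\<lambda>x. frechet_derivative \<phi> (at x))"
  by (simp add: test_fun_def smooth_on_imp_C1_deriv)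

lemma deriv_zero_off_compact:
  fixes f :: "'a::euclidean_space \<Rightarrow> real"
  assumes "C1_deriv UNIV f f'" "compact K" "\<And>x. x \<notin> K \<Longrightarrow> f x = 0" "x \<notin> K"
  shows "f' x e = 0"
proof -
  have "(f has_derivative (\<lambda>_. 0)) (at x)"
    by (rule has_derivative_transform_within_open[OF has_derivative_const, of "- K"])
      (use assms in \<open>auto simp: compact_imp_closed\<close>)
  then show ?thesis using has_derivative_unique[OF C1_derivD[OF assms(1) UNIV_I, of x]] by metis
qed

text \<open>Weak derivatives are defined with smooth test functions, but the cut-offs used later are
  built from quadratic splines. Mollification transfers the identity to them.\<close>

theorem weak_partial_C1_test:
  fixes f :: "'a::euclidean_space \<Rightarrow> real"
  assumes w: "is_weak_partial S e f g" and S: "open S" and \<psi>: "C1_deriv S \<psi> \<psi>'"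
    and K: "compact K" "K \<subseteq> S" "\<And>x. x \<in> S - K \<Longrightarrow> \<psi> x = 0"
  shows "(LINT x:S|lebesgue. f x * \<psi>' x e) = - (LINT x:S|lebesgue. g x * \<psi> x)"
proof -
  define h where "h x = (if x \<in> S then \<psi> x else 0)" for x
  define h' where "h' x e = (if x \<in> S then \<psi>' x e else 0)" for x e
  have h: "C1_deriv UNIV h h'" unfolding h_def[abs_def] h'_def[abs_def]
    by (rule C1_deriv_extend_zero[OF S \<psi> K])
  have h0: "h x = 0" if "x \<notin> K" for x using that K(3) by (auto simp: h_def)
  have "\<exists>\<phi> L. compact L \<and> L \<subseteq> S \<and> (\<forall>n::nat. test_fun S (\<phi> n)) \<and> (\<forall>n x. x \<notin> L \<longrightarrow> \<phi> n x = 0) \<and>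
      uniform_limit UNIV \<phi> h sequentially \<and>
      uniform_limit UNIV (\<lambda>n x. frechet_derivative (\<phi> n) (at x) e) (\<lambda>x. h' x e) sequentially"
    using mollify_approx[OF S C1_deriv_continuous[OF h] K(1,2)] h0 h by blast
  then obtain \<phi> L where \<phi>: "compact L" "L \<subseteq> S" "\<And>n::nat. test_fun S (\<phi> n)" "\<And>n x. x \<notin> L \<Longrightarrow> \<phi> n x = 0"
    "uniform_limit UNIV \<phi> h sequentially"
    "uniform_limit UNIV (\<lambda>n x. frechet_derivative (\<phi> n) (at x) e) (\<lambda>x. h' x e) sequentially"
    by blast
  have d: "C1_deriv UNIV (\<phi> n) (\<lambda>x. frechet_derivative (\<phi> n) (at x))" for n
    using test_fun_C1_deriv[OF \<phi>(3)] .
  have li: "locally_integrable S f" "locally_integrable S g" using w by (auto simp: is_weak_partial_def)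
  have "(\<lambda>n. LINT x:S|lebesgue. f x * frechet_derivative (\<phi> n) (at x) e)
      \<longlonglongrightarrow> (LINT x:S|lebesgue. f x * h' x e)"
    by (rule uniform_limit_set_integral[OF li(1) \<phi>(1,2) C1_deriv_contD[OF d]
          deriv_zero_off_compact[OF d \<phi>(1,4)] \<phi>(6)])
  moreover have "(\<lambda>n. LINT x:S|lebesgue. g x * \<phi> n x) \<longlonglongrightarrow> (LINT x:S|lebesgue. g x * h x)"
    by (rule uniform_limit_set_integral[OF li(2) \<phi>(1,2) C1_deriv_continuous[OF d] \<phi>(4,5)])
  moreover have "(LINT x:S|lebesgue. f x * frechet_derivative (\<phi> n) (at x) e)
      = - (LINT x:S|lebesgue. g x * \<phi> n x)" for n
    using w \<phi>(3) by (auto simp: is_weak_partial_def)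
  ultimately have "(LINT x:S|lebesgue. f x * h' x e) = - (LINT x:S|lebesgue. g x * h x)"
    by (simp add: LIMSEQ_unique[OF _ tendsto_minus])
  then show ?thesis
    by (simp add: h_def h'_def set_lebesgue_integral_def indicator_def of_bool_def if_distrib if_distribR
        cong: if_cong)
qed

text \<open>The vanishing integrals extend from test functions to continuous functions with compact
  support, and from these to indicators of compact sets. Inner regularity then shows that the sets
  where \<open>g\<close> is positive or negative are null.\<close>

theorem du_Bois_Reymond:
  fixes g :: "'a::euclidean_space \<Rightarrow> real"
  assumes S: "open S" and g: "locally_integrable S g"
    and zero: "\<And>\<phi>. test_fun S \<phi> \<Longrightarrow> (LINT x:S|lebesgue. g x * \<phi> x) = 0"
  shows "AE x in lebesgue_on S. g x = 0"
proof -
  have cont0: "(LINT x:S|lebesgue. g x * h x) = 0"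
    if h: "continuous_on UNIV h" and K: "compact K" "K \<subseteq> S" "\<And>x. x \<notin> K \<Longrightarrow> h x = 0" for h K
  proof -
    have "\<exists>\<phi> L. compact L \<and> L \<subseteq> S \<and> (\<forall>n::nat. test_fun S (\<phi> n)) \<and> (\<forall>n x. x \<notin> L \<longrightarrow> \<phi> n x = 0) \<and>
        uniform_limit UNIV \<phi> h sequentially"
      using mollify_approx[OF S h K(1,2)] K(3) by blast
    then obtain \<phi> L where \<phi>: "compact L" "L \<subseteq> S" "\<And>n::nat. test_fun S (\<phi> n)" "\<And>n x. x \<notin> L \<Longrightarrow> \<phi> n x = 0"
      "uniform_limit UNIV \<phi> h sequentially"
      by blast
    have "(\<lambda>n. LINT x:S|lebesgue. g x * \<phi> n x) \<longlonglongrightarrow> (LINT x:S|lebesgue. g x * h x)"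
      by (rule uniform_limit_set_integral[OF g \<phi>(1,2) C1_deriv_continuous[OF test_fun_C1_deriv[OF \<phi>(3)]] \<phi>(4,5)])
    then show ?thesis using zero[OF \<phi>(3)] by (simp add: LIMSEQ_const_iff)
  qed
  have compact0: "(LINT x|lebesgue. indicator K x * g x) = 0" if K: "compact K" "K \<subseteq> S" for K
  proof (cases "K = {}")
    case False
    obtain d where d: "d > 0" "(\<Union>x\<in>K. cball x d) \<subseteq> S"
      using compact_subset_open_imp_cball_epsilon_subset[OF K(1) S K(2)] by blast
    define L where "L = (\<Union>x\<in>K. cball x d)"
    have L: "compact L" "L \<subseteq> S" unfolding L_def using compact_minkowski_sum_cball[OF K(1)] d by auto
    \<comment> \<open>Equal to 1 on \<open>K\<close> and to 0 from distance d / (n + 1) on, so these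
      functions decrease to the indicator of \<open>K\<close> and vanish off
      \<open>L\<close>.\<close>
    define h where "h n x = max 0 (1 - real (Suc n) / d * infdist x K)" for n x
    have h0: "h n x = 0" if "x \<notin> L" for n x
    proof -
      obtain y where y: "y \<in> K" "infdist x K = dist x y"
        using infdist_attains_inf[OF compact_imp_closed[OF K(1)] False] by metis
      then have "d < infdist x K" using that by (auto simp: L_def dist_commute)
      then have "1 \<le> infdist x K / d" using d by simp
      also have "\<dots> \<le> real (Suc n) * (infdist x K / d)" 
        using d mult_right_mono[of 1 "real (Suc n)" "infdist x K / d"] by (simp add: infdist_nonneg)
      finally show ?thesis by (simp add: h_def)
    qed
    have hc: "continuous_on UNIV (h n)" for n
      unfolding h_def by (intro continuous_intros)
    let ?F = "\<lambda>x. indicator L x * g x"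
    have F: "integrable lebesgue ?F" by (rule locally_integrableD[OF g L])
    have m: "k \<in> borel_measurable lebesgue" if "continuous_on UNIV k" for k :: "'a \<Rightarrow> real"
      using that by (intro measurable_completion) (auto intro: borel_measurable_continuous_onI)
    have "(\<lambda>n. LINT x|lebesgue. ?F x * h n x) \<longlonglongrightarrow> (LINT x|lebesgue. ?F x * indicator K x)"
    proof (rule integral_dominated_convergence[where w = "\<lambda>x. \<bar>?F x\<bar>"])
      show "AE x in lebesgue. (\<lambda>n. ?F x * h n x) \<longlonglongrightarrow> ?F x * indicator K x"
      proof (intro AE_I2 tendsto_mult_left)
        fix x
        show "(\<lambda>n. h n x) \<longlonglongrightarrow> indicator K x"
        proof (cases "x \<in> K")
          case True
          then show ?thesis using infdist_zero[OF True] by (simp add: h_def)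
        next
          case xK: False
          then have pos: "0 < infdist x K"
            using K(1) False by (simp add: compact_imp_closed infdist_pos_not_in_closed)
          obtain N where N: "d / infdist x K < real N" using reals_Archimedean2 by blast
          have "h n x = 0" if "n \<ge> N" for n
          proof -
            have "d / infdist x K \<le> real (Suc n)" using N that by linarith
            then have "1 \<le> real (Suc n) / d * infdist x K" using pos d by (simp add: field_simps)
            then show ?thesis by (simp add: h_def)
          qed
          then have "\<forall>\<^sub>F n in sequentially. h n x = indicator K x"
            using xK by (auto simp: eventually_sequentially)
          then show ?thesis by (rule tendsto_eventually)
        qed
      qed
      fix n
      show "AE x in lebesgue. norm (?F x * h n x) \<le> \<bar>?F x\<bar>"
      proof (intro AE_I2)
        fix x
        have "0 \<le> h n x" "h n x \<le> 1" using d by (auto simp: h_def infdist_nonneg)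
        then have "\<bar>?F x\<bar> * \<bar>h n x\<bar> \<le> \<bar>?F x\<bar> * 1" by (intro mult_left_mono) auto
        then show "norm (?F x * h n x) \<le> \<bar>?F x\<bar>" by (simp only: real_norm_def abs_mult mult_1_right)
      qed
    next
      have "K \<in> sets lebesgue" using K(1) by (simp add: borel_compact)
      then show "(\<lambda>x. ?F x * indicator K x) \<in> borel_measurable lebesgue"
        using F by (auto intro!: borel_measurable_times)
    qed (use F m hc in \<open>auto intro!: borel_measurable_times\<close>)
    moreover have "(LINT x|lebesgue. ?F x * h n x) = 0" for n
      using cont0[OF hc L h0] set_integral_compact_support[OF L(2), of "h n" lebesgue g] h0 by simp
    moreover have "(\<lambda>x. ?F x * indicator K x) = (\<lambda>x. indicator K x * g x)"
    proof -
      have "K \<subseteq> L" using d by (auto simp: L_def intro!: bexI)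
      then show ?thesis by (auto simp: indicator_def fun_eq_iff)
    qed
    ultimately show ?thesis by (simp add: LIMSEQ_const_iff)
  qed simp
  \<comment> \<open>The factor \<open>s\<close> will be 1 and -1, to treat both signs. On a closed
    subset \<open>T\<close> of this set a positive function has integral 0, so \<open>T\<close> is
    null, and \<open>T\<close> exhausts the set up to measure \<open>e\<close>.\<close>
  have null: "{x \<in> C. 0 < s * g x} \<in> null_sets lebesgue" if C: "compact C" "C \<subseteq> S" for C s
  proof -
    define A where "A = {x \<in> C. 0 < s * g x}"
    have "integrable lebesgue (\<lambda>x. indicator C x * g x)" by (rule locally_integrableD[OF g C])
    then have "(\<lambda>x. s * (indicator C x * g x)) \<in> borel_measurable lebesgue" by auto
    then have "{x \<in> space lebesgue. 0 < s * (indicator C x * g x)} \<in> sets lebesgue"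
      by measurable
    also have "{x \<in> space lebesgue. 0 < s * (indicator C x * g x)} = A"
      by (auto simp: A_def indicator_def split: if_splits)
    finally have A: "A \<in> sets lebesgue" .
    have le: "emeasure lebesgue A \<le> ennreal e" if e: "0 < e" for e
    proof -
      obtain T where T: "closed T" "T \<subseteq> A" "A - T \<in> lmeasurable" "emeasure lebesgue (A - T) < ennreal e"
        using sets_lebesgue_inner_closed[OF A e] by metis
      have TC: "T \<subseteq> C" using T(2) by (auto simp: A_def)
      have "compact (C \<inter> T)" using C(1) T(1) by (rule compact_Int_closed)
      then have Tc: "compact T" using TC by (simp add: inf.absorb2)
      have TS: "T \<subseteq> S" using TC C(2) by auto
      have int: "integrable lebesgue (\<lambda>x. indicator T x * g x)" by (rule locally_integrableD[OF g Tc TS])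
      have "(LINT x|lebesgue. s * (indicator T x * g x)) = 0" using compact0[OF Tc TS] by simp
      moreover have nonneg: "0 \<le> s * (indicator T x * g x)" for x
        using T(2) by (auto simp: A_def indicator_def)
      ultimately have "AE x in lebesgue. s * (indicator T x * g x) = 0"
        using integral_nonneg_eq_0_iff_AE[of lebesgue "\<lambda>x. s * (indicator T x * g x)"] int by simp
      then have "AE x in lebesgue. x \<notin> T"
        by eventually_elim (use T(2) in \<open>auto simp: A_def indicator_def\<close>)
      moreover have Tm: "T \<in> sets lebesgue" using T(1) by simp
      ultimately have "emeasure lebesgue T = 0" by (simp add: AE_iff_measurable[OF Tm])
      moreover have "emeasure lebesgue A \<le> emeasure lebesgue T + emeasure lebesgue (A - T)"
        using emeasure_subadditive[of T lebesgue "A - T"] Tm A T(2) by (simp add: Un_absorb1)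
      ultimately show ?thesis using T(4) by simp
    qed
    have "emeasure lebesgue A \<le> 0" by (rule ennreal_le_epsilon) (use le in simp)
    then show ?thesis using A by (auto simp: A_def)
  qed
  obtain D where D: "countable D" "D \<subseteq> Pow S" "\<And>X. X \<in> D \<Longrightarrow> \<exists>a b. X = cbox a b" "\<Union>D = S"
    using open_countable_Union_open_cbox[OF S] by metis
  have "AE x in lebesgue. \<forall>C\<in>D. x \<in> C \<longrightarrow> g x = 0"
  proof (subst AE_ball_countable[OF D(1)], intro ballI)
    fix C assume "C \<in> D"
    then obtain a b where "C = cbox a b" "C \<subseteq> S" using D by blast
    then have C: "compact C" "C \<subseteq> S" by auto
    show "AE x in lebesgue. x \<in> C \<longrightarrow> g x = 0"
      using AE_not_in[OF null[OF C, of 1]] AE_not_in[OF null[OF C, of "-1"]]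
      by eventually_elim auto
  qed
  then have "AE x in lebesgue. x \<in> S \<longrightarrow> g x = 0"
    by eventually_elim (use D(4) in blast)
  then show ?thesis using S by (simp add: AE_restrict_space_iff)
qed

lemma set_integral_lebesgue_on:
  "open S \<Longrightarrow> (LINT x:S|lebesgue. f x) = (LINT x|lebesgue_on S. (f x :: real))"
  by (simp add: set_lebesgue_integral_def integral_restrict_space)

lemma locally_integrable_lincomb:
  assumes "locally_integrable S f" "locally_integrable S g"
  shows "locally_integrable S (\<lambda>x. a * f x + b * g x)"
  unfolding locally_integrable_def set_integrable_def
proof (intro allI impI)
  fix K assume K: "compact K \<and> K \<subseteq> S"
  have "integrable lebesgue (\<lambda>x. a * (indicator K x * f x) + b * (indicator K x * g x))"
    using K assms by (intro Bochner_Integration.integrable_add integrable_mult_right locally_integrableD) auto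
  then show "integrable lebesgue (\<lambda>x. indicator K x *\<^sub>R (a * f x + b * g x))"
    by (simp add: algebra_simps)
qed

lemma continuous_locally_integrable:
  fixes f :: "'a::euclidean_space \<Rightarrow> real"
  assumes "continuous_on S f"
  shows "locally_integrable S f"
  unfolding locally_integrable_def set_integrable_def
proof (intro allI impI)
  fix K assume K: "compact K \<and> K \<subseteq> S"
  then have "integrable lborel (\<lambda>x. indicator K x *\<^sub>R f x)"
    using assms by (intro borel_integrable_compact) (auto intro: continuous_on_subset)
  then show "integrable lebesgue (\<lambda>x. indicator K x *\<^sub>R f x)"
    by (subst integrable_completion) auto
qed

lemma test_fun_support:
  assumes "test_fun S \<phi>"
  obtains K where "compact K" "K \<subseteq> S" "\<And>x. x \<notin> K \<Longrightarrow> \<phi> x = 0"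
proof (rule that[of "closure {x. \<phi> x \<noteq> 0}"])
  show "\<phi> x = 0" if "x \<notin> closure {x. \<phi> x \<noteq> 0}" for x
    using that closure_subset[of "{x. \<phi> x \<noteq> 0}"] by blast
qed (use assms in \<open>auto simp: test_fun_def\<close>)

lemma integrable_times_compact:
  fixes f :: "'a::euclidean_space \<Rightarrow> real"
  assumes f: "locally_integrable S f" and S: "open S" and K: "compact K" "K \<subseteq> S"
    and h: "continuous_on S h" "\<And>x. x \<in> S - K \<Longrightarrow> h x = 0"
  shows "integrable (lebesgue_on S) (\<lambda>x. f x * h x)"
proof -
  have "bounded (h ` K)"
    using h(1) K by (intro compact_imp_bounded compact_continuous_image) (auto intro: continuous_on_subset)
  then obtain M where M: "\<And>x. x \<in> K \<Longrightarrow> \<bar>h x\<bar> \<le> M" by (auto simp: bounded_iff)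
  have F: "integrable lebesgue (\<lambda>x. indicator K x * f x)" by (rule locally_integrableD[OF f K])
  have hm: "(\<lambda>x. indicator K x *\<^sub>R h x) \<in> borel_measurable lebesgue"
    using K h(1) by (intro measurable_completion borel_measurable_integrable borel_integrable_compact)
      (auto intro: continuous_on_subset)
  have "integrable lebesgue (\<lambda>x. (indicator K x * f x) * (indicator K x *\<^sub>R h x))"
  proof (rule Bochner_Integration.integrable_bound[of _ "\<lambda>x. M * (indicator K x * f x)"])
    show "integrable lebesgue (\<lambda>x. M * (indicator K x * f x))" using F by simp
    show "(\<lambda>x. (indicator K x * f x) * (indicator K x *\<^sub>R h x)) \<in> borel_measurable lebesgue"
      by (rule borel_measurable_times[OF borel_measurable_integrable[OF F] hm])
    show "AE x in lebesgue. norm ((indicator K x * f x) * (indicator K x *\<^sub>R h x)) \<le> norm (M * (indicator K x * f x))"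
    proof (intro AE_I2)
      fix x
      show "norm ((indicator K x * f x) * (indicator K x *\<^sub>R h x)) \<le> norm (M * (indicator K x * f x))"
      proof (cases "x \<in> K")
        case True
        have "\<bar>h x\<bar> \<le> \<bar>M\<bar>" using M[OF True] by simp
        then have "\<bar>f x\<bar> * \<bar>h x\<bar> \<le> \<bar>f x\<bar> * \<bar>M\<bar>" by (intro mult_left_mono) auto
        then show ?thesis using True by (simp add: abs_mult mult.commute)
      qed simp
    qed
  qed
  moreover have "(\<lambda>x. (indicator K x * f x) * (indicator K x *\<^sub>R h x)) = (\<lambda>x. indicator S x *\<^sub>R (f x * h x))"
    using h(2) K(2) by (auto simp: indicator_def fun_eq_iff)
  ultimately show ?thesis using S by (simp add: integrable_restrict_space)
qed

lemma is_weak_partialD: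
  assumes "is_weak_partial S e f g"
  shows "locally_integrable S f" "locally_integrable S g"
    "test_fun S \<phi> \<Longrightarrow> open S \<Longrightarrow>
      (LINT x|lebesgue_on S. f x * frechet_derivative \<phi> (at x) e) = - (LINT x|lebesgue_on S. g x * \<phi> x)"
  using assms by (simp_all add: is_weak_partial_def set_integral_lebesgue_on)

lemma is_weak_partial_lincomb:
  fixes f1 f2 :: "'a::euclidean_space \<Rightarrow> real"
  assumes "is_weak_partial S e f1 g1" "is_weak_partial S e f2 g2" and S: "open S"
  shows "is_weak_partial S e (\<lambda>x. a * f1 x + b * f2 x) (\<lambda>x. a * g1 x + b * g2 x)"
  unfolding is_weak_partial_def
proof (intro conjI allI impI)
  note li = is_weak_partialD(1,2)[OF assms(1)] is_weak_partialD(1,2)[OF assms(2)]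
  show "locally_integrable S (\<lambda>x. a * f1 x + b * f2 x)" "locally_integrable S (\<lambda>x. a * g1 x + b * g2 x)"
    by (intro locally_integrable_lincomb li)+
  fix \<phi> :: "'a \<Rightarrow> real" assume \<phi>: "test_fun S \<phi>"
  note d = test_fun_C1_deriv[OF \<phi>]
  obtain K where s: "compact K" "K \<subseteq> S" "\<And>x. x \<notin> K \<Longrightarrow> \<phi> x = 0"
    using test_fun_support[OF \<phi>] by metis
  have int: "integrable (lebesgue_on S) (\<lambda>x. f x * \<phi> x)"
      "integrable (lebesgue_on S) (\<lambda>x. f x * frechet_derivative \<phi> (at x) e)"
    if "locally_integrable S f" for f
  proof -
    have "continuous_on S \<phi>" "continuous_on S (\<lambda>x. frechet_derivative \<phi> (at x) e)"
      using continuous_on_subset[OF C1_deriv_continuous[OF d] subset_UNIV]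
        continuous_on_subset[OF C1_deriv_contD[OF d, of e] subset_UNIV] by auto
    then show "integrable (lebesgue_on S) (\<lambda>x. f x * \<phi> x)"
        "integrable (lebesgue_on S) (\<lambda>x. f x * frechet_derivative \<phi> (at x) e)"
      using deriv_zero_off_compact[OF d s(1,3)] s(3)
      by (auto intro!: integrable_times_compact[OF that S s(1,2)])
  qed
  have eq: "(LINT x|lebesgue_on S. f1 x * frechet_derivative \<phi> (at x) e) = - (LINT x|lebesgue_on S. g1 x * \<phi> x)"
     "(LINT x|lebesgue_on S. f2 x * frechet_derivative \<phi> (at x) e) = - (LINT x|lebesgue_on S. g2 x * \<phi> x)"
    using is_weak_partialD(3)[OF assms(1) \<phi> S] is_weak_partialD(3)[OF assms(2) \<phi> S] by auto
  have "(LINT x|lebesgue_on S. (a * f1 x + b * f2 x) * frechet_derivative \<phi> (at x) e)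
    = a * (LINT x|lebesgue_on S. f1 x * frechet_derivative \<phi> (at x) e) + b * (LINT x|lebesgue_on S. f2 x * frechet_derivative \<phi> (at x) e)"
    using int li by (simp add: distrib_right mult.assoc)
  moreover have "(LINT x|lebesgue_on S. (a * g1 x + b * g2 x) * \<phi> x)
    = a * (LINT x|lebesgue_on S. g1 x * \<phi> x) + b * (LINT x|lebesgue_on S. g2 x * \<phi> x)"
    using int li by (simp add: distrib_right mult.assoc)
  ultimately show "(LINT x:S|lebesgue. (a * f1 x + b * f2 x) * frechet_derivative \<phi> (at x) e)
     = - (LINT x:S|lebesgue. (a * g1 x + b * g2 x) * \<phi> x)"
    using eq S by (simp add: set_integral_lebesgue_on)
qed

lemma is_weak_partial_unique:
  fixes f :: "'a::euclidean_space \<Rightarrow> real"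
  assumes w: "is_weak_partial S e f g1" "is_weak_partial S e f g2" and S: "open S"
  shows "AE x in lebesgue_on S. g1 x = g2 x"
proof -
  have d: "is_weak_partial S e (\<lambda>x. 1 * f x + (-1) * f x) (\<lambda>x. 1 * g1 x + (-1) * g2 x)"
    by (rule is_weak_partial_lincomb[OF w S])
  have "AE x in lebesgue_on S. 1 * g1 x + (-1) * g2 x = 0"
  proof (rule du_Bois_Reymond[OF S])
    show "locally_integrable S (\<lambda>x. 1 * g1 x + (-1) * g2 x)" using d by (simp add: is_weak_partial_def)
    fix \<phi> :: "'a \<Rightarrow> real" assume "test_fun S \<phi>"
    then have "(LINT x:S|lebesgue. (1 * f x + (-1) * f x) * frechet_derivative \<phi> (at x) e)
        = - (LINT x:S|lebesgue. (1 * g1 x + (-1) * g2 x) * \<phi> x)"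
      using d by (simp add: is_weak_partial_def)
    then show "(LINT x:S|lebesgue. (1 * g1 x + (-1) * g2 x) * \<phi> x) = 0"
      by (simp add: set_lebesgue_integral_def)
  qed
  then show ?thesis by eventually_elim simp
qed

lemma weak_partial_AE_eq:
  fixes f :: "'a::euclidean_space \<Rightarrow> real"
  assumes "is_weak_partial S e f g" "open S"
  shows "is_weak_partial S e f (weak_partial S e f)" "AE x in lebesgue_on S. weak_partial S e f x = g x"
proof -
  show "is_weak_partial S e f (weak_partial S e f)"
    unfolding weak_partial_def by (rule someI[of "is_weak_partial S e f" g, OF assms(1)])
  then show "AE x in lebesgue_on S. weak_partial S e f x = g x"
    by (rule is_weak_partial_unique[OF _ assms])
qed

text \<open>The product with a test function, continued by 0, is continuously differentiable on the
  whole space, and the integral of its derivative vanishes.\<close>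

lemma C1_is_weak_partial:
  fixes f :: "'a::euclidean_space \<Rightarrow> real"
  assumes S: "open S" and f: "C1_deriv S f f'"
  shows "is_weak_partial S e f (\<lambda>x. f' x e)"
  unfolding is_weak_partial_def
proof (intro conjI allI impI)
  show li: "locally_integrable S f" "locally_integrable S (\<lambda>x. f' x e)"
    using f by (auto intro: continuous_locally_integrable C1_deriv_continuous C1_deriv_contD)
  fix \<phi> :: "'a \<Rightarrow> real" assume \<phi>: "test_fun S \<phi>"
  note d = test_fun_C1_deriv[OF \<phi>]
  obtain K where s: "compact K" "K \<subseteq> S" "\<And>x. x \<notin> K \<Longrightarrow> \<phi> x = 0"
    using test_fun_support[OF \<phi>] by metis
  let ?\<phi>' = "\<lambda>x e. frechet_derivative \<phi> (at x) e"
  have cont: "continuous_on S \<phi>" "continuous_on S (\<lambda>x. ?\<phi>' x e)"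
    using continuous_on_subset[OF C1_deriv_continuous[OF d]] continuous_on_subset[OF C1_deriv_contD[OF d, of e]]
    by auto
  have int: "integrable (lebesgue_on S) (\<lambda>x. f x * ?\<phi>' x e)" "integrable (lebesgue_on S) (\<lambda>x. f' x e * \<phi> x)"
    using deriv_zero_off_compact[OF d s(1,3)] s(3) cont
    by (auto intro!: integrable_times_compact[OF _ S s(1,2)] li)
  let ?p = "\<lambda>x. if x \<in> S then f x * \<phi> x else 0"
  let ?p' = "\<lambda>x e. if x \<in> S then f x * ?\<phi>' x e + f' x e * \<phi> x else 0"
  have p: "C1_deriv UNIV ?p ?p'"
    using C1_deriv_mult[OF f C1_deriv_subset[OF d]] s(3)
    by (intro C1_deriv_extend_zero[OF S _ s(1,2)]) auto
  have "(LINT x|lborel. ?p' x e) = 0"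
    by (rule integral_C1_deriv_eq_0[OF p s(1)]) (use s(3) in auto)
  also have "(LINT x|lborel. ?p' x e) = (LINT x|lebesgue. ?p' x e)"
    using C1_deriv_contD[OF p, of e] by (subst integral_completion) (auto intro: borel_measurable_continuous_onI)
  also have "\<dots> = (LINT x|lebesgue. indicator S x *\<^sub>R (f x * ?\<phi>' x e + f' x e * \<phi> x))"
    by (rule Bochner_Integration.integral_cong) (auto simp: indicator_def)
  also have "\<dots> = (LINT x|lebesgue_on S. f x * ?\<phi>' x e + f' x e * \<phi> x)"
    using S by (simp add: integral_restrict_space)
  also have "\<dots> = (LINT x|lebesgue_on S. f x * ?\<phi>' x e) + (LINT x|lebesgue_on S. f' x e * \<phi> x)"
    using int by simp
  finally show "(LINT x:S|lebesgue. f x * frechet_derivative \<phi> (at x) e) = - (LINT x:S|lebesgue. f' x e * \<phi> x)"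
    using S by (simp add: set_integral_lebesgue_on)
qed

text \<open>Pointwise limits under a continuous, hence locally integrable, majorant. It is made for
  regularised square roots, whose limit fails to be differentiable where the radicand
  vanishes.\<close>

lemma is_weak_partial_limit:
  fixes f :: "'a::euclidean_space \<Rightarrow> real"
  assumes S: "open S" and w: "\<And>n::nat. is_weak_partial S e (F n) (G n)"
    and lim: "\<And>x. x \<in> S \<Longrightarrow> (\<lambda>n. F n x) \<longlonglongrightarrow> f x" "\<And>x. x \<in> S \<Longrightarrow> (\<lambda>n. G n x) \<longlonglongrightarrow> g x"
    and B: "continuous_on S B" "\<And>n x. x \<in> S \<Longrightarrow> \<bar>F n x\<bar> \<le> B x" "\<And>n x. x \<in> S \<Longrightarrow> \<bar>G n x\<bar> \<le> B x"
  shows "is_weak_partial S e f g"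
proof -
  have li: "locally_integrable S f"
    if F: "\<And>n. locally_integrable S (F n)" and lim: "\<And>x. x \<in> S \<Longrightarrow> (\<lambda>n. F n x) \<longlonglongrightarrow> f x"
      and b: "\<And>n x. x \<in> S \<Longrightarrow> \<bar>F n x\<bar> \<le> B x" for F :: "nat \<Rightarrow> 'a \<Rightarrow> real" and f
    unfolding locally_integrable_def set_integrable_def real_scaleR_def
  proof (intro allI impI)
    fix K assume K: "compact K \<and> K \<subseteq> S"
    have Fi: "integrable lebesgue (\<lambda>x. indicator K x * F n x)" for n
      using K F by (intro locally_integrableD) auto
    have l: "(\<lambda>n. indicator K x * F n x) \<longlonglongrightarrow> indicator K x * f x" for x
      using lim[of x] K by (cases "x \<in> K") (auto intro: tendsto_mult_left)
    show "integrable lebesgue (\<lambda>x. indicator K x * f x)"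
    proof (rule integrable_dominated_convergence[where s = "\<lambda>n x. indicator K x * F n x" and w = "\<lambda>x. indicator K x * B x"])
      show "(\<lambda>x. indicator K x * f x) \<in> borel_measurable lebesgue"
        by (rule borel_measurable_LIMSEQ_real[OF l borel_measurable_integrable[OF Fi]])
      show "integrable lebesgue (\<lambda>x. indicator K x * B x)"
        using K by (intro locally_integrableD[OF continuous_locally_integrable[OF B(1)]]) auto
      show "AE x in lebesgue. norm (indicator K x * F n x) \<le> indicator K x * B x" for n
        using b[of _ n] K by (intro AE_I2) (auto simp: indicator_def)
    qed (use l Fi in auto)
  qed
  have lis: "locally_integrable S f" "locally_integrable S g"
    by (rule li[OF is_weak_partialD(1)[OF w] lim(1) B(2)] li[OF is_weak_partialD(2)[OF w] lim(2) B(3)]; assumption)+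
  have conv: "(\<lambda>n. LINT x|lebesgue_on S. F n x * h x) \<longlonglongrightarrow> (LINT x|lebesgue_on S. f x * h x)"
    if F: "\<And>n. locally_integrable S (F n)" and f: "locally_integrable S f"
      and lim: "\<And>x. x \<in> S \<Longrightarrow> (\<lambda>n. F n x) \<longlonglongrightarrow> f x"
      and b: "\<And>n x. x \<in> S \<Longrightarrow> \<bar>F n x\<bar> \<le> B x"
      and h: "continuous_on S h" "\<And>x. x \<in> S - K \<Longrightarrow> h x = 0" and K: "compact K" "K \<subseteq> S"
    for F :: "nat \<Rightarrow> 'a \<Rightarrow> real" and f h K
  proof (rule integral_dominated_convergence[where w = "\<lambda>x. B x * \<bar>h x\<bar>"])
    show "(\<lambda>x. f x * h x) \<in> borel_measurable (lebesgue_on S)"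
      using integrable_times_compact[OF f S K h] by auto
    show "(\<lambda>x. F n x * h x) \<in> borel_measurable (lebesgue_on S)" for n
      using integrable_times_compact[OF F S K h] by auto
    show "integrable (lebesgue_on S) (\<lambda>x. B x * \<bar>h x\<bar>)"
      using h by (intro integrable_times_compact[OF continuous_locally_integrable[OF B(1)] S K]) (auto intro: continuous_intros)
    show "AE x in lebesgue_on S. (\<lambda>n. F n x * h x) \<longlonglongrightarrow> f x * h x"
      using lim by (intro AE_I2) (auto intro: tendsto_mult_right)
    show "AE x in lebesgue_on S. norm (F n x * h x) \<le> B x * \<bar>h x\<bar>" for n
      using b[of _ n] by (intro AE_I2) (auto simp: abs_mult intro: mult_right_mono)
  qed
  show ?thesis
    unfolding is_weak_partial_def
  proof (intro conjI allI impI lis)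
    fix \<phi> :: "'a \<Rightarrow> real" assume \<phi>: "test_fun S \<phi>"
    note d = test_fun_C1_deriv[OF \<phi>]
  obtain K where s: "compact K" "K \<subseteq> S" "\<And>x. x \<notin> K \<Longrightarrow> \<phi> x = 0"
    using test_fun_support[OF \<phi>] by metis
    have cont: "continuous_on S \<phi>" "continuous_on S (\<lambda>x. frechet_derivative \<phi> (at x) e)"
      using continuous_on_subset[OF C1_deriv_continuous[OF d]] continuous_on_subset[OF C1_deriv_contD[OF d, of e]]
      by auto
    have "(\<lambda>n. LINT x|lebesgue_on S. F n x * frechet_derivative \<phi> (at x) e)
        \<longlonglongrightarrow> (LINT x|lebesgue_on S. f x * frechet_derivative \<phi> (at x) e)"
      by (rule conv[OF is_weak_partialD(1)[OF w] lis(1) lim(1) B(2) cont(2) _ s(1,2)])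
        (use deriv_zero_off_compact[OF d s(1,3)] in auto)
    moreover have "(\<lambda>n. - (LINT x|lebesgue_on S. G n x * \<phi> x)) \<longlonglongrightarrow> - (LINT x|lebesgue_on S. g x * \<phi> x)"
      by (rule tendsto_minus, rule conv[OF is_weak_partialD(2)[OF w] lis(2) lim(2) B(3) cont(1) _ s(1,2)])
        (use s(3) in auto)
    moreover have "(LINT x|lebesgue_on S. F n x * frechet_derivative \<phi> (at x) e) = - (LINT x|lebesgue_on S. G n x * \<phi> x)" for n
      by (rule is_weak_partialD(3)[OF w \<phi> S])
    ultimately show "(LINT x:S|lebesgue. f x * frechet_derivative \<phi> (at x) e) = - (LINT x:S|lebesgue. g x * \<phi> x)"
      using S LIMSEQ_unique by (simp add: set_integral_lebesgue_on)
  qed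
qed

section \<open>Square integrable functions\<close>

lemma L2D: "L2 S f \<Longrightarrow> f \<in> borel_measurable (lebesgue_on S)" "L2 S f \<Longrightarrow> integrable (lebesgue_on S) (\<lambda>x. (f x)\<^sup>2)"
  by (auto simp: L2_def)

lemma L2_mult_integrable:
  assumes "L2 S f" "L2 S g"
  shows "integrable (lebesgue_on S) (\<lambda>x. f x * g x)"
proof (rule Bochner_Integration.integrable_bound)
  show "integrable (lebesgue_on S) (\<lambda>x. (f x)\<^sup>2 + (g x)\<^sup>2)" using assms by (intro Bochner_Integration.integrable_add L2D)
  show "(\<lambda>x. f x * g x) \<in> borel_measurable (lebesgue_on S)" using assms by (intro borel_measurable_times L2D)
  show "AE x in lebesgue_on S. norm (f x * g x) \<le> norm ((f x)\<^sup>2 + (g x)\<^sup>2)"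
  proof (intro AE_I2)
    fix x
    have "2 * (\<bar>f x\<bar> * \<bar>g x\<bar>) \<le> (f x)\<^sup>2 + (g x)\<^sup>2"
      using sum_squares_bound[of "\<bar>f x\<bar>" "\<bar>g x\<bar>"] by simp
    moreover have "0 \<le> \<bar>f x\<bar> * \<bar>g x\<bar>" by simp
    ultimately have "\<bar>f x\<bar> * \<bar>g x\<bar> \<le> (f x)\<^sup>2 + (g x)\<^sup>2" by linarith
    then show "norm (f x * g x) \<le> norm ((f x)\<^sup>2 + (g x)\<^sup>2)"
      by (simp add: abs_mult)
  qed
qed

lemma L2_lincomb:
  assumes "L2 S f" "L2 S g"
  shows "L2 S (\<lambda>x. a * f x + b * g x)"
  unfolding L2_def
proof
  show "(\<lambda>x. a * f x + b * g x) \<in> borel_measurable (lebesgue_on S)"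
    using assms by (intro borel_measurable_add borel_measurable_times borel_measurable_const L2D)
  have "integrable (lebesgue_on S) (\<lambda>x. a\<^sup>2 * (f x)\<^sup>2 + b\<^sup>2 * (g x)\<^sup>2 + 2 * a * b * (f x * g x))"
    using assms by (intro Bochner_Integration.integrable_add integrable_mult_right L2D L2_mult_integrable)
  then show "integrable (lebesgue_on S) (\<lambda>x. (a * f x + b * g x)\<^sup>2)"
    by (simp add: power2_eq_square algebra_simps)
qed

lemma borel_measurable_lebesgue_on_AE:
  fixes f g :: "'a::euclidean_space \<Rightarrow> real"
  assumes "open S" "f \<in> borel_measurable (lebesgue_on S)" "AE x in lebesgue_on S. f x = g x"
  shows "g \<in> borel_measurable (lebesgue_on S)"
proof -
  have "(\<lambda>x. if x \<in> S then f x else 0) \<in> borel_measurable lebesgue"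
    using assms by (intro borel_measurable_if_I) auto
  moreover have "AE x in lebesgue. (if x \<in> S then f x else 0) = (if x \<in> S then g x else 0)"
    using assms(1,3) by (auto simp: AE_restrict_space_iff)
  ultimately have "(\<lambda>x. if x \<in> S then g x else 0) \<in> borel_measurable lebesgue"
    by (rule borel_measurable_AE)
  then show ?thesis by (rule borel_measurable_if_D)
qed

lemma L2_AE:
  fixes f g :: "'a::euclidean_space \<Rightarrow> real"
  assumes "open S" "L2 S f" "AE x in lebesgue_on S. f x = g x"
  shows "L2 S g"
proof -
  have g: "g \<in> borel_measurable (lebesgue_on S)"
    by (rule borel_measurable_lebesgue_on_AE[OF assms(1) L2D(1)[OF assms(2)] assms(3)])
  moreover have "integrable (lebesgue_on S) (\<lambda>x. (f x)\<^sup>2) \<longleftrightarrow> integrable (lebesgue_on S) (\<lambda>x. (g x)\<^sup>2)"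
    using assms(3) by (intro integrable_cong_AE borel_measurable_power g L2D(1)[OF assms(2)]) (auto elim: eventually_mono)
  ultimately show ?thesis using L2D(2)[OF assms(2)] by (simp add: L2_def)
qed

lemma lebesgue_on_const_integrable:
  assumes "bounded S" "open S"
  shows "integrable (lebesgue_on S) (\<lambda>_. c :: real)"
proof -
  have "S \<in> lmeasurable" using assms by (simp add: bounded_set_imp_lmeasurable)
  then have "finite_measure (lebesgue_on S)"
    by (simp add: finite_measure_lebesgue_on)
  then show ?thesis by (simp add: finite_measure.integrable_const)
qed

lemma L2_bounded:
  fixes f :: "'a::euclidean_space \<Rightarrow> real"
  assumes "bounded S" "open S" "f \<in> borel_measurable (lebesgue_on S)" "\<And>x. x \<in> S \<Longrightarrow> \<bar>f x\<bar> \<le> C"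
  shows "L2 S f"
  unfolding L2_def
proof
  show "integrable (lebesgue_on S) (\<lambda>x. (f x)\<^sup>2)"
  proof (rule Bochner_Integration.integrable_bound[OF lebesgue_on_const_integrable[OF assms(1,2), of "C\<^sup>2"]])
    show "AE x in lebesgue_on S. norm ((f x)\<^sup>2) \<le> norm (C\<^sup>2)"
      using assms(4) by (intro AE_I2) (auto intro: abs_le_square_iff[THEN iffD1] order_trans[OF _ abs_ge_self])
  qed (use assms(3) in auto)
qed (rule assms(3))

lemma L2_integrable:
  assumes "bounded S" "open S" "L2 S f"
  shows "integrable (lebesgue_on S) f"
proof -
  have "L2 S (\<lambda>_. 1)" by (rule L2_bounded[OF assms(1,2), of _ 1]) auto
  from L2_mult_integrable[OF assms(3) this] show ?thesis by simp
qed

lemma W12_weak_partial: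
  fixes f :: "'a::euclidean_space \<Rightarrow> real"
  assumes "W12 S f" "open S" "e \<in> Basis"
  shows "is_weak_partial S e f (weak_partial S e f)" "L2 S (weak_partial S e f)"
proof -
  obtain g where g: "is_weak_partial S e f g" "L2 S g" using assms by (auto simp: W12_def)
  show "is_weak_partial S e f (weak_partial S e f)" by (rule weak_partial_AE_eq[OF g(1) assms(2)])
  have "AE x in lebesgue_on S. weak_partial S e f x = g x" by (rule weak_partial_AE_eq[OF g(1) assms(2)])
  then show "L2 S (weak_partial S e f)"
    by (intro L2_AE[OF assms(2) g(2)]) (auto elim: eventually_mono)
qed

lemma W12_diff:
  fixes f g :: "'a::euclidean_space \<Rightarrow> real"
  assumes "W12 S f" "W12 S g" "open S"
  shows "W12 S (\<lambda>x. f x - g x)"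
  unfolding W12_def
proof (intro conjI ballI)
  show "L2 S (\<lambda>x. f x - g x)" using L2_lincomb[of S f g 1 "-1"] assms by (simp add: W12_def)
  fix e :: 'a assume e: "e \<in> Basis"
  note a = W12_weak_partial[OF assms(1,3) e] and b = W12_weak_partial[OF assms(2,3) e]
  show "\<exists>k. is_weak_partial S e (\<lambda>x. f x - g x) k \<and> L2 S k"
    using is_weak_partial_lincomb[OF a(1) b(1) assms(3), of 1 "-1"] L2_lincomb[OF a(2) b(2), of 1 "-1"] by auto
qed

section \<open>The Dirichlet energy\<close>

lemma partial_bound_min:
  assumes "partial_bound Q S u e \<phi>" "partial_bound Q S u e \<psi>" "open S"
  shows "partial_bound Q S u e (\<lambda>x. min (\<phi> x) (\<psi> x))"
  unfolding partial_bound_def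
proof (intro conjI ballI)
  have L: "L2 S \<phi>" "L2 S \<psi>" using assms by (auto simp: partial_bound_def)
  show "L2 S (\<lambda>x. min (\<phi> x) (\<psi> x))"
    unfolding L2_def
  proof
    show m: "(\<lambda>x. min (\<phi> x) (\<psi> x)) \<in> borel_measurable (lebesgue_on S)"
      using L by (intro borel_measurable_min L2D)
    show "integrable (lebesgue_on S) (\<lambda>x. (min (\<phi> x) (\<psi> x))\<^sup>2)"
      by (rule Bochner_Integration.integrable_bound[OF Bochner_Integration.integrable_add[OF L2D(2)[OF L(1)] L2D(2)[OF L(2)]]])
        (use m in \<open>auto simp: min_def\<close>)
  qed
  fix T :: "'b multiset" assume "T \<in> AQ Q"
  then have "AE x in lebesgue_on S. \<bar>weak_partial S e (\<lambda>x. qdist Q (u x) T) x\<bar> \<le> \<phi> x"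
    "AE x in lebesgue_on S. \<bar>weak_partial S e (\<lambda>x. qdist Q (u x) T) x\<bar> \<le> \<psi> x"
    using assms by (auto simp: partial_bound_def)
  then show "AE x in lebesgue_on S. \<bar>weak_partial S e (\<lambda>x. qdist Q (u x) T) x\<bar> \<le> min (\<phi> x) (\<psi> x)"
    by eventually_elim simp
qed

lemma AQ_nonempty: "qtup Q (\<lambda>_. c) \<in> AQ Q"
  by (simp add: AQ_def)

lemma partial_bound_nonneg:
  assumes "partial_bound Q S u e \<phi>"
  shows "AE x in lebesgue_on S. 0 \<le> \<phi> x"
proof -
  have "AE x in lebesgue_on S. \<bar>weak_partial S e (\<lambda>x. qdist Q (u x) (qtup Q (\<lambda>_. 0))) x\<bar> \<le> \<phi> x"
    using assms by (simp add: partial_bound_def AQ_nonempty)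
  then show ?thesis by eventually_elim linarith
qed

text \<open>The infimum of a sequence of bounds whose energies tend to the least possible energy.\<close>

lemma partial_bound_minimal_exists:
  assumes ex: "partial_bound Q S u e \<phi>0" and S: "open S"
  shows "\<exists>\<phi>. partial_bound Q S u e \<phi> \<and>
     (\<forall>\<psi>. partial_bound Q S u e \<psi> \<longrightarrow> (AE x in lebesgue_on S. \<phi> x \<le> \<psi> x))"
proof -
  let ?E = "\<lambda>\<phi>. (LINT x|lebesgue_on S. (\<phi> x)\<^sup>2) :: real"
  let ?B = "Collect (partial_bound Q S u e)"
  define I where "I = Inf (?E ` ?B)"
  have bdd: "bdd_below (?E ` ?B)" by (rule bdd_belowI[of _ 0]) auto
  have I_le: "I \<le> ?E \<phi>" if "partial_bound Q S u e \<phi>" for \<phi>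
    unfolding I_def using that by (intro cInf_lower[OF _ bdd]) auto
  have "\<exists>\<phi>. partial_bound Q S u e \<phi> \<and> ?E \<phi> < I + 1 / real (Suc n)" for n
  proof -
    have "Inf (?E ` ?B) < I + 1 / real (Suc n)" by (simp add: I_def)
    then show ?thesis using cInf_less_iff[OF _ bdd, of "I + 1 / real (Suc n)"] ex by auto
  qed
  then obtain \<phi> where \<phi>: "\<And>n. partial_bound Q S u e (\<phi> n)" "\<And>n. ?E (\<phi> n) < I + 1 / real (Suc n)"
    by metis
  \<comment> \<open>Each bound is nonnegative only almost everywhere; truncation at 0 keeps the
    pointwise infimum bounded below at every point.\<close>
  define \<Phi> where "\<Phi> x = (INF n. max 0 (\<phi> n x))" for x
  have bd: "bdd_below (range (\<lambda>n. max 0 (\<phi> n x)))" for x by (rule bdd_belowI[of _ 0]) auto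
  have \<Phi>_le: "\<Phi> x \<le> max 0 (\<phi> n x)" for n x unfolding \<Phi>_def by (intro cINF_lower bd) auto
  have \<Phi>_ge: "0 \<le> \<Phi> x" for x unfolding \<Phi>_def by (intro cINF_greatest) auto
  have L: "L2 S (\<phi> n)" for n using \<phi>(1) by (auto simp: partial_bound_def)
  have meas: "\<Phi> \<in> borel_measurable (lebesgue_on S)"
    unfolding \<Phi>_def using bd
    by (intro borel_measurable_cINF borel_measurable_max borel_measurable_const L2D(1)[OF L]) auto
  have sq: "(\<Phi> x)\<^sup>2 \<le> (\<phi> n x)\<^sup>2" for n x
  proof -
    have "\<bar>\<Phi> x\<bar> \<le> \<bar>\<phi> n x\<bar>" using \<Phi>_le[of x n] \<Phi>_ge[of x] by (auto simp: max_def split: if_splits)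
    then show ?thesis by (simp add: abs_le_square_iff)
  qed
  have int: "integrable (lebesgue_on S) (\<lambda>x. (\<Phi> x)\<^sup>2)"
    by (rule Bochner_Integration.integrable_bound[OF L2D(2)[OF L[of 0]]]) (use meas sq in auto)
  have bound: "partial_bound Q S u e \<Phi>"
    unfolding partial_bound_def
  proof (intro conjI ballI)
    show "L2 S \<Phi>" using meas int by (simp add: L2_def)
    fix T :: "'b multiset" assume T: "T \<in> AQ Q"
    have "AE x in lebesgue_on S. \<forall>n. \<bar>weak_partial S e (\<lambda>x. qdist Q (u x) T) x\<bar> \<le> \<phi> n x"
      unfolding AE_all_countable using \<phi>(1) T by (auto simp: partial_bound_def)
    then show "AE x in lebesgue_on S. \<bar>weak_partial S e (\<lambda>x. qdist Q (u x) T) x\<bar> \<le> \<Phi> x"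
    proof eventually_elim
      case (elim x)
      show ?case unfolding \<Phi>_def
        by (intro cINF_greatest) (use elim in \<open>auto simp: le_max_iff_disj\<close>)
    qed
  qed
  have EI: "?E \<Phi> \<le> I"
  proof (rule field_le_epsilon)
    fix d :: real assume "0 < d"
    then obtain n where n: "inverse (real (Suc n)) < d" using reals_Archimedean by blast
    have "?E \<Phi> \<le> ?E (\<phi> n)" using sq by (intro integral_mono int L2D(2)[OF L])
    then show "?E \<Phi> \<le> I + d" using \<phi>(2)[of n] n by (simp add: inverse_eq_divide)
  qed
  have "AE x in lebesgue_on S. \<Phi> x \<le> \<psi> x" if \<psi>: "partial_bound Q S u e \<psi>" for \<psi>
  proof -
    \<comment> \<open>If \<open>\<psi>\<close> were below \<open>\<Phi>\<close> on a set of positive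
      measure, the minimum of the two would be a bound with energy less than the infimum
      \<open>I\<close>.\<close>
    let ?m = "\<lambda>x. min (\<Phi> x) (\<psi> x)"
    have m: "partial_bound Q S u e ?m" by (rule partial_bound_min[OF bound \<psi> S])
    have im: "integrable (lebesgue_on S) (\<lambda>x. (?m x)\<^sup>2)" using m by (auto simp: partial_bound_def L2_def)
    have nn: "AE x in lebesgue_on S. 0 \<le> (\<Phi> x)\<^sup>2 - (?m x)\<^sup>2"
      using partial_bound_nonneg[OF \<psi>]
      by eventually_elim (auto intro!: power_mono simp: \<Phi>_ge)
    have "(LINT x|lebesgue_on S. (\<Phi> x)\<^sup>2 - (?m x)\<^sup>2) = ?E \<Phi> - ?E ?m" using int im by simp
    also have "\<dots> \<le> 0" using EI I_le[OF m] by linarith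
    finally have "(LINT x|lebesgue_on S. (\<Phi> x)\<^sup>2 - (?m x)\<^sup>2) = 0"
      using integral_nonneg_AE[OF nn] by linarith
    then have "AE x in lebesgue_on S. (\<Phi> x)\<^sup>2 - (?m x)\<^sup>2 = 0"
      using integral_nonneg_eq_0_iff_AE[OF Bochner_Integration.integrable_diff[OF int im] nn] by simp
    then show ?thesis using partial_bound_nonneg[OF \<psi>]
    proof eventually_elim
      case (elim x)
      then have "\<Phi> x = ?m x" using \<Phi>_ge[of x] power2_eq_iff_nonneg[of "\<Phi> x" "?m x"] by auto
      then show ?case by (simp add: min_def split: if_splits)
    qed
  qed
  then show ?thesis using bound by blast
qed

lemma partial_norm_props:
  assumes "W12Q Q S u" "open S" "e \<in> Basis"
  shows "partial_bound Q S u e (partial_norm Q S u e)"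
    "partial_bound Q S u e \<psi> \<Longrightarrow> AE x in lebesgue_on S. partial_norm Q S u e x \<le> \<psi> x"
proof -
  obtain \<phi>0 where "partial_bound Q S u e \<phi>0" using assms by (auto simp: W12Q_def)
  from someI_ex[OF partial_bound_minimal_exists[OF this assms(2)]]
  show "partial_bound Q S u e (partial_norm Q S u e)"
    "partial_bound Q S u e \<psi> \<Longrightarrow> AE x in lebesgue_on S. partial_norm Q S u e x \<le> \<psi> x"
    unfolding partial_norm_def by blast+
qed

lemma dirichlet_energy_ge:
  fixes S :: "'a::euclidean_space set"
  assumes v: "W12Q Q S v" and S: "open S" and T: "T \<in> AQ Q"
  shows "(LINT x|lebesgue_on S. (\<Sum>e\<in>Basis. (weak_partial S e (\<lambda>x. qdist Q (v x) T) x)\<^sup>2)) \<le> dirichlet_energy Q S v"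
  unfolding dirichlet_energy_def
proof (rule integral_mono_AE)
  have W: "W12 S (\<lambda>x. qdist Q (v x) T)" using v T by (simp add: W12Q_def)
  show "integrable (lebesgue_on S) (\<lambda>x. \<Sum>e\<in>Basis. (weak_partial S e (\<lambda>x. qdist Q (v x) T) x)\<^sup>2)"
    by (intro Bochner_Integration.integrable_sum L2D(2) W12_weak_partial(2)[OF W S])
  have pb: "partial_bound Q S v e (partial_norm Q S v e)" if "e \<in> Basis" for e
    by (rule partial_norm_props(1)[OF v S that])
  then show "integrable (lebesgue_on S) (\<lambda>x. \<Sum>e\<in>Basis. (partial_norm Q S v e x)\<^sup>2)"
    by (intro Bochner_Integration.integrable_sum L2D(2)) (auto simp: partial_bound_def)
  have "AE x in lebesgue_on S. \<forall>e\<in>Basis. \<bar>weak_partial S e (\<lambda>x. qdist Q (v x) T) x\<bar> \<le> partial_norm Q S v e x"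
    using pb T by (subst AE_ball_countable) (auto simp: countable_finite partial_bound_def)
  then show "AE x in lebesgue_on S. (\<Sum>e\<in>Basis. (weak_partial S e (\<lambda>x. qdist Q (v x) T) x)\<^sup>2)
      \<le> (\<Sum>e\<in>Basis. (partial_norm Q S v e x)\<^sup>2)"
  proof eventually_elim
    case (elim x)
    show ?case
    proof (rule sum_mono)
      fix e :: 'a assume "e \<in> Basis"
      then have "\<bar>weak_partial S e (\<lambda>x. qdist Q (v x) T) x\<bar> \<le> \<bar>partial_norm Q S v e x\<bar>"
        using elim by force
      then show "(weak_partial S e (\<lambda>x. qdist Q (v x) T) x)\<^sup>2 \<le> (partial_norm Q S v e x)\<^sup>2"
        by (simp add: abs_le_square_iff)
    qed
  qed
qed

section \<open>Multiples of a single real-valued function\<close>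

definition diag :: "nat \<Rightarrow> 'b::euclidean_space \<Rightarrow> real \<Rightarrow> 'b multiset" where
  "diag Q b t = qtup Q (\<lambda>_. t *\<^sub>R b)"

lemma diag_in_AQ [simp]: "diag Q b t \<in> AQ Q"
  by (simp add: diag_def AQ_nonempty)

text \<open>A constant tuple is unchanged by permutations, so the minimum over
  \<open>\<sigma>\<close> disappears.\<close>

lemma qdist_const: "qdist Q (qtup Q (\<lambda>_. p)) (qtup Q R) = sqrt (\<Sum>i<Q. (norm (p - R i))\<^sup>2)"
proof -
  have "(\<Sum>i<Q. (norm (p - R (\<sigma> i)))\<^sup>2) = (\<Sum>i<Q. (norm (p - R i))\<^sup>2)" if "\<sigma> permutes {..<Q}" for \<sigma>
    by (rule sum.reindex_bij_betw[OF permutes_imp_bij[OF that], of "\<lambda>i. (norm (p - R i))\<^sup>2"])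
  then have "(\<lambda>\<sigma>. sqrt (\<Sum>i<Q. (norm (p - R (\<sigma> i)))\<^sup>2)) ` {\<sigma>. \<sigma> permutes {..<Q}} = {sqrt (\<Sum>i<Q. (norm (p - R i))\<^sup>2)}"
    using permutes_id[of "{..<Q}"] by (auto intro!: image_eqI[of _ _ id])
  then show ?thesis by (simp add: qdist_qtup)
qed

text \<open>The distance from the tuple to any fixed \<open>T\<close> is thus the square root of a
  quadratic polynomial in \<open>t\<close>, which makes all the functions in the definition of the
  Sobolev space explicit.\<close>

lemma qdist_diag:
  assumes "norm b = 1"
  shows "qdist Q (diag Q b t) (qtup Q R)
    = sqrt (real Q * t\<^sup>2 - 2 * t * (\<Sum>i<Q. b \<bullet> R i) + (\<Sum>i<Q. (norm (R i))\<^sup>2))"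
proof -
  have "(norm (t *\<^sub>R b - R i))\<^sup>2 = t\<^sup>2 - 2 * t * (b \<bullet> R i) + (norm (R i))\<^sup>2" for i
    using assms unfolding power2_norm_eq_inner norm_eq_1
    by (simp add: inner_diff inner_commute algebra_simps power2_eq_square)
  then show ?thesis
    by (simp add: diag_def qdist_const sum.distrib sum_subtractf sum_distrib_left)
qed

lemma qdist_diag_diag:
  assumes "norm b = 1"
  shows "qdist Q (diag Q b t) (diag Q b s) = sqrt (real Q) * \<bar>t - s\<bar>"
  using assms
  by (simp add: diag_def qdist_const scaleR_diff_left[symmetric] real_sqrt_mult)

lemma qnorm2_diag: "norm b = 1 \<Longrightarrow> qnorm2 (diag Q b t) = real Q * t\<^sup>2"
  by (simp add: qnorm2_def diag_def qtup_mset image_mset.compositionality o_def sum_mset_constant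
      map_replicate_const power_mult_distrib flip: mset_map)

lemma open_vimage_diag:
  assumes b: "norm b = 1" and U: "openin (AQ_top Q) U"
  shows "open {t. diag Q b t \<in> U}"
proof (rule openI)
  interpret Metric_space "AQ Q" "qdist Q" by (rule Metric_space_AQ)
  fix t assume t: "t \<in> {t. diag Q b t \<in> U}"
  then obtain r where r: "r > 0" "mball (diag Q b t) r \<subseteq> U" using U by (auto simp: openin_mtopology)
  \<comment> \<open>The map is Lipschitz with constant sqrt Q; the summand 1 keeps the denominator
    positive for every \<open>Q\<close>.\<close>
  have "ball t (r / (sqrt (real Q) + 1)) \<subseteq> {t. diag Q b t \<in> U}"
  proof
    fix s assume s: "s \<in> ball t (r / (sqrt (real Q) + 1))"
    have "sqrt (real Q) * \<bar>t - s\<bar> \<le> (sqrt (real Q) + 1) * \<bar>t - s\<bar>" by (intro mult_right_mono) auto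
    also have "\<dots> < r"
      using s mult_strict_left_mono[of "\<bar>t - s\<bar>" "r / (sqrt (real Q) + 1)" "sqrt (real Q) + 1"]
      by (simp add: dist_real_def add_nonneg_pos add_nonneg_eq_0_iff)
    finally have "diag Q b s \<in> mball (diag Q b t) r" by (simp add: in_mball qdist_diag_diag[OF b])
    then show "s \<in> {t. diag Q b t \<in> U}" using r(2) by blast
  qed
  then show "\<exists>e>0. ball t e \<subseteq> {t. diag Q b t \<in> U}"
    using r(1) by (intro exI[of _ "r / (sqrt (real Q) + 1)"]) (auto simp: add_nonneg_pos)
qed

lemma diag_continuous_map:
  assumes "norm b = 1" "continuous_on S h"
  shows "continuous_map (top_of_set S) (AQ_top Q) (\<lambda>x. diag Q b (h x))"
proof -
  interpret Metric_space "AQ Q" "qdist Q" by (rule Metric_space_AQ)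
  show ?thesis
    unfolding continuous_map_def
  proof (intro conjI allI impI)
    fix U :: "'a multiset set" assume "openin mtopology U"
    then have "open {t. diag Q b t \<in> U}" by (rule open_vimage_diag[OF assms(1)])
    then have "openin (top_of_set S) (S \<inter> h -` {t. diag Q b t \<in> U})"
      by (rule continuous_openin_preimage_gen[OF assms(2)])
    moreover have "S \<inter> h -` {t. diag Q b t \<in> U} = {x \<in> topspace (top_of_set S). diag Q b (h x) \<in> U}" by auto
    ultimately show "openin (top_of_set S) {x \<in> topspace (top_of_set S). diag Q b (h x) \<in> U}" by simp
  qed simp
qed

lemma diag_measurable:
  assumes b: "norm b = 1" and h: "h \<in> borel_measurable M"
  shows "(\<lambda>x. diag Q b (h x)) \<in> M \<rightarrow>\<^sub>M AQ_borel Q"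
proof (rule measurable_measure_of)
  interpret Metric_space "AQ Q" "qdist Q" by (rule Metric_space_AQ)
  show "{U. openin mtopology U} \<subseteq> Pow (AQ Q)" using openin_subset by fastforce
  fix U :: "'a multiset set" assume "U \<in> {U. openin mtopology U}"
  then have "open {t. diag Q b t \<in> U}" using open_vimage_diag[OF b] by simp
  then have "h -` {t. diag Q b t \<in> U} \<inter> space M \<in> sets M"
    by (intro measurable_sets[OF h]) simp
  then show "(\<lambda>x. diag Q b (h x)) -` U \<inter> space M \<in> sets M" by (simp add: vimage_def)
qed auto

text \<open>The derivative of the square root of a nonnegative quadratic polynomial; at a zero of the
  polynomial the numerator vanishes as well, and the quotient is \<open>0\<close>.\<close>

definition dsqrt :: "real \<Rightarrow> real \<Rightarrow> real \<Rightarrow> real \<Rightarrow> real" where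
  "dsqrt c A B t = (c * t - A) / sqrt (c * t\<^sup>2 - 2 * t * A + B)"

context
  fixes c A B :: real
  assumes c: "0 < c" and AB: "A\<^sup>2 \<le> c * B"
begin

text \<open>The assumption on \<open>A\<close> and \<open>B\<close> says that the discriminant is
  not positive. In this form it gives nonnegativity of the polynomial and bounds the numerator of
  \<open>dsqrt\<close> by its denominator.\<close>

lemma quadratic_le: "(c * t - A)\<^sup>2 \<le> c * (c * t\<^sup>2 - 2 * t * A + B)"
  using AB by (simp add: power2_eq_square algebra_simps)

lemma quadratic_nonneg: "0 \<le> c * t\<^sup>2 - 2 * t * A + B"
  using order_trans[OF zero_le_power2 quadratic_le] c by (simp add: zero_le_mult_iff)

lemma dsqrt_le_aux:
  assumes "0 \<le> d"
  shows "\<bar>(c * t - A) / sqrt (c * t\<^sup>2 - 2 * t * A + B + d)\<bar> \<le> sqrt c"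
proof -
  let ?q = "c * t\<^sup>2 - 2 * t * A + B"
  have "\<bar>c * t - A\<bar> = sqrt ((c * t - A)\<^sup>2)" by simp
  also have "\<dots> \<le> sqrt (c * (?q + d))"
    using add_mono[OF quadratic_le[of t] mult_nonneg_nonneg[OF less_imp_le[OF c] assms]]
    by (intro real_sqrt_le_mono) (simp only: distrib_left add_0_right)
  also have "\<dots> = sqrt c * sqrt (?q + d)" by (rule real_sqrt_mult)
  finally have *: "\<bar>c * t - A\<bar> \<le> sqrt c * sqrt (?q + d)" .
  show ?thesis
  proof (cases "?q + d = 0")
    case True
    then show ?thesis using c by simp
  next
    case False
    then have "0 < ?q + d" using quadratic_nonneg[of t] assms by linarith
    then show ?thesis using * by (simp add: abs_divide divide_le_eq)
  qed
qed

lemma dsqrt_le: "\<bar>dsqrt c A B t\<bar> \<le> sqrt c"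
  using dsqrt_le_aux[of 0 t] by (simp add: dsqrt_def)

text \<open>Adding 1 / (n + 1) under the root yields continuously differentiable functions of
  \<open>h\<close> whose derivatives are bounded by \<open>sqrt c\<close> uniformly in
  \<open>n\<close>; the weak derivative survives the limit.\<close>

lemma weak_partial_sqrt_quadratic:
  fixes h :: "'a::euclidean_space \<Rightarrow> real"
  assumes S: "open S" and h: "C1_deriv S h h'"
  shows "is_weak_partial S e (\<lambda>x. sqrt (c * (h x)\<^sup>2 - 2 * h x * A + B)) (\<lambda>x. dsqrt c A B (h x) * h' x e)"
proof -
  let ?q = "\<lambda>t. c * t\<^sup>2 - 2 * t * A + B"
  let ?d = "\<lambda>n. 1 / real (Suc n)"
  have pos: "0 < ?q t + ?d n" for t n using quadratic_nonneg[of t] by (simp add: add_nonneg_pos)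
  have lim_d: "(\<lambda>n. ?q t + ?d n) \<longlonglongrightarrow> ?q t" for t
    using tendsto_add[OF tendsto_const LIMSEQ_inverse_real_of_nat, of "?q t"] by (simp add: inverse_eq_divide)
  show ?thesis
  proof (rule is_weak_partial_limit[OF S, where F = "\<lambda>n x. sqrt (?q (h x) + ?d n)"
        and G = "\<lambda>n x. (c * h x - A) / sqrt (?q (h x) + ?d n) * h' x e"
        and B = "\<lambda>x. sqrt (?q (h x)) + 1 + sqrt c * \<bar>h' x e\<bar>"])
    fix n
    have dr: "((\<lambda>t. sqrt (?q t + ?d n)) has_real_derivative (c * t - A) / sqrt (?q t + ?d n)) (at t)" for t
    proof -
      have "((\<lambda>t. ?q t + d) has_real_derivative 2 * (c * t - A)) (at t)" for d
        by (auto intro!: derivative_eq_intros)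
      from DERIV_chain2[OF DERIV_real_sqrt[OF pos] this]
      have "((\<lambda>t. sqrt (?q t + ?d n)) has_real_derivative
          inverse (sqrt (?q t + ?d n)) / 2 * (2 * (c * t - A))) (at t)" .
      moreover have "inverse X / 2 * (2 * y) = y / X" for X y :: real
        by (cases "X = 0") (auto simp: field_simps)
      ultimately show ?thesis by (simp only:)
    qed
    have cr: "continuous_on UNIV (\<lambda>t. (c * t - A) / sqrt (?q t + ?d n))"
      using less_imp_neq[OF pos] by (intro continuous_intros) (metis real_sqrt_eq_zero_cancel_iff)
    show "is_weak_partial S e (\<lambda>x. sqrt (?q (h x) + ?d n)) (\<lambda>x. (c * h x - A) / sqrt (?q (h x) + ?d n) * h' x e)"
      by (rule C1_is_weak_partial[OF S C1_deriv_compose[OF h dr cr]])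
  next
    fix x
    show "(\<lambda>n. sqrt (?q (h x) + ?d n)) \<longlonglongrightarrow> sqrt (?q (h x))"
      by (intro tendsto_real_sqrt lim_d)
    show "(\<lambda>n. (c * h x - A) / sqrt (?q (h x) + ?d n) * h' x e) \<longlonglongrightarrow> dsqrt c A B (h x) * h' x e"
    proof (cases "?q (h x) = 0")
      case True
      then have "c * h x - A = 0" using quadratic_le[of "h x"] by simp
      then show ?thesis unfolding dsqrt_def by simp
    next
      case False
      then show ?thesis
        unfolding dsqrt_def by (intro tendsto_intros tendsto_real_sqrt lim_d) simp
    qed
  next
    have "continuous_on S h" by (rule C1_deriv_continuous[OF h])
    then show "continuous_on S (\<lambda>x. sqrt (?q (h x)) + 1 + sqrt c * \<bar>h' x e\<bar>)"
      using C1_deriv_contD[OF h, of e] by (intro continuous_intros)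
    fix n x
    have "sqrt (?q (h x) + ?d n) \<le> sqrt (?q (h x)) + sqrt (?d n)"
      by (intro sqrt_add_le_add_sqrt quadratic_nonneg) simp
    also have "sqrt (?d n) \<le> 1" by simp
    finally have "sqrt (?q (h x) + ?d n) \<le> sqrt (?q (h x)) + 1" by simp
    moreover have "0 \<le> sqrt c * \<bar>h' x e\<bar>" using c by simp
    moreover have "0 \<le> sqrt (?q (h x) + ?d n)" using pos[of "h x" n] by simp
    ultimately show "\<bar>sqrt (?q (h x) + ?d n)\<bar> \<le> sqrt (?q (h x)) + 1 + sqrt c * \<bar>h' x e\<bar>" by linarith
    have "\<bar>(c * h x - A) / sqrt (?q (h x) + ?d n)\<bar> * \<bar>h' x e\<bar> \<le> sqrt c * \<bar>h' x e\<bar>"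
      by (intro mult_right_mono dsqrt_le_aux) auto
    moreover have "0 \<le> sqrt (?q (h x))" using quadratic_nonneg by simp
    ultimately show "\<bar>(c * h x - A) / sqrt (?q (h x) + ?d n) * h' x e\<bar> \<le> sqrt (?q (h x)) + 1 + sqrt c * \<bar>h' x e\<bar>"
      unfolding abs_mult by linarith
  qed
qed

end

text \<open>The Cauchy-Schwarz inequality, once for the sum and once for each inner product. It is
  the discriminant condition for the polynomial in \<open>qdist_diag\<close>.\<close>

lemma sum_inner_le:
  fixes R :: "nat \<Rightarrow> 'b::euclidean_space"
  assumes "norm b = 1"
  shows "(\<Sum>i<Q. b \<bullet> R i)\<^sup>2 \<le> real Q * (\<Sum>i<Q. (norm (R i))\<^sup>2)"
proof -
  have "(\<Sum>i<Q. b \<bullet> R i)\<^sup>2 \<le> real Q * (\<Sum>i<Q. (b \<bullet> R i)\<^sup>2)"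
    using sum_squared_le_sum_of_squares[of "\<lambda>i. b \<bullet> R i" "{..<Q}"] by (simp add: mult.commute)
  also have "\<dots> \<le> real Q * (\<Sum>i<Q. (norm (R i))\<^sup>2)"
  proof (intro mult_left_mono sum_mono)
    fix i
    have "\<bar>b \<bullet> R i\<bar> \<le> \<bar>norm (R i)\<bar>" using Cauchy_Schwarz_ineq2[of b "R i"] assms by simp
    then show "(b \<bullet> R i)\<^sup>2 \<le> (norm (R i))\<^sup>2" by (simp only: abs_le_square_iff)
  qed simp
  finally show ?thesis .
qed

text \<open>The bound 1 on \<open>h\<close> places the tuple \<open>diag Q b 2\<close> beyond all
  values of \<open>u\<close>, so that the distance to it is affine in \<open>h\<close>. The bound
  \<open>C\<close> makes the derivatives square integrable on the bounded set
  \<open>S\<close>.\<close>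

locale bounded_C1 =
  fixes S :: "'a::euclidean_space set" and h :: "'a \<Rightarrow> real" and h' C Q and b :: "'b::euclidean_space"
  assumes S: "open S" "bounded S" and h: "C1_deriv S h h'"
    and h_le: "\<And>x. x \<in> S \<Longrightarrow> \<bar>h x\<bar> \<le> 1" and h'_le: "\<And>x e. x \<in> S \<Longrightarrow> e \<in> Basis \<Longrightarrow> \<bar>h' x e\<bar> \<le> C"
    and Q: "0 < (Q :: nat)" and b: "norm b = 1"
begin

abbreviation "u \<equiv> \<lambda>x. diag Q b (h x)"

lemma measurable_cont: "continuous_on S k \<Longrightarrow> (k :: 'a \<Rightarrow> real) \<in> borel_measurable (lebesgue_on S)"
  using S by (intro continuous_imp_measurable_on_sets_lebesgue) auto

lemma L2_h': "e \<in> Basis \<Longrightarrow> L2 S (\<lambda>x. h' x e)"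
  using h h'_le by (intro L2_bounded[OF S(2,1)] measurable_cont C1_deriv_contD)

lemma qdist_u_weak:
  assumes "T \<in> AQ Q"
  obtains D where "\<And>t. \<bar>D t\<bar> \<le> sqrt (real Q)"
    "\<And>e. is_weak_partial S e (\<lambda>x. qdist Q (u x) T) (\<lambda>x. D (h x) * h' x e)"
    "D \<in> borel_measurable borel"
proof -
  obtain R where T: "T = qtup Q R" using assms by (auto simp: AQ_def)
  let ?A = "\<Sum>i<Q. b \<bullet> R i" and ?B = "\<Sum>i<Q. (norm (R i))\<^sup>2"
  have c: "0 < real Q" using Q by simp
  note AB = sum_inner_le[OF b, where R = R and Q = Q]
  show ?thesis
  proof (rule that[of "dsqrt (real Q) ?A ?B"])
    show "\<bar>dsqrt (real Q) ?A ?B t\<bar> \<le> sqrt (real Q)" for t by (rule dsqrt_le[OF c AB])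
    show "is_weak_partial S e (\<lambda>x. qdist Q (u x) T) (\<lambda>x. dsqrt (real Q) ?A ?B (h x) * h' x e)" for e
      unfolding T qdist_diag[OF b] by (rule weak_partial_sqrt_quadratic[OF c AB S(1) h])
    show "dsqrt (real Q) ?A ?B \<in> borel_measurable borel" unfolding dsqrt_def by measurable
  qed
qed

lemma qdist_u_L2:
  assumes "T \<in> AQ Q"
  shows "L2 S (\<lambda>x. qdist Q (u x) T)"
proof -
  obtain R where T: "T = qtup Q R" using assms by (auto simp: AQ_def)
  let ?A = "\<Sum>i<Q. b \<bullet> R i" and ?B = "\<Sum>i<Q. (norm (R i))\<^sup>2"
  show ?thesis unfolding T qdist_diag[OF b]
  proof (rule L2_bounded[OF S(2,1), where C = "sqrt (real Q + 2 * \<bar>?A\<bar> + ?B)"])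
    show "(\<lambda>x. sqrt (real Q * (h x)\<^sup>2 - 2 * h x * ?A + ?B)) \<in> borel_measurable (lebesgue_on S)"
      using C1_deriv_continuous[OF h] by (intro measurable_cont continuous_intros)
    fix x assume x: "x \<in> S"
    have "(h x)\<^sup>2 \<le> 1" using h_le[OF x] by (simp add: abs_square_le_1)
    then have 1: "real Q * (h x)\<^sup>2 \<le> real Q" using mult_left_mono[of "(h x)\<^sup>2" 1 "real Q"] by simp
    have "\<bar>h x * ?A\<bar> \<le> 1 * \<bar>?A\<bar>" unfolding abs_mult using h_le[OF x] by (intro mult_right_mono) auto
    then have 2: "- (2 * h x * ?A) \<le> 2 * \<bar>?A\<bar>" by (simp add: abs_le_iff)
    have "0 \<le> real Q * (h x)\<^sup>2 - 2 * h x * ?A + ?B"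
      by (rule quadratic_nonneg) (use Q sum_inner_le[OF b, where R = R and Q = Q] in auto)
    then show "\<bar>sqrt (real Q * (h x)\<^sup>2 - 2 * h x * ?A + ?B)\<bar> \<le> sqrt (real Q + 2 * \<bar>?A\<bar> + ?B)"
      using 1 2 by simp
  qed
qed

lemma qdist_u_W12:
  assumes "T \<in> AQ Q"
  shows "W12 S (\<lambda>x. qdist Q (u x) T)" "e \<in> Basis \<Longrightarrow>
    AE x in lebesgue_on S. \<bar>weak_partial S e (\<lambda>x. qdist Q (u x) T) x\<bar> \<le> sqrt (real Q) * \<bar>h' x e\<bar>"
proof -
  obtain D where D: "\<And>t. \<bar>D t\<bar> \<le> sqrt (real Q)"
    "\<And>e. is_weak_partial S e (\<lambda>x. qdist Q (u x) T) (\<lambda>x. D (h x) * h' x e)"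
    "D \<in> borel_measurable borel"
    using qdist_u_weak[OF assms] by metis
  have le: "\<bar>D (h x) * h' x e\<bar> \<le> sqrt (real Q) * \<bar>h' x e\<bar>" for x e
    unfolding abs_mult using D(1) by (intro mult_right_mono) auto
  show "W12 S (\<lambda>x. qdist Q (u x) T)"
    unfolding W12_def
  proof (intro conjI ballI qdist_u_L2[OF assms] exI)
    fix e :: 'a assume e: "e \<in> Basis"
    show "is_weak_partial S e (\<lambda>x. qdist Q (u x) T) (\<lambda>x. D (h x) * h' x e)" by (rule D(2))
    show "L2 S (\<lambda>x. D (h x) * h' x e)"
    proof (rule L2_bounded[OF S(2,1)])
      show "(\<lambda>x. D (h x) * h' x e) \<in> borel_measurable (lebesgue_on S)"
        using measurable_cont[OF C1_deriv_continuous[OF h]] measurable_cont[OF C1_deriv_contD[OF h]] D(3)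
        by (intro borel_measurable_times measurable_compose[OF _ D(3)]) auto
      fix x assume "x \<in> S"
      then show "\<bar>D (h x) * h' x e\<bar> \<le> sqrt (real Q) * C"
        using h'_le[OF _ e] by (intro order_trans[OF le] mult_left_mono) auto
    qed
  qed
  show "AE x in lebesgue_on S. \<bar>weak_partial S e (\<lambda>x. qdist Q (u x) T) x\<bar> \<le> sqrt (real Q) * \<bar>h' x e\<bar>"
    using weak_partial_AE_eq(2)[OF D(2)[of e] S(1)] by eventually_elim (simp add: le)
qed

lemma partial_bound_u: "e \<in> Basis \<Longrightarrow> partial_bound Q S u e (\<lambda>x. sqrt (real Q) * \<bar>h' x e\<bar>)"
  unfolding partial_bound_def
proof (intro conjI ballI qdist_u_W12(2))
  assume e: "e \<in> Basis"
  show "L2 S (\<lambda>x. sqrt (real Q) * \<bar>h' x e\<bar>)"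
  proof (rule L2_bounded[OF S(2,1)])
    show "(\<lambda>x. sqrt (real Q) * \<bar>h' x e\<bar>) \<in> borel_measurable (lebesgue_on S)"
      using C1_deriv_contD[OF h] by (intro measurable_cont continuous_intros)
    show "\<bar>sqrt (real Q) * \<bar>h' x e\<bar>\<bar> \<le> sqrt (real Q) * C" if "x \<in> S" for x
      using h'_le[OF that e] by (simp add: abs_mult mult_left_mono)
  qed
qed

lemma W12Q_u: "W12Q Q S u"
  unfolding W12Q_def
  using partial_bound_u qdist_u_W12(1) diag_measurable[OF b measurable_cont[OF C1_deriv_continuous[OF h]]]
  by blast

lemma qdist_u_pole: "x \<in> S \<Longrightarrow> qdist Q (u x) (diag Q b 2) = sqrt (real Q) * (2 - h x)"
  using h_le[of x] by (simp add: qdist_diag_diag[OF b] abs_le_iff)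

lemma weak_partial_pole:
  "AE x in lebesgue_on S. weak_partial S e (\<lambda>x. qdist Q (u x) (diag Q b 2)) x = - sqrt (real Q) * h' x e"
proof -
  have "C1_deriv S (\<lambda>x. qdist Q (u x) (diag Q b 2)) (\<lambda>x e. - sqrt (real Q) * h' x e)"
    unfolding C1_deriv_def
  proof (intro conjI ballI allI)
    fix x assume x: "x \<in> S"
    have "((\<lambda>x. sqrt (real Q) * (2 - h x)) has_derivative (\<lambda>e. - sqrt (real Q) * h' x e)) (at x)"
      by (rule has_derivative_eq_rhs[OF has_derivative_mult_right[OF has_derivative_diff[OF
            has_derivative_const C1_derivD[OF h x]]]]) simp
    then show "((\<lambda>x. qdist Q (u x) (diag Q b 2)) has_derivative (\<lambda>e. - sqrt (real Q) * h' x e)) (at x)"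
      by (rule has_derivative_transform_within_open[OF _ S(1) x]) (simp add: qdist_u_pole)
  next
    show "continuous_on S (\<lambda>x. - sqrt (real Q) * h' x e)" for e
      using C1_deriv_contD[OF h] by (intro continuous_intros)
  qed
  from weak_partial_AE_eq(2)[OF C1_is_weak_partial[OF S(1) this] S(1)] show ?thesis .
qed

text \<open>Every distance function has slope at most sqrt Q in \<open>h\<close>, which bounds the
  minimal function from above; the distance to \<open>diag Q b 2\<close> has slope exactly sqrt Q in
  modulus, which bounds it from below.\<close>

lemma partial_norm_u:
  assumes e: "e \<in> Basis"
  shows "AE x in lebesgue_on S. partial_norm Q S u e x = sqrt (real Q) * \<bar>h' x e\<bar>"
proof -
  have "AE x in lebesgue_on S. \<bar>weak_partial S e (\<lambda>x. qdist Q (u x) (diag Q b 2)) x\<bar> \<le> partial_norm Q S u e x"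
    using partial_norm_props(1)[OF W12Q_u S(1) e] by (auto simp: partial_bound_def)
  then show ?thesis
    using partial_norm_props(2)[OF W12Q_u S(1) e partial_bound_u[OF e]] weak_partial_pole[of e]
    by eventually_elim (simp add: abs_mult)
qed

lemma dirichlet_energy_u:
  "dirichlet_energy Q S u = real Q * (LINT x|lebesgue_on S. (\<Sum>e\<in>Basis. (h' x e)\<^sup>2))"
proof -
  have "AE x in lebesgue_on S. \<forall>e\<in>Basis. partial_norm Q S u e x = sqrt (real Q) * \<bar>h' x e\<bar>"
    using partial_norm_u by (subst AE_ball_countable) (auto simp: countable_finite)
  then have ae: "AE x in lebesgue_on S. (\<Sum>e\<in>Basis. (partial_norm Q S u e x)\<^sup>2) = real Q * (\<Sum>e\<in>Basis. (h' x e)\<^sup>2)"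
    by eventually_elim (simp add: power_mult_distrib sum_distrib_left)
  have "dirichlet_energy Q S u = (LINT x|lebesgue_on S. real Q * (\<Sum>e\<in>Basis. (h' x e)\<^sup>2))"
    unfolding dirichlet_energy_def
  proof (rule integral_cong_AE[OF _ _ ae])
    show "(\<lambda>x. \<Sum>e\<in>Basis. (partial_norm Q S u e x)\<^sup>2) \<in> borel_measurable (lebesgue_on S)"
      using partial_norm_props(1)[OF W12Q_u S(1)]
      by (intro borel_measurable_sum borel_measurable_power L2D(1)) (auto simp: partial_bound_def)
    show "(\<lambda>x. real Q * (\<Sum>e\<in>Basis. (h' x e)\<^sup>2)) \<in> borel_measurable (lebesgue_on S)"
      using C1_deriv_contD[OF h] by (intro measurable_cont continuous_intros)
  qed
  then show ?thesis by simp
qed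

end

section \<open>A cut-off function\<close>

definition pos2 :: "real \<Rightarrow> real" where "pos2 t = (max 0 t)\<^sup>2"

lemma pos2_deriv: "(pos2 has_real_derivative 2 * max 0 t) (at t)"
proof (cases t "0::real" rule: linorder_cases)
  case less
  then show ?thesis
    by (intro has_field_derivative_transform_within_open[of "\<lambda>_. 0" _ _ "{..<0}" pos2])
      (auto simp: pos2_def max_def)
next
  case greater
  have "((\<lambda>t. t\<^sup>2) has_real_derivative 2 * max 0 t) (at t)"
    using greater by (auto intro!: derivative_eq_intros simp: max_def)
  then show ?thesis
    by (rule has_field_derivative_transform_within_open[of _ _ _ "{0<..}"])
      (use greater in \<open>auto simp: pos2_def max_def\<close>)
next
  case equal
  have "((\<lambda>t. pos2 t / t) \<longlongrightarrow> 0) (at 0)"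
  proof (rule Lim_null_comparison[of _ "\<lambda>t. \<bar>t\<bar>"])
    show "\<forall>\<^sub>F t in at 0. norm (pos2 t / t) \<le> \<bar>t\<bar>"
      by (intro always_eventually) (auto simp: pos2_def max_def power2_eq_square)
    show "((\<lambda>t::real. \<bar>t\<bar>) \<longlongrightarrow> 0) (at 0)"
      by (rule tendsto_rabs_zero) (rule tendsto_ident_at)
  qed
  then have "(pos2 has_real_derivative 0) (at 0)" by (simp add: has_field_derivative_iff pos2_def)
  then show ?thesis using equal by simp
qed

text \<open>The quadratic spline that is 2 t^2 on [0, 1/2] and 1 - 2 (1 - t)^2 on [1/2, 1]: a
  continuously differentiable transition from 0 to 1 with slope at most 2.\<close>

definition step :: "real \<Rightarrow> real" where
  "step t = 2 * pos2 t - 4 * pos2 (t - 1 / 2) + 2 * pos2 (t - 1)"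

definition dstep :: "real \<Rightarrow> real" where
  "dstep t = 4 * max 0 t - 8 * max 0 (t - 1 / 2) + 4 * max 0 (t - 1)"

lemma step_deriv: "(step has_real_derivative dstep t) (at t)"
proof -
  have *: "((\<lambda>t. pos2 (t - a)) has_real_derivative 2 * max 0 (t - a)) (at t)" for a
  proof -
    have "((\<lambda>t. t - a) has_real_derivative 1) (at t)" by (auto intro!: derivative_eq_intros)
    from DERIV_chain2[OF pos2_deriv this] show ?thesis by simp
  qed
  have "((\<lambda>t. 2 * pos2 t - 4 * pos2 (t - 1 / 2) + 2 * pos2 (t - 1)) has_real_derivative
      2 * (2 * max 0 t) - 4 * (2 * max 0 (t - 1 / 2)) + 2 * (2 * max 0 (t - 1))) (at t)"
    by (intro DERIV_add DERIV_diff DERIV_cmult pos2_deriv *)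
  then show ?thesis unfolding step_def[abs_def] dstep_def by (simp add: mult.assoc)
qed

lemma continuous_dstep: "continuous_on S dstep"
  unfolding dstep_def[abs_def] by (intro continuous_intros)

lemma step_0: "t \<le> 0 \<Longrightarrow> step t = 0" and step_1: "1 \<le> t \<Longrightarrow> step t = 1"
  and dstep_0: "t \<le> 0 \<or> 1 \<le> t \<Longrightarrow> dstep t = 0" and dstep_le: "\<bar>dstep t\<bar> \<le> 2"
proof -
  show "t \<le> 0 \<Longrightarrow> step t = 0" by (simp add: step_def pos2_def max_def)
  show "1 \<le> t \<Longrightarrow> step t = 1"
    by (simp add: step_def pos2_def max_def power2_eq_square algebra_simps)
  show "t \<le> 0 \<or> 1 \<le> t \<Longrightarrow> dstep t = 0" by (auto simp: dstep_def max_def)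
  show "\<bar>dstep t\<bar> \<le> 2" by (auto simp: dstep_def max_def abs_le_iff)
qed

lemma step_bounds: "0 \<le> step t" "step t \<le> 1"
proof -
  have "0 \<le> step t \<and> step t \<le> 1"
  proof (cases "t \<le> 0 \<or> 1 \<le> t")
    case True
    then show ?thesis using step_0[of t] step_1[of t] by auto
  next
    case False
    show ?thesis
    proof (cases "t \<le> 1 / 2")
      case True
      then have s: "step t = 2 * t\<^sup>2" using False by (simp add: step_def pos2_def max_def)
      have "t\<^sup>2 \<le> (1 / 2)\<^sup>2" using True False by (intro power_mono) auto
      then have "2 * t\<^sup>2 \<le> 1" by (simp add: power2_eq_square)
      then show ?thesis unfolding s by simp
    next
      case f2: False
      then have s: "step t = 1 - 2 * (1 - t)\<^sup>2"
        using False by (simp add: step_def pos2_def max_def power2_eq_square algebra_simps)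
      have "(1 - t)\<^sup>2 \<le> (1 / 2)\<^sup>2" using f2 False by (intro power_mono) auto
      then have "2 * (1 - t)\<^sup>2 \<le> 1" by (simp add: power2_eq_square)
      then show ?thesis unfolding s by simp
    qed
  qed
  then show "0 \<le> step t" "step t \<le> 1" by auto
qed

section \<open>Boundary strips\<close>

text \<open>The error stands inside the product, and only errors up to \<open>e0\<close> are
  offered, because the covering argument below needs its surplus to be at most the width of the
  strip.\<close>

lemma ennreal_le_epsilon_mult:
  fixes a b c :: ennreal
  assumes "\<And>e. 0 < e \<Longrightarrow> e \<le> (e0::real) \<Longrightarrow> a \<le> c * (b + ennreal e)" "c < top" "0 < e0"
  shows "a \<le> c * b"
proof (rule ennreal_le_epsilon)
  fix e :: real assume e: "0 < e"
  obtain c' where c: "c = ennreal c'" "0 \<le> c'" using assms(2) by (cases c) auto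
  define e' where "e' = min e0 (e / (c' + 1))"
  have e': "0 < e'" "e' \<le> e0" "c' * e' \<le> e"
  proof -
    show "0 < e'" "e' \<le> e0" using e assms(3) c(2) by (auto simp: e'_def)
    have "c' * e' \<le> c' * (e / (c' + 1))" using c(2) by (intro mult_left_mono) (auto simp: e'_def)
    also have "\<dots> \<le> e" using c(2) e by (simp add: field_simps)
    finally show "c' * e' \<le> e" .
  qed
  have "a \<le> c * (b + ennreal e')" by (rule assms(1)[OF e'(1,2)])
  also have "\<dots> = c * b + ennreal (c' * e')"
    using c e' by (simp add: distrib_left ennreal_mult)
  also have "\<dots> \<le> c * b + ennreal e" using e'(3) by (intro add_left_mono ennreal_leI)
  finally show "a \<le> c * b + ennreal e" .
qed

text \<open>The boundary of \<open>S\<close> near \<open>x\<close> is the zero set of \<open>\<sigma>\<close>, and \<open>\<sigma>\<close> measures the distance to it along \<open>\<nu>\<close>.\<close>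

locale local_graph =
  fixes S :: "complex set" and \<sigma> :: "complex \<Rightarrow> real" and \<sigma>' \<nu> x r0
  assumes S: "open S" and \<nu>: "norm \<nu> = 1" and r0: "0 < r0" and \<sigma>: "C1_deriv UNIV \<sigma> \<sigma>'"
    and shift: "\<And>z t. \<sigma> (z + t *\<^sub>R \<nu>) = \<sigma> z + t"
    and graph: "\<And>z. z \<in> ball x r0 \<Longrightarrow> z \<in> S \<longleftrightarrow> 0 < \<sigma> z"
begin

definition strip :: "real \<Rightarrow> real \<Rightarrow> complex set" where
  "strip r \<epsilon> = {z \<in> cball x r. \<epsilon> \<le> \<sigma> z \<and> \<sigma> z \<le> 2 * \<epsilon>}"

text \<open>Projection onto the boundary along the fixed direction \<open>\<nu>\<close>; the
  displacement has signed length \<open>\<sigma> z\<close>.\<close>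

definition proj :: "complex \<Rightarrow> complex" where "proj z = z - \<sigma> z *\<^sub>R \<nu>"

lemma continuous_\<sigma>: "continuous_on A \<sigma>"
  using C1_deriv_continuous[OF \<sigma>] by (rule continuous_on_subset) simp

lemma continuous_proj: "continuous_on A proj"
  unfolding proj_def[abs_def] by (intro continuous_intros continuous_\<sigma>)

lemma proj_measurable [measurable]: "proj \<in> borel_measurable borel"
  by (rule borel_measurable_continuous_onI[OF continuous_proj])

lemma compact_strip: "compact (strip r \<epsilon>)"
proof -
  have "strip r \<epsilon> = cball x r \<inter> (\<sigma> -` {\<epsilon>..2 * \<epsilon>})" by (auto simp: strip_def)
  moreover have "closed (\<sigma> -` {\<epsilon>..2 * \<epsilon>})"
    by (rule continuous_closed_vimage[of _ \<sigma>])
      (use continuous_\<sigma>[of UNIV] in \<open>auto simp: continuous_on_eq_continuous_at\<close>)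
  ultimately show ?thesis by (simp add: compact_Int_closed)
qed

lemma \<sigma>_proj: "\<sigma> (proj z) = 0"
  using shift[of z "- \<sigma> z"] by (simp add: proj_def)

text \<open>The image is a zero of \<open>\<sigma>\<close>, hence outside \<open>S\<close>, but any
  small push along \<open>\<nu>\<close> leads into \<open>S\<close>. The bound on
  \<open>\<sigma> z\<close> keeps the image in the ball where the graph describes
  \<open>S\<close>.\<close>

lemma proj_in_frontier:
  assumes z: "z \<in> cball x r" "\<bar>\<sigma> z\<bar> < r0 - r"
  shows "proj z \<in> frontier S"
proof -
  have "dist x (proj z) \<le> dist x z + dist z (proj z)" by (rule dist_triangle)
  also have "dist z (proj z) = \<bar>\<sigma> z\<bar>" using \<nu> by (simp add: proj_def dist_norm)
  finally have b: "dist x (proj z) < r0" using z by auto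
  then have "proj z \<notin> S" using graph[of "proj z"] \<sigma>_proj by simp
  moreover have "proj z \<in> closure S"
    unfolding closure_approachable
  proof (intro allI impI)
    fix e :: real assume e: "0 < e"
    define t where "t = min (e / 2) ((r0 - dist x (proj z)) / 2)"
    have "t \<le> e / 2" "t \<le> (r0 - dist x (proj z)) / 2" by (simp_all only: t_def min.cobounded1 min.cobounded2)
    then have t: "0 < t" "t < e" "t < r0 - dist x (proj z)" using e b by (auto simp: t_def)
    have "dist x (proj z + t *\<^sub>R \<nu>) \<le> dist x (proj z) + dist (proj z) (proj z + t *\<^sub>R \<nu>)"
      by (rule dist_triangle)
    also have "dist (proj z) (proj z + t *\<^sub>R \<nu>) = t" using \<nu> t by (simp add: dist_norm)
    finally have "proj z + t *\<^sub>R \<nu> \<in> S"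
      using t graph[of "proj z + t *\<^sub>R \<nu>"] by (simp add: shift \<sigma>_proj)
    moreover have "dist (proj z + t *\<^sub>R \<nu>) (proj z) < e" using \<nu> t by (simp add: dist_norm)
    ultimately show "\<exists>y\<in>S. dist y (proj z) < e" by blast
  qed
  ultimately show ?thesis using S by (simp add: frontier_def interior_open)
qed

text \<open>Disjoint translates of the strip fit into a fixed ball.\<close>

lemma strip_area: "\<exists>C\<ge>0. \<forall>\<epsilon>. 0 < \<epsilon> \<and> \<epsilon> \<le> 1 / 6 \<longrightarrow> measure lebesgue (strip r \<epsilon>) \<le> C * \<epsilon>"
proof (intro exI conjI allI impI)
  let ?V = "measure lebesgue (cball x (r + 1))"
  show "0 \<le> 6 * ?V" by simp
  fix \<epsilon> :: real assume \<epsilon>: "0 < \<epsilon> \<and> \<epsilon> \<le> 1 / 6"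
  \<comment> \<open>Translates by multiples of 3 \<epsilon> are disjoint, as \<open>\<sigma>\<close>
    varies by at most \<epsilon> on the strip. \<open>M\<close> of them travel at most the distance
    1, and \<epsilon> \<le> 1/6 makes \<open>M\<close> at least 1 / (6 \<epsilon>), the origin of
    the factor 6.\<close>
  define M where "M = nat \<lfloor>1 / (3 * \<epsilon>)\<rfloor>"
  have M: "real M \<le> 1 / (3 * \<epsilon>)" "1 / (3 * \<epsilon>) - 1 < real M"
    using \<epsilon> by (auto simp: M_def)
  have "1 \<le> 1 / (6 * \<epsilon>)" using \<epsilon> by (simp add: field_simps)
  moreover have "1 / (3 * \<epsilon>) = 2 * (1 / (6 * \<epsilon>))" by simp
  ultimately have M6: "1 / (6 * \<epsilon>) \<le> real M" using M(2) by linarith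
  define T where "T j = (+) ((3 * real j * \<epsilon>) *\<^sub>R \<nu>) ` strip r \<epsilon>" for j
  have mstrip: "strip r \<epsilon> \<in> lmeasurable" using compact_strip by (rule lmeasurable_compact)
  have mT: "T j \<in> lmeasurable" for j unfolding T_def by (rule measurable_translation[OF mstrip])
  have sT: "3 * real j * \<epsilon> + \<epsilon> \<le> \<sigma> z \<and> \<sigma> z \<le> 3 * real j * \<epsilon> + 2 * \<epsilon>" if "z \<in> T j" for z j
    using that by (auto simp: T_def strip_def shift add.commute)
  have disj: "disjoint_family_on T {..<M}"
    unfolding disjoint_family_on_def
  proof (intro ballI impI)
    fix i j :: nat assume "i \<noteq> j"
    have "False" if "z \<in> T i" "z \<in> T j" "i < j" for z and i j :: nat
    proof -
      have "3 * (real i + 1) * \<epsilon> \<le> 3 * real j * \<epsilon>"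
        using \<epsilon> that(3) by (intro mult_right_mono) auto
      then show False using sT[OF that(1)] sT[OF that(2)] \<epsilon> by (simp add: algebra_simps)
    qed
    then show "T i \<inter> T j = {}" using \<open>i \<noteq> j\<close> by (metis disjoint_iff linorder_neqE_nat)
  qed
  have sub: "(\<Union>j<M. T j) \<subseteq> cball x (r + 1)"
  proof
    fix z assume "z \<in> (\<Union>j<M. T j)"
    then obtain j w where j: "j < M" and w: "w \<in> cball x r" and z: "z = (3 * real j * \<epsilon>) *\<^sub>R \<nu> + w"
      by (auto simp: T_def strip_def)
    have "3 * real j * \<epsilon> \<le> 3 * real M * \<epsilon>" using j \<epsilon> by (intro mult_right_mono) auto
    also have "\<dots> \<le> 1" using M(1) \<epsilon> by (simp add: field_simps)
    finally have "dist w z \<le> 1" using \<nu> \<epsilon> by (simp add: z dist_norm abs_mult)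
    then show "z \<in> cball x (r + 1)" using w dist_triangle[of x z w] by simp
  qed
  have "real M * measure lebesgue (strip r \<epsilon>) = (\<Sum>j<M. measure lebesgue (T j))"
    by (simp add: T_def measure_translation)
  also have "\<dots> = measure lebesgue (\<Union>j<M. T j)"
    using fmeasurableD[OF mT] fmeasurableD2[OF mT]
    by (intro measure_finite_Union[symmetric] disj) auto
  also have "\<dots> \<le> ?V"
    using fmeasurableD[OF mT] by (intro measure_mono_fmeasurable[OF sub] sets.finite_UN) auto
  finally have "1 / (6 * \<epsilon>) * measure lebesgue (strip r \<epsilon>) \<le> ?V"
    using mult_right_mono[OF M6, of "measure lebesgue (strip r \<epsilon>)"] by simp
  then show "measure lebesgue (strip r \<epsilon>) \<le> 6 * ?V * \<epsilon>" using \<epsilon> by (simp add: field_simps)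
qed

text \<open>A piece of the strip lying above a set of diameter \<open>d\<close> is covered by about \<open>\<epsilon> / d\<close> balls of radius \<open>2 d\<close>.\<close>

lemma strip_proj_cover:
  fixes U :: "complex set"
  assumes U: "bounded U" and d: "diameter U < d" and \<epsilon>: "0 < \<epsilon>"
  shows "\<exists>V. V \<in> sets borel \<and> {z. proj z \<in> U \<and> \<epsilon> \<le> \<sigma> z \<and> \<sigma> z \<le> 2 * \<epsilon>} \<subseteq> V \<and>
    emeasure lborel V \<le> ennreal (4 * pi * (\<epsilon> * d + d\<^sup>2))"
proof (cases "U = {}")
  case True
  then show ?thesis by (intro exI[of _ "{}"]) simp
next
  case False
  then obtain c where c: "c \<in> U" by blast
  have d0: "0 < d" using d diameter_ge_0[OF U] by linarith
  define m where "m = nat \<lfloor>\<epsilon> / d\<rfloor>"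
  have m: "real m \<le> \<epsilon> / d" using \<epsilon> d0 by (auto simp: m_def)
  let ?V = "\<Union>i\<le>m. cball (c + (\<epsilon> + real i * d) *\<^sub>R \<nu>) (2 * d)"
  have "{z. proj z \<in> U \<and> \<epsilon> \<le> \<sigma> z \<and> \<sigma> z \<le> 2 * \<epsilon>} \<subseteq> ?V"
  proof
    fix z assume "z \<in> {z. proj z \<in> U \<and> \<epsilon> \<le> \<sigma> z \<and> \<sigma> z \<le> 2 * \<epsilon>}"
    then have z: "proj z \<in> U" "\<epsilon> \<le> \<sigma> z" "\<sigma> z \<le> 2 * \<epsilon>" by auto
    define i where "i = nat \<lfloor>(\<sigma> z - \<epsilon>) / d\<rfloor>"
    have i: "real i \<le> (\<sigma> z - \<epsilon>) / d" "(\<sigma> z - \<epsilon>) / d < real i + 1"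
      using z(2) d0 by (auto simp: i_def)
    have "\<lfloor>(\<sigma> z - \<epsilon>) / d\<rfloor> \<le> \<lfloor>\<epsilon> / d\<rfloor>"
      using z(3) d0 by (intro floor_mono divide_right_mono) auto
    then have im: "i \<le> m" by (simp add: i_def m_def nat_mono)
    have e: "\<bar>\<epsilon> + real i * d - \<sigma> z\<bar> \<le> d" using i d0 by (simp add: field_simps abs_le_iff)
    \<comment> \<open>The distance to the centre has a part between boundary points, at most the
      diameter of \<open>U\<close>, and a part along \<open>\<nu>\<close>, at most one step
      \<open>d\<close>; hence the radius 2 d.\<close>
    have "c + (\<epsilon> + real i * d) *\<^sub>R \<nu> - z = (c - proj z) + (\<epsilon> + real i * d - \<sigma> z) *\<^sub>R \<nu>"
      by (simp add: proj_def algebra_simps)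
    then have "norm (c + (\<epsilon> + real i * d) *\<^sub>R \<nu> - z) \<le> norm (c - proj z) + norm ((\<epsilon> + real i * d - \<sigma> z) *\<^sub>R \<nu>)"
      by (metis norm_triangle_ineq)
    also have "norm (c - proj z) \<le> d"
      using diameter_bounded_bound[OF U c z(1)] d by (simp add: dist_norm)
    also have "norm ((\<epsilon> + real i * d - \<sigma> z) *\<^sub>R \<nu>) \<le> d" using \<nu> e by simp
    finally have "z \<in> cball (c + (\<epsilon> + real i * d) *\<^sub>R \<nu>) (2 * d)" by (simp add: dist_norm)
    then show "z \<in> ?V" using im by blast
  qed
  moreover have "emeasure lborel ?V \<le> ennreal (4 * pi * (\<epsilon> * d + d\<^sup>2))"
  proof -
    have "emeasure lborel ?V \<le> (\<Sum>i\<le>m. emeasure lborel (cball (c + (\<epsilon> + real i * d) *\<^sub>R \<nu>) (2 * d)))"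
      by (rule emeasure_subadditive_finite) auto
    also have "\<dots> = (\<Sum>i\<le>m. ennreal (pi * (2 * d)\<^sup>2))"
      using d0 by (simp add: emeasure_cball DIM_complex unit_ball_vol_2 del: emeasure_lborel_cball_finite)
    also have "\<dots> = ennreal (\<Sum>i\<le>m. pi * (2 * d)\<^sup>2)"
      by (rule sum_ennreal) auto
    also have "\<dots> = ennreal ((real m + 1) * (pi * (2 * d)\<^sup>2))" by (simp add: add.commute)
    also have "\<dots> \<le> ennreal ((\<epsilon> / d + 1) * (pi * (2 * d)\<^sup>2))"
      using m by (intro ennreal_leI mult_right_mono) auto
    also have "(\<epsilon> / d + 1) * (pi * (2 * d)\<^sup>2) = 4 * pi * (\<epsilon> * d + d\<^sup>2)"
      using d0 by (simp add: field_simps power2_eq_square)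
    finally show ?thesis .
  qed
  ultimately show ?thesis by (intro exI[of _ ?V]) auto
qed

text \<open>A member of a cover of \<open>B\<close> accounts for a piece of the strip of area at
  most 4 pi (\<epsilon> d + d^2). As d \<le> 2 \<epsilon>, this is at most 12 pi \<epsilon> d, and
  summation compares area with the one-dimensional premeasure at scale \<epsilon>.\<close>

lemma strip_proj_measure:
  assumes \<epsilon>: "0 < \<epsilon>" and B: "B \<in> sets borel"
  shows "emeasure lborel (strip r \<epsilon> \<inter> proj -` B) \<le> ennreal (12 * pi * \<epsilon>) * hausdorff_outer 1 B"
proof -
  have "emeasure lborel (strip r \<epsilon> \<inter> proj -` B) \<le> ennreal (12 * pi * \<epsilon>) * hausdorff_pre 1 \<epsilon> B"
  proof (cases "hausdorff_cover \<epsilon> B = {}")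
    case True
    then show ?thesis using \<epsilon> by (simp add: hausdorff_pre_def ennreal_mult_top)
  next
    case ne: False
    have le: "emeasure lborel (strip r \<epsilon> \<inter> proj -` B)
        \<le> ennreal (12 * pi * \<epsilon>) * ((\<Sum>j. ennreal (diameter (U j) powr 1)) + ennreal \<kappa>)"
      if U: "U \<in> hausdorff_cover \<epsilon> B" and \<kappa>: "0 < \<kappa>" "\<kappa> \<le> \<epsilon>" for U \<kappa>
    proof -
      \<comment> \<open>A surplus of total \<open>\<kappa>\<close> makes \<open>d j\<close> positive
        and strictly larger than the diameter, as the covering lemma asks.\<close>
      define d where "d j = diameter (U j) + \<kappa> * (1/2) ^ Suc j" for j
      have Ub: "bounded (U j)" "diameter (U j) < \<epsilon>" for j using U by (auto simp: hausdorff_cover_def)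
      have dg: "0 \<le> diameter (U j)" for j using Ub by (simp add: diameter_ge_0)
      have ke: "\<kappa> * (1/2) ^ Suc j \<le> \<epsilon> * 1" for j
        using \<kappa> power_le_one[of "1/2::real" "Suc j"] by (intro mult_mono) auto
      then have d: "diameter (U j) < d j" "0 < d j" "d j \<le> 2 * \<epsilon>" for j
      proof -
        have "0 < \<kappa> * (1/2) ^ Suc j" using \<kappa> by simp
        then show "diameter (U j) < d j" "0 < d j" using dg[of j] unfolding d_def by linarith+
        show "d j \<le> 2 * \<epsilon>" using Ub(2)[of j] ke[of j] unfolding d_def by linarith
      qed
      have "\<exists>V. V \<in> sets borel \<and> {z. proj z \<in> U j \<and> \<epsilon> \<le> \<sigma> z \<and> \<sigma> z \<le> 2 * \<epsilon>} \<subseteq> V \<and>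
          emeasure lborel V \<le> ennreal (4 * pi * (\<epsilon> * d j + (d j)\<^sup>2))" for j
        by (rule strip_proj_cover[OF Ub(1) d(1) \<epsilon>])
      then have "\<exists>V. \<forall>j. V j \<in> sets borel \<and> {z. proj z \<in> U j \<and> \<epsilon> \<le> \<sigma> z \<and> \<sigma> z \<le> 2 * \<epsilon>} \<subseteq> V j \<and>
          emeasure lborel (V j) \<le> ennreal (4 * pi * (\<epsilon> * d j + (d j)\<^sup>2))"
        by (intro choice allI)
      then obtain V where "\<forall>j. V j \<in> sets borel \<and> {z. proj z \<in> U j \<and> \<epsilon> \<le> \<sigma> z \<and> \<sigma> z \<le> 2 * \<epsilon>} \<subseteq> V j \<and>
          emeasure lborel (V j) \<le> ennreal (4 * pi * (\<epsilon> * d j + (d j)\<^sup>2))"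
        by (rule exE)
      then have V: "\<And>j. V j \<in> sets borel"
        "\<And>j. {z. proj z \<in> U j \<and> \<epsilon> \<le> \<sigma> z \<and> \<sigma> z \<le> 2 * \<epsilon>} \<subseteq> V j"
        "\<And>j. emeasure lborel (V j) \<le> ennreal (4 * pi * (\<epsilon> * d j + (d j)\<^sup>2))" by simp_all
      have "strip r \<epsilon> \<inter> proj -` B \<subseteq> (\<Union>j. V j)"
      proof
        fix z assume "z \<in> strip r \<epsilon> \<inter> proj -` B"
        then have z: "proj z \<in> B" "\<epsilon> \<le> \<sigma> z \<and> \<sigma> z \<le> 2 * \<epsilon>" by (auto simp: strip_def)
        then obtain j where "proj z \<in> U j" using U by (auto simp: hausdorff_cover_def)
        then show "z \<in> (\<Union>j. V j)" using V(2)[of j] z(2) by blast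
      qed
      then have "emeasure lborel (strip r \<epsilon> \<inter> proj -` B) \<le> emeasure lborel (\<Union>j. V j)"
        using V(1) by (intro emeasure_mono) auto
      also have "\<dots> \<le> (\<Sum>j. emeasure lborel (V j))"
        using V(1) by (intro emeasure_subadditive_countably) auto
      also have "\<dots> \<le> (\<Sum>j. ennreal (12 * pi * \<epsilon>) * (ennreal (diameter (U j) powr 1) + ennreal (\<kappa> * (1/2) ^ Suc j)))"
      proof (intro suminf_le)
        fix j
        have "(d j)\<^sup>2 \<le> 2 * \<epsilon> * d j"
          unfolding power2_eq_square using d[of j] by (intro mult_right_mono) auto
        then have "4 * pi * (\<epsilon> * d j + (d j)\<^sup>2) \<le> 4 * pi * (3 * \<epsilon> * d j)"
          by (intro mult_left_mono) auto
        also have "\<dots> = 12 * pi * \<epsilon> * d j" by simp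
        finally have "emeasure lborel (V j) \<le> ennreal (12 * pi * \<epsilon> * d j)"
          using V(3)[of j] by (meson ennreal_leI order_trans)
        also have "ennreal (12 * pi * \<epsilon> * d j) = ennreal (12 * pi * \<epsilon>) * (ennreal (diameter (U j)) + ennreal (\<kappa> * (1/2) ^ Suc j))"
          using \<epsilon> \<kappa> dg[of j] d(2)[of j] unfolding d_def
          by (subst ennreal_plus[symmetric]) (auto simp: ennreal_mult' simp del: power_Suc)
        finally show "emeasure lborel (V j) \<le> ennreal (12 * pi * \<epsilon>) * (ennreal (diameter (U j) powr 1) + ennreal (\<kappa> * (1/2) ^ Suc j))"
          using dg[of j] by simp
      qed auto
      also have "\<dots> = ennreal (12 * pi * \<epsilon>) * (\<Sum>j. ennreal (diameter (U j) powr 1) + ennreal (\<kappa> * (1/2) ^ Suc j))"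
        by (rule ennreal_suminf_cmult)
      also have "(\<Sum>j. ennreal (diameter (U j) powr 1) + ennreal (\<kappa> * (1/2) ^ Suc j))
          = (\<Sum>j. ennreal (diameter (U j) powr 1)) + (\<Sum>j. ennreal (\<kappa> * (1/2) ^ Suc j))"
        by (rule suminf_add[symmetric]) auto
      also have "(\<Sum>j. ennreal (\<kappa> * (1/2) ^ Suc j)) = ennreal \<kappa>"
        using \<kappa> sums_mult[OF power_half_series, of \<kappa>] by (intro suminf_ennreal_eq) auto
      finally show ?thesis .
    qed
    have "emeasure lborel (strip r \<epsilon> \<inter> proj -` B) \<le> ennreal (12 * pi * \<epsilon>) * (\<Sum>j. ennreal (diameter (U j) powr 1))"
      if "U \<in> hausdorff_cover \<epsilon> B" for U
      by (rule ennreal_le_epsilon_mult[OF le[OF that] _ \<epsilon>]) auto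
    then have leU: "emeasure lborel (strip r \<epsilon> \<inter> proj -` B) \<le> ennreal (12 * pi * \<epsilon>) * (\<Sum>j. ennreal (diameter (U j) powr 1))"
      if "U \<in> hausdorff_cover \<epsilon> B" for U using that .
    show ?thesis
    proof (cases "hausdorff_pre 1 \<epsilon> B = top")
      case True
      then show ?thesis using \<epsilon> by (simp add: ennreal_mult_top)
    next
      case fin: False
      show ?thesis
      proof (rule ennreal_le_epsilon_mult[OF _ _ \<epsilon>])
        fix e :: real assume "0 < e"
        then have "hausdorff_pre 1 \<epsilon> B < hausdorff_pre 1 \<epsilon> B + ennreal e"
          using fin ennreal_add_left_cancel_less[of "hausdorff_pre 1 \<epsilon> B" 0] by (simp add: less_top)
        then obtain U where U: "U \<in> hausdorff_cover \<epsilon> B"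
          "(\<Sum>j. ennreal (diameter (U j) powr 1)) < hausdorff_pre 1 \<epsilon> B + ennreal e"
          unfolding hausdorff_pre_def INF_less_iff by blast
        show "emeasure lborel (strip r \<epsilon> \<inter> proj -` B) \<le> ennreal (12 * pi * \<epsilon>) * (hausdorff_pre 1 \<epsilon> B + ennreal e)"
          by (rule order_trans[OF leU[OF U(1)] mult_left_mono[OF less_imp_le[OF U(2)]]]) simp
      qed simp
    qed
  qed
  also have "\<dots> \<le> ennreal (12 * pi * \<epsilon>) * hausdorff_outer 1 B"
    by (intro mult_left_mono hausdorff_pre_le_outer \<epsilon>) auto
  finally show ?thesis .
qed

text \<open>The estimate for sets is an inequality between two Borel measures, the image under
  \<open>proj\<close> of the area of the strip and a multiple of the Hausdorff measure; so it passes
  to integrals.\<close>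

lemma strip_proj_integral:
  assumes \<epsilon>: "0 < \<epsilon>" and g: "g \<in> borel_measurable borel"
  shows "(\<integral>\<^sup>+z. indicator (strip r \<epsilon>) z * g (proj z) \<partial>lborel)
    \<le> ennreal (12 * pi * \<epsilon>) * (\<integral>\<^sup>+z. g z \<partial>hausdorff_measure 1)"
proof -
  define \<mu> where "\<mu> = distr (density lborel (indicator (strip r \<epsilon>))) borel proj"
  have st: "strip r \<epsilon> \<in> sets borel" using compact_strip by (rule borel_compact)
  have "\<mu> \<le> scale_measure (ennreal (12 * pi * \<epsilon>)) (hausdorff_measure 1)"
  proof (subst le_measure)
    show "sets \<mu> = sets (scale_measure (ennreal (12 * pi * \<epsilon>)) (hausdorff_measure 1))" by (simp add: \<mu>_def)
    show "\<forall>A\<in>sets \<mu>. emeasure \<mu> A \<le> emeasure (scale_measure (ennreal (12 * pi * \<epsilon>)) (hausdorff_measure 1)) A"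
    proof
      fix B assume "B \<in> sets \<mu>"
      then have B: "B \<in> sets borel" by (simp add: \<mu>_def)
      have PB: "proj -` B \<in> sets borel" using measurable_sets[OF proj_measurable B] by simp
      have "emeasure \<mu> B = emeasure lborel (strip r \<epsilon> \<inter> proj -` B)"
        using B st PB by (simp add: \<mu>_def emeasure_distr emeasure_density indicator_inter_arith[symmetric])
      then show "emeasure \<mu> B \<le> emeasure (scale_measure (ennreal (12 * pi * \<epsilon>)) (hausdorff_measure 1)) B"
        using strip_proj_measure[OF \<epsilon> B] B by (simp add: emeasure_hausdorff_measure)
    qed
  qed
  then have "(\<integral>\<^sup>+z. g z \<partial>\<mu>) \<le> (\<integral>\<^sup>+z. g z \<partial>scale_measure (ennreal (12 * pi * \<epsilon>)) (hausdorff_measure 1))"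
    by (intro nn_integral_mono_measure) (simp add: \<mu>_def)
  also have "\<dots> = ennreal (12 * pi * \<epsilon>) * (\<integral>\<^sup>+z. g z \<partial>hausdorff_measure 1)"
    using g by (intro nn_integral_scale_measure) (simp add: measurable_def)
  also have "(\<integral>\<^sup>+z. g z \<partial>\<mu>) = (\<integral>\<^sup>+z. indicator (strip r \<epsilon>) z * g (proj z) \<partial>lborel)"
    using g st by (simp add: \<mu>_def nn_integral_distr nn_integral_density)
  finally show ?thesis .
qed

end

lemma L2_mult_bounded:
  fixes f m :: "'a::euclidean_space \<Rightarrow> real"
  assumes "bounded S" "open S" "L2 S f" "continuous_on S m" "\<And>x. x \<in> S \<Longrightarrow> \<bar>m x\<bar> \<le> M"
  shows "integrable (lebesgue_on S) (\<lambda>x. f x * m x)"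
  using assms
  by (intro L2_mult_integrable L2_bounded[of S m M] continuous_imp_measurable_on_sets_lebesgue) auto

text \<open>Turns smallness in mean square into smallness in mean, up to a free additive
  \<open>\<eta>\<close>.\<close>

lemma abs_le_AM_GM:
  fixes a \<eta> :: real
  assumes "0 < \<eta>"
  shows "\<bar>a\<bar> \<le> \<eta> + a\<^sup>2 / \<eta>"
proof -
  have "2 * \<bar>a\<bar> * \<eta> \<le> \<bar>a\<bar>\<^sup>2 + \<eta>\<^sup>2" by (rule sum_squares_bound)
  moreover have "0 \<le> \<bar>a\<bar> * \<eta>" using assms by simp
  ultimately have "\<bar>a\<bar> * \<eta> \<le> a\<^sup>2 + \<eta>\<^sup>2" by simp
  then show ?thesis using assms by (simp add: field_simps power2_eq_square)
qed

lemma C1_deriv_eq_0: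
  assumes "C1_deriv W \<phi> \<phi>'" "open U" "U \<subseteq> W" "\<And>z. z \<in> U \<Longrightarrow> \<phi> z = 0" "z \<in> U"
  shows "\<phi>' z e = 0"
proof -
  have "(\<phi> has_derivative (\<lambda>_. 0)) (at z)"
    by (rule has_derivative_transform_within_open[OF has_derivative_const assms(2,5)]) (use assms(4) in auto)
  moreover have "(\<phi> has_derivative \<phi>' z) (at z)" using assms by (intro C1_derivD[OF assms(1)]) auto
  ultimately show ?thesis by (metis has_derivative_unique)
qed

lemma continuous_on_compact_bound:
  fixes f :: "'a::metric_space \<Rightarrow> real"
  assumes "compact A" "continuous_on A f"
  obtains M where "0 \<le> M" "\<And>x. x \<in> A \<Longrightarrow> \<bar>f x\<bar> \<le> M"
proof -
  have "bounded (f ` A)" using assms by (intro compact_imp_bounded compact_continuous_image)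
  then obtain M where "\<And>x. x \<in> A \<Longrightarrow> \<bar>f x\<bar> \<le> M" by (auto simp: bounded_iff)
  then show ?thesis by (intro that[of "max M 0"]) (auto simp: le_max_iff_disj)
qed

section \<open>Integration by parts up to the boundary\<close>

context local_graph
begin

definition cut :: "real \<Rightarrow> complex \<Rightarrow> real" where "cut \<epsilon> z = step (\<sigma> z / \<epsilon> - 1)"
definition dcut :: "real \<Rightarrow> complex \<Rightarrow> complex \<Rightarrow> real" where "dcut \<epsilon> z e = dstep (\<sigma> z / \<epsilon> - 1) / \<epsilon> * \<sigma>' z e"

lemma cut_C1: "C1_deriv A (cut \<epsilon>) (dcut \<epsilon>)"
proof -
  have "((\<lambda>t. step (t / \<epsilon> - 1)) has_real_derivative dstep (t / \<epsilon> - 1) / \<epsilon>) (at t)" for t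
  proof -
    have "((\<lambda>t. t / \<epsilon> - 1) has_real_derivative 1 / \<epsilon>) (at t)" 
      using DERIV_diff[OF DERIV_cdivide[OF DERIV_ident, where c = \<epsilon>] DERIV_const[of 1]] by simp
    from DERIV_chain2[OF step_deriv this] show ?thesis by simp
  qed
  moreover have "continuous_on UNIV (\<lambda>t. dstep (t / \<epsilon> - 1) / \<epsilon>)"
    unfolding divide_inverse
    by (intro continuous_intros continuous_on_compose2[OF continuous_dstep[of UNIV]]) auto
  ultimately show ?thesis
    unfolding cut_def[abs_def] dcut_def[abs_def]
    by (rule C1_deriv_compose[OF C1_deriv_subset[OF \<sigma> subset_UNIV]])
qed

text \<open>On the strip \<open>K\<close> is within \<open>\<eta>\<close> of its value at the
  projected boundary point. That value is at most \<eta> plus its square over \<eta>, and the square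
  is compared with the boundary integral.\<close>

lemma strip_integral:
  assumes K: "continuous_on (closure S) K" and \<eta>: "0 < \<eta>" and j: "0 \<le> j"
    and J: "(\<integral>\<^sup>+z\<in>frontier S. ennreal ((K z)\<^sup>2) \<partial>hausdorff_measure 1) \<le> ennreal j"
    and \<epsilon>: "0 < \<epsilon>" "2 * \<epsilon> < r0 - r"
    and close: "\<And>z w. z \<in> closure S \<Longrightarrow> w \<in> closure S \<Longrightarrow> dist z w \<le> 2 * \<epsilon> \<Longrightarrow> \<bar>K z - K w\<bar> \<le> \<eta>"
  shows "(LINT z|lborel. indicator (strip r \<epsilon>) z * \<bar>K z\<bar>)
     \<le> 2 * \<eta> * measure lebesgue (strip r \<epsilon>) + 12 * pi * \<epsilon> * j / \<eta>"
proof (rule integral_real_bounded)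
  let ?A = "strip r \<epsilon>"
  show "0 \<le> 2 * \<eta> * measure lebesgue ?A + 12 * pi * \<epsilon> * j / \<eta>"
    using \<eta> j \<epsilon> by (intro add_nonneg_nonneg divide_nonneg_pos mult_nonneg_nonneg) auto
  have A: "?A \<in> sets borel" using compact_strip by (rule borel_compact)
  define g where "g z = ennreal (indicator (frontier S) z * (K z)\<^sup>2)" for z
  have "(\<lambda>z. indicator (frontier S) z *\<^sub>R (K z)\<^sup>2) \<in> borel_measurable borel"
    using K by (intro borel_measurable_continuous_on_indicator continuous_intros continuous_on_subset[OF K])
      (auto simp: frontier_def)
  then have g: "g \<in> borel_measurable borel" unfolding g_def by simp
  have pt: "ennreal (indicator ?A z * \<bar>K z\<bar>) \<le> ennreal (2 * \<eta>) * indicator ?A z + ennreal (1 / \<eta>) * (indicator ?A z * g (proj z))" for z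
  proof (cases "z \<in> ?A")
    case True
    then have z: "z \<in> cball x r" "\<epsilon> \<le> \<sigma> z" "\<sigma> z \<le> 2 * \<epsilon>" by (auto simp: strip_def)
    have "r < r0" using \<epsilon> by linarith
    then have zS: "z \<in> S" using z \<epsilon> graph[of z] by auto
    have fr: "proj z \<in> frontier S" using z \<epsilon> by (intro proj_in_frontier[of z r]) auto
    have "dist z (proj z) = \<bar>\<sigma> z\<bar>" using \<nu> by (simp add: proj_def dist_norm)
    then have "\<bar>K z - K (proj z)\<bar> \<le> \<eta>"
      using zS fr z \<epsilon> closure_subset[of S] by (intro close) (auto simp: frontier_def)
    then have "\<bar>K z\<bar> \<le> 2 * \<eta> + 1 / \<eta> * (K (proj z))\<^sup>2"
      using abs_le_AM_GM[OF \<eta>, of "K (proj z)"] by simp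
    then have "ennreal \<bar>K z\<bar> \<le> ennreal (2 * \<eta>) + ennreal (1 / \<eta>) * ennreal ((K (proj z))\<^sup>2)"
      using \<eta> by (simp add: ennreal_plus[symmetric] ennreal_mult[symmetric] ennreal_leI del: ennreal_plus)
    then show ?thesis using True fr by (simp add: g_def)
  qed simp
  have "(\<integral>\<^sup>+z. ennreal (indicator ?A z * \<bar>K z\<bar>) \<partial>lborel)
      \<le> (\<integral>\<^sup>+z. ennreal (2 * \<eta>) * indicator ?A z + ennreal (1 / \<eta>) * (indicator ?A z * g (proj z)) \<partial>lborel)"
    by (intro nn_integral_mono pt)
  also have "\<dots> = ennreal (2 * \<eta>) * emeasure lborel ?A + ennreal (1 / \<eta>) * (\<integral>\<^sup>+z. indicator ?A z * g (proj z) \<partial>lborel)"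
    using A measurable_compose[OF proj_measurable g]
    by (subst nn_integral_add) (auto simp: nn_integral_cmult)
  also have "\<dots> \<le> ennreal (2 * \<eta>) * emeasure lborel ?A + ennreal (1 / \<eta>) * (ennreal (12 * pi * \<epsilon>) * ennreal j)"
  proof (intro add_left_mono mult_left_mono)
    have "(\<integral>\<^sup>+z. indicator ?A z * g (proj z) \<partial>lborel) \<le> ennreal (12 * pi * \<epsilon>) * (\<integral>\<^sup>+z. g z \<partial>hausdorff_measure 1)"
      by (rule strip_proj_integral[OF \<epsilon>(1) g])
    also have "(\<integral>\<^sup>+z. g z \<partial>hausdorff_measure 1) = (\<integral>\<^sup>+z\<in>frontier S. ennreal ((K z)\<^sup>2) \<partial>hausdorff_measure 1)"
      by (intro nn_integral_cong) (auto simp: g_def indicator_def)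
    also have "ennreal (12 * pi * \<epsilon>) * \<dots> \<le> ennreal (12 * pi * \<epsilon>) * ennreal j" by (rule mult_left_mono[OF J]) simp
    finally show "(\<integral>\<^sup>+z. indicator ?A z * g (proj z) \<partial>lborel) \<le> ennreal (12 * pi * \<epsilon>) * ennreal j" .
  qed simp
  also have "emeasure lborel ?A = ennreal (measure lebesgue ?A)"
    using A emeasure_bounded_finite[OF compact_imp_bounded[OF compact_strip[of r \<epsilon>]]]
    by (subst emeasure_eq_ennreal_measure) (simp_all add: measure_completion less_top)
  finally show "(\<integral>\<^sup>+z. ennreal (indicator ?A z * \<bar>K z\<bar>) \<partial>lborel)
      \<le> ennreal (2 * \<eta> * measure lebesgue ?A + 12 * pi * \<epsilon> * j / \<eta>)"
    using \<eta> j \<epsilon> by (simp add: ennreal_mult[symmetric] ennreal_plus[symmetric] mult_ac del: ennreal_plus)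
qed

text \<open>The left side is the boundary term of an integration by parts. The function \<phi> is
  multiplied by a cut-off that is 0 up to height \<epsilon> and 1 from height 2 \<epsilon> on; what
  remains is the derivative of the cut-off, of size 1/\<epsilon> on a strip of area of order
  \<epsilon>. \<open>C\<close> is chosen before \<open>K\<close>, so the estimate can be used along
  a sequence with boundary values tending to 0.\<close>

lemma graph_estimate:
  assumes bdd: "bounded S" and W: "closure S \<subseteq> W" "open W"
    and \<phi>: "C1_deriv W \<phi> \<phi>'" and r: "r < r0" and \<phi>0: "\<And>z. z \<in> W - cball x r \<Longrightarrow> \<phi> z = 0"
  shows "\<exists>C\<ge>0. \<forall>K k \<eta> j. continuous_on (closure S) K \<and> is_weak_partial S e K k \<and> L2 S K \<and> L2 S k \<and> 0 < \<eta> \<and> 0 \<le> j \<and>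
    (\<integral>\<^sup>+z\<in>frontier S. ennreal ((K z)\<^sup>2) \<partial>hausdorff_measure 1) \<le> ennreal j \<longrightarrow>
    \<bar>LINT z|lebesgue_on S. K z * \<phi>' z e + k z * \<phi> z\<bar> \<le> C * (\<eta> + j / \<eta>)"
proof -
  have cS: "compact (closure S)" using bdd by (simp add: compact_closure)
  have SW: "S \<subseteq> W" using W closure_subset by blast
  have c\<phi>: "continuous_on W \<phi>" "continuous_on W (\<lambda>z. \<phi>' z e)"
    using \<phi> by (auto intro: C1_deriv_continuous C1_deriv_contD)
  obtain M where M: "0 \<le> M" "\<And>z. z \<in> closure S \<Longrightarrow> \<bar>\<phi> z\<bar> \<le> M"
    using continuous_on_compact_bound[OF cS continuous_on_subset[OF c\<phi>(1) W(1)]] by metis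
  obtain M' where M': "0 \<le> M'" "\<And>z. z \<in> closure S \<Longrightarrow> \<bar>\<phi>' z e\<bar> \<le> M'"
    using continuous_on_compact_bound[OF cS continuous_on_subset[OF c\<phi>(2) W(1)]] by metis
  obtain N where N: "0 \<le> N" "\<And>z. z \<in> cball x r \<Longrightarrow> \<bar>\<sigma>' z e\<bar> \<le> N"
    using continuous_on_compact_bound[OF compact_cball continuous_on_subset[OF C1_deriv_contD[OF \<sigma>] subset_UNIV], of x r e]
    by metis
  obtain C1 where C1: "0 \<le> C1" "\<And>\<epsilon>. 0 < \<epsilon> \<and> \<epsilon> \<le> 1 / 6 \<Longrightarrow> measure lebesgue (strip r \<epsilon>) \<le> C1 * \<epsilon>"
    using strip_area[of r] by metis
  have clS: "z \<in> S \<Longrightarrow> z \<in> closure S" for z using closure_subset by blast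
  have op: "open (S - cball x r)" using S by auto
  have \<phi>'0: "\<phi>' z e = 0" if "z \<in> S - cball x r" for z
    by (rule C1_deriv_eq_0[OF \<phi> op _ _ that]) (use SW \<phi>0 in auto)
  define C where "C = 2 * M * N * (2 * C1 + 12 * pi)"
  show ?thesis
  proof (intro exI[of _ C] conjI allI impI)
    show "0 \<le> C" using M(1) N(1) C1(1) by (simp add: C_def)
    fix K k :: "complex \<Rightarrow> real" and \<eta> j :: real
    assume H: "continuous_on (closure S) K \<and> is_weak_partial S e K k \<and> L2 S K \<and> L2 S k \<and> 0 < \<eta> \<and> 0 \<le> j \<and>
      (\<integral>\<^sup>+z\<in>frontier S. ennreal ((K z)\<^sup>2) \<partial>hausdorff_measure 1) \<le> ennreal j"
    then have K: "continuous_on (closure S) K" and wk: "is_weak_partial S e K k" and L: "L2 S K" "L2 S k"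
      and \<eta>: "0 < \<eta>" and j: "0 \<le> j"
      and J: "(\<integral>\<^sup>+z\<in>frontier S. ennreal ((K z)\<^sup>2) \<partial>hausdorff_measure 1) \<le> ennreal j" by auto
    have "uniformly_continuous_on (closure S) K" by (rule compact_uniformly_continuous[OF K cS])
    then obtain d where d: "d > 0" "\<And>z w. z \<in> closure S \<Longrightarrow> w \<in> closure S \<Longrightarrow> dist w z < d \<Longrightarrow> dist (K w) (K z) < \<eta>"
      using \<eta> unfolding uniformly_continuous_on_def by metis
    \<comment> \<open>The three entries serve the area bound, the continuity of \<open>K\<close>
      over distances 2 \<epsilon>, and the condition that projections stay in the ball of radius
      \<open>r0\<close>.\<close>
    define \<epsilon>1 where "\<epsilon>1 = min (1 / 6) (min (d / 4) ((r0 - r) / 4))"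
    have \<epsilon>1: "0 < \<epsilon>1" "\<epsilon>1 \<le> 1 / 6" "4 * \<epsilon>1 \<le> d" "4 * \<epsilon>1 \<le> r0 - r"
      using d(1) r by (auto simp: \<epsilon>1_def min_def)
    let ?F = "\<lambda>\<epsilon> z. (K z * \<phi>' z e + k z * \<phi> z) * cut \<epsilon> z"
    have cc: "continuous_on S (cut \<epsilon>)" for \<epsilon> by (rule C1_deriv_continuous[OF cut_C1])
    have cutb: "\<bar>cut \<epsilon> z\<bar> \<le> 1" for \<epsilon> z using step_bounds by (simp add: cut_def)
    have c\<phi>S: "continuous_on S \<phi>" "continuous_on S (\<lambda>z. \<phi>' z e)"
      using c\<phi> SW by (auto intro: continuous_on_subset)
    have bnd: "\<bar>LINT z|lebesgue_on S. ?F \<epsilon> z\<bar> \<le> C * (\<eta> + j / \<eta>)" if \<epsilon>: "0 < \<epsilon>" "\<epsilon> \<le> \<epsilon>1" for \<epsilon>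
    proof -
      have \<psi>: "C1_deriv S (\<lambda>z. \<phi> z * cut \<epsilon> z) (\<lambda>z e. \<phi> z * dcut \<epsilon> z e + \<phi>' z e * cut \<epsilon> z)"
        by (rule C1_deriv_mult[OF C1_deriv_subset[OF \<phi> SW] cut_C1])
      let ?K = "{z \<in> cball x r. \<epsilon> \<le> \<sigma> z}"
      have "?K = cball x r \<inter> \<sigma> -` {\<epsilon>..}" by auto
      moreover have "closed (\<sigma> -` {\<epsilon>..})"
        by (rule continuous_closed_vimage[of _ \<sigma>])
          (use continuous_\<sigma>[of UNIV] in \<open>auto simp: continuous_on_eq_continuous_at\<close>)
      ultimately have Kc: "compact ?K" by (simp add: compact_Int_closed)
      have KS: "?K \<subseteq> S" using r \<epsilon> graph by auto
      have K0: "\<phi> z * cut \<epsilon> z = 0" if "z \<in> S - ?K" for z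
      proof (cases "z \<in> cball x r")
        case True
        then have "\<sigma> z / \<epsilon> - 1 \<le> 0" using that \<epsilon> by auto
        then show ?thesis by (simp add: cut_def step_0)
      qed (use that SW \<phi>0 in auto)
      have dc: "\<bar>dcut \<epsilon> z e\<bar> \<le> 2 * N / \<epsilon>" if "z \<in> cball x r" for z
      proof -
        have "\<bar>dcut \<epsilon> z e\<bar> = \<bar>dstep (\<sigma> z / \<epsilon> - 1)\<bar> * \<bar>\<sigma>' z e\<bar> / \<epsilon>"
          using \<epsilon> by (simp add: dcut_def abs_mult)
        also have "\<dots> \<le> 2 * N / \<epsilon>"
          using dstep_le N(2)[OF that] \<epsilon> by (intro divide_right_mono mult_mono) auto
        finally show ?thesis .
      qed
      have \<phi>dc: "\<bar>\<phi> z * dcut \<epsilon> z e\<bar> \<le> 2 * M * N / \<epsilon> * indicator (strip r \<epsilon>) z" if z: "z \<in> S" for z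
      proof (cases "z \<in> strip r \<epsilon>")
        case True
        have "\<bar>\<phi> z\<bar> * \<bar>dcut \<epsilon> z e\<bar> \<le> M * (2 * N / \<epsilon>)"
          using M(2)[OF clS[OF z]] True M(1) by (intro mult_mono dc) (auto simp: strip_def)
        then show ?thesis using True by (simp add: abs_mult mult_ac)
      next
        case False
        have "\<phi> z * dcut \<epsilon> z e = 0"
        proof (cases "z \<in> cball x r")
          case True
          then have "\<sigma> z < \<epsilon> \<or> 2 * \<epsilon> < \<sigma> z" using False by (auto simp: strip_def)
          then have "\<sigma> z / \<epsilon> - 1 \<le> 0 \<or> 1 \<le> \<sigma> z / \<epsilon> - 1" using \<epsilon> by (auto simp: field_simps)
          then show ?thesis by (simp add: dcut_def dstep_0)
        qed (use z SW \<phi>0 in auto)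
        then show ?thesis using False by simp
      qed
      have "(LINT z:S|lebesgue. K z * (\<phi> z * dcut \<epsilon> z e + \<phi>' z e * cut \<epsilon> z)) = - (LINT z:S|lebesgue. k z * (\<phi> z * cut \<epsilon> z))"
        by (rule weak_partial_C1_test[OF wk S \<psi> Kc KS K0])
      then have eq: "(LINT z|lebesgue_on S. K z * (\<phi> z * dcut \<epsilon> z e + \<phi>' z e * cut \<epsilon> z)) = - (LINT z|lebesgue_on S. k z * (\<phi> z * cut \<epsilon> z))"
        by (simp add: set_integral_lebesgue_on[OF S])
      have i1: "integrable (lebesgue_on S) (\<lambda>z. K z * (\<phi> z * dcut \<epsilon> z e))"
      proof (rule L2_mult_bounded[OF bdd S L(1)])
        show "continuous_on S (\<lambda>z. \<phi> z * dcut \<epsilon> z e)"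
          by (intro continuous_on_mult c\<phi>S C1_deriv_contD[OF cut_C1])
        show "\<bar>\<phi> z * dcut \<epsilon> z e\<bar> \<le> 2 * M * N / \<epsilon>" if "z \<in> S" for z
          using \<phi>dc[OF that] M(1) N(1) \<epsilon>(1) by (auto simp: indicator_def split: if_splits intro: order_trans)
      qed
      have i2: "integrable (lebesgue_on S) (\<lambda>z. K z * (\<phi>' z e * cut \<epsilon> z))"
      proof (rule L2_mult_bounded[OF bdd S L(1)])
        show "\<bar>\<phi>' z e * cut \<epsilon> z\<bar> \<le> M' * 1" if "z \<in> S" for z
          unfolding abs_mult by (intro mult_mono M' cutb clS that) auto
      qed (intro continuous_on_mult c\<phi>S cc)
      have i3: "integrable (lebesgue_on S) (\<lambda>z. k z * (\<phi> z * cut \<epsilon> z))"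
      proof (rule L2_mult_bounded[OF bdd S L(2)])
        show "\<bar>\<phi> z * cut \<epsilon> z\<bar> \<le> M * 1" if "z \<in> S" for z
          unfolding abs_mult by (intro mult_mono M cutb clS that) auto
      qed (intro continuous_on_mult c\<phi>S cc)
      have i4: "integrable lborel (\<lambda>z. indicator (strip r \<epsilon>) z * \<bar>K z\<bar>)"
      proof -
        have "strip r \<epsilon> \<subseteq> S" using r \<epsilon> graph by (auto simp: strip_def)
        then have "continuous_on (strip r \<epsilon>) (\<lambda>z. \<bar>K z\<bar>)"
          using clS by (intro continuous_intros continuous_on_subset[OF K]) auto
        from borel_integrable_compact[OF compact_strip this] show ?thesis by simp
      qed
      have "(LINT z|lebesgue_on S. ?F \<epsilon> z) = (LINT z|lebesgue_on S. K z * (\<phi>' z e * cut \<epsilon> z) + k z * (\<phi> z * cut \<epsilon> z))"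
        by (simp add: algebra_simps)
      also have "\<dots> = (LINT z|lebesgue_on S. K z * (\<phi>' z e * cut \<epsilon> z)) + (LINT z|lebesgue_on S. k z * (\<phi> z * cut \<epsilon> z))"
        using i2 i3 by simp
      also have "\<dots> = - (LINT z|lebesgue_on S. K z * (\<phi> z * dcut \<epsilon> z e))"
        using eq i1 i2 by (simp add: distrib_left)
      finally have "\<bar>LINT z|lebesgue_on S. ?F \<epsilon> z\<bar> = \<bar>LINT z|lebesgue_on S. K z * (\<phi> z * dcut \<epsilon> z e)\<bar>" by simp
      also have "\<dots> \<le> (LINT z|lebesgue_on S. \<bar>K z * (\<phi> z * dcut \<epsilon> z e)\<bar>)" by (rule integral_abs_bound)
      also have "\<dots> = (LINT z|lebesgue. indicator S z *\<^sub>R \<bar>K z * (\<phi> z * dcut \<epsilon> z e)\<bar>)"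
        using S by (simp add: integral_restrict_space)
      also have "\<dots> \<le> (LINT z|lebesgue. 2 * M * N / \<epsilon> * (indicator (strip r \<epsilon>) z * \<bar>K z\<bar>))"
      proof (rule integral_mono)
        show "integrable lebesgue (\<lambda>z. indicator S z *\<^sub>R \<bar>K z * (\<phi> z * dcut \<epsilon> z e)\<bar>)"
          using integrable_abs[OF i1] S by (simp add: integrable_restrict_space)
        show "integrable lebesgue (\<lambda>z. 2 * M * N / \<epsilon> * (indicator (strip r \<epsilon>) z * \<bar>K z\<bar>))"
          using i4 by (subst integrable_completion) auto
        fix z
        have nn: "0 \<le> 2 * M * N / \<epsilon> * (indicator (strip r \<epsilon>) z * \<bar>K z\<bar>)" using M(1) N(1) \<epsilon>(1) by simp
        show "indicator S z *\<^sub>R \<bar>K z * (\<phi> z * dcut \<epsilon> z e)\<bar> \<le> 2 * M * N / \<epsilon> * (indicator (strip r \<epsilon>) z * \<bar>K z\<bar>)"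
        proof (cases "z \<in> S")
          case True
          have "\<bar>K z\<bar> * \<bar>\<phi> z * dcut \<epsilon> z e\<bar> \<le> \<bar>K z\<bar> * (2 * M * N / \<epsilon> * indicator (strip r \<epsilon>) z)"
            by (intro mult_left_mono \<phi>dc[OF True]) simp
          then show ?thesis using True by (simp add: abs_mult mult_ac)
        qed (use nn in simp)
      qed
      also have "\<dots> = 2 * M * N / \<epsilon> * (LINT z|lborel. indicator (strip r \<epsilon>) z * \<bar>K z\<bar>)"
        using i4 by (subst integral_completion) auto
      also have "\<dots> \<le> 2 * M * N / \<epsilon> * (2 * \<eta> * measure lebesgue (strip r \<epsilon>) + 12 * pi * \<epsilon> * j / \<eta>)"
      proof (intro mult_left_mono strip_integral[OF K \<eta> j J])
        show "2 * \<epsilon> < r0 - r" using \<epsilon> \<epsilon>1 by linarith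
        fix z w assume zw: "z \<in> closure S" "w \<in> closure S" "dist z w \<le> 2 * \<epsilon>"
        then have "dist w z < d" using \<epsilon> \<epsilon>1 by (simp add: dist_commute)
        from d(2)[OF zw(1,2) this] show "\<bar>K z - K w\<bar> \<le> \<eta>" by (simp add: dist_real_def abs_minus_commute)
      qed (use M(1) N(1) \<epsilon> in auto)
      also have "\<dots> \<le> 2 * M * N / \<epsilon> * (2 * \<eta> * (C1 * \<epsilon>) + 12 * pi * \<epsilon> * j / \<eta>)"
        using C1(2)[of \<epsilon>] M(1) N(1) \<epsilon> \<epsilon>1 \<eta> by (intro mult_left_mono add_right_mono) auto
      also have "\<dots> = 2 * M * N * (2 * C1 * \<eta> + 12 * pi * (j / \<eta>))"
        using \<epsilon> by (simp add: field_simps)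
      also have "\<dots> \<le> 2 * M * N * ((2 * C1 + 12 * pi) * (\<eta> + j / \<eta>))"
      proof (intro mult_left_mono)
        have "0 \<le> 12 * pi * \<eta>" "0 \<le> 2 * C1 * (j / \<eta>)" using \<eta> j C1(1) by auto
        then show "2 * C1 * \<eta> + 12 * pi * (j / \<eta>) \<le> (2 * C1 + 12 * pi) * (\<eta> + j / \<eta>)"
          by (simp add: algebra_simps)
      qed (use M(1) N(1) in auto)
      finally show ?thesis by (simp add: C_def mult.assoc)
    qed
    define \<epsilon> where "\<epsilon> n = \<epsilon>1 / real (Suc n)" for n
    have \<epsilon>: "0 < \<epsilon> n" "\<epsilon> n \<le> \<epsilon>1" for n using \<epsilon>1(1) by (auto simp: \<epsilon>_def field_simps)
    have iF: "integrable (lebesgue_on S) (\<lambda>z. K z * \<phi>' z e + k z * \<phi> z)"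
      by (intro Bochner_Integration.integrable_add L2_mult_bounded[OF bdd S L(1), of _ M'] L2_mult_bounded[OF bdd S L(2), of _ M] c\<phi>S)
        (use M M' clS in auto)
    have "(\<lambda>n. LINT z|lebesgue_on S. ?F (\<epsilon> n) z) \<longlonglongrightarrow> (LINT z|lebesgue_on S. K z * \<phi>' z e + k z * \<phi> z)"
    proof (rule integral_dominated_convergence[where w = "\<lambda>z. \<bar>K z * \<phi>' z e + k z * \<phi> z\<bar>"])
      show "AE z in lebesgue_on S. (\<lambda>n. ?F (\<epsilon> n) z) \<longlonglongrightarrow> K z * \<phi>' z e + k z * \<phi> z"
      proof (intro AE_I2)
        fix z assume "z \<in> space (lebesgue_on S)"
        then have z: "z \<in> S" by simp
        show "(\<lambda>n. ?F (\<epsilon> n) z) \<longlonglongrightarrow> K z * \<phi>' z e + k z * \<phi> z"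
        proof (cases "z \<in> cball x r")
          case True
          then have pos: "0 < \<sigma> z" using z graph[of z] r by auto
          obtain N0 where N0: "2 * \<epsilon>1 / \<sigma> z < real N0" using reals_Archimedean2 by blast
          have "cut (\<epsilon> n) z = 1" if "n \<ge> N0" for n
          proof -
            have "2 * \<epsilon>1 / \<sigma> z \<le> real (Suc n)" using N0 that by linarith
            then have "2 * \<epsilon>1 \<le> real (Suc n) * \<sigma> z" using pos by (simp add: field_simps)
            then have "1 \<le> \<sigma> z / \<epsilon> n - 1" using \<epsilon>1(1) by (simp add: \<epsilon>_def field_simps)
            then show ?thesis by (simp add: cut_def step_1)
          qed
          then have "\<forall>\<^sub>F n in sequentially. ?F (\<epsilon> n) z = K z * \<phi>' z e + k z * \<phi> z"
            by (auto simp: eventually_sequentially)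
          then show ?thesis by (rule tendsto_eventually)
        next
          case False
          then have "\<phi> z = 0" "\<phi>' z e = 0" using z SW \<phi>0 \<phi>'0 by auto
          then show ?thesis by simp
        qed
      qed
      fix n
      show "AE z in lebesgue_on S. norm (?F (\<epsilon> n) z) \<le> \<bar>K z * \<phi>' z e + k z * \<phi> z\<bar>"
        using cutb by (intro AE_I2) (simp add: abs_mult mult_left_le)
      show "(\<lambda>z. ?F (\<epsilon> n) z) \<in> borel_measurable (lebesgue_on S)"
        by (intro borel_measurable_times borel_measurable_integrable[OF iF]
            continuous_imp_measurable_on_sets_lebesgue[OF cc]) (use S in auto)
    qed (use iF in auto)
    then have "(\<lambda>n. \<bar>LINT z|lebesgue_on S. ?F (\<epsilon> n) z\<bar>) \<longlonglongrightarrow> \<bar>LINT z|lebesgue_on S. K z * \<phi>' z e + k z * \<phi> z\<bar>"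
      by (rule tendsto_rabs)
    then show "\<bar>LINT z|lebesgue_on S. K z * \<phi>' z e + k z * \<phi> z\<bar> \<le> C * (\<eta> + j / \<eta>)"
      by (rule LIMSEQ_le_const2) (use bnd \<epsilon> in auto)
  qed
qed

end

section \<open>Functions with vanishing trace\<close>

lemma L1_le_L2:
  fixes a :: "'a::euclidean_space \<Rightarrow> real"
  assumes S: "bounded S" "open S" and a: "L2 S a"
  shows "(LINT x|lebesgue_on S. \<bar>a x\<bar>) \<le> sqrt (LINT x|lebesgue_on S. (a x)\<^sup>2) * (measure lebesgue S + 1)"
proof -
  let ?I = "LINT x|lebesgue_on S. (a x)\<^sup>2" and ?m = "measure lebesgue S"
  have i1: "integrable (lebesgue_on S) (\<lambda>x. \<bar>a x\<bar>)" using L2_integrable[OF S a] by simp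
  \<comment> \<open>Below, \<open>\<eta>\<close> becomes the square root of the integral, which
    yields the factor measure + 1; if the integral is 0, \<open>\<eta>\<close> tends to 0.\<close>
  have le: "(LINT x|lebesgue_on S. \<bar>a x\<bar>) \<le> \<eta> * ?m + ?I / \<eta>" if \<eta>: "0 < \<eta>" for \<eta>
  proof -
    have ic: "integrable (lebesgue_on S) (\<lambda>_. \<eta>)" by (rule lebesgue_on_const_integrable[OF S])
    have i2: "integrable (lebesgue_on S) (\<lambda>x. (a x)\<^sup>2 / \<eta>)" using L2D(2)[OF a] by simp
    have "(LINT x|lebesgue_on S. \<bar>a x\<bar>) \<le> (LINT x|lebesgue_on S. \<eta> + (a x)\<^sup>2 / \<eta>)"
      by (rule integral_mono[OF i1 Bochner_Integration.integrable_add[OF ic i2] abs_le_AM_GM[OF \<eta>]])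
    also have "\<dots> = (LINT x|lebesgue_on S. \<eta>) + (LINT x|lebesgue_on S. (a x)\<^sup>2 / \<eta>)"
      by (rule Bochner_Integration.integral_add[OF ic i2])
    also have "(LINT x|lebesgue_on S. \<eta>) = \<eta> * ?m"
      using S by (simp add: measure_restrict_space mult.commute)
    finally show ?thesis by simp
  qed
  have I0: "0 \<le> ?I" by simp
  show ?thesis
  proof (cases "?I = 0")
    case True
    have "(LINT x|lebesgue_on S. \<bar>a x\<bar>) \<le> 0"
    proof (rule field_le_epsilon)
      fix e :: real assume e: "0 < e"
      have "(LINT x|lebesgue_on S. \<bar>a x\<bar>) \<le> e / (?m + 1) * ?m"
        using le[of "e / (?m + 1)"] e True by (simp add: add_nonneg_pos)
      also have "\<dots> \<le> e"
      proof -
        have "e * ?m \<le> e * (?m + 1)" using e by simp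
        moreover have "0 < ?m + 1" by (simp add: add_nonneg_pos)
        ultimately show ?thesis by (simp add: divide_le_eq)
      qed
      finally show "(LINT x|lebesgue_on S. \<bar>a x\<bar>) \<le> 0 + e" by simp
    qed
    then show ?thesis using True by simp
  next
    case False
    then have "0 < ?I" using I0 by linarith
    then have s: "0 < sqrt ?I" by simp
    have "?I / sqrt ?I = sqrt ?I" using I0 by (simp add: real_div_sqrt)
    then show ?thesis using le[OF s] by (simp add: distrib_left)
  qed
qed

lemma L2_tendsto_L1:
  fixes a :: "nat \<Rightarrow> 'a::euclidean_space \<Rightarrow> real"
  assumes S: "bounded S" "open S" and a: "\<And>n. L2 S (a n)"
    and lim: "(\<lambda>n. LINT x|lebesgue_on S. (a n x)\<^sup>2) \<longlonglongrightarrow> 0"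
  shows "(\<lambda>n. LINT x|lebesgue_on S. \<bar>a n x\<bar>) \<longlonglongrightarrow> 0"
proof (rule tendsto_sandwich[OF _ _ tendsto_const])
  show "\<forall>\<^sub>F n in sequentially. 0 \<le> (LINT x|lebesgue_on S. \<bar>a n x\<bar>)" by simp
  show "\<forall>\<^sub>F n in sequentially. (LINT x|lebesgue_on S. \<bar>a n x\<bar>)
      \<le> sqrt (LINT x|lebesgue_on S. (a n x)\<^sup>2) * (measure lebesgue S + 1)"
    using L1_le_L2[OF S a] by simp
  have "(\<lambda>n. sqrt (LINT x|lebesgue_on S. (a n x)\<^sup>2) * (measure lebesgue S + 1)) \<longlonglongrightarrow> sqrt 0 * (measure lebesgue S + 1)"
    by (intro tendsto_mult_right tendsto_real_sqrt lim)
  then show "(\<lambda>n. sqrt (LINT x|lebesgue_on S. (a n x)\<^sup>2) * (measure lebesgue S + 1)) \<longlonglongrightarrow> 0" by simp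
qed

text \<open>\<open>\<sigma>\<close> is the height along \<open>\<nu>\<close> minus the graph
  function. The projection \<open>P\<close> removes the \<open>\<nu>\<close>-component, so moving by
  \<open>t\<close> along \<open>\<nu>\<close> changes only the height.\<close>

lemma C1_regular_local_graph:
  assumes S: "C1_regular S" and x: "x \<in> frontier S"
  obtains \<sigma> \<sigma>' \<nu> r0 where "local_graph S \<sigma> \<sigma>' \<nu> x r0"
proof -
  obtain r \<nu> \<gamma> where r: "0 < r" and \<nu>: "norm \<nu> = 1" and \<gamma>: "cont_diff_on 1 UNIV (\<gamma> :: complex \<Rightarrow> real)"
    and eq: "S \<inter> ball x r = {z \<in> ball x r. \<gamma> (z - (z \<bullet> \<nu>) *\<^sub>R \<nu>) < z \<bullet> \<nu>}"
    using S x unfolding C1_regular_def by blast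
  define P where "P z = z - (z \<bullet> \<nu>) *\<^sub>R \<nu>" for z
  define \<sigma> where "\<sigma> z = z \<bullet> \<nu> - \<gamma> (P z)" for z
  define \<sigma>' where "\<sigma>' z e = e \<bullet> \<nu> - frechet_derivative \<gamma> (at (P z)) (P e)" for z e
  have g: "C1_deriv UNIV \<gamma> (\<lambda>z. frechet_derivative \<gamma> (at z))"
    using \<gamma> by (intro cont_diff_on_imp_C1_deriv) (simp add: One_nat_def)
  have Pd: "(P has_derivative P) (at z)" for z
    unfolding P_def[abs_def] by (auto intro!: derivative_eq_intros)
  have Pc: "continuous_on UNIV P" unfolding P_def[abs_def] by (intro continuous_intros)
  have "C1_deriv UNIV \<sigma> \<sigma>'"
    unfolding C1_deriv_def
  proof (intro conjI ballI allI)
    fix z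
    have "((\<lambda>z. \<gamma> (P z)) has_derivative (\<lambda>e. frechet_derivative \<gamma> (at (P z)) (P e))) (at z)"
      by (rule has_derivative_compose[OF Pd C1_derivD[OF g UNIV_I]])
    then show "(\<sigma> has_derivative \<sigma>' z) (at z)"
      unfolding \<sigma>_def[abs_def] \<sigma>'_def by (auto intro!: derivative_eq_intros)
  next
    fix e
    show "continuous_on UNIV (\<lambda>z. \<sigma>' z e)"
      unfolding \<sigma>'_def by (intro continuous_intros continuous_on_compose2[OF C1_deriv_contD[OF g] Pc]) auto
  qed
  moreover have "\<nu> \<bullet> \<nu> = 1" using \<nu> by (simp add: norm_eq_1)
  then have "\<sigma> (z + t *\<^sub>R \<nu>) = \<sigma> z + t" for z t
    by (simp add: \<sigma>_def P_def inner_add_left algebra_simps)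
  moreover have "z \<in> S \<longleftrightarrow> 0 < \<sigma> z" if "z \<in> ball x r" for z
  proof -
    have "z \<in> S \<longleftrightarrow> z \<in> S \<inter> ball x r" using that by simp
    also have "\<dots> \<longleftrightarrow> 0 < \<sigma> z" unfolding eq using that by (simp add: \<sigma>_def P_def)
    finally show ?thesis .
  qed
  ultimately have "local_graph S \<sigma> \<sigma>' \<nu> x r"
    using S \<nu> r by (auto simp: local_graph_def C1_regular_def)
  then show ?thesis by (rule that)
qed

text \<open>\<open>Z\<close> has trace \<open>0\<close>: it is the limit of functions \<open>K n\<close> continuous up to the boundary and tending to \<open>0\<close> there.\<close>

locale zero_trace =
  fixes S :: "complex set" and e :: complex and Z g and K k :: "nat \<Rightarrow> complex \<Rightarrow> real" and W
  assumes S: "bounded S" "C1_regular S" and W: "open W" "closure S \<subseteq> W"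
    and Z: "is_weak_partial S e Z g" "L2 S Z" "L2 S g"
    and K: "\<And>n. continuous_on (closure S) (K n)" "\<And>n. is_weak_partial S e (K n) (k n)"
      "\<And>n. L2 S (K n)" "\<And>n. L2 S (k n)"
    and lim: "(\<lambda>n. LINT z|lebesgue_on S. (K n z - Z z)\<^sup>2) \<longlonglongrightarrow> 0"
      "(\<lambda>n. LINT z|lebesgue_on S. (k n z - g z)\<^sup>2) \<longlonglongrightarrow> 0"
      "(\<lambda>n. \<integral>\<^sup>+z\<in>frontier S. ennreal ((K n z)\<^sup>2) \<partial>hausdorff_measure 1) \<longlonglongrightarrow> 0"
begin

lemma open_S: "open S" using S(2) by (simp add: C1_regular_def)

lemma S_W: "S \<subseteq> W" using W(2) closure_subset by blast

lemma test_bounds: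
  assumes "C1_deriv W \<phi> \<phi>'"
  obtains M where "0 \<le> M" "\<And>z. z \<in> S \<Longrightarrow> \<bar>\<phi> z\<bar> \<le> M" "\<And>z. z \<in> S \<Longrightarrow> \<bar>\<phi>' z e\<bar> \<le> M"
proof -
  have c: "compact (closure S)" using S(1) by (simp add: compact_closure)
  obtain M1 where M1: "0 \<le> M1" "\<And>z. z \<in> closure S \<Longrightarrow> \<bar>\<phi> z\<bar> \<le> M1"
    using continuous_on_compact_bound[OF c continuous_on_subset[OF C1_deriv_continuous[OF assms] W(2)]] by metis
  obtain M2 where M2: "0 \<le> M2" "\<And>z. z \<in> closure S \<Longrightarrow> \<bar>\<phi>' z e\<bar> \<le> M2"
    using continuous_on_compact_bound[OF c continuous_on_subset[OF C1_deriv_contD[OF assms, of e] W(2)]] by metis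
  show ?thesis
  proof (rule that[of "max M1 M2"])
    show "\<bar>\<phi> z\<bar> \<le> max M1 M2" "\<bar>\<phi>' z e\<bar> \<le> max M1 M2" if "z \<in> S" for z
      using M1(2)[of z] M2(2)[of z] that closure_subset[of S] by (auto simp: le_max_iff_disj)
  qed (use M1 in simp)
qed

lemma test_integrable:
  assumes \<phi>: "C1_deriv W \<phi> \<phi>'" and L: "L2 S A" "L2 S B"
  shows "integrable (lebesgue_on S) (\<lambda>z. A z * \<phi>' z e)" "integrable (lebesgue_on S) (\<lambda>z. B z * \<phi> z)"
proof -
  obtain M where M: "0 \<le> M" "\<And>z. z \<in> S \<Longrightarrow> \<bar>\<phi> z\<bar> \<le> M" "\<And>z. z \<in> S \<Longrightarrow> \<bar>\<phi>' z e\<bar> \<le> M"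
    using test_bounds[OF \<phi>] by metis
  show "integrable (lebesgue_on S) (\<lambda>z. A z * \<phi>' z e)"
    by (rule L2_mult_bounded[OF S(1) open_S L(1) continuous_on_subset[OF C1_deriv_contD[OF \<phi>] S_W] M(3)])
  show "integrable (lebesgue_on S) (\<lambda>z. B z * \<phi> z)"
    by (rule L2_mult_bounded[OF S(1) open_S L(2) continuous_on_subset[OF C1_deriv_continuous[OF \<phi>] S_W] M(2)])
qed

text \<open>The defect in integration by parts against a function that may be nonzero on the
  boundary. It is to be shown that trace zero makes it vanish.\<close>

definition \<Lambda> :: "(complex \<Rightarrow> real) \<Rightarrow> (complex \<Rightarrow> complex \<Rightarrow> real) \<Rightarrow> real" where
  "\<Lambda> \<phi> \<phi>' = (LINT z|lebesgue_on S. Z z * \<phi>' z e + g z * \<phi> z)"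

lemma \<Lambda>_approx:
  assumes \<phi>: "C1_deriv W \<phi> \<phi>'"
  shows "(\<lambda>n. LINT z|lebesgue_on S. K n z * \<phi>' z e + k n z * \<phi> z) \<longlonglongrightarrow> \<Lambda> \<phi> \<phi>'"
proof -
  obtain M where M: "0 \<le> M" "\<And>z. z \<in> S \<Longrightarrow> \<bar>\<phi> z\<bar> \<le> M" "\<And>z. z \<in> S \<Longrightarrow> \<bar>\<phi>' z e\<bar> \<le> M"
    using test_bounds[OF \<phi>] by metis
  have L: "L2 S (\<lambda>z. K n z - Z z)" "L2 S (\<lambda>z. k n z - g z)" for n
    using L2_lincomb[OF K(3)[of n] Z(2), of 1 "-1"] L2_lincomb[OF K(4)[of n] Z(3), of 1 "-1"] by auto
  note l1 = L2_tendsto_L1[OF S(1) open_S L(1) lim(1)] and l2 = L2_tendsto_L1[OF S(1) open_S L(2) lim(2)]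
  let ?D = "\<lambda>n. (LINT z|lebesgue_on S. K n z * \<phi>' z e + k n z * \<phi> z) - \<Lambda> \<phi> \<phi>'"
  have le: "norm (?D n) \<le> M * (LINT z|lebesgue_on S. \<bar>K n z - Z z\<bar>) + M * (LINT z|lebesgue_on S. \<bar>k n z - g z\<bar>)" for n
  proof -
    note i = test_integrable[OF \<phi> K(3)[of n] K(4)[of n]] test_integrable[OF \<phi> Z(2,3)]
      test_integrable[OF \<phi> L(1)[of n] L(2)[of n]]
    have iL: "integrable (lebesgue_on S) (\<lambda>z. \<bar>K n z - Z z\<bar>)" "integrable (lebesgue_on S) (\<lambda>z. \<bar>k n z - g z\<bar>)"
      using L2_integrable[OF S(1) open_S] L by auto
    have deq: "?D n = (LINT z|lebesgue_on S. (K n z - Z z) * \<phi>' z e + (k n z - g z) * \<phi> z)"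
      unfolding \<Lambda>_def using i by (simp add: left_diff_distrib)
    have "norm (?D n) = \<bar>LINT z|lebesgue_on S. (K n z - Z z) * \<phi>' z e + (k n z - g z) * \<phi> z\<bar>"
      by (simp only: deq real_norm_def)
    also have "\<dots> \<le> (LINT z|lebesgue_on S. \<bar>(K n z - Z z) * \<phi>' z e + (k n z - g z) * \<phi> z\<bar>)"
      by (rule integral_abs_bound)
    also have "\<dots> \<le> (LINT z|lebesgue_on S. M * \<bar>K n z - Z z\<bar> + M * \<bar>k n z - g z\<bar>)"
    proof (rule integral_mono)
      show "integrable (lebesgue_on S) (\<lambda>z. \<bar>(K n z - Z z) * \<phi>' z e + (k n z - g z) * \<phi> z\<bar>)"
        using i by (intro integrable_abs Bochner_Integration.integrable_add)
      show "integrable (lebesgue_on S) (\<lambda>z. M * \<bar>K n z - Z z\<bar> + M * \<bar>k n z - g z\<bar>)" using iL by simp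
      fix z assume "z \<in> space (lebesgue_on S)"
      then have z: "z \<in> S" by simp
      have "\<bar>K n z - Z z\<bar> * \<bar>\<phi>' z e\<bar> \<le> \<bar>K n z - Z z\<bar> * M" "\<bar>k n z - g z\<bar> * \<bar>\<phi> z\<bar> \<le> \<bar>k n z - g z\<bar> * M"
        using M(2,3)[OF z] by (auto intro: mult_left_mono)
      then show "\<bar>(K n z - Z z) * \<phi>' z e + (k n z - g z) * \<phi> z\<bar> \<le> M * \<bar>K n z - Z z\<bar> + M * \<bar>k n z - g z\<bar>"
        unfolding abs_mult[symmetric] by (simp only: mult.commute[of M])
    qed
    also have "\<dots> = M * (LINT z|lebesgue_on S. \<bar>K n z - Z z\<bar>) + M * (LINT z|lebesgue_on S. \<bar>k n z - g z\<bar>)"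
      using iL by simp
    finally show ?thesis .
  qed
  have "(\<lambda>n. M * (LINT z|lebesgue_on S. \<bar>K n z - Z z\<bar>) + M * (LINT z|lebesgue_on S. \<bar>k n z - g z\<bar>)) \<longlonglongrightarrow> M * 0 + M * 0"
    by (intro tendsto_add tendsto_mult_left l1 l2)
  then have lim0: "(\<lambda>n. M * (LINT z|lebesgue_on S. \<bar>K n z - Z z\<bar>) + M * (LINT z|lebesgue_on S. \<bar>k n z - g z\<bar>)) \<longlonglongrightarrow> 0"
    by simp
  have "?D \<longlonglongrightarrow> 0" by (rule Lim_null_comparison[OF always_eventually[OF allI[OF le]] lim0])
  then show ?thesis by (rule LIM_zero_cancel)
qed

text \<open>Localised form of the claim: the radius depends on the point, interior and boundary
  points are treated separately, and compactness joins the pieces.\<close>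

definition vanishing_near :: "complex \<Rightarrow> real \<Rightarrow> bool" where
  "vanishing_near x r \<longleftrightarrow> (\<forall>\<phi> \<phi>'. C1_deriv W \<phi> \<phi>' \<longrightarrow> (\<forall>z\<in>W - cball x r. \<phi> z = 0) \<longrightarrow> \<Lambda> \<phi> \<phi>' = 0)"

lemma vanishing_near_frontier:
  assumes x: "x \<in> frontier S"
  shows "\<exists>r>0. vanishing_near x r"
proof -
  obtain \<sigma> \<sigma>' \<nu> r0 where "local_graph S \<sigma> \<sigma>' \<nu> x r0" using C1_regular_local_graph[OF S(2) x] by metis
  then interpret G: local_graph S \<sigma> \<sigma>' \<nu> x r0 .
  have "vanishing_near x (r0 / 2)"
    unfolding vanishing_near_def
  proof (intro allI impI)
    fix \<phi> \<phi>' assume \<phi>: "C1_deriv W \<phi> \<phi>'" and \<phi>0: "\<forall>z\<in>W - cball x (r0 / 2). \<phi> z = 0"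
    have "r0 / 2 < r0" using G.r0 by simp
    from G.graph_estimate[OF S(1) W(2,1) \<phi> this, of e] \<phi>0
    obtain C where C: "0 \<le> C" and est: "\<And>K k \<eta> j. continuous_on (closure S) K \<and> is_weak_partial S e K k \<and> L2 S K \<and> L2 S k \<and> 0 < \<eta> \<and> 0 \<le> j \<and>
      (\<integral>\<^sup>+z\<in>frontier S. ennreal ((K z)\<^sup>2) \<partial>hausdorff_measure 1) \<le> ennreal j \<Longrightarrow>
      \<bar>LINT z|lebesgue_on S. K z * \<phi>' z e + k z * \<phi> z\<bar> \<le> C * (\<eta> + j / \<eta>)"
      by auto
    let ?L = "\<lambda>n. LINT z|lebesgue_on S. K n z * \<phi>' z e + k n z * \<phi> z"
    have "\<bar>\<Lambda> \<phi> \<phi>'\<bar> \<le> 0"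
    proof (rule field_le_epsilon)
      fix d :: real assume d: "0 < d"
      \<comment> \<open>Once the boundary integral is below \<eta>^2, the estimate reads C (\<eta> +
        \<eta>^2 / \<eta>) = 2 C \<eta>, which this choice makes at most \<open>d\<close>.\<close>
      define \<eta> where "\<eta> = d / (2 * (C + 1))"
      have \<eta>: "0 < \<eta>" using d C by (simp add: \<eta>_def)
      have "\<forall>\<^sub>F n in sequentially. (\<integral>\<^sup>+z\<in>frontier S. ennreal ((K n z)\<^sup>2) \<partial>hausdorff_measure 1) < ennreal (\<eta>\<^sup>2)"
        using lim(3) \<eta> by (intro order_tendstoD(2)) auto
      then have ev: "\<forall>\<^sub>F n in sequentially. \<bar>?L n\<bar> \<le> d"
      proof eventually_elim
        case (elim n)
        have "\<bar>?L n\<bar> \<le> C * (\<eta> + \<eta>\<^sup>2 / \<eta>)"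
          using elim \<eta> K by (intro est) auto
        also have "\<dots> = 2 * C * \<eta>" using \<eta> by (simp add: power2_eq_square)
        also have "\<dots> \<le> d" 
        proof -
          have "\<eta> * (2 * (C + 1)) = d" using C by (simp add: \<eta>_def)
          then show ?thesis using \<eta> by (simp add: algebra_simps)
        qed
        finally show ?case .
      qed
      have "\<bar>\<Lambda> \<phi> \<phi>'\<bar> \<le> d"
        by (rule tendsto_upperbound[OF tendsto_rabs[OF \<Lambda>_approx[OF \<phi>]] ev]) simp
      then show "\<bar>\<Lambda> \<phi> \<phi>'\<bar> \<le> 0 + d" by simp
    qed
    then show "\<Lambda> \<phi> \<phi>' = 0" by simp
  qed
  then show ?thesis using G.r0 by (intro exI[of _ "r0 / 2"]) simp
qed

lemma vanishing_near_interior: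
  assumes x: "x \<in> S"
  shows "\<exists>r>0. vanishing_near x r"
proof -
  obtain r where r: "r > 0" "cball x r \<subseteq> S" using open_S x by (meson open_contains_cball)
  have "vanishing_near x r"
    unfolding vanishing_near_def
  proof (intro allI impI)
    fix \<phi> \<phi>' assume \<phi>: "C1_deriv W \<phi> \<phi>'" and \<phi>0: "\<forall>z\<in>W - cball x r. \<phi> z = 0"
    have "(LINT z:S|lebesgue. Z z * \<phi>' z e) = - (LINT z:S|lebesgue. g z * \<phi> z)"
      by (rule weak_partial_C1_test[OF Z(1) open_S C1_deriv_subset[OF \<phi> S_W] compact_cball r(2)])
        (use \<phi>0 S_W in auto)
    then show "\<Lambda> \<phi> \<phi>' = 0"
      unfolding \<Lambda>_def using test_integrable[OF \<phi> Z(2,3)] by (simp add: set_integral_lebesgue_on[OF open_S])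
  qed
  then show ?thesis using r(1) by blast
qed

text \<open>A cut-off equal to 1 on the ball of radius r/2 and to 0 off the ball of radius r. It
  depends on the squared distance, which is smooth at the centre.\<close>

definition ball_cut :: "complex \<Rightarrow> real \<Rightarrow> complex \<Rightarrow> real" where
  "ball_cut x r z = step (2 - 4 / r\<^sup>2 * ((z - x) \<bullet> (z - x)))"

definition dball_cut :: "complex \<Rightarrow> real \<Rightarrow> complex \<Rightarrow> complex \<Rightarrow> real" where
  "dball_cut x r z v = dstep (2 - 4 / r\<^sup>2 * ((z - x) \<bullet> (z - x))) * (- (4 / r\<^sup>2 * (2 * ((z - x) \<bullet> v))))"

lemma ball_cut_C1: "C1_deriv A (ball_cut x r) (dball_cut x r)"
  unfolding ball_cut_def[abs_def] dball_cut_def[abs_def]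
proof (rule C1_deriv_compose[OF _ step_deriv continuous_dstep])
  show "C1_deriv A (\<lambda>z. 2 - 4 / r\<^sup>2 * ((z - x) \<bullet> (z - x))) (\<lambda>z v. - (4 / r\<^sup>2 * (2 * ((z - x) \<bullet> v))))"
    unfolding C1_deriv_def
  proof (intro conjI ballI allI)
    fix z
    have "((\<lambda>z. (z - x) \<bullet> (z - x)) has_derivative (\<lambda>v. 2 * ((z - x) \<bullet> v))) (at z)"
      by (auto intro!: derivative_eq_intros simp: inner_commute)
    from has_derivative_diff[OF has_derivative_const[of 2] has_derivative_mult_right[OF this, of "4 / r\<^sup>2"]]
    show "((\<lambda>z. 2 - 4 / r\<^sup>2 * ((z - x) \<bullet> (z - x))) has_derivative (\<lambda>v. - (4 / r\<^sup>2 * (2 * ((z - x) \<bullet> v))))) (at z)"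
      by simp
  next
    fix v
    show "continuous_on A (\<lambda>z. - (4 / r\<^sup>2 * (2 * ((z - x) \<bullet> v))))" by (intro continuous_intros)
  qed
qed

lemma ball_cut_inside:
  assumes "0 < r" "z \<in> ball x (r / 2)"
  shows "ball_cut x r z = 1"
proof -
  have "(norm (z - x))\<^sup>2 \<le> (r / 2)\<^sup>2" using assms by (intro power_mono) (auto simp: dist_norm norm_minus_commute)
  then have "4 / r\<^sup>2 * (norm (z - x))\<^sup>2 \<le> 4 / r\<^sup>2 * (r / 2)\<^sup>2" by (intro mult_left_mono) auto
  also have "\<dots> = 1" using assms(1) by (simp add: power2_eq_square)
  finally show ?thesis by (simp add: ball_cut_def step_1 power2_norm_eq_inner)
qed

lemma ball_cut_outside:
  assumes "0 < r" "z \<notin> cball x r"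
  shows "ball_cut x r z = 0"
proof -
  have "r\<^sup>2 \<le> (norm (z - x))\<^sup>2" using assms by (intro power_mono) (auto simp: dist_norm norm_minus_commute)
  then have "4 / r\<^sup>2 * r\<^sup>2 \<le> 4 / r\<^sup>2 * (norm (z - x))\<^sup>2" by (intro mult_left_mono) auto
  moreover have "4 / r\<^sup>2 * r\<^sup>2 = 4" using assms(1) by simp
  ultimately show ?thesis by (simp add: ball_cut_def step_0 power2_norm_eq_inner)
qed

text \<open>Takes the place of a partition of unity: \<phi> is split into \<phi> times the cut-off
  of one ball, whose defect vanishes by locality, and a rest that vanishes outside the remaining
  balls.\<close>

lemma \<Lambda>_finite_cover:
  assumes "finite F" "\<And>x r. (x, r) \<in> F \<Longrightarrow> 0 < r \<and> vanishing_near x r"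
    and "C1_deriv W \<phi> \<phi>'" "\<And>z. z \<in> S \<Longrightarrow> (\<And>x r. (x, r) \<in> F \<Longrightarrow> z \<notin> ball x (r / 2)) \<Longrightarrow> \<phi> z = 0"
  shows "\<Lambda> \<phi> \<phi>' = 0"
  using assms
proof (induction F arbitrary: \<phi> \<phi>' rule: finite_induct)
  case empty
  have z0: "\<phi> z = 0" if "z \<in> S" for z using empty.prems(3)[OF that] by simp
  then have "\<phi>' z e = 0" if "z \<in> S" for z
    using C1_deriv_eq_0[OF empty.prems(2) open_S S_W z0 that] by simp
  then have "\<Lambda> \<phi> \<phi>' = (LINT z|lebesgue_on S. 0)"
    unfolding \<Lambda>_def using z0 by (intro Bochner_Integration.integral_cong) auto
  then show ?case by simp
next
  case (insert p F)
  obtain x r where p: "p = (x, r)" by (cases p)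
  then have r: "0 < r" "vanishing_near x r" using insert.prems(1) by auto
  let ?c = "ball_cut x r" and ?c' = "dball_cut x r"
  have c: "C1_deriv W ?c ?c'" by (rule ball_cut_C1)
  have c1: "C1_deriv W (\<lambda>z. 1 - ?c z) (\<lambda>z v. - ?c' z v)"
    using c by (auto simp: C1_deriv_def intro!: derivative_eq_intros continuous_intros)
  note d1 = C1_deriv_mult[OF insert.prems(2) c] and d2 = C1_deriv_mult[OF insert.prems(2) c1]
  have "\<Lambda> (\<lambda>z. \<phi> z * ?c z) (\<lambda>z v. \<phi> z * ?c' z v + \<phi>' z v * ?c z) = 0"
    using r(2) d1 ball_cut_outside[OF r(1)] unfolding vanishing_near_def by simp
  moreover have "\<Lambda> (\<lambda>z. \<phi> z * (1 - ?c z)) (\<lambda>z v. \<phi> z * - ?c' z v + \<phi>' z v * (1 - ?c z)) = 0"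
  proof (rule insert.IH[OF _ d2])
    show "0 < r \<and> vanishing_near x r" if "(x, r) \<in> F" for x r
      using insert.prems(1)[of x r] that by auto
    fix z assume z: "z \<in> S" "\<And>x r. (x, r) \<in> F \<Longrightarrow> z \<notin> ball x (r / 2)"
    show "\<phi> z * (1 - ?c z) = 0"
    proof (cases "z \<in> ball x (r / 2)")
      case True
      then show ?thesis using ball_cut_inside[OF r(1)] by simp
    next
      case False
      then have "\<phi> z = 0" using z p by (intro insert.prems(3)) auto
      then show ?thesis by simp
    qed
  qed
  moreover have "\<Lambda> \<phi> \<phi>' = \<Lambda> (\<lambda>z. \<phi> z * ?c z) (\<lambda>z v. \<phi> z * ?c' z v + \<phi>' z v * ?c z)
      + \<Lambda> (\<lambda>z. \<phi> z * (1 - ?c z)) (\<lambda>z v. \<phi> z * - ?c' z v + \<phi>' z v * (1 - ?c z))"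
  proof -
    let ?f1 = "\<lambda>z. Z z * (\<phi> z * ?c' z e + \<phi>' z e * ?c z) + g z * (\<phi> z * ?c z)"
    let ?f2 = "\<lambda>z. Z z * (\<phi> z * - ?c' z e + \<phi>' z e * (1 - ?c z)) + g z * (\<phi> z * (1 - ?c z))"
    have i: "integrable (lebesgue_on S) ?f1" "integrable (lebesgue_on S) ?f2"
      by (intro Bochner_Integration.integrable_add test_integrable[OF d1 Z(2,3)] test_integrable[OF d2 Z(2,3)])+
    have "(\<lambda>z. Z z * \<phi>' z e + g z * \<phi> z) = (\<lambda>z. ?f1 z + ?f2 z)" by (simp add: fun_eq_iff algebra_simps)
    then show ?thesis unfolding \<Lambda>_def using i by simp
  qed
  ultimately show ?case by simp
qed

text \<open>Finitely many balls of half the local radius cover the compact closure of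
  \<open>S\<close>, so the hypothesis on the zeros of \<phi> in the finite version is satisfied by
  every \<phi>.\<close>

theorem zero_trace_test:
  assumes \<phi>: "C1_deriv W \<phi> \<phi>'"
  shows "(LINT z|lebesgue_on S. Z z * \<phi>' z e + g z * \<phi> z) = 0"
proof -
  have "\<exists>r>0. vanishing_near x r" if "x \<in> closure S" for x
    using vanishing_near_interior[of x] vanishing_near_frontier[of x] that open_S
    by (cases "x \<in> S") (auto simp: frontier_def interior_open)
  then obtain r where r: "\<And>x. x \<in> closure S \<Longrightarrow> 0 < r x \<and> vanishing_near x (r x)" by metis
  have "compact (closure S)" using S(1) by (simp add: compact_closure)
  then obtain D where D: "D \<subseteq> closure S" "finite D" "closure S \<subseteq> (\<Union>x\<in>D. ball x (r x / 2))"
  proof (rule compactE_image[of "closure S" "closure S" "\<lambda>x. ball x (r x / 2)"])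
    show "closure S \<subseteq> (\<Union>x\<in>closure S. ball x (r x / 2))" using r by fastforce
  qed auto
  have "\<Lambda> \<phi> \<phi>' = 0"
  proof (rule \<Lambda>_finite_cover[OF _ _ \<phi>, of "(\<lambda>x. (x, r x)) ` D"])
    show "finite ((\<lambda>x. (x, r x)) ` D)" using D(2) by simp
    show "0 < s \<and> vanishing_near x s" if "(x, s) \<in> (\<lambda>x. (x, r x)) ` D" for x s
      using that r D(1) by auto
    fix z assume "z \<in> S" and n: "\<And>x s. (x, s) \<in> (\<lambda>x. (x, r x)) ` D \<Longrightarrow> z \<notin> ball x (s / 2)"
    then obtain x where "x \<in> D" "z \<in> ball x (r x / 2)" using D(3) closure_subset[of S] by blast
    then show "\<phi> z = 0" using n[of x "r x"] by auto
  qed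
  then show ?thesis by (simp add: \<Lambda>_def)
qed

end

section \<open>Minimality\<close>

lemma W12_norm_tendsto:
  fixes f :: "nat \<Rightarrow> 'a::euclidean_space \<Rightarrow> real"
  assumes "(\<lambda>n. W12_norm S (f n)) \<longlonglongrightarrow> 0"
  shows "(\<lambda>n. LINT x|lebesgue_on S. (f n x)\<^sup>2) \<longlonglongrightarrow> 0"
    "e \<in> Basis \<Longrightarrow> (\<lambda>n. LINT x|lebesgue_on S. (weak_partial S e (f n) x)\<^sup>2) \<longlonglongrightarrow> 0"
proof -
  let ?A = "\<lambda>n. LINT x|lebesgue_on S. (f n x)\<^sup>2"
  let ?B = "\<lambda>n e. LINT x|lebesgue_on S. (weak_partial S e (f n) x)\<^sup>2"
  have eq: "(W12_norm S (f n))\<^sup>2 = ?A n + (\<Sum>e\<in>Basis. ?B n e)" for n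
    unfolding W12_norm_def by (rule real_sqrt_pow2) (intro add_nonneg_nonneg sum_nonneg; simp)
  have lim: "(\<lambda>n. (W12_norm S (f n))\<^sup>2) \<longlonglongrightarrow> 0" using tendsto_power[OF assms, of 2] by simp
  have nn: "0 \<le> (\<Sum>e\<in>Basis. ?B n e)" for n by (intro sum_nonneg) simp
  have Al: "?A n \<le> (W12_norm S (f n))\<^sup>2" for n unfolding eq using nn[of n] by simp
  show "?A \<longlonglongrightarrow> 0"
    by (rule tendsto_sandwich[OF _ _ tendsto_const lim]) (use Al in auto)
  assume e: "e \<in> Basis"
  have "?B n e \<le> (\<Sum>e\<in>Basis. ?B n e)" for n using e by (intro member_le_sum) auto
  moreover have "0 \<le> ?A n" for n by simp
  ultimately have Bl: "?B n e \<le> (W12_norm S (f n))\<^sup>2" for n unfolding eq by (intro add_increasing)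
  show "(\<lambda>n. ?B n e) \<longlonglongrightarrow> 0"
    by (rule tendsto_sandwich[OF _ _ tendsto_const lim]) (use Bl in auto)
qed

lemma trace_difference_tendsto:
  fixes F G :: "nat \<Rightarrow> complex \<Rightarrow> real"
  assumes F: "\<And>n. continuous_on (closure S) (F n)" and G: "\<And>n. continuous_on (closure S) (G n)"
    and w: "w \<in> borel_measurable borel"
    and limF: "(\<lambda>n. \<integral>\<^sup>+z\<in>frontier S. ennreal ((F n z - w z)\<^sup>2) \<partial>hausdorff_measure 1) \<longlonglongrightarrow> 0"
    and limG: "(\<lambda>n. \<integral>\<^sup>+z\<in>frontier S. ennreal ((G n z - w z)\<^sup>2) \<partial>hausdorff_measure 1) \<longlonglongrightarrow> 0"
  shows "(\<lambda>n. \<integral>\<^sup>+z\<in>frontier S. ennreal ((F n z - G n z)\<^sup>2) \<partial>hausdorff_measure 1) \<longlonglongrightarrow> 0"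
proof -
  have meas: "(\<lambda>z. ennreal ((H z - w z)\<^sup>2) * indicator (frontier S) z) \<in> borel_measurable (hausdorff_measure 1)"
    if "continuous_on (closure S) H" for H :: "complex \<Rightarrow> real"
  proof -
    have "(\<lambda>z. indicator (frontier S) z *\<^sub>R H z) \<in> borel_measurable borel"
      by (rule borel_measurable_continuous_on_indicator) (auto simp: frontier_def intro: continuous_on_subset[OF that])
    then have "(\<lambda>z. indicator (frontier S) z *\<^sub>R H z - indicator (frontier S) z * w z) \<in> borel_measurable borel"
      using w by (intro borel_measurable_diff borel_measurable_times borel_measurable_indicator) auto
    then have "(\<lambda>z. ennreal ((indicator (frontier S) z *\<^sub>R H z - indicator (frontier S) z * w z)\<^sup>2)) \<in> borel_measurable borel"
      by simp
    also have "(\<lambda>z. ennreal ((indicator (frontier S) z *\<^sub>R H z - indicator (frontier S) z * w z)\<^sup>2))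
      = (\<lambda>z. ennreal ((H z - w z)\<^sup>2) * indicator (frontier S) z)"
      by (auto simp: indicator_def fun_eq_iff)
    finally show ?thesis by (simp add: measurable_def)
  qed
  let ?J = "\<lambda>H n. \<integral>\<^sup>+z\<in>frontier S. ennreal ((H n z - w z)\<^sup>2) \<partial>hausdorff_measure 1"
  have le: "(\<integral>\<^sup>+z\<in>frontier S. ennreal ((F n z - G n z)\<^sup>2) \<partial>hausdorff_measure 1) \<le> 2 * ?J F n + 2 * ?J G n" for n
  proof -
    have "(\<integral>\<^sup>+z\<in>frontier S. ennreal ((F n z - G n z)\<^sup>2) \<partial>hausdorff_measure 1)
      \<le> (\<integral>\<^sup>+z. 2 * (ennreal ((F n z - w z)\<^sup>2) * indicator (frontier S) z) + 2 * (ennreal ((G n z - w z)\<^sup>2) * indicator (frontier S) z) \<partial>hausdorff_measure 1)"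
    proof (rule nn_integral_mono)
      fix z
      have "(F n z - G n z)\<^sup>2 \<le> 2 * (F n z - w z)\<^sup>2 + 2 * (G n z - w z)\<^sup>2"
        using zero_le_power2[of "(F n z - w z) + (G n z - w z)"] by (simp add: power2_eq_square algebra_simps)
      then have "ennreal ((F n z - G n z)\<^sup>2) \<le> ennreal (2 * (F n z - w z)\<^sup>2 + 2 * (G n z - w z)\<^sup>2)" by (rule ennreal_leI)
      also have "\<dots> = 2 * ennreal ((F n z - w z)\<^sup>2) + 2 * ennreal ((G n z - w z)\<^sup>2)"
        by (simp add: ennreal_mult)
      finally show "ennreal ((F n z - G n z)\<^sup>2) * indicator (frontier S) z
        \<le> 2 * (ennreal ((F n z - w z)\<^sup>2) * indicator (frontier S) z) + 2 * (ennreal ((G n z - w z)\<^sup>2) * indicator (frontier S) z)"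
        by (auto simp: indicator_def)
    qed
    also have "\<dots> = 2 * ?J F n + 2 * ?J G n"
      using meas[OF F] meas[OF G] by (simp add: nn_integral_add nn_integral_cmult)
    finally show ?thesis .
  qed
  have "(\<lambda>n. 2 * ?J F n + 2 * ?J G n) \<longlonglongrightarrow> 2 * 0 + 2 * 0"
    by (intro tendsto_add ennreal_tendsto_cmult limF limG) auto
  then have lim: "(\<lambda>n. 2 * ?J F n + 2 * ?J G n) \<longlonglongrightarrow> 0" by simp
  show ?thesis
    by (rule tendsto_sandwich[OF _ _ tendsto_const lim]) (use le in auto)
qed

text \<open>The approximating sequences of \<open>a\<close> and \<open>c\<close> have the same limit
  \<open>w\<close> on the boundary; their differences therefore approximate \<open>a - c\<close> and
  tend to 0 on the boundary.\<close>

lemma same_trace_zero_trace: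
  fixes S :: "complex set"
  assumes S: "bounded S" "C1_regular S" and W: "open W" "closure S \<subseteq> W" and e: "e \<in> Basis"
    and tr: "same_trace S a c"
  shows "\<exists>K k. zero_trace S e (\<lambda>z. a z - c z) (\<lambda>z. weak_partial S e a z - weak_partial S e c z) K k W"
proof -
  have op: "open S" using S(2) by (simp add: C1_regular_def)
  obtain w F G where wm: "w \<in> borel_measurable borel" and a: "W12 S a" and c: "W12 S c"
    and F: "\<And>n::nat. W12 S (F n)" "\<And>n. continuous_on (closure S) (F n)"
      "(\<lambda>n. W12_norm S (\<lambda>x. F n x - a x)) \<longlonglongrightarrow> 0"
      "(\<lambda>n. \<integral>\<^sup>+z\<in>frontier S. ennreal ((F n z - w z)\<^sup>2) \<partial>hausdorff_measure 1) \<longlonglongrightarrow> 0"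
    and G: "\<And>n::nat. W12 S (G n)" "\<And>n. continuous_on (closure S) (G n)"
      "(\<lambda>n. W12_norm S (\<lambda>x. G n x - c x)) \<longlonglongrightarrow> 0"
      "(\<lambda>n. \<integral>\<^sup>+z\<in>frontier S. ennreal ((G n z - w z)\<^sup>2) \<partial>hausdorff_measure 1) \<longlonglongrightarrow> 0"
  proof -
    obtain w where "has_trace S a w" "has_trace S c w" using tr unfolding same_trace_def by blast
    then have h: "W12 S a" "W12 S c" "w \<in> borel_measurable borel"
      "\<exists>F. (\<forall>n. W12 S (F n) \<and> continuous_on (closure S) (F n)) \<and> (\<lambda>n. W12_norm S (\<lambda>x. F n x - a x)) \<longlonglongrightarrow> 0 \<and>
        (\<lambda>n. \<integral>\<^sup>+z\<in>frontier S. ennreal ((F n z - w z)\<^sup>2) \<partial>hausdorff_measure 1) \<longlonglongrightarrow> 0"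
      "\<exists>F. (\<forall>n. W12 S (F n) \<and> continuous_on (closure S) (F n)) \<and> (\<lambda>n. W12_norm S (\<lambda>x. F n x - c x)) \<longlonglongrightarrow> 0 \<and>
        (\<lambda>n. \<integral>\<^sup>+z\<in>frontier S. ennreal ((F n z - w z)\<^sup>2) \<partial>hausdorff_measure 1) \<longlonglongrightarrow> 0"
      by (simp_all add: has_trace_def)
    from h(4) obtain F where F: "\<forall>n. W12 S (F n) \<and> continuous_on (closure S) (F n)"
      "(\<lambda>n. W12_norm S (\<lambda>x. F n x - a x)) \<longlonglongrightarrow> 0"
      "(\<lambda>n. \<integral>\<^sup>+z\<in>frontier S. ennreal ((F n z - w z)\<^sup>2) \<partial>hausdorff_measure 1) \<longlonglongrightarrow> 0" by (elim exE conjE)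
    from h(5) obtain G where G: "\<forall>n. W12 S (G n) \<and> continuous_on (closure S) (G n)"
      "(\<lambda>n. W12_norm S (\<lambda>x. G n x - c x)) \<longlonglongrightarrow> 0"
      "(\<lambda>n. \<integral>\<^sup>+z\<in>frontier S. ennreal ((G n z - w z)\<^sup>2) \<partial>hausdorff_measure 1) \<longlonglongrightarrow> 0" by (elim exE conjE)
    show ?thesis
      by (rule that[OF h(3) h(1,2) _ _ F(2,3) _ _ G(2,3)]) (use F(1) G(1) in simp_all)
  qed
  let ?wa = "weak_partial S e a" and ?wc = "weak_partial S e c"
  let ?p = "\<lambda>n. weak_partial S e (\<lambda>x. F n x - a x)" and ?q = "\<lambda>n. weak_partial S e (\<lambda>x. G n x - c x)"
  have dF: "W12 S (\<lambda>x. F n x - a x)" and dG: "W12 S (\<lambda>x. G n x - c x)" for n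
    using W12_diff[OF F(1) a op] W12_diff[OF G(1) c op] by auto
  note wa = W12_weak_partial[OF a op e] and wc = W12_weak_partial[OF c op e]
  note wp = W12_weak_partial[OF dF op e] and wq = W12_weak_partial[OF dG op e]
  note Z = is_weak_partial_lincomb[OF wa(1) wc(1) op, of 1 "-1"]
  have D: "is_weak_partial S e (\<lambda>x. 1 * (F n x - a x) + (-1) * (G n x - c x)) (\<lambda>x. 1 * ?p n x + (-1) * ?q n x)" for n
    by (rule is_weak_partial_lincomb[OF wp(1) wq(1) op])
  \<comment> \<open>A weak derivative of \<open>F n - G n\<close>, written so that subtracting that
    of \<open>a - c\<close> leaves exactly the part known to tend to 0.\<close>
  let ?k = "\<lambda>n z. (?p n z - ?q n z) + (?wa z - ?wc z)"
  have L: "L2 S (\<lambda>z. ?p n z - ?q n z)" for n using L2_lincomb[OF wp(2)[of n] wq(2)[of n], of 1 "-1"] by simp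
  have Lg: "L2 S (\<lambda>z. ?wa z - ?wc z)" using L2_lincomb[OF wa(2) wc(2), of 1 "-1"] by simp
  have LK: "L2 S (F n)" "L2 S (G n)" "L2 S a" "L2 S c" for n using F(1) G(1) a c by (auto simp: W12_def)
  have sq: "(LINT z|lebesgue_on S. (s z - t z)\<^sup>2) \<le> 2 * (LINT z|lebesgue_on S. (s z)\<^sup>2) + 2 * (LINT z|lebesgue_on S. (t z)\<^sup>2)"
    if st: "L2 S s" "L2 S t" for s t :: "complex \<Rightarrow> real"
  proof -
    have "(LINT z|lebesgue_on S. (s z - t z)\<^sup>2) \<le> (LINT z|lebesgue_on S. 2 * (s z)\<^sup>2 + 2 * (t z)\<^sup>2)"
    proof (rule integral_mono)
      show "integrable (lebesgue_on S) (\<lambda>z. (s z - t z)\<^sup>2)"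
        using L2D(2)[OF L2_lincomb[OF st, of 1 "-1"]] by simp
      show "integrable (lebesgue_on S) (\<lambda>z. 2 * (s z)\<^sup>2 + 2 * (t z)\<^sup>2)" using st[THEN L2D(2)] by simp
      show "(s z - t z)\<^sup>2 \<le> 2 * (s z)\<^sup>2 + 2 * (t z)\<^sup>2" for z
        using zero_le_power2[of "s z + t z"] by (simp add: power2_eq_square algebra_simps)
    qed
    also have "\<dots> = 2 * (LINT z|lebesgue_on S. (s z)\<^sup>2) + 2 * (LINT z|lebesgue_on S. (t z)\<^sup>2)"
      using st[THEN L2D(2)] by simp
    finally show ?thesis .
  qed
  have sq_lim: "(\<lambda>n. LINT z|lebesgue_on S. (s n z - t n z)\<^sup>2) \<longlonglongrightarrow> 0"
    if "\<And>n. L2 S (s n)" "\<And>n. L2 S (t n)" "(\<lambda>n. LINT z|lebesgue_on S. (s n z)\<^sup>2) \<longlonglongrightarrow> 0"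
      "(\<lambda>n. LINT z|lebesgue_on S. (t n z)\<^sup>2) \<longlonglongrightarrow> 0" for s t :: "nat \<Rightarrow> complex \<Rightarrow> real"
  proof (rule tendsto_sandwich[OF _ _ tendsto_const])
    show "\<forall>\<^sub>F n in sequentially. 0 \<le> (LINT z|lebesgue_on S. (s n z - t n z)\<^sup>2)" by simp
    show "\<forall>\<^sub>F n in sequentially. (LINT z|lebesgue_on S. (s n z - t n z)\<^sup>2)
       \<le> 2 * (LINT z|lebesgue_on S. (s n z)\<^sup>2) + 2 * (LINT z|lebesgue_on S. (t n z)\<^sup>2)"
      using sq that(1,2) by (intro always_eventually) blast
    have "(\<lambda>n. 2 * (LINT z|lebesgue_on S. (s n z)\<^sup>2) + 2 * (LINT z|lebesgue_on S. (t n z)\<^sup>2)) \<longlonglongrightarrow> 2 * 0 + 2 * 0"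
      by (intro tendsto_add tendsto_mult_left that(3,4))
    then show "(\<lambda>n. 2 * (LINT z|lebesgue_on S. (s n z)\<^sup>2) + 2 * (LINT z|lebesgue_on S. (t n z)\<^sup>2)) \<longlonglongrightarrow> 0" by simp
  qed
  have "zero_trace S e (\<lambda>z. a z - c z) (\<lambda>z. ?wa z - ?wc z) (\<lambda>n z. F n z - G n z) ?k W"
  proof
    show "is_weak_partial S e (\<lambda>z. a z - c z) (\<lambda>z. ?wa z - ?wc z)" using Z by simp
    show "L2 S (\<lambda>z. a z - c z)" using L2_lincomb[OF LK(3,4), of 1 "-1"] by simp
    show "continuous_on (closure S) (\<lambda>z. F n z - G n z)" for n by (intro continuous_on_diff F(2) G(2))
    show "is_weak_partial S e (\<lambda>z. F n z - G n z) (?k n)" for n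
      using is_weak_partial_lincomb[OF D[of n] Z op, of 1 1] by (simp add: algebra_simps)
    show "L2 S (\<lambda>z. F n z - G n z)" for n using L2_lincomb[OF LK(1)[of n] LK(2)[of n], of 1 "-1"] by simp
    show "L2 S (?k n)" for n using L2_lincomb[OF L[of n] Lg, of 1 1] by simp
    have "(\<lambda>n. LINT z|lebesgue_on S. ((F n z - a z) - (G n z - c z))\<^sup>2) \<longlonglongrightarrow> 0"
      using dF dG by (intro sq_lim W12_norm_tendsto(1) F(3) G(3)) (auto simp: W12_def)
    then show "(\<lambda>n. LINT z|lebesgue_on S. (F n z - G n z - (a z - c z))\<^sup>2) \<longlonglongrightarrow> 0"
      by (simp add: algebra_simps)
    have "(\<lambda>n. LINT z|lebesgue_on S. (?p n z - ?q n z)\<^sup>2) \<longlonglongrightarrow> 0"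
      by (intro sq_lim W12_norm_tendsto(2)[OF F(3) e] W12_norm_tendsto(2)[OF G(3) e] wp(2) wq(2))
    then show "(\<lambda>n. LINT z|lebesgue_on S. (?k n z - (?wa z - ?wc z))\<^sup>2) \<longlonglongrightarrow> 0" by simp
    show "(\<lambda>n. \<integral>\<^sup>+z\<in>frontier S. ennreal ((F n z - G n z)\<^sup>2) \<partial>hausdorff_measure 1) \<longlonglongrightarrow> 0"
      by (rule trace_difference_tendsto[OF F(2) G(2) wm F(4) G(4)])
  qed (use S W Lg in auto)
  then show ?thesis by blast
qed

section \<open>Dirichlet's principle on the half plane\<close>

lemma C1_deriv_Re_holomorphic:
  assumes "open U" "f holomorphic_on U"
  shows "C1_deriv U (\<lambda>z. Re (c * f z)) (\<lambda>z e. Re (c * (deriv f z * e)))"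
  unfolding C1_deriv_def
proof (intro conjI ballI allI)
  fix z assume "z \<in> U"
  then have "(f has_field_derivative deriv f z) (at z)"
    using assms by (simp add: holomorphic_derivI)
  then have "(f has_derivative (*) (deriv f z)) (at z)" by (simp add: has_field_derivative_def)
  from bounded_linear.has_derivative[OF bounded_linear_Re has_derivative_mult_right[OF this, of c]]
  show "((\<lambda>z. Re (c * f z)) has_derivative (\<lambda>e. Re (c * (deriv f z * e)))) (at z)" .
next
  fix e
  have "continuous_on U (deriv f)"
    using assms by (intro holomorphic_on_imp_continuous_on holomorphic_deriv)
  then show "continuous_on U (\<lambda>z. Re (c * (deriv f z * e)))" by (intro continuous_intros)
qed

text \<open>\<open>h\<close> is kept apart from the real part of \<open>f\<close> because it also
  carries the boundary values, while \<open>f\<close> is holomorphic only inside.\<close>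

locale half_plane_potential =
  fixes f :: "complex \<Rightarrow> complex" and h :: "complex \<Rightarrow> real" and C Q and b :: "'b::euclidean_space"
  assumes hol: "f holomorphic_on half_plane" and h_eq: "\<And>z. z \<in> half_plane \<Longrightarrow> h z = Re (f z)"
    and h_le1: "\<And>z. z \<in> half_plane \<Longrightarrow> \<bar>h z\<bar> \<le> 1" and f'_le: "\<And>z. z \<in> half_plane \<Longrightarrow> norm (deriv f z) \<le> C"
    and Q: "0 < (Q :: nat)" and b: "norm b = 1"
begin

abbreviation "u \<equiv> \<lambda>z. diag Q b (h z)"
abbreviation "h' \<equiv> \<lambda>z e. Re (deriv f z * e)"

lemma open_half_plane: "open half_plane"
  using open_halfspace_gt[of 0 "1::complex"] by (simp add: inner_complex_def)

lemma C1_h: "C1_deriv half_plane h h'"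
proof -
  have c: "C1_deriv half_plane (\<lambda>z. Re (1 * f z)) (\<lambda>z e. Re (1 * (deriv f z * e)))"
    by (rule C1_deriv_Re_holomorphic[OF open_half_plane hol])
  show ?thesis
    unfolding C1_deriv_def
  proof (intro conjI ballI allI)
    fix z assume z: "z \<in> half_plane"
    have "((\<lambda>z. Re (f z)) has_derivative h' z) (at z)" using C1_derivD[OF c z] by simp
    then show "(h has_derivative h' z) (at z)"
      by (rule has_derivative_transform_within_open[OF _ open_half_plane z]) (simp add: h_eq)
  qed (use C1_deriv_contD[OF c] in simp)
qed

lemma bounded_C1_u:
  assumes "open S" "bounded S" "S \<subseteq> half_plane"
  shows "bounded_C1 S h h' C Q b"
proof
  show "C1_deriv S h h'" by (rule C1_deriv_subset[OF C1_h assms(3)])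
  fix z e :: complex assume z: "z \<in> S"
  then show "\<bar>h z\<bar> \<le> 1" using h_le1 assms(3) by blast
  assume "e \<in> Basis"
  then have "norm e = 1" by simp
  then have "\<bar>Re (deriv f z * e)\<bar> \<le> norm (deriv f z)"
    using abs_Re_le_cmod[of "deriv f z * e"] by (simp add: norm_mult)
  also have "\<dots> \<le> C" using f'_le z assms(3) by blast
  finally show "\<bar>Re (deriv f z * e)\<bar> \<le> C" .
qed (use assms Q b in auto)

text \<open>Harmonicity of \<open>h\<close> tested with a difference of trace zero. The test
  function is Re f' in direction 1 and Re (i f') in direction i; the terms with f'' cancel because
  i^2 = -1. As \<open>S\<close> may touch the boundary of the half plane, f' is first translated by
  \<open>d\<close>, which makes it smooth near the closure of \<open>S\<close>; boundedness of f'
  then permits d to tend to 0.\<close>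

lemma orthogonal:
  assumes S: "bounded S" "C1_regular S" "S \<subseteq> half_plane" and tr: "same_trace S a c" "W12 S a" "W12 S c"
  shows "(LINT z|lebesgue_on S. (\<Sum>e\<in>Basis. (weak_partial S e a z - weak_partial S e c z) * h' z e)) = 0"
proof -
  have op: "open S" using S(2) by (simp add: C1_regular_def)
  let ?g = "\<lambda>e z. weak_partial S e a z - weak_partial S e c z" and ?Z = "\<lambda>z. a z - c z"
  have Lg: "L2 S (?g e)" if "e \<in> Basis" for e
    using L2_lincomb[OF W12_weak_partial(2)[OF tr(2) op that] W12_weak_partial(2)[OF tr(3) op that], of 1 "-1"] by simp
  have ig: "integrable (lebesgue_on S) (?g e)" if "e \<in> Basis" for e
    by (rule L2_integrable[OF S(1) op Lg[OF that]])
  have shifted: "(LINT z|lebesgue_on S. ?g 1 z * Re (deriv f (z + of_real d)) + ?g \<i> z * Re (deriv f (z + of_real d) * \<i>)) = 0"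
    if d: "0 < d" for d :: real
  proof -
    define W where "W = {z. - d < Re z}"
    have Wo: "open W" using open_halfspace_gt[of "-d" "1::complex"] by (simp add: W_def inner_complex_def)
    have "closure S \<subseteq> {z. 0 \<le> Re z}"
      using S(3) closed_halfspace_ge[of 0 "1::complex"]
      by (intro closure_minimal) (auto simp: inner_complex_def intro: less_imp_le)
    then have WS: "closure S \<subseteq> W" using d by (auto simp: W_def)
    let ?k = "\<lambda>z. deriv f (z + of_real d)"
    have kh: "?k holomorphic_on W"
    proof -
      have "(\<lambda>z. z + of_real d) holomorphic_on W" by (intro holomorphic_intros)
      moreover have "(\<lambda>z. z + of_real d) ` W \<subseteq> half_plane" by (auto simp: W_def)
      ultimately show ?thesis
        using holomorphic_on_compose_gen[OF _ holomorphic_deriv[OF hol open_half_plane]] by (force simp: o_def)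
    qed
    note C = C1_deriv_Re_holomorphic[OF Wo kh]
    have B: "1 \<in> (Basis :: complex set)" "\<i> \<in> (Basis :: complex set)" by (auto simp: Basis_complex_def)
    obtain K1 k1 where "zero_trace S 1 ?Z (?g 1) K1 k1 W"
      using same_trace_zero_trace[OF S(1,2) Wo WS B(1) tr(1)] by blast
    then interpret z1: zero_trace S 1 ?Z "?g 1" K1 k1 W .
    obtain K2 k2 where "zero_trace S \<i> ?Z (?g \<i>) K2 k2 W"
      using same_trace_zero_trace[OF S(1,2) Wo WS B(2) tr(1)] by blast
    then interpret z2: zero_trace S \<i> ?Z "?g \<i>" K2 k2 W .
    have "(LINT z|lebesgue_on S. ?Z z * Re (1 * (deriv ?k z * 1)) + ?g 1 z * Re (1 * ?k z)) = 0"
      by (rule z1.zero_trace_test[OF C])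
    moreover have "(LINT z|lebesgue_on S. ?Z z * Re (\<i> * (deriv ?k z * \<i>)) + ?g \<i> z * Re (\<i> * ?k z)) = 0"
      by (rule z2.zero_trace_test[OF C])
    moreover note i = z1.test_integrable[OF C[of 1] z1.Z(2,3)] z2.test_integrable[OF C[of \<i>] z2.Z(2,3)]
    ultimately have "(LINT z|lebesgue_on S. (?Z z * Re (1 * (deriv ?k z * 1)) + ?g 1 z * Re (1 * ?k z))
        + (?Z z * Re (\<i> * (deriv ?k z * \<i>)) + ?g \<i> z * Re (\<i> * ?k z))) = 0"
      by (subst Bochner_Integration.integral_add) (auto intro!: Bochner_Integration.integrable_add)
    then show ?thesis by (simp add: mult.commute)
  qed
  define \<delta> where "\<delta> n = 1 / real (Suc n)" for n
  have \<delta>: "0 < \<delta> n" for n by (simp add: \<delta>_def)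
  have \<delta>lim: "(\<lambda>n. z + of_real (\<delta> n)) \<longlonglongrightarrow> z" for z :: complex
    using tendsto_add[OF tendsto_const tendsto_of_real[OF LIMSEQ_inverse_real_of_nat], of z]
    by (simp add: \<delta>_def[abs_def] inverse_eq_divide)
  have dc: "continuous_on half_plane (deriv f)"
    by (intro holomorphic_on_imp_continuous_on holomorphic_deriv hol open_half_plane)
  have C0: "0 \<le> C" using order_trans[OF norm_ge_zero f'_le[of 1]] by simp
  define G where "G r z = ?g 1 z * Re (deriv f (z + of_real r)) + ?g \<i> z * Re (deriv f (z + of_real r) * \<i>)" for r :: real and z
  have B: "1 \<in> (Basis :: complex set)" "\<i> \<in> (Basis :: complex set)" by (auto simp: Basis_complex_def)
  have sub: "z + of_real d \<in> half_plane" if "z \<in> S" "0 \<le> d" for z d using that S(3) by auto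
  have contF: "continuous_on S (\<lambda>z. Re (deriv f (z + of_real d) * v))" if "0 \<le> d" for d v
    using sub[OF _ that] by (intro continuous_intros continuous_on_compose2[OF dc]) auto
  have measF: "G d \<in> borel_measurable (lebesgue_on S)" if "0 \<le> d" for d
    unfolding G_def[abs_def] using contF[OF that, of 1] contF[OF that, of \<i>] op
    by (intro borel_measurable_add borel_measurable_times borel_measurable_integrable ig B
        continuous_imp_measurable_on_sets_lebesgue) auto
  have "(\<lambda>n. LINT z|lebesgue_on S. G (\<delta> n) z) \<longlonglongrightarrow> (LINT z|lebesgue_on S. G 0 z)"
  proof (rule integral_dominated_convergence[where w = "\<lambda>z. \<bar>?g 1 z\<bar> * C + \<bar>?g \<i> z\<bar> * C"])
    show "integrable (lebesgue_on S) (\<lambda>z. \<bar>?g 1 z\<bar> * C + \<bar>?g \<i> z\<bar> * C)" using ig B by simp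
    show "G 0 \<in> borel_measurable (lebesgue_on S)" by (rule measF) simp
    show "G (\<delta> n) \<in> borel_measurable (lebesgue_on S)" for n using measF \<delta> less_imp_le by blast
    show "AE z in lebesgue_on S. (\<lambda>n. G (\<delta> n) z) \<longlonglongrightarrow> G 0 z"
    proof (intro AE_I2)
      fix z assume "z \<in> space (lebesgue_on S)"
      then have z: "z \<in> half_plane" using S(3) by auto
      have "isCont (deriv f) z" using dc open_half_plane z by (simp add: continuous_on_eq_continuous_at)
      then have "(\<lambda>n. deriv f (z + of_real (\<delta> n))) \<longlonglongrightarrow> deriv f z"
        using \<delta>lim by (rule isCont_tendsto_compose)
      then show "(\<lambda>n. G (\<delta> n) z) \<longlonglongrightarrow> G 0 z" unfolding G_def by (auto intro!: tendsto_intros)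
    qed
    fix n
    show "AE z in lebesgue_on S. norm (G (\<delta> n) z) \<le> \<bar>?g 1 z\<bar> * C + \<bar>?g \<i> z\<bar> * C"
    proof (intro AE_I2)
      fix z assume "z \<in> space (lebesgue_on S)"
      then have "norm (deriv f (z + of_real (\<delta> n))) \<le> C" using sub[of z "\<delta> n"] \<delta>[of n] f'_le by simp
      then have b: "\<bar>Re (deriv f (z + of_real (\<delta> n)))\<bar> \<le> C" "\<bar>Re (deriv f (z + of_real (\<delta> n)) * \<i>)\<bar> \<le> C"
        using abs_Re_le_cmod[of "deriv f (z + of_real (\<delta> n))"] abs_Re_le_cmod[of "deriv f (z + of_real (\<delta> n)) * \<i>"]
        by (auto simp: norm_mult)
      show "norm (G (\<delta> n) z) \<le> \<bar>?g 1 z\<bar> * C + \<bar>?g \<i> z\<bar> * C"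
        unfolding real_norm_def G_def
        by (rule order_trans[OF abs_triangle_ineq]) (unfold abs_mult, intro add_mono mult_left_mono b, auto)
    qed
  qed
  moreover have "(LINT z|lebesgue_on S. G (\<delta> n) z) = 0" for n
    unfolding G_def by (rule shifted[OF \<delta>])
  ultimately have "(LINT z|lebesgue_on S. G 0 z) = 0" by (simp add: LIMSEQ_const_iff)
  then show ?thesis by (simp add: G_def Basis_complex_def)
qed

theorem energy_le:
  assumes S: "bounded S" "C1_regular S" "S \<subseteq> half_plane" and v: "W12Q Q S v" and tr: "same_traceQ Q S u v"
  shows "dirichlet_energy Q S u \<le> dirichlet_energy Q S v"
proof -
  have op: "open S" using S(2) by (simp add: C1_regular_def)
  interpret B: bounded_C1 S h h' C Q b by (rule bounded_C1_u[OF op S(1,3)])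
  let ?T = "diag Q b 2"
  let ?a = "\<lambda>x. qdist Q (u x) ?T" and ?c = "\<lambda>x. qdist Q (v x) ?T"
  let ?A = "\<lambda>e. weak_partial S e ?a" and ?C = "\<lambda>e. weak_partial S e ?c"
  have a: "W12 S ?a" by (rule B.qdist_u_W12(1)) simp
  have c: "W12 S ?c" using v by (simp add: W12Q_def)
  have tr1: "same_trace S ?a ?c" using tr by (simp add: same_traceQ_def)
  note LA = W12_weak_partial(2)[OF a op] and LC = W12_weak_partial(2)[OF c op]
  have ae: "AE x in lebesgue_on S. \<forall>e\<in>Basis. ?A e x = - sqrt (real Q) * h' x e"
    using B.weak_partial_pole by (subst AE_ball_countable) (auto simp: countable_finite)
  have mA: "(\<lambda>x. \<Sum>e\<in>Basis. (?A e x)\<^sup>2) \<in> borel_measurable (lebesgue_on S)"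
    by (intro borel_measurable_sum borel_measurable_power L2D(1) LA)
  have mh: "(\<lambda>x. h' x e) \<in> borel_measurable (lebesgue_on S)" for e
    by (rule B.measurable_cont[OF C1_deriv_contD[OF B.h]])
  have iA: "integrable (lebesgue_on S) (\<lambda>x. \<Sum>e\<in>Basis. (?A e x)\<^sup>2)"
    by (intro Bochner_Integration.integrable_sum L2D(2) LA)
  have iC: "integrable (lebesgue_on S) (\<lambda>x. \<Sum>e\<in>Basis. (?C e x)\<^sup>2)"
    by (intro Bochner_Integration.integrable_sum L2D(2) LC)
  have iAC: "integrable (lebesgue_on S) (\<lambda>x. \<Sum>e\<in>Basis. ?C e x * ?A e x)"
    by (intro Bochner_Integration.integrable_sum L2_mult_integrable LA LC)
  have "dirichlet_energy Q S u = (LINT x|lebesgue_on S. real Q * (\<Sum>e\<in>Basis. (h' x e)\<^sup>2))"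
    by (simp add: B.dirichlet_energy_u)
  also have "\<dots> = (LINT x|lebesgue_on S. (\<Sum>e\<in>Basis. (?A e x)\<^sup>2))"
    using ae mA mh by (intro integral_cong_AE) (auto elim!: eventually_mono simp: power_mult_distrib sum_distrib_left)
  finally have eu: "dirichlet_energy Q S u = (LINT x|lebesgue_on S. (\<Sum>e\<in>Basis. (?A e x)\<^sup>2))" .
  \<comment> \<open>Orthogonality in the form that the integrals of A^2 and of C A agree,
    \<open>A\<close> and \<open>C\<close> being the gradients of the two distance functions. With 2
    C A \<le> C^2 + A^2 this bounds the energy of the first by that of the second.\<close>
  have "(LINT x|lebesgue_on S. (\<Sum>e\<in>Basis. (?A e x)\<^sup>2) - (\<Sum>e\<in>Basis. ?C e x * ?A e x))
      = (LINT x|lebesgue_on S. - sqrt (real Q) * (\<Sum>e\<in>Basis. (?A e x - ?C e x) * h' x e))"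
  proof (rule integral_cong_AE)
    show "(\<lambda>x. - sqrt (real Q) * (\<Sum>e\<in>Basis. (?A e x - ?C e x) * h' x e)) \<in> borel_measurable (lebesgue_on S)"
      by (intro borel_measurable_times borel_measurable_const borel_measurable_sum borel_measurable_diff L2D(1) LA LC mh)
    show "AE x in lebesgue_on S. (\<Sum>e\<in>Basis. (?A e x)\<^sup>2) - (\<Sum>e\<in>Basis. ?C e x * ?A e x)
        = - sqrt (real Q) * (\<Sum>e\<in>Basis. (?A e x - ?C e x) * h' x e)"
      using ae
    proof eventually_elim
      case (elim x)
      have "(?A e x)\<^sup>2 - ?C e x * ?A e x = - sqrt (real Q) * ((?A e x - ?C e x) * h' x e)" if "e \<in> Basis" for e
      proof -
        have "(?A e x)\<^sup>2 - ?C e x * ?A e x = (?A e x - ?C e x) * ?A e x" by (simp add: power2_eq_square algebra_simps)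
        also have "\<dots> = (?A e x - ?C e x) * (- sqrt (real Q) * h' x e)" using elim that by simp
        finally show ?thesis by (simp add: mult_ac)
      qed
      then show ?case by (simp add: sum_subtractf[symmetric] sum_distrib_left)
    qed
  qed (use iA iAC in auto)
  also have "\<dots> = 0" using orthogonal[OF S tr1 a c] by simp
  finally have zero: "(LINT x|lebesgue_on S. (\<Sum>e\<in>Basis. (?A e x)\<^sup>2)) = (LINT x|lebesgue_on S. (\<Sum>e\<in>Basis. ?C e x * ?A e x))"
    using iA iAC by simp
  have "(LINT x|lebesgue_on S. 2 * (\<Sum>e\<in>Basis. ?C e x * ?A e x)) \<le> (LINT x|lebesgue_on S. (\<Sum>e\<in>Basis. (?C e x)\<^sup>2) + (\<Sum>e\<in>Basis. (?A e x)\<^sup>2))"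
  proof (rule integral_mono)
    fix x
    show "2 * (\<Sum>e\<in>Basis. ?C e x * ?A e x) \<le> (\<Sum>e\<in>Basis. (?C e x)\<^sup>2) + (\<Sum>e\<in>Basis. (?A e x)\<^sup>2)"
      unfolding sum.distrib[symmetric] sum_distrib_left
      by (intro sum_mono) (use sum_squares_bound in \<open>simp add: mult.assoc\<close>)
  qed (use iA iC iAC in auto)
  then have "2 * (LINT x|lebesgue_on S. (\<Sum>e\<in>Basis. ?C e x * ?A e x))
      \<le> (LINT x|lebesgue_on S. (\<Sum>e\<in>Basis. (?C e x)\<^sup>2)) + (LINT x|lebesgue_on S. (\<Sum>e\<in>Basis. (?A e x)\<^sup>2))"
    using iA iC iAC by simp
  then have "dirichlet_energy Q S u \<le> (LINT x|lebesgue_on S. (\<Sum>e\<in>Basis. (?C e x)\<^sup>2))" using zero eu by linarith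
  also have "\<dots> \<le> dirichlet_energy Q S v" by (rule dirichlet_energy_ge[OF v op]) simp
  finally show ?thesis .
qed

end

section \<open>A flat holomorphic function\<close>

lemma exp_minus_le_power:
  fixes y :: real
  assumes "0 < y"
  shows "exp (- y) \<le> fact n / y ^ n"
proof -
  have s: "(\<lambda>n. y ^ n /\<^sub>R fact n) sums exp y" by (rule exp_converges)
  have "(\<Sum>k\<in>{n}. y ^ k /\<^sub>R fact k) \<le> (\<Sum>k. y ^ k /\<^sub>R fact k)"
    using assms by (intro sum_le_suminf sums_summable[OF s]) auto
  then have "y ^ n / fact n \<le> exp y"
    using sums_unique[OF s] by (simp add: inverse_eq_divide)
  then show ?thesis using assms by (simp add: exp_minus field_simps)
qed

text \<open>With M \<tau> \<ge> N, the term of order \<open>M\<close> of the exponential series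
  already beats x^(-N).\<close>

lemma exp_flat:
  fixes a \<tau> :: real
  assumes "0 < a" "0 < \<tau>"
  obtains C where "0 \<le> C" "\<And>x. 0 < x \<Longrightarrow> x \<le> 1 \<Longrightarrow> exp (- (a * x powr - \<tau>)) \<le> C * x ^ N"
proof -
  obtain M where M: "real N / \<tau> < real M" using reals_Archimedean2 by blast
  show ?thesis
  proof (rule that[of "fact M / a ^ M"])
    show "0 \<le> fact M / a ^ M" using assms by simp
    fix x :: real assume x: "0 < x" "x \<le> 1"
    have NM: "real N \<le> \<tau> * real M" using M assms(2) by (simp add: field_simps)
    have "exp (- (a * x powr - \<tau>)) \<le> fact M / (a * x powr - \<tau>) ^ M"
      using assms x by (intro exp_minus_le_power) simp
    also have "(a * x powr - \<tau>) ^ M = a ^ M * x powr (- (\<tau> * real M))"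
      using x by (simp add: power_mult_distrib powr_power mult.commute)
    also have "fact M / (a ^ M * x powr (- (\<tau> * real M))) = fact M / a ^ M * x powr (\<tau> * real M)"
      using x by (simp add: powr_minus field_simps)
    also have "\<dots> \<le> fact M / a ^ M * x powr (real N)"
      using x assms NM by (intro mult_left_mono powr_mono') auto
    finally show "exp (- (a * x powr - \<tau>)) \<le> fact M / a ^ M * x ^ N"
      using x by (simp add: powr_realpow)
  qed
qed

text \<open>\<open>\<eta>\<close> widens the half plane to a sector, and \<open>angle\<close> says
  that the power -\<beta> followed by the rotation by -\<psi> maps this sector into the open right
  half plane. \<open>blowup\<close> is all that is required of the joint distribution of poles and
  weights.\<close>

locale flat_data =
  fixes E :: "real set" and p c :: "nat \<Rightarrow> real" and \<beta> \<psi> \<eta> A \<tau> :: real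
  assumes E: "compact E" "E \<noteq> {}" and p: "\<And>n. p n \<in> E" and c: "\<And>n. 0 \<le> c n" "summable c"
    and \<beta>: "0 < \<beta>" "\<beta> < 1" and \<psi>: "0 < \<psi>" and \<eta>: "0 < \<eta>" "\<eta> < pi / 2" and angle: "\<psi> + \<beta> * (pi / 2 + \<eta>) < pi / 2"
    and A: "0 < A" "0 < \<tau>"
    and blowup: "\<And>z. 0 < infdist z ((\<lambda>y. - \<i> * of_real y) ` E) \<Longrightarrow> infdist z ((\<lambda>y. - \<i> * of_real y) ` E) \<le> 1 \<Longrightarrow>
      A * infdist z ((\<lambda>y. - \<i> * of_real y) ` E) powr - \<tau> \<le> (\<Sum>n. c n * norm (z + \<i> * of_real (p n)) powr - \<beta>)"
begin

definition P :: "complex set" where "P = (\<lambda>y. - \<i> * of_real y) ` E"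

definition q :: "nat \<Rightarrow> complex" where "q n = - \<i> * of_real (p n)"

abbreviation d :: "complex \<Rightarrow> real" where "d z \<equiv> infdist z P"

lemma P: "compact P" "P \<noteq> {}"
  unfolding P_def using E by (auto intro!: compact_continuous_image continuous_intros)

lemma q_in_P: "q n \<in> P" using p by (simp add: P_def q_def)

lemma Re_P: "y \<in> P \<Longrightarrow> Re y = 0" by (auto simp: P_def)

lemma d_pos: "z \<notin> P \<Longrightarrow> 0 < d z"
  using P by (simp add: compact_imp_closed infdist_pos_not_in_closed)

text \<open>The solution of lam = sin \<eta> (1 - lam). A point within lam d z of some z in the
  closed half plane keeps distance at least (1 - lam) d z from every y in P, so its real part
  relative to y is at least -sin \<eta> times its distance from y.\<close>

definition lam :: real where "lam = sin \<eta> / (1 + sin \<eta>)"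

lemma sin_\<eta>: "0 < sin \<eta>" "sin \<eta> < 1"
proof -
  show "0 < sin \<eta>" using \<eta> by (intro sin_gt_zero) auto
  have "sin \<eta> < sin (pi / 2)" using \<eta> by (intro sin_monotone_2pi) auto
  then show "sin \<eta> < 1" by simp
qed

lemma lam: "0 < lam" "lam < 1" "lam = sin \<eta> * (1 - lam)"
  using sin_\<eta> by (auto simp: lam_def field_simps)

text \<open>A neighbourhood of the closed half plane without \<open>P\<close> whose width is
  proportional to the distance from \<open>P\<close>: it has room for Cauchy's inequality at
  boundary points and stays in the sector of every pole.\<close>

definition V :: "complex set" where
  "V = (\<Union>z\<in>{z. 0 \<le> Re z \<and> z \<notin> P}. ball z (lam * d z))"

lemma open_V: "open V" by (simp add: V_def open_UN)

lemma closed_half_in_V: "0 \<le> Re z \<Longrightarrow> z \<notin> P \<Longrightarrow> z \<in> V"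
  unfolding V_def using d_pos lam by (auto intro!: bexI[of _ z])

lemma half_in_V: "half_plane \<subseteq> V"
proof
  fix z assume "z \<in> half_plane"
  then have "0 \<le> Re z" "z \<notin> P" using Re_P by auto
  then show "z \<in> V" by (rule closed_half_in_V)
qed

lemma V_sector:
  assumes "z \<in> V" "y \<in> P"
  shows "- (sin \<eta> * norm (z - y)) \<le> Re (z - y)" "z \<noteq> y"
proof -
  obtain z0 where z0: "0 \<le> Re z0" "z0 \<notin> P" "dist z0 z < lam * d z0" using assms by (auto simp: V_def)
  have d0: "0 < d z0" by (rule d_pos[OF z0(2)])
  have "d z0 \<le> dist z0 y" by (rule infdist_le[OF assms(2)])
  also have "\<dots> \<le> dist z0 z + dist z y" by (rule dist_triangle)
  finally have "(1 - lam) * d z0 \<le> norm (z - y)" using z0(3) by (simp add: dist_norm algebra_simps)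
  moreover have "0 < (1 - lam) * d z0" using lam d0 by simp
  ultimately show "z \<noteq> y" by auto
  have "lam * d z0 = sin \<eta> * ((1 - lam) * d z0)" using lam(3) by (simp add: mult.assoc[symmetric])
  also have "\<dots> \<le> sin \<eta> * norm (z - y)"
    using \<open>(1 - lam) * d z0 \<le> norm (z - y)\<close> sin_\<eta> by (intro mult_left_mono) auto
  finally have "lam * d z0 \<le> sin \<eta> * norm (z - y)" .
  moreover have "\<bar>Re z0 - Re z\<bar> \<le> dist z0 z" using abs_Re_le_cmod[of "z0 - z"] by (simp add: dist_norm)
  ultimately show "- (sin \<eta> * norm (z - y)) \<le> Re (z - y)" using z0 Re_P[OF assms(2)] by auto
qed

lemma V_not_P: "z \<in> V \<Longrightarrow> z \<notin> P" using V_sector(2) by blast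

text \<open>The rotated power e^(-i \<psi>) w^(-\<beta>) with the principal logarithm; if w has
  argument a, this has argument -(\<psi> + \<beta> a).\<close>

definition kern :: "complex \<Rightarrow> complex" where
  "kern w = exp (- \<i> * of_real \<psi> - of_real \<beta> * Ln w)"

definition \<kappa> :: real where "\<kappa> = cos (\<psi> + \<beta> * (pi / 2 + \<eta>))"

lemma \<kappa>_pos: "0 < \<kappa>"
proof -
  have "0 < \<psi> + \<beta> * (pi / 2 + \<eta>)" using \<psi> \<beta> \<eta> by (intro add_pos_pos mult_pos_pos) auto
  then show ?thesis unfolding \<kappa>_def using angle by (intro cos_gt_zero_pi) auto
qed

lemma norm_kern: "w \<noteq> 0 \<Longrightarrow> norm (kern w) = norm w powr - \<beta>"
  by (simp add: kern_def powr_def)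

lemma Re_kern: "w \<noteq> 0 \<Longrightarrow> Re (kern w) = norm w powr - \<beta> * cos (\<psi> + \<beta> * Im (Ln w))"
  by (simp add: kern_def powr_def Re_exp cos_minus[of "\<psi> + \<beta> * Im (Ln w)", symmetric] del: cos_minus)

text \<open>The hypothesis bounds the cosine of the argument from below by cos (pi/2 + \<eta>), and
  the cosine decreases on [0, pi].\<close>

lemma Im_Ln_sector:
  assumes "w \<noteq> 0" "- (sin \<eta> * norm w) \<le> Re w"
  shows "\<bar>Im (Ln w)\<bar> \<le> pi / 2 + \<eta>"
proof -
  have "Re w = norm w * cos (Im (Ln w))"
    using assms(1) exp_Ln[OF assms(1)] Re_exp[of "Ln w"] by simp
  then have "norm w * (- sin \<eta>) \<le> norm w * cos (Im (Ln w))" using assms(2) by (simp add: mult.commute)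
  then have "- sin \<eta> \<le> cos (Im (Ln w))" using assms(1) mult_le_cancel_left_pos[of "norm w" "- sin \<eta>"] by simp
  then have "cos (pi / 2 + \<eta>) \<le> cos \<bar>Im (Ln w)\<bar>" by (simp add: cos_add)
  moreover have "\<bar>Im (Ln w)\<bar> \<le> pi" using mpi_less_Im_Ln[OF assms(1)] Im_Ln_le_pi[OF assms(1)] by auto
  ultimately show ?thesis using \<eta> cos_mono_le_eq[of "pi / 2 + \<eta>" "\<bar>Im (Ln w)\<bar>"] by auto
qed

lemma Re_kern_ge:
  assumes "w \<noteq> 0" "- (sin \<eta> * norm w) \<le> Re w"
  shows "\<kappa> * norm w powr - \<beta> \<le> Re (kern w)"
proof -
  have "\<bar>\<psi> + \<beta> * Im (Ln w)\<bar> \<le> \<psi> + \<beta> * \<bar>Im (Ln w)\<bar>"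
    using \<psi> \<beta> abs_triangle_ineq[of \<psi> "\<beta> * Im (Ln w)"] by (simp add: abs_mult)
  also have "\<dots> \<le> \<psi> + \<beta> * (pi / 2 + \<eta>)" using Im_Ln_sector[OF assms] \<beta> by simp
  finally have le: "\<bar>\<psi> + \<beta> * Im (Ln w)\<bar> \<le> \<psi> + \<beta> * (pi / 2 + \<eta>)" .
  have "\<kappa> \<le> cos \<bar>\<psi> + \<beta> * Im (Ln w)\<bar>"
    unfolding \<kappa>_def using le angle by (intro cos_monotone_0_pi_le) auto
  then have "\<kappa> \<le> cos (\<psi> + \<beta> * Im (Ln w))" by simp
  then show ?thesis using assms(1) by (simp add: Re_kern mult.commute[of \<kappa>] mult_left_mono)
qed

lemma kern_has_field_derivative:
  assumes "w \<notin> \<real>\<^sub>\<le>\<^sub>0"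
  shows "(kern has_field_derivative - of_real \<beta> / w * kern w) (at w)"
  unfolding kern_def[abs_def] using assms
  by (auto intro!: derivative_eq_intros simp: divide_inverse)

lemma V_minus_q:
  assumes "z \<in> V"
  shows "z - q n \<noteq> 0" "z - q n \<notin> \<real>\<^sub>\<le>\<^sub>0" "d z \<le> norm (z - q n)" "\<kappa> * norm (z - q n) powr - \<beta> \<le> Re (kern (z - q n))"
proof -
  note s = V_sector[OF assms q_in_P[of n]]
  show 0: "z - q n \<noteq> 0" using s(2) by simp
  show "z - q n \<notin> \<real>\<^sub>\<le>\<^sub>0"
  proof
    assume "z - q n \<in> \<real>\<^sub>\<le>\<^sub>0"
    then have "Re (z - q n) \<le> 0" "Im (z - q n) = 0" by (auto simp: complex_nonpos_Reals_iff)
    then have "norm (z - q n) = - Re (z - q n)" by (simp add: cmod_eq_Re)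
    moreover have "0 < norm (z - q n)" using 0 by simp
    ultimately have "norm (z - q n) \<le> sin \<eta> * norm (z - q n)" using s(1) by linarith
    then show False using sin_\<eta> \<open>0 < norm (z - q n)\<close> by (simp add: mult_le_cancel_right1)
  qed
  show "d z \<le> norm (z - q n)" using infdist_le[OF q_in_P[of n], of z] by (simp add: dist_norm)
  show "\<kappa> * norm (z - q n) powr - \<beta> \<le> Re (kern (z - q n))" by (rule Re_kern_ge[OF 0 s(1)])
qed

definition F :: "complex \<Rightarrow> complex" where "F z = (\<Sum>n. of_real (c n) * kern (z - q n))"
definition F' :: "complex \<Rightarrow> complex" where
  "F' z = (\<Sum>n. of_real (c n) * (- of_real \<beta> / (z - q n) * kern (z - q n)))"

lemma F_derivative:
  assumes "z \<in> V"
  shows "(\<lambda>n. of_real (c n) * kern (z - q n)) sums F z"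
    "(\<lambda>n. of_real (c n) * (- of_real \<beta> / (z - q n) * kern (z - q n))) sums F' z"
    "(F has_field_derivative F' z) (at z)"
proof -
  have "\<exists>g g'. \<forall>x\<in>V. ((\<lambda>n. of_real (c n) * kern (x - q n)) sums g x) \<and>
      ((\<lambda>n. of_real (c n) * (- of_real \<beta> / (x - q n) * kern (x - q n))) sums g' x) \<and> (g has_field_derivative g' x) (at x)"
  proof (rule series_and_derivative_comparison_complex[OF open_V])
    fix n x assume x: "x \<in> V"
    have "((\<lambda>x. kern (x - q n)) has_field_derivative (- of_real \<beta> / (x - q n) * kern (x - q n)) * 1) (at x)"
      by (rule DERIV_chain2[where f = kern and g = "\<lambda>x. x - q n", OF kern_has_field_derivative[OF V_minus_q(2)[OF x]]]) (auto intro!: derivative_eq_intros)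
    then show "((\<lambda>x. of_real (c n) * kern (x - q n)) has_field_derivative
        of_real (c n) * (- of_real \<beta> / (x - q n) * kern (x - q n))) (at x)"
      using DERIV_cmult by fastforce
  next
    fix x assume x: "x \<in> V"
    have d0: "0 < d x" using x V_not_P d_pos by blast
    show "\<exists>e h. 0 < e \<and> summable h \<and> range h \<subseteq> \<real>\<^sub>\<ge>\<^sub>0 \<and>
        (\<forall>\<^sub>F n in sequentially. \<forall>y\<in>ball x e \<inter> V. cmod (of_real (c n) * kern (y - q n)) \<le> cmod (h n))"
    \<comment> \<open>On a ball of half the distance to \<open>P\<close> all poles are at distance
      at least d x / 2, so a multiple of the weights dominates the terms.\<close>
    proof (intro exI[of _ "d x / 2"] exI[of _ "\<lambda>n. of_real (c n * (d x / 2) powr - \<beta>)"] conjI)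
      show "0 < d x / 2" using d0 by simp
      show "summable (\<lambda>n. of_real (c n * (d x / 2) powr - \<beta>) :: complex)"
        by (intro summable_of_real summable_mult2 c(2))
      show "range (\<lambda>n. of_real (c n * (d x / 2) powr - \<beta>) :: complex) \<subseteq> \<real>\<^sub>\<ge>\<^sub>0" using c(1) by auto
      show "\<forall>\<^sub>F n in sequentially. \<forall>y\<in>ball x (d x / 2) \<inter> V. cmod (of_real (c n) * kern (y - q n)) \<le> cmod (of_real (c n * (d x / 2) powr - \<beta>))"
      proof (intro always_eventually allI ballI)
        fix n y assume y: "y \<in> ball x (d x / 2) \<inter> V"
        have "d x \<le> dist x y + dist y (q n)"
          using infdist_le[OF q_in_P[of n], of x] dist_triangle[of x "q n" y] by simp
        then have "d x / 2 \<le> norm (y - q n)" using y by (simp add: dist_norm)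
        then have "norm (y - q n) powr - \<beta> \<le> (d x / 2) powr - \<beta>"
          using d0 \<beta> by (intro powr_mono2') auto
        then show "cmod (of_real (c n) * kern (y - q n)) \<le> cmod (of_real (c n * (d x / 2) powr - \<beta>))"
          using c(1)[of n] y V_minus_q(1)[of y n] norm_kern[of "y - q n"]
          by (simp add: norm_mult mult_left_mono)
      qed
    qed
  qed
  then obtain g g' where g: "\<And>x. x \<in> V \<Longrightarrow> (\<lambda>n. of_real (c n) * kern (x - q n)) sums g x"
    "\<And>x. x \<in> V \<Longrightarrow> (\<lambda>n. of_real (c n) * (- of_real \<beta> / (x - q n) * kern (x - q n))) sums g' x"
    "\<And>x. x \<in> V \<Longrightarrow> (g has_field_derivative g' x) (at x)" by blast
  have gF: "g x = F x" "g' x = F' x" if "x \<in> V" for x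
    using sums_unique[OF g(1)[OF that]] sums_unique[OF g(2)[OF that]] by (auto simp: F_def F'_def)
  show "(\<lambda>n. of_real (c n) * kern (z - q n)) sums F z"
    "(\<lambda>n. of_real (c n) * (- of_real \<beta> / (z - q n) * kern (z - q n))) sums F' z"
    using g(1,2)[OF assms] gF[OF assms] by auto
  have "(g has_field_derivative F' z) (at z)" using g(3)[OF assms] gF[OF assms] by simp
  then show "(F has_field_derivative F' z) (at z)"
    by (rule has_field_derivative_transform_within_open[OF _ open_V assms]) (rule gF)
qed

section \<open>The flat function and its derivatives near the poles\<close>

definition f :: "complex \<Rightarrow> complex" where "f z = exp (- F z)"

lemma f_derivative: "z \<in> V \<Longrightarrow> (f has_field_derivative - F' z * f z) (at z)"
  unfolding f_def[abs_def] using F_derivative(3) by (auto intro!: derivative_eq_intros)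

lemma f_holomorphic: "f holomorphic_on V"
  using f_derivative by (auto simp: holomorphic_on_def field_differentiable_def intro: has_field_derivative_at_within)

lemma deriv_f: "z \<in> V \<Longrightarrow> deriv f z = - F' z * f z"
  by (rule DERIV_imp_deriv[OF f_derivative])

lemma norm_f: "norm (f z) = exp (- Re (F z))"
  by (simp add: f_def)

lemma Re_F_ge:
  assumes "z \<in> V"
  shows "summable (\<lambda>n. c n * norm (z - q n) powr - \<beta>)" "\<kappa> * (\<Sum>n. c n * norm (z - q n) powr - \<beta>) \<le> Re (F z)"
proof -
  have d0: "0 < d z" using assms V_not_P d_pos by blast
  show s: "summable (\<lambda>n. c n * norm (z - q n) powr - \<beta>)"
  proof (rule summable_comparison_test'[OF summable_mult2[OF c(2), of "d z powr - \<beta>"]])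
    fix n
    have "norm (z - q n) powr - \<beta> \<le> d z powr - \<beta>"
      using d0 \<beta> V_minus_q(3)[OF assms] by (intro powr_mono2') auto
    then show "norm (c n * norm (z - q n) powr - \<beta>) \<le> c n * d z powr - \<beta>"
      using c(1)[of n] by (simp add: mult_left_mono)
  qed
  have s1: "(\<lambda>n. Re (of_real (c n) * kern (z - q n))) sums Re (F z)" by (rule sums_Re[OF F_derivative(1)[OF assms]])
  have s2: "(\<lambda>n. \<kappa> * (c n * norm (z - q n) powr - \<beta>)) sums (\<kappa> * (\<Sum>n. c n * norm (z - q n) powr - \<beta>))"
    by (intro sums_mult summable_sums s)
  have le: "\<kappa> * (c n * norm (z - q n) powr - \<beta>) \<le> Re (of_real (c n) * kern (z - q n))" for n
    using mult_left_mono[OF V_minus_q(4)[OF assms, of n] c(1)[of n]] by (simp add: mult_ac)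
  show "\<kappa> * (\<Sum>n. c n * norm (z - q n) powr - \<beta>) \<le> Re (F z)" by (rule sums_le[OF le s2 s1])
qed

lemma Re_F_nonneg:
  assumes "z \<in> V"
  shows "0 \<le> Re (F z)"
proof -
  have "0 \<le> (\<Sum>n. c n * norm (z - q n) powr - \<beta>)"
    by (rule suminf_nonneg[OF Re_F_ge(1)[OF assms]]) (simp add: c(1))
  then have "0 \<le> \<kappa> * (\<Sum>n. c n * norm (z - q n) powr - \<beta>)" using \<kappa>_pos by simp
  also note Re_F_ge(2)[OF assms]
  finally show ?thesis .
qed

lemma norm_f_le_1: "z \<in> V \<Longrightarrow> norm (f z) \<le> 1"
  using Re_F_nonneg by (simp add: norm_f)

lemma norm_f_flat:
  assumes "z \<in> V" "d z \<le> 1"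
  shows "norm (f z) \<le> exp (- (\<kappa> * A * d z powr - \<tau>))"
proof -
  have d0: "0 < d z" using assms V_not_P d_pos by blast
  have zq: "z - q n = z + \<i> * of_real (p n)" for n by (simp add: q_def)
  have "A * d z powr - \<tau> \<le> (\<Sum>n. c n * norm (z - q n) powr - \<beta>)"
    unfolding zq using blowup[of z, folded P_def] d0 assms(2) by blast
  then have "\<kappa> * (A * d z powr - \<tau>) \<le> \<kappa> * (\<Sum>n. c n * norm (z - q n) powr - \<beta>)"
    using \<kappa>_pos by (intro mult_left_mono) auto
  also have "\<dots> \<le> Re (F z)" by (rule Re_F_ge(2)[OF assms(1)])
  finally show ?thesis by (simp add: norm_f mult.assoc)
qed

text \<open>Cauchy's inequality on balls of radius proportional to the distance from \<open>P\<close>.\<close>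

lemma higher_deriv_f_le:
  obtains C where "0 \<le> C" "\<And>z. 0 \<le> Re z \<Longrightarrow> z \<notin> P \<Longrightarrow> norm ((deriv ^^ j) f z) \<le> C * (min 1 (d z))\<^sup>2"
proof -
  \<comment> \<open>Cauchy's inequality costs \<open>j\<close> powers of the distance; of the
    exponent \<open>j + 2\<close> two remain.\<close>
  obtain C0 where C0: "0 \<le> C0" "\<And>x. 0 < x \<Longrightarrow> x \<le> 1 \<Longrightarrow> exp (- (\<kappa> * A * x powr - \<tau>)) \<le> C0 * x ^ (j + 2)"
    using exp_flat[of "\<kappa> * A" \<tau> "j + 2"] \<kappa>_pos A by auto
  have cauchy: "norm ((deriv ^^ j) f z) \<le> fact j * B / (lam * d z / 2) ^ j"
    if z: "0 \<le> Re z" "z \<notin> P" and B: "\<And>w. dist z w \<le> lam * d z / 2 \<Longrightarrow> w \<in> V \<Longrightarrow> norm (f w) \<le> B" for z B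
  proof (rule Cauchy_inequality)
    have d0: "0 < d z" by (rule d_pos[OF z(2)])
    have "lam * d z / 2 < lam * d z" using d0 lam by simp
    then have "cball z (lam * d z / 2) \<subseteq> ball z (lam * d z)" by (simp add: cball_subset_ball_iff)
    also have "\<dots> \<subseteq> V" unfolding V_def using z by blast
    finally have sub: "cball z (lam * d z / 2) \<subseteq> V" .
    then show "f holomorphic_on ball z (lam * d z / 2)" using f_holomorphic by (meson ball_subset_cball holomorphic_on_subset order_trans)
    show "continuous_on (cball z (lam * d z / 2)) f"
      using sub f_holomorphic by (meson holomorphic_on_imp_continuous_on holomorphic_on_subset)
    show "0 < lam * d z / 2" using d0 lam by simp
    show "norm (f w) \<le> B" if w: "norm (z - w) = lam * d z / 2" for w
    proof (rule B)
      show "dist z w \<le> lam * d z / 2" using w by (simp add: dist_norm)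
      then show "w \<in> V" using sub by auto
    qed
  qed
  \<comment> \<open>The first entry belongs to points near \<open>P\<close>, where flatness is used
    on a ball with d w \<le> 2 d z \<le> 1. The second belongs to the others, where |f| \<le> 1 is
    used and the minimum of 1 and d z exceeds 1/2.\<close>
  define C where "C = max (fact j * C0 * 2 ^ (j + 2) * (2 / lam) ^ j) (4 * (fact j * (4 / lam) ^ j))"
  show ?thesis
  proof (rule that[of C])
    have "0 \<le> 4 * (fact j * (4 / lam) ^ j)" using lam by simp
    then show C_nonneg: "0 \<le> C" unfolding C_def by (rule max.coboundedI2)
    fix z assume z: "0 \<le> Re z" "z \<notin> P"
    have d0: "0 < d z" by (rule d_pos[OF z(2)])
    show "norm ((deriv ^^ j) f z) \<le> C * (min 1 (d z))\<^sup>2"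
    proof (cases "2 * d z \<le> 1")
      case True
      have "norm ((deriv ^^ j) f z) \<le> fact j * (C0 * (2 * d z) ^ (j + 2)) / (lam * d z / 2) ^ j"
      proof (rule cauchy[OF z])
        fix w assume w: "dist z w \<le> lam * d z / 2" "w \<in> V"
        have "d w \<le> d z + dist w z" by (rule infdist_triangle)
        also have "\<dots> \<le> d z + d z"
        proof -
          have "lam * d z \<le> 1 * d z" using lam d0 by (intro mult_right_mono) auto
          then have "dist z w \<le> d z" using w(1) d0 by linarith
          then show ?thesis by (simp add: dist_commute)
        qed
        finally have dw: "d w \<le> 2 * d z" by simp
        have dw0: "0 < d w" using w(2) V_not_P d_pos by blast
        have "norm (f w) \<le> exp (- (\<kappa> * A * d w powr - \<tau>))" using dw True by (intro norm_f_flat w(2)) auto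
        also have "\<dots> \<le> C0 * d w ^ (j + 2)" using dw True dw0 by (intro C0(2)) auto
        also have "\<dots> \<le> C0 * (2 * d z) ^ (j + 2)" using dw dw0 C0(1) by (intro mult_left_mono power_mono) auto
        finally show "norm (f w) \<le> C0 * (2 * d z) ^ (j + 2)" .
      qed
      also have "\<dots> = fact j * C0 * 2 ^ (j + 2) * (2 / lam) ^ j * (d z)\<^sup>2"
        using d0 lam by (simp add: power_mult_distrib power_divide power_add power2_eq_square field_simps)
      also have "\<dots> \<le> C * (d z)\<^sup>2" by (intro mult_right_mono) (auto simp: C_def)
      finally show ?thesis using True by (simp add: min_def)
    next
      case False
      have "norm ((deriv ^^ j) f z) \<le> fact j * 1 / (lam * d z / 2) ^ j"
        by (rule cauchy[OF z]) (rule norm_f_le_1)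
      also have "\<dots> \<le> fact j * 1 / (lam / 4) ^ j"
      proof (intro divide_left_mono power_mono)
        show "lam / 4 \<le> lam * d z / 2" using False lam by (simp add: field_simps)
        show "0 < (lam * d z / 2) ^ j * (lam / 4) ^ j" using lam d0 by simp
      qed (use lam in auto)
      also have "\<dots> = 4 * (fact j * (4 / lam) ^ j) * (1 / 4)" using lam by (simp add: power_divide)
      also have "\<dots> \<le> C * (min 1 (d z))\<^sup>2"
      proof (intro mult_mono)
        have "(1 / 2)\<^sup>2 \<le> (min 1 (d z))\<^sup>2" using False by (intro power_mono) auto
        then show "1 / 4 \<le> (min 1 (d z))\<^sup>2" by (simp add: power2_eq_square)
        show "4 * (fact j * (4 / lam) ^ j) \<le> C" by (simp add: C_def)
        show "0 \<le> C" by (rule C_nonneg)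
      qed simp
      finally show ?thesis .
    qed
  qed
qed

text \<open>On \<open>P\<close> the value 0 is the limit from the closed half plane; in the open
  left half plane it is a default.\<close>

definition h :: "complex \<Rightarrow> real" where "h z = (if 0 \<le> Re z \<and> z \<notin> P then Re (f z) else 0)"

lemma h_half_plane: "z \<in> half_plane \<Longrightarrow> h z = Re (f z)"
  using Re_P by (auto simp: h_def)

lemma h_le_1: "\<bar>h z\<bar> \<le> 1"
proof (cases "0 \<le> Re z \<and> z \<notin> P")
  case True
  then have "norm (f z) \<le> 1" using closed_half_in_V norm_f_le_1 by blast
  then show ?thesis using True abs_Re_le_cmod[of "f z"] by (simp add: h_def)
qed (auto simp: h_def)

lemma h_P: "z \<in> P \<Longrightarrow> h z = 0" by (simp add: h_def)

lemma h_continuous: "continuous_on {z. 0 \<le> Re z} h"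
  unfolding continuous_on_eq_continuous_within
proof
  fix z :: complex assume "z \<in> {z. 0 \<le> Re z}"
  then have z: "0 \<le> Re z" by simp
  obtain C where C: "0 \<le> C" "\<And>z. 0 \<le> Re z \<Longrightarrow> z \<notin> P \<Longrightarrow> norm ((deriv ^^ 0) f z) \<le> C * (min 1 (d z))\<^sup>2"
    using higher_deriv_f_le by blast
  show "continuous (at z within {z. 0 \<le> Re z}) h"
  proof (cases "z \<in> P")
    case False
    have "isCont f z"
      using holomorphic_on_imp_continuous_on[OF f_holomorphic] open_V closed_half_in_V[OF z False]
      by (simp add: continuous_on_eq_continuous_at)
    then have "continuous (at z within {z. 0 \<le> Re z}) (\<lambda>z. Re (f z))"
      by (rule continuous_Re[OF continuous_at_imp_continuous_within])
    moreover have "\<forall>\<^sub>F w in at z within {z. 0 \<le> Re z}. Re (f w) = h w"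
    proof -
      have "open (- P)" using P by (simp add: compact_imp_closed open_Compl)
      then have "\<forall>\<^sub>F w in nhds z. w \<in> - P" using False by (intro eventually_nhds_in_open) auto
      then have "\<forall>\<^sub>F w in at z within {z. 0 \<le> Re z}. w \<in> - P" unfolding eventually_at_filter by (rule eventually_mono) simp
      moreover have "\<forall>\<^sub>F w in at z within {z. 0 \<le> Re z}. 0 \<le> Re w" by (simp add: eventually_at_filter)
      ultimately show ?thesis by eventually_elim (simp add: h_def)
    qed
    moreover have "h z = Re (f z)" using z False by (simp add: h_def)
    ultimately show ?thesis by (simp add: continuous_within Lim_transform_eventually)
  next
    case True
    have "((\<lambda>w. h w) \<longlongrightarrow> 0) (at z within {z. 0 \<le> Re z})"
    proof (rule Lim_null_comparison[of _ "\<lambda>w. C * (dist w z)\<^sup>2"])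
      show "\<forall>\<^sub>F w in at z within {z. 0 \<le> Re z}. norm (h w) \<le> C * (dist w z)\<^sup>2"
      proof (intro always_eventually allI)
        fix w
        show "norm (h w) \<le> C * (dist w z)\<^sup>2"
        proof (cases "0 \<le> Re w \<and> w \<notin> P")
          case w: True
          have "norm (h w) \<le> norm (f w)" using w abs_Re_le_cmod[of "f w"] by (simp add: h_def)
          also have "\<dots> \<le> C * (min 1 (d w))\<^sup>2" using C(2)[of w] w by simp
          also have "\<dots> \<le> C * (dist w z)\<^sup>2"
            using C(1) infdist_le[OF True, of w] infdist_nonneg[of w P]
            by (intro mult_left_mono power_mono) (auto simp: min_def)
          finally show ?thesis .
        qed (use C(1) in \<open>auto simp: h_def\<close>)
      qed
      have "((\<lambda>w. C * (dist w z)\<^sup>2) \<longlongrightarrow> C * (dist z z)\<^sup>2) (at z within {z. 0 \<le> Re z})"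
        by (intro tendsto_intros)
      then show "((\<lambda>w. C * (dist w z)\<^sup>2) \<longlongrightarrow> 0) (at z within {z. 0 \<le> Re z})" by simp
    qed
    then show ?thesis using h_P[OF True] by (simp add: continuous_within)
  qed
qed

text \<open>The j-th derivative of the boundary function t -> h (i t), with one factor i per
  differentiation; on \<open>P\<close> every order is 0.\<close>

definition bd :: "nat \<Rightarrow> real \<Rightarrow> real" where
  "bd j t = (if \<i> * of_real t \<in> P then 0 else Re (\<i> ^ j * (deriv ^^ j) f (\<i> * of_real t)))"

lemma bd_0: "bd 0 t = h (\<i> * of_real t)"
  by (simp add: bd_def h_def)

text \<open>Off \<open>P\<close> this is the chain rule, \<open>V\<close> being open around boundary
  points. At a point of \<open>P\<close> the quadratic bound on all derivatives makes the difference
  quotient of order |s - t|.\<close>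

lemma bd_has_derivative: "(bd j has_real_derivative bd (Suc j) t) (at t)"
proof (cases "\<i> * of_real t \<in> P")
  case False
  let ?g = "(deriv ^^ j) f"
  have V: "\<i> * of_real t \<in> V" using False by (intro closed_half_in_V) auto
  have "?g holomorphic_on V" by (intro holomorphic_higher_deriv f_holomorphic open_V)
  then have "(?g has_field_derivative deriv ?g (\<i> * of_real t)) (at (\<i> * of_real t))"
    using holomorphic_derivI open_V V by blast
  moreover have "((\<lambda>t. \<i> * of_real t) has_vector_derivative \<i>) (at t)"
    by (auto intro!: derivative_eq_intros simp: has_vector_derivative_def scaleR_conv_of_real mult.commute)
  ultimately have "((\<lambda>t. ?g (\<i> * of_real t)) has_vector_derivative \<i> * deriv ?g (\<i> * of_real t)) (at t)"
    by (intro field_vector_diff_chain_at[unfolded o_def])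
  then have "((\<lambda>t. \<i> ^ j * ?g (\<i> * of_real t)) has_vector_derivative \<i> ^ j * (\<i> * deriv ?g (\<i> * of_real t))) (at t)"
    by (rule has_vector_derivative_mult_right)
  from bounded_linear.has_vector_derivative[OF bounded_linear_Re this]
  have "((\<lambda>t. Re (\<i> ^ j * ?g (\<i> * of_real t))) has_real_derivative Re (\<i> ^ j * (\<i> * deriv ?g (\<i> * of_real t)))) (at t)"
    by (simp add: has_real_derivative_iff_has_vector_derivative)
  moreover have "Re (\<i> ^ j * (\<i> * deriv ?g (\<i> * of_real t))) = bd (Suc j) t"
    using False by (simp add: bd_def mult_ac)
  ultimately have "((\<lambda>t. Re (\<i> ^ j * ?g (\<i> * of_real t))) has_real_derivative bd (Suc j) t) (at t)"
    by (simp only:)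
  moreover have "open {t. \<i> * of_real t \<notin> P}"
  proof -
    have "open ((\<lambda>t::real. \<i> * of_real t) -` (- P))"
      using P by (intro open_vimage) (auto simp: compact_imp_closed intro!: continuous_intros)
    then show ?thesis by (simp add: vimage_def)
  qed
  ultimately show ?thesis
    by (rule has_field_derivative_transform_within_open) (use False in \<open>auto simp: bd_def\<close>)
next
  case True
  obtain C where C: "0 \<le> C" "\<And>z. 0 \<le> Re z \<Longrightarrow> z \<notin> P \<Longrightarrow> norm ((deriv ^^ j) f z) \<le> C * (min 1 (d z))\<^sup>2"
    using higher_deriv_f_le by blast
  have bound: "\<bar>bd j s\<bar> \<le> C * (s - t)\<^sup>2" for s
  proof (cases "\<i> * of_real s \<in> P")
    case False
    have "\<bar>bd j s\<bar> \<le> norm (\<i> ^ j * (deriv ^^ j) f (\<i> * of_real s))"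
      unfolding bd_def using False abs_Re_le_cmod by (simp only: if_False)
    also have "\<dots> \<le> C * (min 1 (d (\<i> * of_real s)))\<^sup>2"
      using C(2)[of "\<i> * of_real s"] False by (simp add: norm_mult norm_power)
    also have "\<dots> \<le> C * \<bar>s - t\<bar>\<^sup>2"
    proof (intro mult_left_mono power_mono)
      have "d (\<i> * of_real s) \<le> dist (\<i> * of_real s) (\<i> * of_real t)" by (rule infdist_le[OF True])
      also have "\<dots> = norm (\<i> * of_real (s - t))" by (simp add: dist_norm algebra_simps)
      also have "\<dots> = \<bar>s - t\<bar>" by (simp add: norm_mult del: of_real_diff)
      finally show "min 1 (d (\<i> * of_real s)) \<le> \<bar>s - t\<bar>" by simp
    qed (use C(1) infdist_nonneg[of "\<i> * of_real s" P] in auto)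
    finally show ?thesis by simp
  qed (use C(1) in \<open>auto simp: bd_def\<close>)
  have t0: "bd j t = 0" "bd (Suc j) t = 0" using True by (auto simp: bd_def)
  have "((\<lambda>s. (bd j s - bd j t) / (s - t)) \<longlongrightarrow> 0) (at t)"
  proof (rule Lim_null_comparison[of _ "\<lambda>s. C * \<bar>s - t\<bar>"])
    show "\<forall>\<^sub>F s in at t. norm ((bd j s - bd j t) / (s - t)) \<le> C * \<bar>s - t\<bar>"
      unfolding eventually_at_filter
    proof (intro always_eventually allI impI)
      fix s assume "s \<noteq> t"
      then show "norm ((bd j s - bd j t) / (s - t)) \<le> C * \<bar>s - t\<bar>"
        using bound[of s] t0 by (simp add: abs_divide divide_le_eq power2_eq_square mult.assoc abs_mult_self_eq)
    qed
    have "((\<lambda>s. C * \<bar>s - t\<bar>) \<longlongrightarrow> C * \<bar>t - t\<bar>) (at t)" by (intro tendsto_intros)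
    then show "((\<lambda>s. C * \<bar>s - t\<bar>) \<longlongrightarrow> 0) (at t)" by simp
  qed
  then show ?thesis using t0 by (simp add: has_field_derivative_iff)
qed

lemma f'_bounded: "\<exists>C. \<forall>z\<in>half_plane. norm (deriv f z) \<le> C"
proof -
  obtain C where C: "0 \<le> C" "\<And>z. 0 \<le> Re z \<Longrightarrow> z \<notin> P \<Longrightarrow> norm ((deriv ^^ 1) f z) \<le> C * (min 1 (d z))\<^sup>2"
    using higher_deriv_f_le by blast
  have "norm (deriv f z) \<le> C" if "z \<in> half_plane" for z
  proof -
    have "norm (deriv f z) \<le> C * (min 1 (d z))\<^sup>2" using C(2)[of z] that Re_P[of z] by force
    also have "\<dots> \<le> C * 1"
      using C(1) infdist_nonneg[of z P] by (intro mult_left_mono power_le_one) auto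
    finally show ?thesis by simp
  qed
  then show ?thesis by blast
qed

end

section \<open>The frequency at a pole with a gap on its left\<close>

text \<open>The difference is 2 sin (mean) sin (half difference). The mean lies between \<psi> and
  pi/2, so the first sine is at least sin \<psi>, and the second is bounded below linearly.
  Positivity of \<psi> makes the linear rate hold on the whole half circle.\<close>

lemma cos_diff_ge:
  fixes \<psi> \<beta> t :: real
  assumes "0 < \<psi>" "0 < \<beta>" "\<beta> < 1" "\<psi> + \<beta> * (pi / 2) \<le> pi / 2" "- (pi / 2) \<le> t" "t \<le> pi / 2"
  shows "\<beta> * sin \<psi> * cos (\<beta> * (pi / 2)) * (pi / 2 - t) \<le> cos (\<psi> + \<beta> * t) - cos (\<psi> + \<beta> * (pi / 2))"
proof -
  define x where "x = \<beta> * (pi / 2 - t) / 2"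
  have bp: "0 < \<beta> * (pi / 2)" "\<beta> * (pi / 2) < pi / 2"
    using assms(2) mult_strict_right_mono[OF assms(3), of "pi / 2"] by auto
  have bt: "- (\<beta> * (pi / 2)) \<le> \<beta> * t" "\<beta> * t \<le> \<beta> * (pi / 2)"
    using mult_left_mono[of "- (pi / 2)" t \<beta>] mult_left_mono[of t "pi / 2" \<beta>] assms by auto
  then have x: "0 \<le> x" "x \<le> \<beta> * (pi / 2)" by (auto simp: x_def algebra_simps)
  have sx: "x * cos (\<beta> * (pi / 2)) \<le> sin x"
  proof (cases "x = 0")
    case False
    then obtain \<xi> where \<xi>: "0 < \<xi>" "\<xi> < x" "sin x - sin 0 = (x - 0) * cos \<xi>"
      using MVT2[of 0 x sin cos] x(1) by (auto intro: DERIV_sin)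
    have "cos (\<beta> * (pi / 2)) \<le> cos \<xi>" using \<xi> x bp by (intro cos_monotone_0_pi_le) auto
    then show ?thesis using \<xi>(3) x(1) by (simp add: mult_left_mono)
  qed simp
  have "sin \<psi> \<le> sin ((\<psi> + \<beta> * t + (\<psi> + \<beta> * (pi / 2))) / 2)"
  proof -
    have "\<psi> \<le> (\<psi> + u + (\<psi> + v)) / 2 \<and> (\<psi> + u + (\<psi> + v)) / 2 \<le> pi / 2"
      if "- v \<le> u" "u \<le> v" "\<psi> + v \<le> pi / 2" for u v :: real
      using that by simp
    from this[OF bt assms(4)] show ?thesis using assms(1) by (intro sin_monotone_2pi_le) auto
  qed
  moreover have "\<psi> < pi" using bp(1) assms(4) pi_gt_zero by linarith
  then have "0 < sin \<psi>" using assms(1) by (intro sin_gt_zero)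
  moreover have "0 \<le> cos (\<beta> * (pi / 2))" by (intro cos_ge_zero) (use bp in linarith)+
  ultimately have "sin \<psi> * (x * cos (\<beta> * (pi / 2))) \<le> sin ((\<psi> + \<beta> * t + (\<psi> + \<beta> * (pi / 2))) / 2) * sin x"
    using sx x by (intro mult_mono) auto
  moreover have "cos (\<psi> + \<beta> * t) - cos (\<psi> + \<beta> * (pi / 2)) = 2 * (sin ((\<psi> + \<beta> * t + (\<psi> + \<beta> * (pi / 2))) / 2) * sin x)"
    unfolding cos_diff_cos x_def by (simp add: algebra_simps)
  ultimately show ?thesis by (simp add: x_def algebra_simps)
qed

lemma norm_cis_diff_le: "norm (cis s - cis t) \<le> \<bar>s - t\<bar>"
proof -
  have "norm (exp (\<i> * of_real s) - exp (\<i> * of_real t)) \<le> 1 * norm (of_real s - of_real t :: complex)"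
  proof (rule field_differentiable_bound[OF convex_Reals])
    fix z :: complex assume z: "z \<in> \<real>"
    show "((\<lambda>z. exp (\<i> * z)) has_field_derivative \<i> * exp (\<i> * z)) (at z within \<real>)"
      by (auto intro!: derivative_eq_intros)
    show "norm (\<i> * exp (\<i> * z)) \<le> 1" using z by (auto simp: norm_mult elim!: Reals_cases)
  qed auto
  then show ?thesis by (simp add: cis_conv_exp norm_of_real flip: of_real_diff)
qed

lemma polar_right:
  assumes "v \<noteq> 0" "0 \<le> Re v"
  obtains a where "v = of_real (norm v) * cis a" "\<bar>a\<bar> \<le> pi / 2" "0 \<le> Im v \<Longrightarrow> 0 \<le> a"
proof (rule that[of "Im (Ln v)"])
  show v: "v = of_real (norm v) * cis (Im (Ln v))"
    using exp_eq_polar[of "Ln v"] assms(1) by simp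
  show a: "\<bar>Im (Ln v)\<bar> \<le> pi / 2" using assms Re_Ln_pos_le by blast
  assume "0 \<le> Im v"
  then have "0 \<le> norm v * sin (Im (Ln v))" using arg_cong[OF v, of Im] by simp
  then have "0 \<le> sin (Im (Ln v))" using assms(1) by (simp add: zero_le_mult_iff)
  then show "0 \<le> Im (Ln v)" using a sin_gt_zero[of "- Im (Ln v)"] by (cases "Im (Ln v) < 0") auto
qed

text \<open>The map y -> -i y turns a gap to the left of \<open>p m\<close> into a gap above
  \<open>q m\<close>. The top point q m + i r of the half circle thus lies in the gap for small r,
  and everything is compared with it.\<close>

locale flat_pole = flat_data +
  fixes m :: nat and g :: real
  assumes cm: "0 < c m" and g: "0 < g" and gap: "\<And>y. y \<in> E \<Longrightarrow> p m \<le> y \<or> y \<le> p m - g"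
begin

definition S :: real where "S = suminf c"

text \<open>q n = q m - i \<delta> n: poles with \<delta> n \<ge> 0 lie at or below q m, those with
  \<delta> n \<le> -g lie beyond the gap.\<close>

definition \<delta> :: "nat \<Rightarrow> real" where "\<delta> n = p n - p m"

text \<open>Bounds the derivative of \<open>kern\<close> at distance at least g/2 from its pole; for
  r \<le> g/2 this covers all poles beyond the gap.\<close>

definition K :: real where "K = (g / 2) powr (- \<beta> - 1)"

lemma S_pos: "0 < S"
  unfolding S_def using suminf_pos_iff[OF c(2)] c(1) cm by blast

lemma K_pos: "0 < K" using g by (simp add: K_def)

lemma \<delta>_cases:
  obtains "0 \<le> \<delta> n" | "\<delta> n \<le> - g"
  using gap[OF p[of n]] by (auto simp: \<delta>_def)

lemma minus_q: "q m + w - q n = w + \<i> * of_real (\<delta> n)"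
  by (simp add: q_def \<delta>_def algebra_simps)

lemma angle': "\<psi> + \<beta> * (pi / 2) < pi / 2"
proof -
  have "0 < \<beta> * \<eta>" using \<beta> \<eta> by simp
  then show ?thesis using angle by (simp add: algebra_simps)
qed

text \<open>Pattern of the lower bounds that follow: the pole \<open>m\<close> supplies the main
  term \<open>a\<close>, the poles below have a favourable sign, and those beyond the gap lose at
  most \<open>k\<close> times their weight.\<close>

lemma weighted_ge:
  assumes "\<And>n. - k \<le> l n" "a \<le> l m" "0 \<le> k" "(\<lambda>n. c n * l n) sums x"
  shows "c m * a - k * S \<le> x"
proof -
  have "(\<lambda>n. (if n = m then c n * a else 0) - k * c n) sums (c m * a - k * S)"
    unfolding S_def using c(2)
    by (intro sums_diff sums_mult summable_sums sums_single[of m "\<lambda>n. c n * a"])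
  then show ?thesis
  proof (rule sums_le[rotated, OF _ assms(4)])
    fix n
    show "(if n = m then c n * a else 0) - k * c n \<le> c n * l n"
    proof (cases "n = m")
      case True
      have "c m * a \<le> c m * l m" using assms(2) c(1) by (intro mult_left_mono)
      moreover have "0 \<le> k * c m" using assms(3) c(1) by simp
      ultimately show ?thesis using True by simp
    next
      case False
      then show ?thesis using mult_left_mono[OF assms(1)[of n] c(1)[of n]] by (simp add: mult.commute)
    qed
  qed
qed

lemma kern_polar:
  assumes "0 < r" "\<bar>a\<bar> \<le> pi / 2"
  shows "kern (of_real r * cis a) = of_real (r powr - \<beta>) * cis (- (\<psi> + \<beta> * a))"
proof -
  have "of_real r * cis a = exp (Complex (ln r) a)" using assms(1) by (simp add: exp_eq_polar)
  moreover have "- pi < a" "a \<le> pi" using assms(2) pi_gt_zero by linarith+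
  ultimately have "Ln (of_real r * cis a) = Complex (ln r) a" by (simp add: Ln_exp)
  then show ?thesis using assms(1)
    by (simp add: kern_def exp_eq_polar powr_def)
qed

lemma in_V:
  assumes "0 < Re w \<or> Re w = 0 \<and> 0 < Im w" "norm w \<le> g / 2"
  shows "q m + w \<in> V"
proof (rule closed_half_in_V)
  show "0 \<le> Re (q m + w)" using assms(1) by (auto simp: q_def)
  show "q m + w \<notin> P"
  proof
    assume "q m + w \<in> P"
    then obtain y where y: "y \<in> E" "q m + w = - \<i> * of_real y" by (auto simp: P_def)
    then have "Re w = 0" "Im w = p m - y" by (auto simp: q_def complex_eq_iff)
    then show False using assms gap[OF y(1)] abs_Im_le_cmod[of w] g by auto
  qed
qed

lemma shift_norm:
  assumes "norm w \<le> g / 2" "\<delta> n \<le> - g"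
  shows "g / 2 \<le> norm (w + \<i> * of_real (\<delta> n))"
proof -
  have "norm (\<i> * of_real (\<delta> n)) \<le> norm (w + \<i> * of_real (\<delta> n)) + norm w"
    using norm_triangle_ineq4[of "w + \<i> * of_real (\<delta> n)" w] by simp
  then show ?thesis using assms by (simp add: norm_mult)
qed

text \<open>Seen from a pole at or below the centre, the top point of the half circle is the
  farthest and has the largest argument; both make the real part of the kernel smallest.\<close>

lemma Re_kern_shift_ge:
  assumes "0 \<le> e" "0 < r" "\<bar>t\<bar> \<le> pi / 2" "of_real r * cis t + \<i> * of_real e \<noteq> 0"
  shows "Re (kern (\<i> * of_real r + \<i> * of_real e)) \<le> Re (kern (of_real r * cis t + \<i> * of_real e))"
proof -
  let ?v = "of_real r * cis t + \<i> * of_real e"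
  have "0 \<le> Re ?v" using assms(2,3) by (auto intro!: mult_nonneg_nonneg cos_ge_zero)
  then obtain a where a: "?v = of_real (norm ?v) * cis a" "\<bar>a\<bar> \<le> pi / 2" using polar_right[OF assms(4)] by metis
  have v0: "0 < norm ?v" using assms(4) by simp
  have nv: "norm ?v \<le> r + e"
    using norm_triangle_ineq[of "of_real r * cis t" "\<i> * of_real e"] assms(1,2) by (simp add: norm_mult)
  have "\<bar>\<psi> + \<beta> * a\<bar> \<le> \<psi> + \<beta> * \<bar>a\<bar>" using \<psi> \<beta> abs_triangle_ineq[of \<psi> "\<beta> * a"] by (simp add: abs_mult)
  also have "\<dots> \<le> \<psi> + \<beta> * (pi / 2)" using a(2) \<beta> by (intro add_left_mono mult_left_mono) auto
  finally have "cos (\<psi> + \<beta> * (pi / 2)) \<le> cos \<bar>\<psi> + \<beta> * a\<bar>" using angle' by (intro cos_monotone_0_pi_le) auto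
  then have cs: "cos (\<psi> + \<beta> * (pi / 2)) \<le> cos (\<psi> + \<beta> * a)" by simp
  have "0 < \<beta> * (pi / 2)" using \<beta> by simp
  then have "0 \<le> cos (\<psi> + \<beta> * (pi / 2))" by (intro cos_ge_zero) (use angle' \<psi> in linarith)+
  moreover have "(r + e) powr - \<beta> \<le> norm ?v powr - \<beta>" using nv v0 \<beta> by (intro powr_mono2') auto
  ultimately have "(r + e) powr - \<beta> * cos (\<psi> + \<beta> * (pi / 2)) \<le> norm ?v powr - \<beta> * cos (\<psi> + \<beta> * a)"
    using cs by (intro mult_mono) auto
  moreover have "Re (kern ?v) = norm ?v powr - \<beta> * cos (\<psi> + \<beta> * a)"
    by (subst a(1)) (simp add: kern_polar[OF v0 a(2)] del: minus_add_distrib)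
  moreover have "Re (kern (of_real (r + e) * cis (pi / 2))) = (r + e) powr - \<beta> * cos (\<psi> + \<beta> * (pi / 2))"
    using assms(1,2) by (subst kern_polar) (auto simp del: cis_pi_half minus_add_distrib)
  moreover have "of_real (r + e) * cis (pi / 2) = \<i> * of_real r + \<i> * of_real e"
    by (simp add: algebra_simps)
  ultimately show ?thesis by simp
qed

lemma kern_lipschitz:
  assumes "\<delta> n \<le> - g" "0 \<le> Re v" "norm v \<le> g / 2" "0 \<le> Re w" "norm w \<le> g / 2"
  shows "norm (kern (v + \<i> * of_real (\<delta> n)) - kern (w + \<i> * of_real (\<delta> n))) \<le> K * norm (v - w)"
proof -
  let ?X = "{x. Im x \<le> - (g / 2)} \<inter> {x. 0 \<le> Re x}"
  have cv: "convex ?X" by (intro convex_Int convex_halfspace_Im_le convex_halfspace_Re_ge)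
  have X: "v' + \<i> * of_real (\<delta> n) \<in> ?X" if "0 \<le> Re v'" "norm v' \<le> g / 2" for v'
    using that assms(1) abs_Im_le_cmod[of v'] by auto
  have "norm (kern (v + \<i> * of_real (\<delta> n)) - kern (w + \<i> * of_real (\<delta> n)))
      \<le> K * norm (v + \<i> * of_real (\<delta> n) - (w + \<i> * of_real (\<delta> n)))"
  proof (rule field_differentiable_bound[OF cv])
    fix x assume x: "x \<in> ?X"
    have n: "g / 2 \<le> norm x" using x abs_Im_le_cmod[of x] by (simp only: Int_iff mem_Collect_eq) linarith
    have n0: "x \<noteq> 0" using n g by (intro notI) simp
    have "x \<notin> \<real>\<^sub>\<le>\<^sub>0" using x g by (simp add: complex_nonpos_Reals_iff)
    then show "(kern has_field_derivative - of_real \<beta> / x * kern x) (at x within ?X)"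
      by (rule has_field_derivative_at_within[OF kern_has_field_derivative])
    have "norm (- of_real \<beta> / x * kern x) = \<beta> * (norm x powr - \<beta> / norm x)"
      using \<beta> by (simp add: norm_mult norm_divide norm_kern[OF n0])
    also have "\<dots> = \<beta> * norm x powr (- \<beta> - 1)" using n0 by (simp add: powr_diff)
    also have "\<dots> \<le> 1 * K" unfolding K_def using n g \<beta> by (intro mult_mono powr_mono2') auto
    finally show "norm (- of_real \<beta> / x * kern x) \<le> K" by simp
  qed (use X assms in auto)
  then show ?thesis by simp
qed

text \<open>Half of the rate that \<open>cos_diff_ge\<close> gives for the pole \<open>m\<close>;
  the other half absorbs the poles beyond the gap.\<close>

definition A1 :: real where "A1 = c m * (\<beta> * sin \<psi> * cos (\<beta> * (pi / 2))) / 2"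

lemma sin_\<psi>: "0 < sin \<psi>"
proof -
  have "0 < \<beta> * (pi / 2)" using \<beta> by simp
  then show ?thesis using \<psi> angle' by (intro sin_gt_zero) auto
qed

lemma A1_pos: "0 < A1"
proof -
  have "0 < cos (\<beta> * (pi / 2))" using \<beta> by (intro cos_gt_zero) auto
  then show ?thesis using sin_\<psi> cm \<beta> by (simp add: A1_def)
qed

lemma powr_minus_ge_1: "0 < r \<Longrightarrow> r \<le> 1 \<Longrightarrow> 1 \<le> r powr - \<beta>"
  using powr_mono2'[of "- \<beta>" r 1] \<beta> by simp

lemma i_eq_cis: "\<i> * of_real r = of_real r * cis (pi / 2)"
  by (simp add: mult.commute)

lemma Re_F_compare:
  assumes r: "0 < r" "r \<le> g / 2" "r \<le> 1" "r * (K * S) \<le> A1" and t: "- (pi / 2) < t" "t \<le> pi / 2"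
  shows "Re (F (q m + \<i> * of_real r)) + A1 * r powr - \<beta> * (pi / 2 - t) \<le> Re (F (q m + of_real r * cis t))"
proof -
  let ?v = "of_real r * cis t" and ?w = "\<i> * of_real r" and ?k = "K * (r * (pi / 2 - t))"
  have nv: "norm ?v \<le> g / 2" "norm ?w \<le> g / 2" using r by (auto simp: norm_mult)
  have v0: "0 \<le> Re ?v" using r t by (auto intro!: mult_nonneg_nonneg cos_ge_zero)
  have vw: "norm (?v - ?w) \<le> r * (pi / 2 - t)"
  proof -
    have "norm (cis t - cis (pi / 2)) \<le> \<bar>t - pi / 2\<bar>"
      by (rule norm_cis_diff_le)
    then have "r * norm (cis t - cis (pi / 2)) \<le> r * (pi / 2 - t)" using r t by (intro mult_left_mono) auto
    moreover have "?v - ?w = of_real r * (cis t - cis (pi / 2))" by (simp add: algebra_simps)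
    ultimately show ?thesis using r by (simp only: norm_mult norm_of_real abs_of_pos)
  qed
  have vV: "q m + ?v \<in> V"
  proof (rule in_V[OF _ nv(1)])
    show "0 < Re ?v \<or> Re ?v = 0 \<and> 0 < Im ?v"
    proof (cases "t = pi / 2")
      case True
      show ?thesis unfolding True using r by simp
    next
      case False
      then have "0 < cos t" using t by (intro cos_gt_zero_pi) auto
      then show ?thesis using r by simp
    qed
  qed
  have wV: "q m + ?w \<in> V" using r nv by (intro in_V) auto
  let ?l = "\<lambda>n. Re (kern (?v + \<i> * of_real (\<delta> n))) - Re (kern (?w + \<i> * of_real (\<delta> n)))"
  have lsum: "(\<lambda>n. c n * ?l n) sums (Re (F (q m + ?v)) - Re (F (q m + ?w)))"
    using sums_diff[OF sums_Re[OF F_derivative(1)[OF vV]] sums_Re[OF F_derivative(1)[OF wV]]]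
    unfolding minus_q by (simp add: algebra_simps)
  have k0: "0 \<le> ?k" using K_pos r t by simp
  have "c m * (r powr - \<beta> * (\<beta> * sin \<psi> * cos (\<beta> * (pi / 2)) * (pi / 2 - t))) - ?k * S
      \<le> Re (F (q m + ?v)) - Re (F (q m + ?w))"
  proof (rule weighted_ge[OF _ _ k0 lsum])
    fix n
    show "- ?k \<le> ?l n"
    proof (cases rule: \<delta>_cases[of n])
      case 1
      have "?v + \<i> * of_real (\<delta> n) \<noteq> 0"
        using V_minus_q(1)[OF vV, of n] unfolding minus_q .
      then have "0 \<le> ?l n" using Re_kern_shift_ge[OF 1 r(1), of t] t by auto
      then show ?thesis using k0 by linarith
    next
      case 2
      have "\<bar>?l n\<bar> \<le> norm (kern (?v + \<i> * of_real (\<delta> n)) - kern (?w + \<i> * of_real (\<delta> n)))"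
        using abs_Re_le_cmod[of "kern (?v + \<i> * of_real (\<delta> n)) - kern (?w + \<i> * of_real (\<delta> n))"] by simp
      also have "\<dots> \<le> K * norm (?v - ?w)" using 2 v0 nv by (intro kern_lipschitz) auto
      also have "\<dots> \<le> ?k" using vw K_pos by (intro mult_left_mono) auto
      finally show ?thesis by linarith
    qed
  next
    have "Re (kern ?v) = r powr - \<beta> * cos (\<psi> + \<beta> * t)"
      using kern_polar[OF r(1), of t] t by (simp add: abs_le_iff del: minus_add_distrib)
    moreover have "Re (kern ?w) = r powr - \<beta> * cos (\<psi> + \<beta> * (pi / 2))"
      unfolding i_eq_cis using kern_polar[OF r(1), of "pi / 2"] by (simp del: minus_add_distrib cis_pi_half)
    ultimately have "?l m = r powr - \<beta> * (cos (\<psi> + \<beta> * t) - cos (\<psi> + \<beta> * (pi / 2)))"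
      by (simp add: \<delta>_def right_diff_distrib)
    then show "r powr - \<beta> * (\<beta> * sin \<psi> * cos (\<beta> * (pi / 2)) * (pi / 2 - t)) \<le> ?l m"
      using cos_diff_ge[of \<psi> \<beta> t] \<psi> \<beta> angle' t by (simp add: mult_left_mono)
  qed
  \<comment> \<open>The loss from beyond the gap is of order r (pi/2 - t), while the gain carries
    \<open>r powr - \<beta>\<close>, which is at least 1.\<close>
  moreover have "?k * S \<le> A1 * r powr - \<beta> * (pi / 2 - t)"
  proof -
    have "A1 * 1 \<le> A1 * r powr - \<beta>" using powr_minus_ge_1[OF r(1,3)] A1_pos by (intro mult_left_mono) auto
    then have "r * (K * S) \<le> A1 * r powr - \<beta>" using r(4) by simp
    then have "r * (K * S) * (pi / 2 - t) \<le> A1 * r powr - \<beta> * (pi / 2 - t)" using t by (intro mult_right_mono) auto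
    then show ?thesis by (simp add: mult_ac)
  qed
  moreover have "c m * (r powr - \<beta> * (\<beta> * sin \<psi> * cos (\<beta> * (pi / 2)) * (pi / 2 - t))) = 2 * (A1 * r powr - \<beta> * (pi / 2 - t))"
    by (simp add: A1_def)
  ultimately show ?thesis by linarith
qed

text \<open>The n-th term of w F' (q m + w) without weight and factor -\<beta>. After multiplication
  by w, the real part of the derivative is r times the radial derivative of Re F, and the imaginary
  part is minus its angular derivative.\<close>

definition term' :: "complex \<Rightarrow> nat \<Rightarrow> complex" where
  "term' w n = w / (w + \<i> * of_real (\<delta> n)) * kern (w + \<i> * of_real (\<delta> n))"

lemma F'_sums:
  assumes "q m + w \<in> V"
  shows "(\<lambda>n. of_real (c n) * (- of_real \<beta> * term' w n)) sums (w * F' (q m + w))"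
proof -
  have "w * (of_real (c n) * (- of_real \<beta> / (w + \<i> * of_real (\<delta> n)) * kern (w + \<i> * of_real (\<delta> n))))
      = of_real (c n) * (- of_real \<beta> * term' w n)" for n
    by (simp add: term'_def)
  then show ?thesis
    using sums_mult[OF F_derivative(2)[OF assms], of w] unfolding minus_q by simp
qed

lemma term'_bound:
  assumes "norm w \<le> g / 2" "\<delta> n \<le> - g"
  shows "norm (term' w n) \<le> norm w * K"
proof -
  let ?v = "w + \<i> * of_real (\<delta> n)"
  note n = shift_norm[OF assms]
  then have n0: "?v \<noteq> 0" using g by auto
  have "norm (term' w n) = norm w * (norm ?v powr - \<beta> / norm ?v)"
    by (simp add: term'_def norm_mult norm_divide norm_kern[OF n0])
  also have "\<dots> = norm w * norm ?v powr (- \<beta> - 1)" using n0 by (simp add: powr_diff)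
  also have "\<dots> \<le> norm w * K" unfolding K_def using n g \<beta> by (intro mult_left_mono powr_mono2') auto
  finally show ?thesis .
qed

text \<open>For a pole at or below q m, let w have argument t and w + i \<delta> argument u \<ge> t.
  The quotient turns by t - u and the kernel by -(\<psi> + \<beta> u), in total by -a with a =
  \<psi> + \<beta> u + u - t. Since \<psi> \<le> a \<le> pi, the imaginary parts of these terms
  cannot cancel.\<close>

lemma term'_polar:
  assumes "w \<noteq> 0" "0 \<le> Re w" "0 \<le> Im w" "0 \<le> \<delta> n"
  obtains R a where "0 \<le> R" "term' w n = of_real R * cis (- a)" "\<psi> \<le> a" "a \<le> pi"
    "Re w = 0 \<Longrightarrow> a \<le> pi / 2" "n = m \<Longrightarrow> R = norm w powr - \<beta> \<and> a \<le> pi / 2 \<and> (Re w = 0 \<longrightarrow> a = \<psi> + \<beta> * (pi / 2))"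
proof -
  let ?v = "w + \<i> * of_real (\<delta> n)"
  obtain t where t: "w = of_real (norm w) * cis t" "\<bar>t\<bar> \<le> pi / 2" "0 \<le> t"
    using polar_right[OF assms(1,2)] assms(3) by metis
  have v: "Re ?v = Re w" "Im ?v = Im w + \<delta> n" by auto
  have "cmod w \<le> cmod ?v"
    unfolding cmod_def v using assms(3,4) by (intro real_sqrt_le_mono add_left_mono power_mono) auto
  moreover have w0: "0 < cmod w" using assms(1) by simp
  ultimately have n: "norm w \<le> norm ?v" "0 < norm ?v" by auto
  then have v0: "?v \<noteq> 0" by auto
  obtain u where u: "?v = of_real (norm ?v) * cis u" "\<bar>u\<bar> \<le> pi / 2" "0 \<le> u"
    using polar_right[OF v0] v assms(2,3,4) by (metis add_nonneg_nonneg)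
  have Re_eq: "norm ?v * cos u = norm w * cos t" using arg_cong[OF u(1), of Re] arg_cong[OF t(1), of Re] v(1) by simp
  have tu: "t \<le> u"
  proof (rule ccontr)
    assume "\<not> t \<le> u"
    then have "cos t < cos u" using t u by (intro cos_monotone_0_pi) auto
    moreover have "0 \<le> cos t" using t by (intro cos_ge_zero) auto
    ultimately have "norm w * cos t < norm ?v * cos u"
      using n w0 by (intro mult_le_less_imp_less) auto
    then show False using Re_eq by simp
  qed
  have t90: "t = pi / 2" if "Re w = 0"
  proof -
    have "cos t = 0" using arg_cong[OF t(1), of Re] that w0 by simp
    then show ?thesis using cos_gt_zero[of t] t by (cases "t = pi / 2"; cases "t = 0") auto
  qed
  define a where "a = \<psi> + \<beta> * u + u - t"
  define R where "R = norm w * norm ?v powr (- \<beta> - 1)"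
  have bu: "0 \<le> \<beta> * u" "\<beta> * u \<le> \<beta> * (pi / 2)" using \<beta> u by (auto intro: mult_left_mono)
  show ?thesis
  proof (rule that[of R a])
    show "0 \<le> R" by (simp add: R_def)
    have "term' w n = of_real (norm w) * cis t / (of_real (norm ?v) * cis u) * (of_real (norm ?v powr - \<beta>) * cis (- (\<psi> + \<beta> * u)))"
      unfolding term'_def by (subst (1) t(1), subst (1 2) u(1)) (simp only: kern_polar[OF n(2) u(2)])
    also have "\<dots> = of_real (norm w * (norm ?v powr - \<beta> / norm ?v)) * (cis t / cis u * cis (- (\<psi> + \<beta> * u)))"
      by (simp add: field_simps)
    also have "cis t / cis u * cis (- (\<psi> + \<beta> * u)) = cis (- a)"
      by (simp add: cis_divide cis_mult a_def algebra_simps)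
    also have "norm w * (norm ?v powr - \<beta> / norm ?v) = R" using n by (simp add: R_def powr_diff)
    finally show "term' w n = of_real R * cis (- a)" .
    show "\<psi> \<le> a" using bu tu by (simp add: a_def)
    show "a \<le> pi" using bu u t angle' by (simp add: a_def)
    show "a \<le> pi / 2" if "Re w = 0" using t90[OF that] bu u angle' by (simp add: a_def)
    assume nm: "n = m"
    then have vw: "?v = w" by (simp add: \<delta>_def)
    have "cos u = cos t" using Re_eq w0 unfolding vw by simp
    then have ut: "u = t" using t u by (simp add: cos_inj_pi)
    have "R = norm w * (norm w powr - \<beta> / norm w)" unfolding R_def vw using w0 by (simp add: powr_diff)
    then have "R = norm w powr - \<beta>" using w0 by simp
    then show "R = norm w powr - \<beta> \<and> a \<le> pi / 2 \<and> (Re w = 0 \<longrightarrow> a = \<psi> + \<beta> * (pi / 2))"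
      using ut bu angle' t90 by (auto simp: a_def)
  qed
qed

end

section \<open>The derivative near the top point and the numerator of the frequency\<close>

context flat_pole
begin

text \<open>The last two conditions let the pole \<open>m\<close> outweigh the poles beyond the gap,
  in the angular and in the radial derivative respectively.\<close>

definition small :: "real \<Rightarrow> bool" where
  "small r \<longleftrightarrow> 0 < r \<and> r \<le> g / 2 \<and> r \<le> 1 \<and> r * (K * S) \<le> A1 \<and> r * (K * S) < c m * cos (\<psi> + \<beta> * (pi / 2))"

text \<open>The modulus at the top point. Numerator and denominator of the frequency are both
  compared with its square, which then cancels.\<close>

definition amp :: "real \<Rightarrow> real" where "amp r = norm (f (q m + \<i> * of_real r))"

lemma smallD:
  assumes "small r"
  shows "0 < r" "r \<le> g / 2" "r \<le> 1" "r * (K * S) \<le> A1" "r * (K * S) < c m * cos (\<psi> + \<beta> * (pi / 2))"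
  using assms by (auto simp: small_def)

lemma amp_pos: "0 < amp r"
  by (simp add: amp_def f_def)

lemma norm_f_arc_le:
  assumes "small r" "- (pi / 2) < t" "t \<le> pi / 2"
  shows "norm (f (q m + of_real r * cis t)) \<le> amp r * exp (- (A1 * r powr - \<beta> * (pi / 2 - t)))"
  using Re_F_compare[OF smallD(1-4)[OF assms(1)] assms(2,3)]
  by (simp add: amp_def norm_f flip: exp_add)

text \<open>The poles below contribute imaginary parts of one sign, and the pole \<open>m\<close>
  contributes at least sin \<psi> times |w|^(-\<beta>); the poles beyond the gap are absorbed as
  before.\<close>

lemma F'_Im_ge:
  assumes "w \<noteq> 0" "0 \<le> Re w" "0 \<le> Im w" "norm w \<le> g / 2" "norm w \<le> 1" "norm w * (K * S) \<le> A1"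
  shows "\<beta> * A1 * norm w powr - \<beta> \<le> Im (w * F' (q m + w))"
proof -
  have w0: "0 < norm w" using assms(1) by simp
  have V: "q m + w \<in> V" using assms by (intro in_V) (auto simp: complex_eq_iff)
  have s: "(\<lambda>n. c n * (- Im (term' w n))) sums (Im (w * F' (q m + w)) / \<beta>)"
    using sums_divide[OF sums_Im[OF F'_sums[OF V]], of \<beta>] \<beta> by (simp add: mult.left_commute)
  have "c m * (norm w powr - \<beta> * sin \<psi>) - norm w * K * S \<le> Im (w * F' (q m + w)) / \<beta>"
  proof (rule weighted_ge[OF _ _ _ s])
    fix n
    show "- (norm w * K) \<le> - Im (term' w n)"
    proof (cases rule: \<delta>_cases[of n])
      case 1
      obtain R a where "0 \<le> R" "term' w n = of_real R * cis (- a)" "\<psi> \<le> a" "a \<le> pi"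
        using term'_polar[OF assms(1-3) 1] by metis
      then have "Im (term' w n) \<le> 0" using \<psi> by (auto intro!: mult_nonneg_nonneg sin_ge_zero)
      moreover have "0 \<le> norm w * K" using K_pos by simp
      ultimately show ?thesis by linarith
    next
      case 2
      then show ?thesis using term'_bound[OF assms(4) 2] abs_Im_le_cmod[of "term' w n"] by linarith
    qed
  next
    have "0 \<le> \<delta> m" by (simp add: \<delta>_def)
    then obtain R a where a: "0 \<le> R" "term' w m = of_real R * cis (- a)" "\<psi> \<le> a" "R = norm w powr - \<beta> \<and> a \<le> pi / 2"
      using term'_polar[OF assms(1-3), of m] by metis
    have "sin \<psi> \<le> sin a" using a \<psi> by (intro sin_monotone_2pi_le) auto
    then show "norm w powr - \<beta> * sin \<psi> \<le> - Im (term' w m)" using a by (simp add: mult_left_mono)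
  qed (use K_pos in auto)
  moreover have "A1 \<le> c m * sin \<psi> / 2"
  proof -
    have "0 < \<beta> * (pi / 2)" using \<beta> by simp
    then have "0 \<le> cos (\<beta> * (pi / 2))" by (intro cos_ge_zero) (use angle' \<psi> in linarith)+
    then have "\<beta> * cos (\<beta> * (pi / 2)) \<le> 1 * 1" using \<beta> by (intro mult_mono) auto
    then have "c m * sin \<psi> / 2 * (\<beta> * cos (\<beta> * (pi / 2))) \<le> c m * sin \<psi> / 2 * 1"
      using cm sin_\<psi> by (intro mult_left_mono) auto
    then show ?thesis by (simp add: A1_def mult_ac)
  qed
  then have "A1 * norm w powr - \<beta> \<le> c m * sin \<psi> / 2 * norm w powr - \<beta>" by (intro mult_right_mono) auto
  moreover have "norm w * K * S \<le> A1 * norm w powr - \<beta>"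
  proof -
    have "A1 * 1 \<le> A1 * norm w powr - \<beta>"
      using A1_pos by (intro mult_left_mono powr_minus_ge_1 w0 assms(5)) simp
    then show ?thesis using assms(6) by (simp only: mult.assoc mult_1_right)
  qed
  ultimately have "A1 * norm w powr - \<beta> \<le> Im (w * F' (q m + w)) / \<beta>" by (simp add: mult_ac)
  then show ?thesis using \<beta> by (simp add: le_divide_eq mult_ac)
qed

text \<open>At the top point the total angle of each pole below is at most pi/2, so the real parts
  have a common sign as well. This will exclude that Re f vanishes along the arc.\<close>

lemma F'_Re_neg:
  assumes "small r"
  shows "Re (\<i> * of_real r * F' (q m + \<i> * of_real r)) < 0"
proof -
  let ?w = "\<i> * of_real r"
  note r = smallD[OF assms]
  have w: "?w \<noteq> 0" "0 \<le> Re ?w" "0 \<le> Im ?w" "norm ?w = r" "Re ?w = 0" using r by (auto simp: norm_mult)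
  have V: "q m + ?w \<in> V" using r w(4) by (intro in_V) auto
  have s: "(\<lambda>n. c n * Re (term' ?w n)) sums (- (Re (?w * F' (q m + ?w)) / \<beta>))"
    using sums_minus[OF sums_divide[OF sums_Re[OF F'_sums[OF V]], of \<beta>]] \<beta> by (simp add: mult.left_commute)
  have "c m * (r powr - \<beta> * cos (\<psi> + \<beta> * (pi / 2))) - r * K * S \<le> - (Re (?w * F' (q m + ?w)) / \<beta>)"
  proof (rule weighted_ge[OF _ _ _ s])
    fix n
    show "- (r * K) \<le> Re (term' ?w n)"
    proof (cases rule: \<delta>_cases[of n])
      case 1
      obtain R a where "0 \<le> R" "term' ?w n = of_real R * cis (- a)" "\<psi> \<le> a" "a \<le> pi / 2"
        using term'_polar[OF w(1-3) 1] w(5) by metis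
      then have "0 \<le> Re (term' ?w n)" using \<psi> by (auto intro!: mult_nonneg_nonneg cos_ge_zero)
      moreover have "0 \<le> r * K" using K_pos r by simp
      ultimately show ?thesis by linarith
    next
      case 2
      have "norm (term' ?w n) \<le> r * K" using term'_bound[OF _ 2, of ?w] w(4) r by simp
      then show ?thesis using abs_Re_le_cmod[of "term' ?w n"] by linarith
    qed
  next
    have "0 \<le> \<delta> m" by (simp add: \<delta>_def)
    then obtain R a where a: "term' ?w m = of_real R * cis (- a)" "R = norm ?w powr - \<beta>" "a = \<psi> + \<beta> * (pi / 2)"
      using term'_polar[OF w(1-3), of m] w(5) by metis
    show "r powr - \<beta> * cos (\<psi> + \<beta> * (pi / 2)) \<le> Re (term' ?w m)"
      unfolding a(1) a(2) w(4) a(3) using cos_minus[of "\<psi> + \<beta> * (pi / 2)"] by simp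
  qed (use K_pos r in auto)
  moreover have "r * K * S < c m * (r powr - \<beta> * cos (\<psi> + \<beta> * (pi / 2)))"
  proof -
    have "0 < \<beta> * (pi / 2)" using \<beta> by simp
    then have "0 \<le> c m * cos (\<psi> + \<beta> * (pi / 2))"
      using cm by (intro mult_nonneg_nonneg cos_ge_zero) (use angle' \<psi> in linarith)+
    then have "1 * (c m * cos (\<psi> + \<beta> * (pi / 2))) \<le> r powr - \<beta> * (c m * cos (\<psi> + \<beta> * (pi / 2)))"
      using powr_minus_ge_1[OF r(1,3)] by (intro mult_right_mono)
    then show ?thesis using r(5) by (simp add: mult_ac)
  qed
  ultimately have "Re (?w * F' (q m + ?w)) / \<beta> < 0" by linarith
  then show ?thesis using \<beta> by (simp only: divide_less_0_iff) linarith
qed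

lemma norm_F'_le:
  assumes "q m + w \<in> V" "0 < e" "\<And>n. e \<le> norm (w + \<i> * of_real (\<delta> n))"
  shows "norm (F' (q m + w)) \<le> S * e powr (- \<beta> - 1)"
proof -
  have s: "(\<lambda>n. of_real (c n) * (- of_real \<beta> / (w + \<i> * of_real (\<delta> n)) * kern (w + \<i> * of_real (\<delta> n)))) sums F' (q m + w)"
    using F_derivative(2)[OF assms(1)] unfolding minus_q .
  have le: "norm (of_real (c n) * (- of_real \<beta> / (w + \<i> * of_real (\<delta> n)) * kern (w + \<i> * of_real (\<delta> n))))
      \<le> c n * e powr (- \<beta> - 1)" for n
  proof -
    let ?v = "w + \<i> * of_real (\<delta> n)"
    have v0: "?v \<noteq> 0" using assms(2) assms(3)[of n] by auto
    have "norm (- of_real \<beta> / ?v * kern ?v) = \<beta> * (norm ?v powr - \<beta> / norm ?v)"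
      using \<beta> by (simp add: norm_mult norm_divide norm_kern[OF v0])
    also have "\<dots> = \<beta> * norm ?v powr (- \<beta> - 1)" using v0 by (simp add: powr_diff)
    also have "\<dots> \<le> 1 * e powr (- \<beta> - 1)" using assms(2) assms(3)[of n] \<beta> by (intro mult_mono powr_mono2') auto
    finally show ?thesis using c(1)[of n] by (simp only: norm_mult norm_of_real abs_of_nonneg mult_left_mono mult_1)
  qed
  have "norm (\<Sum>n. of_real (c n) * (- of_real \<beta> / (w + \<i> * of_real (\<delta> n)) * kern (w + \<i> * of_real (\<delta> n))))
      \<le> (\<Sum>n. c n * e powr (- \<beta> - 1))"
    using le by (intro norm_suminf_le summable_mult2 c(2))
  then show ?thesis using sums_unique[OF s] suminf_mult2[OF c(2)] by (simp add: S_def)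
qed

text \<open>Within 3 r^(1+\<beta>) / 8 of the top, where |F'| is at most S (r/2)^(-\<beta>-1), the
  function F varies by a bounded amount: at most (3/8) 2^(1+\<beta>) S, which is below 2 S.\<close>

lemma norm_f_near:
  assumes r: "small r" and w: "0 \<le> Re w" "r / 2 \<le> Im w" "norm w \<le> r" "norm (w - \<i> * of_real r) \<le> 3 * (r * r powr \<beta> / 8)"
  shows "amp r * exp (- (2 * S)) \<le> norm (f (q m + w))"
proof -
  note rr = smallD[OF r]
  let ?X = "{w. 0 \<le> Re w} \<inter> {w. r / 2 \<le> Im w} \<inter> cball 0 r"
  let ?L = "S * (r / 2) powr (- \<beta> - 1)"
  have cv: "convex ?X" by (intro convex_Int convex_halfspace_Im_ge convex_halfspace_Re_ge convex_cball)
  have "norm (F (q m + w) - F (q m + \<i> * of_real r)) \<le> ?L * norm (w - \<i> * of_real r)"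
  proof (rule field_differentiable_bound[OF cv, of "\<lambda>w. F (q m + w)" "\<lambda>w. F' (q m + w)"])
    fix x assume x: "x \<in> ?X"
    then have x': "0 \<le> Re x" "r / 2 \<le> Im x" "norm x \<le> g / 2" using rr by auto
    have V: "q m + x \<in> V" using x' rr by (intro in_V) auto
    have "((\<lambda>w. F (q m + w)) has_field_derivative F' (q m + x) * 1) (at x)"
      by (rule DERIV_chain2[where f = F and g = "\<lambda>w. q m + w", OF F_derivative(3)[OF V]]) (auto intro!: derivative_eq_intros)
    then show "((\<lambda>w. F (q m + w)) has_field_derivative F' (q m + x)) (at x within ?X)"
      by (simp add: has_field_derivative_at_within)
    show "norm (F' (q m + x)) \<le> ?L"
    proof (rule norm_F'_le[OF V])
      fix n
      show "r / 2 \<le> norm (x + \<i> * of_real (\<delta> n))"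
      proof (cases rule: \<delta>_cases[of n])
        case 1
        then have "r / 2 \<le> Im (x + \<i> * of_real (\<delta> n))" using x'(2) by simp
        then show ?thesis using abs_Im_le_cmod[of "x + \<i> * of_real (\<delta> n)"] by linarith
      next
        case 2
        then show ?thesis using shift_norm[OF x'(3) 2] rr by linarith
      qed
    qed (use rr in simp)
  qed (use w rr in \<open>auto simp: norm_mult\<close>)
  also have "\<dots> \<le> ?L * (3 * (r * r powr \<beta> / 8))" using w(4) S_pos by (intro mult_left_mono) auto
  also have "\<dots> = S * (3 / 8) * (2 powr \<beta> * 2)"
  proof -
    have "(r / 2) powr (- \<beta> - 1) = (r / 2) powr - \<beta> / (r / 2)" using rr by (simp add: powr_diff)
    also have "(r / 2) powr - \<beta> = 2 powr \<beta> / r powr \<beta>" using rr by (simp add: powr_minus powr_divide)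
    finally show ?thesis using rr by (simp add: field_simps)
  qed
  also have "\<dots> \<le> S * (3 / 8) * (2 powr 1 * 2)" using \<beta> S_pos by (intro mult_left_mono mult_right_mono powr_mono) auto
  also have "\<dots> \<le> 2 * S" using S_pos by simp
  finally have "\<bar>Re (F (q m + w) - F (q m + \<i> * of_real r))\<bar> \<le> 2 * S" by (rule order_trans[OF abs_Re_le_cmod])
  then have "- Re (F (q m + \<i> * of_real r)) + - (2 * S) \<le> - Re (F (q m + w))" by (simp add: abs_le_iff)
  then show ?thesis by (simp add: amp_def norm_f flip: exp_add)
qed

text \<open>The box in the next proof has area e^2 / 2 with e = r^(1+\<beta>) / 8, whence 128 = 2 *
  8^2; its power of r cancels against that of the squared derivative.\<close>

definition C1 :: real where "C1 = (\<beta> * A1 * exp (- (2 * S)))\<^sup>2 / 128"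

lemma C1_pos: "0 < C1" using \<beta> A1_pos by (simp add: C1_def)

lemma integral_deriv_f_ge:
  assumes r: "small r" and int: "integrable (lebesgue_on (ball (q m) r \<inter> half_plane)) (\<lambda>z. (norm (deriv f z))\<^sup>2)"
  shows "C1 * (amp r)\<^sup>2 \<le> (LINT z|lebesgue_on (ball (q m) r \<inter> half_plane). (norm (deriv f z))\<^sup>2)"
proof -
  note rr = smallD[OF r]
  let ?S = "ball (q m) r \<inter> half_plane"
  define e where "e = r * r powr \<beta> / 8"
  have rb: "0 < r powr \<beta>" "r powr \<beta> \<le> 1" using rr powr_mono2[of \<beta> r 1] \<beta> by auto
  have e: "0 < e" "e \<le> r / 8" using rr(1) rb mult_left_mono[OF rb(2), of r] by (auto simp: e_def)
  \<comment> \<open>A box just below the top point and to its right: the sum of the coordinates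
    relative to \<open>q m\<close> is at most r, so it lies in the half disc, and every point of it
    is within 3 e of the top.\<close>
  let ?B = "cbox (q m + Complex (e / 2) (r - 2 * e)) (q m + Complex e (r - e))"
  define H where "H = (\<beta> * A1 * r powr - \<beta> / r * (amp r * exp (- (2 * S))))\<^sup>2"
  have B: "z \<in> ?S \<and> H \<le> (norm (deriv f z))\<^sup>2" if "z \<in> ?B" for z
  proof -
    define w where "w = z - q m"
    have z: "z = q m + w" by (simp add: w_def)
    have w: "e / 2 \<le> Re w" "Re w \<le> e" "r - 2 * e \<le> Im w" "Im w \<le> r - e"
      using that by (auto simp: z in_cbox_complex_iff)
    have "norm w \<le> \<bar>Re w\<bar> + \<bar>Im w\<bar>" by (rule cmod_le)
    then have nw: "norm w \<le> r" using w e by simp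
    have nw': "norm w < r"
    proof -
      have "0 < Re w" "0 < Im w" using w e by auto
      then have "(norm w)\<^sup>2 < (\<bar>Re w\<bar> + \<bar>Im w\<bar>)\<^sup>2" by (simp add: cmod_power2 power2_sum)
      then have "norm w < \<bar>Re w\<bar> + \<bar>Im w\<bar>" by (rule power2_less_imp_less) simp
      then show ?thesis using w e by simp
    qed
    have S: "z \<in> ?S" using w e nw' by (auto simp: z dist_norm q_def norm_minus_commute)
    have V: "z \<in> V" using S half_in_V by auto
    have "norm (w - \<i> * of_real r) \<le> \<bar>Re (w - \<i> * of_real r)\<bar> + \<bar>Im (w - \<i> * of_real r)\<bar>" by (rule cmod_le)
    also have "\<dots> \<le> 3 * (r * r powr \<beta> / 8)" using w e by (simp flip: e_def)
    finally have fw: "amp r * exp (- (2 * S)) \<le> norm (f z)"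
      unfolding z using w e nw by (intro norm_f_near[OF r]) auto
    have w0: "w \<noteq> 0" "0 < norm w" using w e by auto
    have "norm w * (K * S) \<le> r * (K * S)" using nw K_pos S_pos by (intro mult_right_mono) auto
    then have "\<beta> * A1 * norm w powr - \<beta> \<le> Im (w * F' z)"
      unfolding z using w e nw rr by (intro F'_Im_ge w0) auto
    also have "\<dots> \<le> norm w * norm (F' z)" using abs_Im_le_cmod[of "w * F' z"] by (simp add: norm_mult)
    also have "\<dots> \<le> r * norm (F' z)" using nw by (intro mult_right_mono) auto
    finally have "\<beta> * A1 * norm w powr - \<beta> \<le> r * norm (F' z)" .
    moreover have "\<beta> * A1 * r powr - \<beta> \<le> \<beta> * A1 * norm w powr - \<beta>"
      using nw w0 \<beta> A1_pos by (intro mult_left_mono powr_mono2') auto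
    ultimately have "\<beta> * A1 * r powr - \<beta> / r \<le> norm (F' z)" using rr by (simp add: divide_le_eq mult.commute)
    then have "\<beta> * A1 * r powr - \<beta> / r * (amp r * exp (- (2 * S))) \<le> norm (F' z) * norm (f z)"
      using fw amp_pos by (intro mult_mono) (auto simp: less_imp_le)
    also have "\<dots> = norm (deriv f z)" by (simp add: deriv_f[OF V] norm_mult)
    finally have "H \<le> (norm (deriv f z))\<^sup>2"
      unfolding H_def using \<beta> A1_pos rr amp_pos[of r] by (intro power_mono mult_nonneg_nonneg divide_nonneg_nonneg) auto
    then show ?thesis using S by blast
  qed
  have meas: "measure lebesgue ?B = e / 2 * e"
    using e by (simp add: measure_lborel_cbox_eq Basis_complex_def inner_complex_def)
  have Sm: "?S \<in> sets lebesgue" by (intro sets_completionI_sets) (auto intro!: borel_open open_Int open_halfspace_Re_gt)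
  have subB: "?B \<subseteq> ?S" using B by blast
  have "C1 * (amp r)\<^sup>2 = H * (e / 2 * e)"
  proof -
    have "r powr - \<beta> * r powr \<beta> = 1" using rr by (simp add: powr_minus)
    then have "(r powr - \<beta>)\<^sup>2 * (r powr \<beta>)\<^sup>2 = 1" by (simp flip: power_mult_distrib)
    moreover have "H * (e / 2 * e) = (\<beta> * A1 * exp (- (2 * S)))\<^sup>2 / 128 * (amp r)\<^sup>2 * ((r powr - \<beta>)\<^sup>2 * (r powr \<beta>)\<^sup>2)"
      using rr by (simp add: H_def e_def power_mult_distrib power_divide power2_eq_square field_simps)
    ultimately show ?thesis by (simp only: C1_def mult_1_right)
  qed
  also have "\<dots> = (LINT z|lebesgue_on ?S. H * indicator ?B z)"
    using subB meas Sm by (simp add: integral_restrict_space Int_absorb1 indicator_inter_arith[symmetric]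
        measure_restrict_space Int_absorb2)
  also have "\<dots> \<le> (LINT z|lebesgue_on ?S. (norm (deriv f z))\<^sup>2)"
  proof (rule integral_mono[OF _ int])
    show "integrable (lebesgue_on ?S) (\<lambda>z. H * indicator ?B z)"
      using subB Sm by (intro integrable_mult_right integrable_real_indicator)
        (auto simp: sets_restrict_space emeasure_restrict_space image_iff emeasure_lborel_cbox_finite[unfolded infinity_ennreal_def] intro!: bexI[of _ ?B])
  qed (use B in \<open>auto simp: indicator_def\<close>)
  finally show ?thesis .
qed

text \<open>With parameters in [0, 2 pi] the half circle has two pieces. On the second, t - 2 pi is
  the angle to compare with pi/2, and it is so far away that the constant exp (- a pi/2) is
  enough.\<close>

lemma h_arc_le:
  assumes r: "small r" and t: "t \<in> {0..2 * pi}" "0 < cos t"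
  defines "a \<equiv> 2 * A1 * r powr - \<beta>"
  shows "(h (q m + of_real r * cis t))\<^sup>2
    \<le> (amp r)\<^sup>2 * (exp (- a * (pi / 2 - t)) * indicator {0..pi / 2} t + exp (- a * (pi / 2)) * indicator {3 * pi / 2..2 * pi} t)"
proof -
  have z: "q m + of_real r * cis t \<in> half_plane" using t smallD(1)[OF r] by (simp add: q_def)
  have sq: "(h (q m + of_real r * cis t))\<^sup>2 \<le> (amp r)\<^sup>2 * exp (- a * (pi / 2 - s))"
    if s: "- (pi / 2) < s" "s \<le> pi / 2" "cis s = cis t" for s
  proof -
    have "\<bar>h (q m + of_real r * cis t)\<bar> \<le> norm (f (q m + of_real r * cis s))"
      unfolding h_half_plane[OF z] s(3) by (rule abs_Re_le_cmod)
    also have "\<dots> \<le> amp r * exp (- (A1 * r powr - \<beta> * (pi / 2 - s)))" by (rule norm_f_arc_le[OF r s(1,2)])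
    finally have "\<bar>h (q m + of_real r * cis t)\<bar>\<^sup>2 \<le> (amp r * exp (- (A1 * r powr - \<beta> * (pi / 2 - s))))\<^sup>2"
      by (rule power_mono) simp
    then show ?thesis by (simp add: power_mult_distrib a_def mult_ac flip: exp_double)
  qed
  have a: "0 < a" using A1_pos smallD(1)[OF r] by (simp add: a_def)
  show ?thesis
  proof (cases "t \<le> pi / 2")
    case True
    have t': "- (pi / 2) < t" "\<not> 3 * pi / 2 \<le> t" 
      using True t(1) pi_gt_zero by (simp_all only: atLeastAtMost_iff) linarith+
    then show ?thesis using sq[of t] True t by (simp add: indicator_def)
  next
    case False
    have "3 * pi / 2 < t"
    proof (rule ccontr)
      assume "\<not> 3 * pi / 2 < t"
      then have "0 \<le> cos (t - pi)" using False by (intro cos_ge_zero) auto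
      then show False using t by (simp add: cos_diff)
    qed
    then have t': "- (pi / 2) < t - 2 * pi" "t - 2 * pi \<le> 0" using t by auto
    have "cis (t - 2 * pi) = cis t" by (simp add: cis_conv_exp exp_diff algebra_simps exp_two_pi_i')
    then have "(h (q m + of_real r * cis t))\<^sup>2 \<le> (amp r)\<^sup>2 * exp (- a * (pi / 2 - (t - 2 * pi)))"
      using t' pi_gt_zero by (intro sq) linarith+
    also have "\<dots> \<le> (amp r)\<^sup>2 * exp (- a * (pi / 2))"
      using a t' by (intro mult_left_mono) auto
    finally show ?thesis using \<open>3 * pi / 2 < t\<close> t False by (simp add: indicator_def)
  qed
qed

section \<open>The denominator of the frequency\<close>

definition circ_arc :: "real set" where "circ_arc = {t \<in> {0..2 * pi}. 0 < cos t}"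

text \<open>The first piece of the majorant integrates to at most 1/a. On the second, exp (-x) \<le>
  1/x at x = a pi/2 gives another 1/a.\<close>

lemma arc_integrable:
  assumes "small r"
  shows "set_integrable lborel circ_arc (\<lambda>t. (h (q m + of_real r * cis t))\<^sup>2)"
    "(LINT t:circ_arc|lborel. (h (q m + of_real r * cis t))\<^sup>2) \<le> (amp r)\<^sup>2 / (A1 * r powr - \<beta>)"
proof -
  define a where "a = 2 * A1 * r powr - \<beta>"
  have a: "0 < a" using A1_pos smallD(1)[OF assms] by (simp add: a_def)
  let ?G1 = "\<lambda>t. exp (- a * (pi / 2 - t)) * indicator {0..pi / 2} t"
  let ?G2 = "\<lambda>t. exp (- a * (pi / 2)) * indicator {3 * pi / 2..2 * pi} t"
  let ?G = "\<lambda>t. (amp r)\<^sup>2 * (?G1 t + ?G2 t)"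
  have 1: "has_bochner_integral lborel ?G1 (exp (- a * (pi / 2 - pi / 2)) / a - exp (- a * (pi / 2 - 0)) / a)"
    using a by (intro has_bochner_integral_FTC_Icc_real) (auto intro!: derivative_eq_intros continuous_intros)
  have 2: "has_bochner_integral lborel ?G2 (exp (- a * (pi / 2)) * (pi / 2))"
    by (auto simp: has_bochner_integral_iff)
  have int: "integrable lborel ?G" and val: "integral\<^sup>L lborel ?G \<le> (amp r)\<^sup>2 * (2 / a)"
  proof -
    have "has_bochner_integral lborel ?G ((amp r)\<^sup>2 * (exp (- a * (pi / 2 - pi / 2)) / a - exp (- a * (pi / 2 - 0)) / a + exp (- a * (pi / 2)) * (pi / 2)))"
      by (intro has_bochner_integral_mult_right has_bochner_integral_add 1 2)
    then have G: "integrable lborel ?G" "integral\<^sup>L lborel ?G = (amp r)\<^sup>2 * (exp (- a * (pi / 2 - pi / 2)) / a - exp (- a * (pi / 2 - 0)) / a + exp (- a * (pi / 2)) * (pi / 2))"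
      unfolding has_bochner_integral_iff by blast+
    show "integrable lborel ?G" by (rule G(1))
    have "exp (- (a * (pi / 2))) \<le> fact 1 / (a * (pi / 2)) ^ 1" using a by (intro exp_minus_le_power) simp
    then have "exp (- (a * (pi / 2))) * (pi / 2) \<le> 1 / a" using a by (simp add: field_simps)
    moreover have "0 \<le> exp (- (a * (pi / 2))) / a" using a by simp
    ultimately have "exp (- a * (pi / 2 - pi / 2)) / a - exp (- a * (pi / 2 - 0)) / a + exp (- a * (pi / 2)) * (pi / 2) \<le> 2 / a"
      by simp
    then show "integral\<^sup>L lborel ?G \<le> (amp r)\<^sup>2 * (2 / a)"
      unfolding G(2) by (rule mult_left_mono) simp
  qed
  have arcb: "circ_arc \<in> sets borel"
  proof -
    have "{t::real. 0 < cos t} \<in> sets borel" by (intro borel_open open_Collect_less continuous_intros)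
    then show ?thesis unfolding circ_arc_def by (simp add: Collect_conj_eq Int_def[symmetric])
  qed
  have cont: "continuous_on circ_arc (\<lambda>t. (h (q m + of_real r * cis t))\<^sup>2)"
  proof -
    have "q m + of_real r * cis t \<in> {z. 0 \<le> Re z}" if "t \<in> circ_arc" for t
      using that smallD(1)[OF assms] by (auto simp: circ_arc_def q_def less_imp_le)
    then show ?thesis
      by (intro continuous_intros continuous_on_compose2[OF h_continuous]) auto
  qed
  have le: "(indicator circ_arc t *\<^sub>R (h (q m + of_real r * cis t))\<^sup>2) \<le> ?G t" for t
    using h_arc_le[OF assms, of t] by (auto simp: indicator_def circ_arc_def a_def)
  show i: "set_integrable lborel circ_arc (\<lambda>t. (h (q m + of_real r * cis t))\<^sup>2)"
    unfolding set_integrable_def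
    using le borel_measurable_continuous_on_indicator[OF arcb cont]
    by (intro Bochner_Integration.integrable_bound[OF int]) (auto intro!: AE_I2 simp: abs_of_nonneg indicator_def)
  have "(LINT t:circ_arc|lborel. (h (q m + of_real r * cis t))\<^sup>2) \<le> integral\<^sup>L lborel ?G"
    unfolding set_lebesgue_integral_def using le i by (intro integral_mono int) (auto simp: set_integrable_def)
  also note val
  finally show "(LINT t:circ_arc|lborel. (h (q m + of_real r * cis t))\<^sup>2) \<le> (amp r)\<^sup>2 / (A1 * r powr - \<beta>)"
    by (simp add: a_def)
qed

text \<open>If \<open>Re f\<close> vanished on the upper half of the arc, its tangential derivative would vanish at the end point.\<close>

lemma arc_not_zero:
  assumes "small r"
  shows "\<exists>t>0. t < pi / 2 \<and> h (q m + of_real r * cis t) \<noteq> 0"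
proof (rule ccontr)
  assume "\<not> ?thesis"
  then have z: "h (q m + of_real r * cis t) = 0" if "0 < t" "t < pi / 2" for t using that by blast
  note r = smallD[OF assms]
  let ?w = "\<i> * of_real r" and ?\<phi> = "\<lambda>t. Re (f (q m + of_real r * cis t))"
  have w: "of_real r * cis (pi / 2) = ?w" by simp
  have V: "q m + ?w \<in> V" using r by (intro in_V) (auto simp: norm_mult)
  have zero: "?\<phi> t = 0" if "0 < t" "t < pi / 2" for t
  proof -
    have "q m + of_real r * cis t \<in> half_plane" using that r(1) cos_gt_zero[of t] by (simp add: q_def)
    then show ?thesis using z[OF that] h_half_plane by metis
  qed
  have d1: "((\<lambda>t. q m + of_real r * cis t) has_vector_derivative of_real r * (\<i> * cis (pi / 2))) (at (pi / 2))"
    unfolding cis_conv_exp by (auto intro!: derivative_eq_intros has_vector_derivative_real_field simp: mult_ac)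
  have d2: "(f has_field_derivative - F' (q m + ?w) * f (q m + ?w)) (at (q m + of_real r * cis (pi / 2)))"
    unfolding w by (rule f_derivative[OF V])
  have "((\<lambda>t. f (q m + of_real r * cis t)) has_vector_derivative
      of_real r * (\<i> * cis (pi / 2)) * (- F' (q m + ?w) * f (q m + ?w))) (at (pi / 2))"
    using field_vector_diff_chain_at[OF d1 d2] by (simp only: o_def)
  from bounded_linear.has_vector_derivative[OF bounded_linear_Re this]
  have D: "(?\<phi> has_real_derivative Re (of_real r * (\<i> * cis (pi / 2)) * (- F' (q m + ?w) * f (q m + ?w)))) (at (pi / 2))"
    by (simp only: has_real_derivative_iff_has_vector_derivative)
  have ev: "\<forall>\<^sub>F t in at_left (pi / 2). ?\<phi> t = 0"
    unfolding eventually_at_left_field using zero pi_gt_zero by (intro exI[of _ 0]) auto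
  have "(?\<phi> \<longlongrightarrow> ?\<phi> (pi / 2)) (at_left (pi / 2))"
    using DERIV_isCont[OF D] by (simp add: isCont_def filterlim_at_split)
  then have "((\<lambda>_. 0) \<longlongrightarrow> ?\<phi> (pi / 2)) (at_left (pi / 2))" using ev by (rule Lim_transform_eventually)
  then have 0: "?\<phi> (pi / 2) = 0" by (simp add: tendsto_const_iff)
  have "((\<lambda>t. (?\<phi> t - ?\<phi> (pi / 2)) / (t - pi / 2)) \<longlongrightarrow> Re (of_real r * (\<i> * cis (pi / 2)) * (- F' (q m + ?w) * f (q m + ?w)))) (at_left (pi / 2))"
    using D unfolding has_field_derivative_iff by (simp only: filterlim_at_split)
  moreover have "\<forall>\<^sub>F t in at_left (pi / 2). (?\<phi> t - ?\<phi> (pi / 2)) / (t - pi / 2) = 0"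
    using ev by eventually_elim (simp only: 0 diff_self div_0)
  ultimately have "((\<lambda>_. 0) \<longlongrightarrow> Re (of_real r * (\<i> * cis (pi / 2)) * (- F' (q m + ?w) * f (q m + ?w)))) (at_left (pi / 2))"
    by (rule Lim_transform_eventually)
  then have D0: "Re (of_real r * (\<i> * cis (pi / 2)) * (- F' (q m + ?w) * f (q m + ?w))) = 0" by (simp add: tendsto_const_iff)
  \<comment> \<open>At the top f would be purely imaginary, equal to i y with y nonzero; the
    tangential derivative of Re f there is y Re X, and Re X is negative.\<close>
  define X y where "X = ?w * F' (q m + ?w)" and "y = Im (f (q m + ?w))"
  have fy: "f (q m + ?w) = \<i> * of_real y" using 0 by (simp add: y_def complex_eq_iff mult.commute)
  have "of_real r * (\<i> * cis (pi / 2)) * (- F' (q m + ?w) * f (q m + ?w)) = X * of_real y"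
    unfolding fy X_def by simp
  then have "Re X * y = 0" using D0 by simp
  moreover have "y \<noteq> 0" using fy amp_pos[of r] by (auto simp: amp_def)
  ultimately have "Re X = 0" by simp
  then show False using F'_Re_neg[OF assms, folded X_def] by simp
qed

text \<open>The integral is a denominator: were it 0, the quotient in \<open>frequency\<close> would
  be 0 by convention and the upper bound on the integral would be of no help.\<close>

lemma arc_integral_pos:
  assumes "small r"
  shows "0 < (LINT t:circ_arc|lborel. (h (q m + of_real r * cis t))\<^sup>2)"
proof (rule ccontr)
  let ?k = "\<lambda>t. indicator circ_arc t *\<^sub>R (h (q m + of_real r * cis t))\<^sup>2"
  let ?N = "{t \<in> {0<..<pi / 2}. h (q m + of_real r * cis t) \<noteq> 0}"
  have int: "integrable lborel ?k" using arc_integrable(1)[OF assms] by (simp add: set_integrable_def)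
  assume "\<not> ?thesis"
  then have "integral\<^sup>L lborel ?k \<le> 0" unfolding set_lebesgue_integral_def by (rule leI)
  moreover have "0 \<le> integral\<^sup>L lborel ?k" by (intro integral_nonneg_AE AE_I2) (simp add: indicator_def)
  ultimately have "integral\<^sup>L lborel ?k = 0" by (rule antisym)
  then have "AE t in lborel. ?k t = 0" using int by (subst (asm) integral_nonneg_eq_0_iff_AE) (auto simp: indicator_def)
  moreover have circ_arc: "t \<in> circ_arc" if "t \<in> {0<..<pi / 2}" for t using that cos_gt_zero[of t] by (auto simp: circ_arc_def)
  ultimately have "AE t in lborel. t \<notin> ?N" by (auto elim!: eventually_mono simp: indicator_def)
  then have ae: "AE t in lebesgue. t \<notin> ?N" by (rule AE_completion)
  have op: "open ?N"
  proof -
    have "continuous_on {0<..<pi / 2} (\<lambda>t. h (q m + of_real r * cis t))"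
    proof (intro continuous_on_compose2[OF h_continuous] continuous_intros)
      show "(\<lambda>t. q m + of_real r * cis t) ` {0<..<pi / 2} \<subseteq> {z. 0 \<le> Re z}"
        using circ_arc smallD(1)[OF assms] by (auto simp: circ_arc_def q_def less_imp_le)
    qed
    then have "open ({0<..<pi / 2} \<inter> (\<lambda>t. h (q m + of_real r * cis t)) -` (- {0}))"
      by (rule continuous_open_preimage) auto
    then show ?thesis by (simp add: vimage_def Int_def conj_commute)
  qed
  have "?N \<in> sets lebesgue" using op by (intro sets_completionI_sets) simp
  then have "negligible ?N" unfolding negligible_iff_null_sets by (rule AE_iff_null_sets[THEN iffD2, OF _ ae])
  then have "?N = {}" using open_not_negligible[OF op] by blast
  then show False using arc_not_zero[OF assms] by auto
qed

lemma frequency_ge: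
  fixes b :: "'b::euclidean_space"
  assumes "0 < Q" "norm b = 1" "small r"
  shows "C1 * A1 * r powr - \<beta> \<le> frequency Q half_plane (\<lambda>z. diag Q b (h z)) (q m) r"
proof -
  let ?S = "ball (q m) r \<inter> half_plane"
  obtain C where C: "\<And>z. z \<in> half_plane \<Longrightarrow> norm (deriv f z) \<le> C" using f'_bounded by blast
  have "half_plane_potential f h C Q b"
    by unfold_locales (rule holomorphic_on_subset[OF f_holomorphic half_in_V] h_half_plane h_le_1 C assms; assumption?)+
  then interpret half_plane_potential f h C Q b .
  have op: "open ?S" by (intro open_Int open_half_plane) simp
  interpret B: bounded_C1 ?S h h' C Q b by (rule bounded_C1_u[OF op]) auto
  have sq: "(\<Sum>e\<in>Basis. (h' z e)\<^sup>2) = (norm (deriv f z))\<^sup>2" for z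
    by (simp add: Basis_complex_def cmod_power2)
  have "integrable (lebesgue_on ?S) (\<lambda>z. (\<Sum>e\<in>Basis. (h' z e)\<^sup>2))"
    using B.L2_h' by (intro Bochner_Integration.integrable_sum) (auto simp: L2_def)
  then have D: "C1 * (amp r)\<^sup>2 \<le> (LINT z|lebesgue_on ?S. (\<Sum>e\<in>Basis. (h' z e)\<^sup>2))"
    unfolding sq by (rule integral_deriv_f_ge[OF assms(3)])
  let ?M = "LINT t:circ_arc|lborel. (h (q m + of_real r * cis t))\<^sup>2"
  have circ_arc: "{t \<in> {0..2 * pi}. q m + of_real r * cis t \<in> half_plane} = circ_arc"
    using smallD(1)[OF assms(3)] by (auto simp: circ_arc_def q_def zero_less_mult_iff)
  have "1 / r * circle_integral half_plane (q m) r (\<lambda>z. qnorm2 (diag Q b (h z))) = real Q * ?M"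
    unfolding circle_integral_def circ_arc qnorm2_diag[OF assms(2)] using smallD(1)[OF assms(3)]
    by (simp add: set_lebesgue_integral_def mult.assoc mult.left_commute[of _ "real Q"] mult.left_commute[of "indicator _ _" "real Q"])
  then have fr: "frequency Q half_plane u (q m) r = (LINT z|lebesgue_on ?S. (\<Sum>e\<in>Basis. (h' z e)\<^sup>2)) / ?M"
    unfolding frequency_def B.dirichlet_energy_u using assms(1) by simp
  have M: "0 < ?M" by (rule arc_integral_pos[OF assms(3)])
  have a: "0 < A1 * r powr - \<beta>" using A1_pos smallD(1)[OF assms(3)] by simp
  have "C1 * A1 * r powr - \<beta> * ?M \<le> C1 * A1 * r powr - \<beta> * ((amp r)\<^sup>2 / (A1 * r powr - \<beta>))"
    using arc_integrable(2)[OF assms(3)] C1_pos A1_pos by (intro mult_left_mono) auto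
  also have "\<dots> = C1 * (amp r)\<^sup>2" using a A1_pos smallD(1)[OF assms(3)] by simp
  finally have "C1 * A1 * r powr - \<beta> * ?M \<le> (LINT z|lebesgue_on ?S. (\<Sum>e\<in>Basis. (h' z e)\<^sup>2))" using D by linarith
  then show ?thesis unfolding fr using M by (simp add: le_divide_eq)
qed

text \<open>The lower bound holds for all small radii, not just along a special sequence; hence the
  radii 1 / (n + 1) serve every pole at once.\<close>

lemma frequency_tendsto:
  fixes b :: "'b::euclidean_space"
  assumes "0 < Q" "norm b = 1"
  shows "filterlim (\<lambda>n. frequency Q half_plane (\<lambda>z. diag Q b (h z)) (q m) (1 / real (Suc n))) at_top sequentially"
proof (rule filterlim_at_top_mono)
  have "0 < \<beta> * (pi / 2)" using \<beta> by simp
  then have cp: "0 < c m * cos (\<psi> + \<beta> * (pi / 2))"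
    using cm by (intro mult_pos_pos cos_gt_zero) (use angle' \<psi> in linarith)+
  have lim: "(\<lambda>n. 1 / real (Suc n)) \<longlonglongrightarrow> 0" using LIMSEQ_inverse_real_of_nat by (simp add: inverse_eq_divide)
  have lim': "(\<lambda>n. 1 / real (Suc n) * (K * S)) \<longlonglongrightarrow> 0 * (K * S)" by (intro tendsto_mult lim tendsto_const)
  have "\<forall>\<^sub>F n in sequentially. 1 / real (Suc n) < g / 2" using lim g by (intro order_tendstoD) auto
  moreover have "\<forall>\<^sub>F n in sequentially. 1 / real (Suc n) * (K * S) < A1"
    using lim' A1_pos by (intro order_tendstoD) auto
  moreover have "\<forall>\<^sub>F n in sequentially. 1 / real (Suc n) * (K * S) < c m * cos (\<psi> + \<beta> * (pi / 2))"
    using lim' cp by (intro order_tendstoD) auto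
  ultimately show "\<forall>\<^sub>F n in sequentially. C1 * A1 * (1 / real (Suc n)) powr - \<beta>
      \<le> frequency Q half_plane (\<lambda>z. diag Q b (h z)) (q m) (1 / real (Suc n))"
    by eventually_elim (rule frequency_ge[OF assms], auto simp: small_def)
  have "filterlim (\<lambda>n. real (Suc n) powr \<beta>) at_top sequentially"
    using \<beta> by (intro filterlim_compose[OF real_powr_at_top] filterlim_compose[OF filterlim_real_sequentially] filterlim_Suc)
  then have "filterlim (\<lambda>n. C1 * A1 * real (Suc n) powr \<beta>) at_top sequentially"
    using C1_pos A1_pos by (intro filterlim_tendsto_pos_mult_at_top[OF tendsto_const]) auto
  then show "filterlim (\<lambda>n. C1 * A1 * (1 / real (Suc n)) powr - \<beta>) at_top sequentially"
    by (simp add: powr_minus powr_divide)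
qed

end

section \<open>Regularity inside and on the boundary\<close>

lemma has_derivative_linear_holomorphic:
  assumes "open S" "g holomorphic_on S" "bounded_linear L" "z \<in> S"
  shows "((\<lambda>z. L (g z)) has_derivative (\<lambda>e. L (deriv g z * e))) (at z)"
  using bounded_linear.has_derivative[OF assms(3) has_field_derivative_imp_has_derivative[OF holomorphic_derivI[OF assms(2,1,4)]]] .

lemma bounded_linear_mult_left_comp:
  fixes L :: "complex \<Rightarrow> 'b::real_normed_vector"
  assumes "bounded_linear L"
  shows "bounded_linear (\<lambda>w. L (w * e))"
  by (rule bounded_linear_compose[OF assms bounded_linear_mult_left])

text \<open>An arbitrary real-linear \<open>L\<close> is allowed because a directional derivative
  has the same form, with g' in place of g and w -> L (w e) in place of L; this closes the
  induction.\<close>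

lemma cont_diff_on_linear_holomorphic:
  assumes "open S" "g holomorphic_on S" "bounded_linear L"
  shows "cont_diff_on k S (\<lambda>z. L (g z))"
  using assms(2,3)
proof (induction k arbitrary: g L)
  case 0
  then show ?case
    by (simp add: bounded_linear.continuous_on holomorphic_on_imp_continuous_on)
next
  case (Suc k)
  have "cont_diff_on k S (\<lambda>z. L (deriv g z * e))" for e
    using Suc.IH[OF holomorphic_deriv[OF Suc.prems(1) assms(1)] bounded_linear_mult_left_comp[OF Suc.prems(2)]] .
  then show ?case
    using cont_diff_on_Suc_iff[OF assms(1) has_derivative_linear_holomorphic[OF assms(1) Suc.prems]] by blast
qed

text \<open>The second derivatives in the directions 1 and i are L (g'') and L (i^2 g''), so they
  cancel.\<close>

lemma harmonic_on_linear_holomorphic: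
  assumes "open S" "g holomorphic_on S" "bounded_linear L" "\<And>z. z \<in> S \<Longrightarrow> u z = L (g z)"
  shows "harmonic_on S u"
  unfolding harmonic_on_def smooth_on_def
proof (intro conjI allI ballI)
  show "cont_diff_on k S u" for k
    by (rule cont_diff_on_cong[OF assms(1) _ cont_diff_on_linear_holomorphic[OF assms(1-3)]]) (simp add: assms(4))
  have d1: "frechet_derivative u (at z) e = L (deriv g z * e)" if "z \<in> S" for z e
    using has_derivative_transform_within_open[OF has_derivative_linear_holomorphic[OF assms(1-3) that] assms(1) that, of u]
      assms(4) frechet_derivative_at by metis
  fix z assume z: "z \<in> S"
  have "frechet_derivative (\<lambda>z. frechet_derivative u (at z) e) (at z) e = L (deriv (deriv g) z * e * e)" for e
  proof -
    have "((\<lambda>z. L (deriv g z * e)) has_derivative (\<lambda>w. L (deriv (deriv g) z * w * e))) (at z)"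
      using has_derivative_linear_holomorphic[OF assms(1) holomorphic_deriv[OF assms(2,1)] bounded_linear_mult_left_comp[OF assms(3)] z] .
    then have "((\<lambda>z. frechet_derivative u (at z) e) has_derivative (\<lambda>w. L (deriv (deriv g) z * w * e))) (at z)"
      by (rule has_derivative_transform_within_open[OF _ assms(1) z]) (simp add: d1)
    from frechet_derivative_at[OF this] show ?thesis by metis
  qed
  then have "laplacian u z = L (deriv (deriv g) z) + L (- deriv (deriv g) z)"
    by (simp add: laplacian_def Basis_complex_def mult.assoc)
  then show "laplacian u z = 0"
    using bounded_linear.linear[OF assms(3)] by (simp add: linear_neg)
qed

text \<open>\<open>G j\<close> stands for the j-th derivative. Being a formal polynomial, it can be
  differentiated by \<open>pderiv\<close>, and the result is the Taylor polynomial of the shifted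
  family.\<close>

definition taylor_poly :: "nat \<Rightarrow> (nat \<Rightarrow> real \<Rightarrow> real) \<Rightarrow> real \<Rightarrow> real poly" where
  "taylor_poly k G x = (\<Sum>j\<le>k. smult (G j x / fact j) ([:- x, 1:] ^ j))"

lemma poly_taylor_poly: "poly (taylor_poly k G x) y = (\<Sum>j\<le>k. G j x / fact j * (y - x) ^ j)"
  by (simp add: taylor_poly_def poly_sum)

lemma pderiv_taylor_poly: "pderiv (taylor_poly (Suc k) G x) = taylor_poly k (\<lambda>j. G (Suc j)) x"
proof -
  have "pderiv (smult (G (Suc j) x / fact (Suc j)) ([:- x, 1:] ^ Suc j)) = smult (G (Suc j) x / fact j) ([:- x, 1:] ^ j)" for j
    by (simp add: pderiv_smult pderiv_power_Suc pderiv_pCons smult_smult field_simps del: power_Suc of_nat_Suc)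
  then show ?thesis
    unfolding taylor_poly_def sum.atMost_Suc_shift
    using higher_pderiv_sum[of 1 "\<lambda>j. smult (G (Suc j) x / fact (Suc j)) ([:- x, 1:] ^ Suc j)" "{..k}"]
    by (simp add: pderiv_add pderiv_smult del: power_Suc fact_Suc)
qed

lemma degree_taylor_poly: "degree (taylor_poly k G x) \<le> k"
  unfolding taylor_poly_def
proof (rule degree_sum_le)
  fix j assume "j \<in> {..k}"
  have "degree (smult (G j x / fact j) ([:- x, 1:] ^ j)) \<le> degree ([:- x, 1:] ^ j)" by (rule degree_smult_le)
  also have "\<dots> \<le> degree [:- x, 1:] * j" by (rule degree_power_le)
  also have "\<dots> \<le> k" using \<open>j \<in> {..k}\<close> by simp
  finally show "degree (smult (G j x / fact j) ([:- x, 1:] ^ j)) \<le> k" .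
qed simp

lemma higher_pderiv_taylor_poly:
  "j \<le> k \<Longrightarrow> (pderiv ^^ j) (taylor_poly k G x) = taylor_poly (k - j) (\<lambda>i. G (i + j)) x"
proof (induction j)
  case (Suc j)
  then obtain l where "k - j = Suc l" by (metis Suc_diff_Suc Suc_le_eq)
  then have "k - Suc j = l" by simp
  then show ?case using Suc \<open>k - j = Suc l\<close> by (simp add: pderiv_taylor_poly)
qed simp

lemma nth_deriv_poly_scaleR:
  "nth_deriv j (\<lambda>t. poly p t *\<^sub>R b) = (\<lambda>t. poly ((pderiv ^^ j) p) t *\<^sub>R b)"
proof (induction j)
  case (Suc j)
  have "(poly q has_vector_derivative poly (pderiv q) t) (at t)" for q :: "real poly" and t
    using poly_DERIV[of q t] by (simp add: has_real_derivative_iff_has_vector_derivative)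
  from bounded_linear.has_vector_derivative[OF bounded_linear_scaleR_left this]
  have "((\<lambda>t. poly q t *\<^sub>R b) has_vector_derivative poly (pderiv q) t *\<^sub>R b) (at t)" for q t .
  then have "vector_derivative (\<lambda>t. poly q t *\<^sub>R b) (at t) = poly (pderiv q) t *\<^sub>R b" for q t
    by (rule vector_derivative_at)
  note vd = this
  show ?case
    using Suc unfolding nth_deriv_def by (simp only: funpow.simps o_apply vd)
qed (simp add: nth_deriv_def)

lemma poly_le_scaleR:
  assumes "degree p \<le> k"
  shows "poly_le k (\<lambda>t. poly p t *\<^sub>R b)"
  unfolding poly_le_def
proof (intro exI allI)
  fix t
  have "poly p t = (\<Sum>j\<le>k. coeff p j * t ^ j)"
    unfolding poly_altdef using assms by (intro sum.mono_neutral_left) (auto simp: coeff_eq_0)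
  then show "poly p t *\<^sub>R b = (\<Sum>j\<le>k. t ^ j *\<^sub>R (coeff p j *\<^sub>R b))"
    by (simp add: scaleR_sum_left mult.commute)
qed

lemma taylor_poly_remainder:
  assumes G: "\<And>j t. (G j has_real_derivative G (Suc j) t) (at t)"
    and M: "\<And>t. t \<in> {- R..R} \<Longrightarrow> \<bar>G (Suc k) t\<bar> \<le> M" and xy: "x \<in> {- R..R}" "y \<in> {- R..R}" and j: "j \<le> k"
  shows "\<bar>G j y - poly ((pderiv ^^ j) (taylor_poly k G x)) y\<bar> * fact (k - j) \<le> M * \<bar>x - y\<bar> ^ Suc (k - j)"
proof (cases "x = y")
  case True
  then show ?thesis
    by (simp add: higher_pderiv_taylor_poly[OF j] poly_taylor_poly power_0_left if_distrib sum.delta cong: if_cong)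
next
  case False
  obtain t where t: "if y < x then y < t \<and> t < x else x < t \<and> t < y"
    "G j y = (\<Sum>m<Suc (k - j). G (m + j) x / fact m * (y - x) ^ m) + G (Suc (k - j) + j) t / fact (Suc (k - j)) * (y - x) ^ Suc (k - j)"
    using Taylor[of "Suc (k - j)" "\<lambda>m. G (m + j)" "G j" "- R" R x y] G xy False by auto
  have tR: "t \<in> {- R..R}" using t(1) xy by (auto split: if_splits)
  have "G j y - poly ((pderiv ^^ j) (taylor_poly k G x)) y = G (Suc k) t / fact (Suc (k - j)) * (y - x) ^ Suc (k - j)"
    using t(2) j by (simp add: higher_pderiv_taylor_poly[OF j] poly_taylor_poly lessThan_Suc_atMost del: power_Suc fact_Suc)
  then have "\<bar>G j y - poly ((pderiv ^^ j) (taylor_poly k G x)) y\<bar> * fact (k - j)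
      = \<bar>G (Suc k) t\<bar> * (fact (k - j) / fact (Suc (k - j))) * \<bar>x - y\<bar> ^ Suc (k - j)"
    by (simp add: abs_mult power_abs abs_minus_commute del: power_Suc fact_Suc)
  also have "\<dots> \<le> M * 1 * \<bar>x - y\<bar> ^ Suc (k - j)"
    using M[OF tR] by (intro mult_right_mono mult_mono) (auto simp: fact_mono divide_le_eq_1 simp del: fact_Suc)
  finally show ?thesis by simp
qed

text \<open>All Q polynomials at a point are the same Taylor polynomial times \<open>b\<close>, so
  coinciding values are consistent and the identity permutation suffices. One derivative beyond
  \<open>k\<close> bounds every weighted summand by M \<delta>.\<close>

lemma CkQ_on_diag:
  fixes b :: "'b::euclidean_space"
  assumes b: "norm b = 1" and G: "\<And>j t. (G j has_real_derivative G (Suc j) t) (at t)"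
  shows "CkQ_on k Q UNIV (\<lambda>t. diag Q b (G 0 t))"
  unfolding CkQ_on_def
proof (intro conjI exI ballI allI impI)
  let ?P = "\<lambda>x (i::nat) t. poly (taylor_poly k G x) t *\<^sub>R b"
  have cont: "continuous_on A (G j)" for A j
    using G DERIV_isCont continuous_at_imp_continuous_on by blast
  show "continuous_map (top_of_set UNIV) (AQ_top Q) (\<lambda>t. diag Q b (G 0 t))"
    by (rule diag_continuous_map[OF b cont])
  show "poly_le k (?P x i)" for x i by (rule poly_le_scaleR[OF degree_taylor_poly])
  have val: "poly ((pderiv ^^ j) (taylor_poly k G x)) x = G j x" if "j \<le> k" for j x
    by (simp add: higher_pderiv_taylor_poly[OF that] poly_taylor_poly power_0_left if_distrib sum.delta cong: if_cong)
  show "qtup Q (\<lambda>i. ?P x i x) = diag Q b (G 0 x)" for x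
    using val[of 0 x] by (simp add: diag_def)
  fix K :: "real set" assume K: "compact K \<and> K \<subseteq> UNIV"
  then obtain R where R: "\<And>x. x \<in> K \<Longrightarrow> \<bar>x\<bar> \<le> R" using compact_imp_bounded bounded_real by metis
  have "bounded (G (Suc k) ` {- R..R})" by (intro compact_imp_bounded compact_continuous_image cont compact_Icc)
  then obtain M where M: "\<And>t. t \<in> {- R..R} \<Longrightarrow> \<bar>G (Suc k) t\<bar> \<le> M"
    unfolding bounded_real by blast
  define B where "B \<delta> = real Q * (real (Suc k) * (M * \<delta>))\<^sup>2" for \<delta>
  have le: "CkQ_modulus k Q ?P K \<delta> \<le> ennreal (B \<delta>)" for \<delta>
    unfolding CkQ_modulus_def
  proof (intro SUP_least, clarify)
    fix x y assume xy: "x \<in> K" "y \<in> K" "0 < \<bar>x - y\<bar>" "\<bar>x - y\<bar> \<le> \<delta>"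
    then have R': "x \<in> {- R..R}" "y \<in> {- R..R}" using R[of x] R[of y] by auto
    have M0: "0 \<le> M" using M[OF R'(1)] by simp
    have tm: "norm (nth_deriv j (?P y i) y - nth_deriv j (?P x i) y) * \<bar>x - y\<bar> powi (int j - int k) * fact (k - j) \<le> M * \<delta>"
      if "j \<le> k" for i :: nat and j
    proof -
      have "\<bar>x - y\<bar> powi (int j - int k) = inverse (\<bar>x - y\<bar> ^ (k - j))"
        using that by (simp add: power_int_def nat_diff_distrib' power_inverse)
      moreover have "norm (nth_deriv j (?P y i) y - nth_deriv j (?P x i) y) = \<bar>G j y - poly ((pderiv ^^ j) (taylor_poly k G x)) y\<bar>"
        unfolding nth_deriv_poly_scaleR val[OF that] using b by (simp flip: scaleR_left_diff_distrib)
      ultimately have "norm (nth_deriv j (?P y i) y - nth_deriv j (?P x i) y) * \<bar>x - y\<bar> powi (int j - int k) * fact (k - j)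
          = \<bar>G j y - poly ((pderiv ^^ j) (taylor_poly k G x)) y\<bar> * fact (k - j) * inverse (\<bar>x - y\<bar> ^ (k - j))"
        by simp
      also have "\<dots> \<le> M * \<bar>x - y\<bar> ^ Suc (k - j) * inverse (\<bar>x - y\<bar> ^ (k - j))"
        using taylor_poly_remainder[OF G M R' that] by (intro mult_right_mono) auto
      also have "\<dots> = M * \<bar>x - y\<bar>" using xy(3) by simp
      also have "\<dots> \<le> M * \<delta>" using xy(4) M0 by (intro mult_left_mono)
      finally show ?thesis .
    qed
    have "(INF \<sigma> \<in> {\<sigma>. \<sigma> permutes {..<Q}}. ennreal (\<Sum>i<Q. (\<Sum>j\<le>k. norm (nth_deriv j (?P y i) y - nth_deriv j (?P x (\<sigma> i)) y)
             * \<bar>x - y\<bar> powi (int j - int k) * fact (k - j))\<^sup>2))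
        \<le> ennreal (\<Sum>i<Q. (\<Sum>j\<le>k. norm (nth_deriv j (?P y i) y - nth_deriv j (?P x (id i)) y)
             * \<bar>x - y\<bar> powi (int j - int k) * fact (k - j))\<^sup>2)"
      by (rule INF_lower2[of id]) (simp_all add: permutes_id)
    also have "\<dots> \<le> ennreal (B \<delta>)"
    proof (rule ennreal_leI)
      have "(\<Sum>i<Q. (\<Sum>j\<le>k. norm (nth_deriv j (?P y i) y - nth_deriv j (?P x (id i)) y)
             * \<bar>x - y\<bar> powi (int j - int k) * fact (k - j))\<^sup>2) \<le> (\<Sum>i<Q. (real (Suc k) * (M * \<delta>))\<^sup>2)"
      proof (intro sum_mono power_mono)
        fix i
        show "(\<Sum>j\<le>k. norm (nth_deriv j (?P y i) y - nth_deriv j (?P x (id i)) y)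
             * \<bar>x - y\<bar> powi (int j - int k) * fact (k - j)) \<le> real (Suc k) * (M * \<delta>)"
          using sum_bounded_above[of "{..k}" _ "M * \<delta>"] tm by simp
        show "0 \<le> (\<Sum>j\<le>k. norm (nth_deriv j (?P y i) y - nth_deriv j (?P x (id i)) y)
             * \<bar>x - y\<bar> powi (int j - int k) * fact (k - j))"
          by (intro sum_nonneg mult_nonneg_nonneg) (auto intro: zero_le_power_int)
      qed
      then show "(\<Sum>i<Q. (\<Sum>j\<le>k. norm (nth_deriv j (?P y i) y - nth_deriv j (?P x (id i)) y)
             * \<bar>x - y\<bar> powi (int j - int k) * fact (k - j))\<^sup>2) \<le> B \<delta>" by (simp add: B_def)
    qed
    finally show "(INF \<sigma> \<in> {\<sigma>. \<sigma> permutes {..<Q}}. ennreal (\<Sum>i<Q. (\<Sum>j\<le>k. norm (nth_deriv j (?P y i) y - nth_deriv j (?P x (\<sigma> i)) y)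
             * \<bar>x - y\<bar> powi (int j - int k) * fact (k - j))\<^sup>2)) \<le> ennreal (B \<delta>)" .
  qed
  have "((\<lambda>\<delta>. ennreal (B \<delta>)) \<longlongrightarrow> ennreal (B 0)) (at_right 0)"
    unfolding B_def by (intro tendsto_ennrealI tendsto_intros)
  then have lim: "((\<lambda>\<delta>. ennreal (B \<delta>)) \<longlongrightarrow> 0) (at_right 0)" by (simp add: B_def)
  show "(CkQ_modulus k Q ?P K \<longlongrightarrow> 0) (at_right 0)"
    by (rule tendsto_sandwich[OF _ _ tendsto_const lim]) (use le in auto)
qed auto

section \<open>Traces, interior regularity and minimality of \<open>u\<close>\<close>

lemma W12_norm_zero:
  fixes S :: "'a::euclidean_space set"
  assumes "open S"
  shows "W12_norm S (\<lambda>_. 0) = 0"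
proof -
  have "C1_deriv S (\<lambda>_. 0 :: real) (\<lambda>_ _. 0)" by (auto simp: C1_deriv_def)
  from weak_partial_AE_eq(2)[OF C1_is_weak_partial[OF assms this] assms]
  have ae: "AE x in lebesgue_on S. weak_partial S e (\<lambda>_. 0) x = 0" for e .
  have "(LINT x|lebesgue_on S. (weak_partial S e (\<lambda>_. 0) x)\<^sup>2) = 0" for e
    by (rule integral_eq_zero_AE) (use ae[of e] in \<open>auto elim: eventually_mono\<close>)
  then show ?thesis by (simp add: W12_norm_def)
qed

text \<open>The constant sequence is an admissible approximation.\<close>

lemma has_trace_continuous:
  fixes F :: "'a::euclidean_space \<Rightarrow> real"
  assumes "open S" "W12 S F" "continuous_on (closure S) F" "w \<in> borel_measurable borel" "\<And>z. z \<in> frontier S \<Longrightarrow> w z = F z"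
  shows "has_trace S F w"
  unfolding has_trace_def
proof (intro conjI exI[of _ "\<lambda>_. F"] allI assms)
  show "(\<lambda>n. W12_norm S (\<lambda>x. F x - F x)) \<longlonglongrightarrow> 0" using W12_norm_zero[OF assms(1)] by simp
  have "(\<integral>\<^sup>+z\<in>frontier S. ennreal ((F z - w z)\<^sup>2) \<partial>hausdorff_measure (real DIM('a) - 1))
      = nn_integral (hausdorff_measure (real DIM('a) - 1)) (\<lambda>_ :: 'a. 0)"
    using assms(5) by (intro nn_integral_cong) (auto simp: indicator_def)
  then show "(\<lambda>n::nat. \<integral>\<^sup>+z\<in>frontier S. ennreal ((F z - w z)\<^sup>2) \<partial>hausdorff_measure (real DIM('a) - 1)) \<longlonglongrightarrow> 0"
    by simp
qed

lemma continuous_on_qdist_diag: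
  assumes "norm b = 1" "continuous_on S h" "T \<in> AQ Q"
  shows "continuous_on S (\<lambda>z. qdist Q (diag Q b (h z)) T)"
proof -
  obtain R where "T = qtup Q R" using assms(3) by (auto simp: AQ_def)
  then show ?thesis unfolding qdist_diag[OF assms(1)] \<open>T = qtup Q R\<close> by (intro continuous_intros assms(2))
qed

context half_plane_potential
begin

lemma trace_normalized_u:
  assumes h: "continuous_on {z. 0 \<le> Re z} h"
  shows "trace_normalized Q half_plane u"
  unfolding trace_normalized_def
proof (intro conjI allI impI)
  have "continuous_on half_plane h" by (rule continuous_on_subset[OF h]) auto
  then show "continuous_map (top_of_set half_plane) (AQ_top Q) u" by (rule diag_continuous_map[OF b])
  fix S :: "complex set" and T :: "'b multiset" assume ST: "admissible_domain half_plane S \<and> T \<in> AQ Q"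
  then have S: "open S" "bounded S" "S \<subseteq> half_plane" and T: "T \<in> AQ Q"
    by (auto simp: admissible_domain_def C1_regular_def)
  interpret B: bounded_C1 S h h' C Q b by (rule bounded_C1_u[OF S])
  \<comment> \<open>A trace has to be Borel on the whole plane; the distance is cut off outside the
    closed half plane, where nothing is assumed of \<open>h\<close>.\<close>
  define w where "w z = indicator {z. 0 \<le> Re z} z *\<^sub>R qdist Q (u z) T" for z
  have cont: "continuous_on {z. 0 \<le> Re z} (\<lambda>z. qdist Q (u z) T)" by (rule continuous_on_qdist_diag[OF b h T])
  have cl: "closed {z. 0 \<le> Re z}" by (rule closed_halfspace_Re_ge)
  have cS: "closure S \<subseteq> {z. 0 \<le> Re z}" using S(3) by (intro closure_minimal cl) auto
  have "w \<in> borel_measurable borel"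
    unfolding w_def[abs_def] using cl cont by (intro borel_measurable_continuous_on_indicator borel_closed)
  then have "has_trace S (\<lambda>z. qdist Q (u z) T) w"
    using cS by (intro has_trace_continuous S B.qdist_u_W12(1) T continuous_on_subset[OF cont]) (auto simp: w_def frontier_def)
  moreover have "w z = qdist Q (u z) T" if "z \<in> frontier half_plane" for z
  proof -
    have "closure half_plane \<subseteq> {z. 0 \<le> Re z}" by (intro closure_minimal cl) auto
    then show ?thesis using that by (auto simp: w_def frontier_def)
  qed
  ultimately show "\<exists>w. has_trace S (\<lambda>z. qdist Q (u z) T) w \<and> (AE z in hausdorff_measure (real DIM(complex) - 1).
      z \<in> frontier S \<inter> frontier half_plane \<longrightarrow> w z = qdist Q (u z) T)"
    by (intro exI[of _ w]) auto
qed auto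

text \<open>The whole half plane serves as neighbourhood of each of its points, with all Q branches
  equal to \<open>h\<close> times \<open>b\<close>.\<close>

lemma sing_u: "sing Q half_plane u = {}"
proof -
  have "harmonic_on half_plane (\<lambda>z. h z *\<^sub>R b)"
  proof (rule harmonic_on_linear_holomorphic[OF open_half_plane hol])
    show "bounded_linear (\<lambda>z. Re z *\<^sub>R b)"
      by (rule bounded_linear_compose[OF bounded_linear_scaleR_left bounded_linear_Re])
  qed (simp add: h_eq)
  then have "regular_point Q half_plane u y" if "y \<in> half_plane" for y
    unfolding regular_point_def using that open_half_plane
    by (intro exI[of _ half_plane] exI[of _ "\<lambda>_ z. h z *\<^sub>R b"]) (auto simp: diag_def)
  then show ?thesis by (auto simp: sing_def)
qed

lemma W12Q_loc_u: "W12Q_loc Q half_plane u"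
  unfolding W12Q_loc_def
proof (intro allI impI)
  fix S assume "admissible_domain half_plane S"
  then have S: "open S" "bounded S" "S \<subseteq> half_plane" by (auto simp: admissible_domain_def C1_regular_def)
  interpret B: bounded_C1 S h h' C Q b by (rule bounded_C1_u[OF S])
  show "W12Q Q S u" by (rule B.W12Q_u)
qed

lemma dirichlet_minimizer_u: "dirichlet_minimizer Q half_plane u"
  unfolding dirichlet_minimizer_def admissible_domain_def using energy_le by blast

end

section \<open>Poles at the left end points of the Cantor intervals\<close>

text \<open>Poles are numbered level by level, n = 2^k + l - 1 with l from 1 to 2^k. Thus n is
  comparable to 2^k, and the weight n^(-\<sigma>) to 2^(-k \<sigma>).\<close>

definition dyadic_level :: "nat \<Rightarrow> nat" where "dyadic_level n = nat \<lfloor>log 2 (real n)\<rfloor>"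

lemma dyadic_level:
  assumes "l \<in> {1..2 ^ k}"
  shows "dyadic_level (2 ^ k + l - 1) = k"
proof -
  have "\<lfloor>log (real 2) (real (2 ^ k + l - 1))\<rfloor> = int k"
    using assms floor_log_nat_eq_powr_iff[of 2 "2 ^ k + l - 1" k] by auto
  then show ?thesis by (simp add: dyadic_level_def)
qed

lemma dyadic_level_bounds:
  assumes "0 < n"
  shows "2 ^ dyadic_level n \<le> n" "n < 2 * 2 ^ dyadic_level n"
proof -
  have "0 \<le> log 2 (real n)" using assms by simp
  then have "\<lfloor>log (real 2) (real n)\<rfloor> = int (dyadic_level n)" by (simp add: dyadic_level_def)
  then show "2 ^ dyadic_level n \<le> n" "n < 2 * 2 ^ dyadic_level n"
    using floor_log_nat_eq_powr_iff[of 2 n "dyadic_level n"] assms by auto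
qed

text \<open>Each left end point is listed on its level and again on all later ones. For
  \<open>n = 0\<close> truncated subtraction gives the index 1, hence the point 0, and the weight
  \<open>0 powr _\<close> is 0.\<close>

definition cantor_pole :: "real \<Rightarrow> nat \<Rightarrow> real" where
  "cantor_pole s n = cantor_left s (dyadic_level n) (n - 2 ^ dyadic_level n + 1)"

lemma cantor_pole_eq: "l \<in> {1..2 ^ k} \<Longrightarrow> cantor_pole s (2 ^ k + l - 1) = cantor_left s k l"
  unfolding cantor_pole_def dyadic_level by simp

context
  fixes s :: real
  assumes s: "0 < s" "s < 1"
begin

lemma cantor_pole_in_E: "cantor_pole s n \<in> cantor_E s"
  unfolding cantor_pole_def
proof (rule cantor_left_in_E[OF s])
  show "n - 2 ^ dyadic_level n + 1 \<in> {1..2 ^ dyadic_level n}"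
  proof (cases "n = 0")
    case False
    then show ?thesis using dyadic_level_bounds[of n] by auto
  qed (simp add: dyadic_level_def)
qed

lemma cantor_pole_pt: "cantor_pole s (2 ^ Suc n + 1) = cantor_pt s n"
  using cantor_pole_eq[of 2 "Suc n" s] cantor_pt_eq[OF s, of n] by simp

lemma cantor_scale:
  assumes "0 < d" "d \<le> 1"
  obtains k where "clen s (Suc k) \<le> d" "d \<le> clen s k"
proof -
  have "\<exists>k. clen s (Suc k) < d"
    using order_tendstoD(2)[OF LIMSEQ_Suc[OF clen_tendsto[OF s]] assms(1)] eventually_happens'[OF sequentially_bot] by blast
  then have ex: "\<exists>k. clen s (Suc k) \<le> d" using less_imp_le by blast
  define k where "k = (LEAST k. clen s (Suc k) \<le> d)"
  show ?thesis
  proof (rule that[of k])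
    show "clen s (Suc k) \<le> d" unfolding k_def by (rule LeastI_ex[OF ex])
    show "d \<le> clen s k"
    proof (cases k)
      case 0
      then show ?thesis using assms(2) clen_0[OF s] by simp
    next
      case (Suc j)
      then have "\<not> clen s (Suc j) \<le> d" using not_less_Least[of j "\<lambda>k. clen s (Suc k) \<le> d"] unfolding k_def by auto
      then show ?thesis using Suc by simp
    qed
  qed
qed

text \<open>A single term suffices: for D between two consecutive lengths there is a pole of the
  finer level within 2 D of z, which gives 2^(-\<beta>). Its number is at most 4 * 2^k, which gives
  4^(-\<sigma>), and 2^(-k) \<ge> D^s turns the weight into a power of D.\<close>

lemma cantor_blowup:
  fixes z :: complex and \<beta> \<sigma> :: real
  defines "D \<equiv> infdist z ((\<lambda>y. - \<i> * of_real y) ` cantor_E s)"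
  assumes "0 < D" "D \<le> 1" "1 < \<sigma>" "0 < \<beta>"
  shows "4 powr - \<sigma> * 2 powr - \<beta> * D powr - (\<beta> - s * \<sigma>)
    \<le> (\<Sum>n. real n powr - \<sigma> * norm (z + \<i> * of_real (cantor_pole s n)) powr - \<beta>)"
proof -
  let ?P = "(\<lambda>y. - \<i> * of_real y) ` cantor_E s" and ?t = "\<lambda>n. real n powr - \<sigma> * norm (z + \<i> * of_real (cantor_pole s n)) powr - \<beta>"
  have "compact ?P" using compact_cantor_E[OF s] by (intro compact_continuous_image continuous_intros)
  moreover have "?P \<noteq> {}" using cantor_pole_in_E[of 0] by blast
  ultimately obtain w where "w \<in> ?P" "D = dist z w"
    unfolding D_def using infdist_attains_inf[of ?P z] compact_imp_closed by metis
  then obtain y where y: "y \<in> cantor_E s" "D = norm (z + \<i> * of_real y)" by (auto simp: dist_norm)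
  obtain k where k: "clen s (Suc k) \<le> D" "D \<le> clen s k" using cantor_scale[OF assms(2,3)] by blast
  obtain l where l: "l \<in> {1..2 ^ Suc k}" "\<bar>y - cantor_left s (Suc k) l\<bar> \<le> clen s (Suc k)"
    using cantor_E_approx[OF s y(1), of "Suc k"] by blast
  define n where "n = 2 ^ Suc k + l - 1"
  have pn: "cantor_pole s n = cantor_left s (Suc k) l" unfolding n_def by (rule cantor_pole_eq[OF l(1)])
  have ge: "D \<le> norm (z + \<i> * of_real (cantor_pole s j))" for j
    using infdist_le[of "- \<i> * of_real (cantor_pole s j)" ?P z] cantor_pole_in_E[of j] by (simp add: D_def dist_norm)
  have sm: "summable ?t"
  proof (rule summable_comparison_test'[of "\<lambda>n. real n powr - \<sigma> * D powr - \<beta>" 0])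
    show "summable (\<lambda>n. real n powr - \<sigma> * D powr - \<beta>)"
      using assms(4) summable_real_powr_iff[of "- \<sigma>"] by (intro summable_mult2) simp
    show "norm (?t j) \<le> real j powr - \<sigma> * D powr - \<beta>" for j
      using ge[of j] assms(2,5) by (auto intro!: mult_left_mono powr_mono2')
  qed
  have "norm (z + \<i> * of_real (cantor_pole s n)) \<le> norm (z + \<i> * of_real y) + norm (\<i> * of_real (cantor_pole s n - y))"
    using norm_triangle_ineq[of "z + \<i> * of_real y" "\<i> * of_real (cantor_pole s n - y)"] by (simp add: algebra_simps)
  also have "\<dots> \<le> D + D" using y(2) l(2) k(1) by (simp add: pn norm_mult abs_minus_commute del: of_real_diff)
  finally have up: "norm (z + \<i> * of_real (cantor_pole s n)) \<le> 2 * D" by simp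
  have n: "0 < n" "n \<le> 4 * 2 ^ k" using l(1) by (auto simp: n_def)
  have "(2 ^ k) powr - \<sigma> \<ge> D powr (s * \<sigma>)"
  proof -
    have "D powr s \<le> clen s k powr s" using k(2) assms(2) s by (intro powr_mono2) auto
    then have Ds: "D powr s \<le> 1 / 2 ^ k" using clen_powr[OF s, of k] by simp
    have "(D powr s) powr \<sigma> \<le> (1 / 2 ^ k) powr \<sigma>" using Ds assms(4) by (intro powr_mono2) auto
    then show ?thesis by (simp add: powr_powr powr_minus powr_divide inverse_eq_divide)
  qed
  then have "4 powr - \<sigma> * D powr (s * \<sigma>) \<le> 4 powr - \<sigma> * (2 ^ k) powr - \<sigma>" by (intro mult_left_mono) auto
  also have "\<dots> = (4 * 2 ^ k) powr - \<sigma>" by (simp add: powr_mult)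
  also have "\<dots> \<le> real n powr - \<sigma>"
  proof (rule powr_mono2')
    show "real n \<le> 4 * 2 ^ k" using n(2) of_nat_le_iff[of n "4 * 2 ^ k", where 'a = real] by simp
  qed (use n assms(4) in auto)
  finally have c: "4 powr - \<sigma> * D powr (s * \<sigma>) \<le> real n powr - \<sigma>" .
  have "2 powr - \<beta> * D powr - \<beta> = (2 * D) powr - \<beta>" using assms(2) by (simp add: powr_mult)
  also have "\<dots> \<le> norm (z + \<i> * of_real (cantor_pole s n)) powr - \<beta>"
    using up ge[of n] assms(2,5) by (intro powr_mono2') auto
  finally have "4 powr - \<sigma> * D powr (s * \<sigma>) * (2 powr - \<beta> * D powr - \<beta>) \<le> ?t n"
    using c by (intro mult_mono) auto
  moreover have "4 powr - \<sigma> * 2 powr - \<beta> * D powr - (\<beta> - s * \<sigma>) = 4 powr - \<sigma> * D powr (s * \<sigma>) * (2 powr - \<beta> * D powr - \<beta>)"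
    using assms(2) by (simp add: powr_add[symmetric] algebra_simps)
  moreover have "sum ?t {n} \<le> suminf ?t" by (intro sum_le_suminf sm) auto
  ultimately show ?thesis by (simp only: sum.insert finite.emptyI empty_iff sum.empty not_False_eq_True add_0_right)
qed

text \<open>\<beta> is the midpoint of s and 1, and the exponent \<sigma> of the weights is the
  midpoint of 1 and \<beta> / s, so that s \<sigma> < \<beta>. With \<psi> = \<eta> = (1 - s) pi /
  16 one has \<beta> pi/2 = pi/2 - 4 \<psi>, which leaves room for \<psi> + \<beta> \<psi>.\<close>

lemma cantor_flat_data:
  defines "\<beta> \<equiv> (1 + s) / 2" and "\<psi> \<equiv> (1 - s) * pi / 16"
  obtains A \<tau> where "flat_data (cantor_E s) (cantor_pole s) (\<lambda>n. real n powr - ((1 + \<beta> / s) / 2)) \<beta> \<psi> \<psi> A \<tau>"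
proof
  let ?\<sigma> = "(1 + \<beta> / s) / 2"
  have \<beta>: "0 < \<beta>" "\<beta> < 1" "s < \<beta>" using s by (auto simp: \<beta>_def)
  have \<sigma>: "1 < ?\<sigma>" "0 < \<beta> - s * ?\<sigma>"
    using s \<beta> by (auto simp: field_simps)
  have \<psi>: "0 < \<psi>" "\<psi> < pi / 2" using s by (auto simp: \<psi>_def)
  have angle: "\<psi> + \<beta> * (pi / 2 + \<psi>) < pi / 2"
  proof -
    have "\<beta> * \<psi> < 1 * \<psi>" using \<beta> \<psi> by (intro mult_strict_right_mono) auto
    moreover have "\<beta> * (pi / 2) = pi / 2 - 4 * \<psi>" by (simp add: \<beta>_def \<psi>_def field_simps)
    ultimately show ?thesis using \<psi>(1) unfolding distrib_left by linarith
  qed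
  show "flat_data (cantor_E s) (cantor_pole s) (\<lambda>n. real n powr - ?\<sigma>) \<beta> \<psi> \<psi> (4 powr - ?\<sigma> * 2 powr - \<beta>) (\<beta> - s * ?\<sigma>)"
  proof
    show "summable (\<lambda>n. real n powr - ?\<sigma>)" using \<sigma>(1) summable_real_powr_iff[of "- ?\<sigma>"] by simp
    show "compact (cantor_E s)" by (rule compact_cantor_E[OF s])
    show "cantor_E s \<noteq> {}" using cantor_pole_in_E[of 0] by blast
    show "4 powr - ?\<sigma> * 2 powr - \<beta> * infdist z ((\<lambda>y. - \<i> * of_real y) ` cantor_E s) powr - (\<beta> - s * ?\<sigma>)
        \<le> (\<Sum>n. real n powr - ?\<sigma> * norm (z + \<i> * of_real (cantor_pole s n)) powr - \<beta>)"
      if "0 < infdist z ((\<lambda>y. - \<i> * of_real y) ` cantor_E s)" "infdist z ((\<lambda>y. - \<i> * of_real y) ` cantor_E s) \<le> 1" for z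
      by (rule cantor_blowup[OF that \<sigma>(1) \<beta>(1)])
  qed (use \<beta> \<psi> \<sigma> angle cantor_pole_in_E in auto)
qed

end

section \<open>The theorem\<close>

theorem corollary3p8:
  fixes Q :: nat and s :: real
  assumes "Q > 2" and "0 < s" and "s < 1"
  shows "\<exists>u :: complex \<Rightarrow> (real ^ 2) multiset.
    W12Q_loc Q half_plane u \<and> dirichlet_minimizer Q half_plane u \<and>
    trace_normalized Q half_plane u \<and>
    (\<forall>k. CkQ_on k Q UNIV (\<lambda>t. u (\<i> * of_real t))) \<and>
    sing Q half_plane u = {} \<and>
    (\<forall>z \<in> (\<lambda>y. - \<i> * of_real y) ` cantor_E s. u z = qtup Q (\<lambda>_. 0)) \<and>
    hausdorff_outer s (cantor_E s) = 1 \<and>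
    (\<exists>(y :: nat \<Rightarrow> real) R. inj y \<and> range y \<subseteq> cantor_E s \<and>
       (\<forall>n. R n > 0) \<and> R \<longlonglongrightarrow> 0 \<and>
       (\<forall>k. filterlim (\<lambda>n. frequency Q half_plane u (- \<i> * of_real (y k)) (R n)) at_top sequentially))"
proof -
  note s = assms(2,3)
  obtain A \<tau> where fd: "flat_data (cantor_E s) (cantor_pole s) (\<lambda>n. real n powr - ((1 + (1 + s) / 2 / s) / 2))
      ((1 + s) / 2) ((1 - s) * pi / 16) ((1 - s) * pi / 16) A \<tau>"
    using cantor_flat_data[OF s] by blast
  define c where "c n = real n powr - ((1 + (1 + s) / 2 / s) / 2)" for n
  interpret flat_data "cantor_E s" "cantor_pole s" c "(1 + s) / 2" "(1 - s) * pi / 16" "(1 - s) * pi / 16" A \<tau>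
    using fd unfolding c_def[abs_def] .
  define b :: "real ^ 2" where "b = axis 1 1"
  have b: "norm b = 1" by (simp add: b_def)
  have Q: "0 < Q" using assms(1) by simp
  obtain C where C: "\<And>z. z \<in> half_plane \<Longrightarrow> norm (deriv f z) \<le> C" using f'_bounded by blast
  interpret half_plane_potential f h C Q b
    by unfold_locales (rule holomorphic_on_subset[OF f_holomorphic half_in_V] h_half_plane h_le_1 C b Q; assumption?)+
  have freq: "filterlim (\<lambda>n. frequency Q half_plane u (- \<i> * of_real (cantor_pt s k)) (1 / real (Suc n))) at_top sequentially" for k
  proof -
    obtain g where g: "0 < g" "\<forall>y\<in>cantor_E s. cantor_pt s k \<le> y \<or> y \<le> cantor_pt s k - g"
      using cantor_pt_gap[OF s] by blast
    \<comment> \<open>The index 2^(k+1) + 1 is the second interval of level k + 1, whose left end is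
      \<open>cantor_pt s k\<close>. Its weight is positive, and \<open>g\<close> is the gap to its
      left.\<close>
    interpret flat_pole "cantor_E s" "cantor_pole s" c "(1 + s) / 2" "(1 - s) * pi / 16" "(1 - s) * pi / 16" A \<tau> "2 ^ Suc k + 1" g
    proof
      show "0 < c (2 ^ Suc k + 1)" unfolding c_def powr_gt_zero of_nat_eq_0_iff by simp
    qed (use g in \<open>simp_all only: cantor_pole_pt[OF s]\<close>)
    show ?thesis using frequency_tendsto[OF Q b] by (simp only: q_def cantor_pole_pt[OF s])
  qed
  have lim: "(\<lambda>n. 1 / real (Suc n)) \<longlonglongrightarrow> 0"
    using LIMSEQ_inverse_real_of_nat by (simp add: inverse_eq_divide)
  have range: "range (cantor_pt s) \<subseteq> cantor_E s" using cantor_pt_in_E[OF s] by blast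
  have Ck: "CkQ_on k Q UNIV (\<lambda>t. u (\<i> * of_real t))" for k
    using CkQ_on_diag[where G = bd, OF b bd_has_derivative, of k Q] unfolding bd_0 .
  have zero: "u z = qtup Q (\<lambda>_. 0)" if "z \<in> (\<lambda>y. - \<i> * of_real y) ` cantor_E s" for z
    using h_P[of z] that by (simp add: P_def diag_def)
  \<comment> \<open>One sequence of radii for all points, as the statement demands; how far one must
    go in it before the lower bound applies depends on the point.\<close>
  have "\<exists>(y :: nat \<Rightarrow> real) R. inj y \<and> range y \<subseteq> cantor_E s \<and> (\<forall>n. R n > 0) \<and> R \<longlonglongrightarrow> 0 \<and>
       (\<forall>k. filterlim (\<lambda>n. frequency Q half_plane u (- \<i> * of_real (y k)) (R n)) at_top sequentially)"
    by (rule exI[of _ "cantor_pt s"], rule exI[of _ "\<lambda>n. 1 / real (Suc n)"])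
      (intro conjI allI inj_cantor_pt[OF s] range lim freq, simp)
  then show ?thesis
    using W12Q_loc_u dirichlet_minimizer_u trace_normalized_u[OF h_continuous] Ck sing_u zero hausdorff_cantor_E[OF s]
    by (intro exI[of _ u] conjI allI ballI)
qed

end
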